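(* Let $d\ge 3$ and let $K$ be an algebraically closed field of characteristic $p$, where $p=0$ or $p>d$. Let $X_d\subset\mathbb{P}^3(K)$ be a smooth surface of degree $d$, and let $\ell(X_d)$ denote the number of lines contained in $X_d$. Then $$\ell(X_d)\le 11d^2-30d+18 .$$ *)

theory Defs
  imports "HOL-Computational_Algebra.Polynomial"
begin

text \<open>Points of K^4 are 4-tuples. A homogeneous form of degree d in x0..x3 is given
by a coefficient function on exponent vectors (i,j,k,l); only the exponents with
i+j+k+l = d are used.\<close>

type_synonym 'a pt4 = "'a \<times> 'a \<times> 'a \<times> 'a"
type_synonym 'a form4 = "nat \<times> nat \<times> nat \<times> nat \<Rightarrow> 'a"

definition mons :: "nat \<Rightarrow> (nat \<times> nat \<times> nat \<times> nat) set" where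
  "mons d = {(i,j,k,l). i + j + k + l = d}"

definition monom_eval :: "nat \<times> nat \<times> nat \<times> nat \<Rightarrow> 'a::comm_ring_1 pt4 \<Rightarrow> 'a" where
  "monom_eval m x = (case m of (i,j,k,l) \<Rightarrow> case x of (x0,x1,x2,x3) \<Rightarrow>
      x0 ^ i * x1 ^ j * x2 ^ k * x3 ^ l)"

definition form_eval :: "nat \<Rightarrow> 'a::comm_ring_1 form4 \<Rightarrow> 'a pt4 \<Rightarrow> 'a" where
  "form_eval d c x = (\<Sum>m\<in>mons d. c m * monom_eval m x)"

definition pderiv0 :: "nat \<Rightarrow> 'a::comm_ring_1 form4 \<Rightarrow> 'a form4" where
  "pderiv0 d c = (\<lambda>(i,j,k,l). of_nat (Suc i) * c (Suc i, j, k, l))"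
definition pderiv1 :: "nat \<Rightarrow> 'a::comm_ring_1 form4 \<Rightarrow> 'a form4" where
  "pderiv1 d c = (\<lambda>(i,j,k,l). of_nat (Suc j) * c (i, Suc j, k, l))"
definition pderiv2 :: "nat \<Rightarrow> 'a::comm_ring_1 form4 \<Rightarrow> 'a form4" where
  "pderiv2 d c = (\<lambda>(i,j,k,l). of_nat (Suc k) * c (i, j, Suc k, l))"
definition pderiv3 :: "nat \<Rightarrow> 'a::comm_ring_1 form4 \<Rightarrow> 'a form4" where
  "pderiv3 d c = (\<lambda>(i,j,k,l). of_nat (Suc l) * c (i, j, k, Suc l))"

definition smooth_surface :: "nat \<Rightarrow> 'a::comm_ring_1 form4 \<Rightarrow> bool" where
  "smooth_surface d c \<longleftrightarrow>
     (\<exists>m\<in>mons d. c m \<noteq> 0) \<and>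
     (\<forall>x. x \<noteq> (0,0,0,0) \<longrightarrow>
        \<not> (form_eval d c x = 0 \<and>
            form_eval (d - 1) (pderiv0 d c) x = 0 \<and>
            form_eval (d - 1) (pderiv1 d c) x = 0 \<and>
            form_eval (d - 1) (pderiv2 d c) x = 0 \<and>
            form_eval (d - 1) (pderiv3 d c) x = 0))"

definition lincomb :: "'a::comm_ring_1 \<Rightarrow> 'a pt4 \<Rightarrow> 'a \<Rightarrow> 'a pt4 \<Rightarrow> 'a pt4" where
  "lincomb a u b v = (case u of (u0,u1,u2,u3) \<Rightarrow> case v of (v0,v1,v2,v3) \<Rightarrow>
     (a*u0 + b*v0, a*u1 + b*v1, a*u2 + b*v2, a*u3 + b*v3))"

text \<open>A line of P^3 is represented by the corresponding 2-dimensional linear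
subspace of K^4, i.e. the span of two linearly independent vectors.\<close>
definition proj_line :: "'a::comm_ring_1 pt4 set \<Rightarrow> bool" where
  "proj_line L \<longleftrightarrow> (\<exists>u v. (\<forall>a b. lincomb a u b v = (0,0,0,0) \<longrightarrow> a = 0 \<and> b = 0) \<and>
                          L = {lincomb a u b v | a b. True})"

definition lines_on :: "nat \<Rightarrow> 'a::comm_ring_1 form4 \<Rightarrow> 'a pt4 set set" where
  "lines_on d c = {L. proj_line L \<and> (\<forall>x\<in>L. form_eval d c x = 0)}"

end

theory Submission
  imports Defs "HOL-Analysis.Determinants" "Berlekamp_Zassenhaus.Unique_Factorization_Poly" "Subresultants.Resultant_Prelim"
begin

text \<open>
A line on the surface has contact of infinite order, so all lines lie on the flecnodal divisor, cut out by Clebsch's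
form Phi of degree 11d - 24. Call a line of the second kind if the other asymptotic direction is also flecnodal
along it: then the flecnodal divisor contains it with multiplicity at least two, whereas Phi does not vanish on the whole
surface as soon as one line is of the first kind. The multiplicities are counted by intersecting with a generic quadric
through a chain of three lines l1, l3, l2 with l1, l2 skew and l3 meeting both. Such a quadric is a product of two
projective lines, where Bezout bounds the common zeros of the equation of the surface and Phi, once their factors along
the chain have been removed; a line of the surface meeting none (one) of the l_i contributes two (one) points.

If the l_i are three lines of the first kind, each of which meets at most 8d - 14 others (Segre), this is exactly the
bound 11d^2 - 30d + 18. If there is no such chain, intersections with generic quadrics and with quadrics through two skew
lines show that a surface with more lines would have three skew lines of the second kind having far more than d + 1
common transversals on the surface. If all lines are of the second kind, a form of degree 8d - 14 replaces Phi.
\<close>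

no_notation vec_index (infixl "$" 100)
hide_const (open) Matrix.vec Matrix.mat Matrix.row Matrix.col Determinant.det Determinant.cofactor Polynomial.content
  Divisibility.irreducible Divisibility.prime Coset.order Module.smult

section \<open>Polynomials over an algebraically closed field\<close>

definition good_char :: "'a::alg_closed_field itself \<Rightarrow> nat \<Rightarrow> bool" where
  "good_char _ d \<longleftrightarrow> CHAR('a) = 0 \<or> CHAR('a) > d"

lemma good_char_of_nat: "good_char TYPE('a::alg_closed_field) d \<Longrightarrow> 0 < k \<Longrightarrow> k \<le> d \<Longrightarrow> (of_nat k :: 'a) \<noteq> 0"
  by (auto simp: good_char_def of_nat_eq_0_iff_char_dvd dest: dvd_imp_le)

lemma infinite_UNIV_alg_closed: "infinite (UNIV :: 'a::alg_closed_field set)"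
proof
  assume fin: "finite (UNIV :: 'a set)"
  define p :: "'a poly" where "p = (\<Prod>a\<in>UNIV. [:-a, 1:])"
  have "degree p = card (UNIV :: 'a set)" unfolding p_def by (subst degree_prod_eq_sum_degree) auto
  then have "degree p > 0" using fin by (simp add: card_gt_0_iff)
  then have "degree (p + 1) > 0" by (simp add: degree_add_eq_left)
  then obtain x where "poly (p + 1) x = 0" using alg_closed_imp_poly_has_root by blast
  moreover have "poly p x = 0" using fin by (auto simp: p_def poly_prod)
  ultimately show False by simp
qed

lemma obtain_outside_finite:
  assumes "finite (S :: 'a::alg_closed_field set)"
  obtains x where "x \<notin> S"
  using ex_new_if_finite[OF infinite_UNIV_alg_closed assms] by blast

lemma poly_eq_0_if_cofinitely_many_roots:
  fixes p :: "'a::alg_closed_field poly"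
  assumes "finite S" "\<And>x. x \<notin> S \<Longrightarrow> poly p x = 0"
  shows "p = 0"
proof (rule ccontr)
  assume "p \<noteq> 0"
  then have "finite (S \<union> {x. poly p x = 0})" using assms(1) by (simp add: poly_roots_finite)
  then obtain x where "x \<notin> S \<union> {x. poly p x = 0}" by (rule obtain_outside_finite)
  then show False using assms(2) by blast
qed

lemma poly_eq_0I:
  fixes p :: "'a::alg_closed_field poly"
  shows "(\<And>x. poly p x = 0) \<Longrightarrow> p = 0"
  using poly_eq_0_if_cofinitely_many_roots[of "{}"] by blast

lemma poly_ext:
  fixes p q :: "'a::alg_closed_field poly"
  shows "(\<And>x. poly p x = poly q x) \<Longrightarrow> p = q"
  using poly_eq_0I[of "p - q"] by simp

lemma obtain_nonroot:
  fixes p :: "'a::alg_closed_field poly"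
  assumes "p \<noteq> 0" "finite S"
  obtains x where "poly p x \<noteq> 0" "x \<notin> S"
  using poly_eq_0_if_cofinitely_many_roots[of S p] assms by blast

lemma dvd_if_no_common_root:
  fixes A B C :: "'a::alg_closed_field poly"
  assumes "A \<noteq> 0" "A dvd C * B" "\<And>r. poly A r = 0 \<Longrightarrow> poly B r \<noteq> 0"
  shows "A dvd C"
  using assms
proof (induction "degree A" arbitrary: A C)
  case 0
  then show ?case by (metis is_unit_iff_degree unit_imp_dvd)
next
  case (Suc n)
  then obtain r where r: "poly A r = 0" using alg_closed_imp_poly_has_root[of A] by auto
  then obtain A' where A': "A = [:-r,1:] * A'" by (auto simp: poly_eq_0_iff_dvd)
  have "poly (C * B) r = 0" using Suc.prems(2) r unfolding poly_eq_0_iff_dvd by (rule dvd_trans[rotated])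
  then have "poly C r = 0" using Suc.prems(3)[OF r] by simp
  then obtain C' where C': "C = [:-r,1:] * C'" by (auto simp: poly_eq_0_iff_dvd)
  have "A' \<noteq> 0" using A' Suc.prems by auto
  then have "degree A = Suc (degree A')" unfolding A' by (subst degree_mult_eq) auto
  then have "n = degree A'" using Suc.hyps(2) by simp
  moreover have "A' dvd C' * B" using Suc.prems(2) unfolding A' C' mult.assoc
    by (simp add: dvd_mult_cancel_left del: mult_pCons_left)
  moreover have "poly B s \<noteq> 0" if "poly A' s = 0" for s using Suc.prems(3)[of s] that A' by simp
  ultimately have "A' dvd C'" using Suc.hyps(1) \<open>A' \<noteq> 0\<close> by blast
  then show ?case unfolding A' C' by (rule mult_dvd_mono[OF dvd_refl])
qed

lemma linear_power_dvd_cancel: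
  fixes f g :: "'a::idom poly"
  assumes "[:-r,1:]^m dvd f * g" "poly f r \<noteq> 0"
  shows "[:-r,1:]^m dvd g"
proof (cases "g = 0")
  case False
  then have "f * g \<noteq> 0" using assms(2) by auto
  then show ?thesis using assms False order_mult[of f g r] unfolding order_divides by (simp add: order_0I)
qed simp

lemma sum_multiplicities_le_degree:
  fixes R :: "'a::idom poly"
  assumes "finite Z" "R \<noteq> 0" "\<And>x. x \<in> Z \<Longrightarrow> [:-x,1:]^M x dvd R"
  shows "(\<Sum>x\<in>Z. M x) \<le> degree R"
proof -
  have "(\<Sum>x\<in>Z. M x) \<le> (\<Sum>x\<in>Z. order x R)" using assms(2,3) unfolding order_divides by (intro sum_mono) auto
  also have "\<dots> = (\<Sum>x\<in>Z \<inter> {x. poly R x = 0}. order x R)"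
    using assms(1) by (intro sum.mono_neutral_right) (auto simp: order_gt_0_iff[OF assms(2)])
  also have "\<dots> \<le> (\<Sum>x | poly R x = 0. order x R)" using assms(2) by (intro sum_mono2 poly_roots_finite) auto
  also have "\<dots> \<le> degree R" by (rule sum_order_le_degree[OF assms(2)])
  finally show ?thesis .
qed

lemma linear_mult_pderiv_power_mult:
  fixes Z :: "'a::idom poly"
  shows "[:-r,1:] * pderiv ([:-r,1:]^m * Z) = [:-r,1:]^m * (of_nat m * Z + [:-r,1:] * pderiv Z)"
proof -
  have "[:-r,1:] * pderiv ([:-r,1:]^m) = of_nat m * [:-r,1:]^m"
  proof (cases m)
    case (Suc n)
    have "pderiv ([:-r,1:]^Suc n) = of_nat (Suc n) * [:-r,1:]^n"
      by (simp only: pderiv_power_Suc) (simp add: pderiv_pCons of_nat_poly)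
    then show ?thesis unfolding Suc by (simp only: power_Suc mult.left_commute)
  qed (simp add: pderiv_1)
  then have "[:-r,1:] * pderiv ([:-r,1:]^m) * Z = of_nat m * [:-r,1:]^m * Z" by simp
  then show ?thesis unfolding pderiv_mult distrib_left by (simp only: algebra_simps)
qed

lemma linear_power_dvd_pderiv:
  fixes Q :: "'a::idom poly"
  assumes "[:-r,1:]^Suc m dvd Q"
  shows "[:-r,1:]^m dvd pderiv Q"
proof -
  obtain T where "Q = [:-r,1:]^Suc m * T" using assms by blast
  then have "[:-r,1:] * pderiv Q = [:-r,1:] * ([:-r,1:]^m * (of_nat (Suc m) * T + [:-r,1:] * pderiv T))"
    using linear_mult_pderiv_power_mult[of r "Suc m" T] by (simp only: power_Suc mult.assoc)
  then show ?thesis by (metis dvd_triv_left mult_left_cancel pCons_eq_0_iff zero_neq_one)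
qed

lemma linear_square_dvdI:
  fixes Q :: "'a::idom poly"
  assumes "poly Q x = 0" "poly (pderiv Q) x = 0"
  shows "[:-x,1:]^2 dvd Q"
proof -
  obtain R where R: "Q = [:-x,1:] * R" using assms(1) by (metis poly_eq_0_iff_dvd dvdE)
  have "pderiv Q = R + [:-x,1:] * pderiv R" unfolding R pderiv_mult by (simp add: pderiv_pCons)
  then have "poly R x = 0" using assms(2) by simp
  then have "[:-x,1:] dvd R" unfolding poly_eq_0_iff_dvd .
  then show ?thesis unfolding R power2_eq_square by (rule mult_dvd_mono[OF dvd_refl])
qed

lemma linear_power_dvd_if_pcompose_coeffs_0:
  fixes Q :: "'a::idom poly"
  assumes "\<And>i. i < k \<Longrightarrow> coeff (Q \<circ>\<^sub>p [:z,1:]) i = 0"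
  shows "[:-z,1:]^k dvd Q"
proof -
  have "[:0,1:]^k dvd Q \<circ>\<^sub>p [:z,1:]"
    using assms monom_1_dvd_iff'[of k] by (metis x_pow_n monom_altdef smult_1_left)
  then obtain T where T: "Q \<circ>\<^sub>p [:z,1:] = [:0,1:]^k * T" by blast
  have "[:z,1:] \<circ>\<^sub>p [:-z,1:] = [:0,1:]" by (simp add: pcompose_pCons)
  then have "Q = (Q \<circ>\<^sub>p [:z,1:]) \<circ>\<^sub>p [:-z,1:]" unfolding pcompose_assoc[symmetric] by (simp only: pcompose_idR)
  also have "\<dots> = ([:0,1:]^k) \<circ>\<^sub>p [:-z,1:] * (T \<circ>\<^sub>p [:-z,1:])" unfolding T by (rule pcompose_mult)
  also have "([:0,1:]^k) \<circ>\<^sub>p [:-z,1:] = [:-z,1:]^k"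
    by (induction k) (simp_all add: pcompose_mult pcompose_pCons pcompose_1)
  finally show ?thesis by simp
qed

lemma quadratic_two_roots:
  fixes a b q :: "'a::alg_closed_field"
  assumes q: "q \<noteq> 0" and disc: "b^2 - 4 * a * q \<noteq> 0" and two: "(2::'a) \<noteq> 0"
  obtains R where "card R = 2" "finite R" "\<And>t. t \<in> R \<Longrightarrow> a + t * b + t^2 * q = 0"
proof -
  obtain s where s: "s^2 = b^2 - 4 * a * q" using nth_root_exists[of 2 "b^2 - 4 * a * q"] by auto
  have root: "a + t * b + t^2 * q = 0" if "2 * q * t = - b + s'" "s'^2 = s^2" for t s'
  proof -
    have "(2 * 2 * q) * (a + t * b + t^2 * q) = 4 * a * q + 2 * b * (2 * q * t) + (2 * q * t)^2"
      by (simp add: power2_eq_square algebra_simps)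
    also have "\<dots> = 4 * a * q - b^2 + s'^2" unfolding that(1) by (simp add: power2_eq_square algebra_simps)
    also have "\<dots> = 0" unfolding that(2) s by simp
    finally show ?thesis using q two by (metis mult_eq_0_iff)
  qed
  let ?R = "{(- b + s) / (2 * q), (- b - s) / (2 * q)}"
  have "(- b + s) / (2 * q) \<noteq> (- b - s) / (2 * q)"
  proof
    assume "(- b + s) / (2 * q) = (- b - s) / (2 * q)"
    then have "2 * s = 0" using q two by (simp add: algebra_simps)
    then show False using s disc two by auto
  qed
  then have "card ?R = 2" by simp
  moreover have "a + t * b + t^2 * q = 0" if "t \<in> ?R" for t
    using that root[of t s] root[of t "- s"] q two by auto
  ultimately show ?thesis using that[of ?R] by blast
qed

text \<open>The coefficient \<open>a\<close> may be zero, so that leading coefficients can be tracked through cancellations.\<close>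
definition top_coeff :: "nat \<Rightarrow> 'a::comm_ring_1 poly \<Rightarrow> 'a \<Rightarrow> bool" where
  "top_coeff n p a \<longleftrightarrow> degree p \<le> n \<and> coeff p n = a"

lemma top_coeff_mult:
  assumes "top_coeff m p a" "top_coeff n q b"
  shows "top_coeff (m + n) (p * q) (a * b)"
proof -
  have "coeff p i * coeff q (m + n - i) = 0" if "i \<noteq> m" for i
  proof (rule ccontr)
    assume "coeff p i * coeff q (m + n - i) \<noteq> 0"
    then have "coeff p i \<noteq> 0" "coeff q (m + n - i) \<noteq> 0" by auto
    then have "i \<le> m" "m + n - i \<le> n" using assms le_degree unfolding top_coeff_def by (meson order_trans)+
    then show False using \<open>i \<noteq> m\<close> by auto
  qed
  then have "coeff (p * q) (m + n) = (\<Sum>i\<in>{m}. coeff p i * coeff q (m + n - i))"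
    unfolding coeff_mult by (intro sum.mono_neutral_right) auto
  moreover have "degree (p * q) \<le> m + n" using assms degree_mult_le[of p q] by (auto simp: top_coeff_def)
  ultimately show ?thesis using assms by (auto simp: top_coeff_def)
qed

lemma top_coeff_power: "top_coeff m p a \<Longrightarrow> top_coeff (m * k) (p ^ k) (a ^ k)"
  by (induction k) (auto simp: top_coeff_def[of 0] top_coeff_mult[of m p a "m * _"])

lemma top_coeff_sum: "(\<And>i. i \<in> A \<Longrightarrow> top_coeff n (f i) (g i)) \<Longrightarrow> top_coeff n (sum f A) (sum g A)"
  unfolding top_coeff_def coeff_sum by (cases "finite A") (auto intro!: degree_sum_le sum.cong)

lemma top_coeff_const: "top_coeff 0 [:a:] a"
  and top_coeff_numeral: "top_coeff 0 (numeral k) (numeral k)"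
  by (simp_all add: top_coeff_def numeral_poly)

lemma top_coeff_add: "top_coeff n p a \<Longrightarrow> top_coeff n q b \<Longrightarrow> top_coeff n (p + q) (a + b)"
  and top_coeff_diff: "top_coeff n p a \<Longrightarrow> top_coeff n q b \<Longrightarrow> top_coeff n (p - q) (a - b)"
  by (auto simp: top_coeff_def degree_add_le degree_diff_le)

lemma top_coeff_pderiv: "top_coeff n p a \<Longrightarrow> n \<ge> 1 \<Longrightarrow> top_coeff (n-1) (pderiv p) (of_nat n * a)" for p :: "'a::idom poly"
  unfolding top_coeff_def by (auto simp: coeff_pderiv degree_pderiv_le intro: order_trans[OF degree_pderiv_le])

lemma top_coeff_0_if_less: "top_coeff n p a \<Longrightarrow> n < m \<Longrightarrow> top_coeff m p 0"
  by (auto simp: top_coeff_def coeff_eq_0)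

lemma top_coeff_Suc_0: "top_coeff (Suc n) p 0 \<Longrightarrow> top_coeff n p (coeff p n)"
  unfolding top_coeff_def by (metis Suc_le_eq le_SucE leading_coeff_0_iff degree_0 le0)

section \<open>Wronskians and Schwarzians\<close>

definition wronskian :: "'a::idom poly \<Rightarrow> 'a poly \<Rightarrow> 'a poly" where
  "wronskian A B = B * pderiv A - A * pderiv B"
definition wronskian2 :: "'a::idom poly \<Rightarrow> 'a poly \<Rightarrow> 'a poly" where
  "wronskian2 A B = pderiv B * pderiv (pderiv A) - pderiv A * pderiv (pderiv B)"
text \<open>Up to a factor, the Schwarzian derivative of B/A: it measures how the asymptotic direction along a line bends when
the point leaves the line.\<close>
definition schwarzian :: "'a::idom poly \<Rightarrow> 'a poly \<Rightarrow> 'a poly" where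
  "schwarzian A B = 2 * wronskian A B * pderiv (pderiv (wronskian A B)) + 4 * wronskian A B * wronskian2 A B
     - 3 * (pderiv (wronskian A B))^2"

lemma pderiv_wronskian: "pderiv (wronskian A B) = B * pderiv (pderiv A) - A * pderiv (pderiv B)"
  by (simp add: wronskian_def pderiv_diff pderiv_mult algebra_simps)

lemma wronskian_swap: "wronskian B A = - wronskian A B"
  and wronskian2_swap: "wronskian2 B A = - wronskian2 A B"
  by (simp_all add: wronskian_def wronskian2_def)

lemma schwarzian_swap: "schwarzian B A = schwarzian A B"
  unfolding schwarzian_def wronskian_swap[of B A] wronskian2_swap[of B A] by (simp add: pderiv_minus)

lemma wronskian_diff_smult: "wronskian (A - smult l B) B = wronskian A B"
  and wronskian2_diff_smult: "wronskian2 (A - smult l B) B = wronskian2 A B"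
  by (simp_all add: wronskian_def wronskian2_def pderiv_diff pderiv_smult algebra_simps)

lemma schwarzian_diff_smult: "schwarzian (A - smult l B) B = schwarzian A B"
  by (simp add: schwarzian_def wronskian_diff_smult wronskian2_diff_smult)

lemma pderiv2_eq_0_if_dvd:
  fixes P :: "'a::idom poly"
  assumes "P dvd pderiv (pderiv P)"
  shows "pderiv (pderiv P) = 0"
proof (rule ccontr)
  assume nz: "pderiv (pderiv P) \<noteq> 0"
  then have "degree P \<le> degree (pderiv (pderiv P))" using assms dvd_imp_degree_le by blast
  also have "\<dots> \<le> degree P - 1 - 1" by (meson degree_pderiv_le diff_le_mono order_trans)
  finally have "degree P = 0" by linarith
  then show False using nz by (metis pderiv_0 pderiv_pCons degree_eq_zeroE pCons_0_0 add_0)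
qed

lemma coeff_eq_0_if_pderiv2_eq_0:
  fixes P :: "'a::alg_closed_field poly"
  assumes "d \<ge> 3" "good_char TYPE('a) d" "pderiv (pderiv P) = 0"
  shows "coeff P (d-1) = 0"
proof -
  have "coeff (pderiv (pderiv P)) (d - 3) = of_nat (d-2) * (of_nat (d-1) * coeff P (d-1))"
    using assms(1) by (simp add: coeff_pderiv Suc_diff_Suc numeral_2_eq_2 numeral_3_eq_3)
  then show ?thesis
    using assms good_char_of_nat[OF assms(2), of "d-2"] good_char_of_nat[OF assms(2), of "d-1"] by auto
qed

lemma pderiv_wronskian_nonzero:
  fixes A B :: "'a::alg_closed_field poly"
  assumes d: "d \<ge> 3" and char: "good_char TYPE('a) d"
    and no_common_root: "\<And>r. poly A r = 0 \<Longrightarrow> poly B r \<noteq> 0"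
    and top: "coeff A (d-1) \<noteq> 0 \<or> coeff B (d-1) \<noteq> 0"
  shows "pderiv (wronskian A B) \<noteq> 0"
proof
  assume "pderiv (wronskian A B) = 0"
  then have eq: "B * pderiv (pderiv A) = A * pderiv (pderiv B)" unfolding pderiv_wronskian by simp
  have "P = 0 \<or> P dvd pderiv (pderiv P)"
    if "Q * pderiv (pderiv P) = P * pderiv (pderiv Q)" "\<And>r. poly P r = 0 \<Longrightarrow> poly Q r \<noteq> 0" for P Q :: "'a poly"
    using dvd_if_no_common_root[of P "pderiv (pderiv P)" Q] that by (metis dvd_triv_left mult.commute)
  then have "pderiv (pderiv A) = 0" "pderiv (pderiv B) = 0"
    using eq no_common_root pderiv2_eq_0_if_dvd pderiv_0 by metis+
  then show False using coeff_eq_0_if_pderiv2_eq_0[OF d char] top by blast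
qed

lemma linear_sq_mult_pderiv2:
  fixes P :: "'a::idom poly"
  assumes "[:-r,1:] * pderiv P = [:-r,1:]^m * P1"
  shows "[:-r,1:] * ([:-r,1:] * pderiv (pderiv P)) = [:-r,1:]^m * (of_nat m * P1 + [:-r,1:] * pderiv P1 - P1)"
proof -
  define q where "q = [:-r,1:]"
  have "q * pderiv (q * pderiv P) = q^m * (of_nat m * P1 + q * pderiv P1)"
    unfolding q_def assms by (rule linear_mult_pderiv_power_mult)
  moreover have "pderiv q = 1" by (simp add: q_def pderiv_pCons)
  moreover have "q * pderiv P = q^m * P1" unfolding q_def by (rule assms)
  ultimately have "q * (q * pderiv (pderiv P)) = q^m * (of_nat m * P1 + q * pderiv P1 - P1)"
    unfolding pderiv_mult by (simp add: algebra_simps)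
  then show ?thesis unfolding q_def .
qed

lemma wronskian_at_root:
  fixes B E :: "'a::idom poly" and r :: 'a and m :: nat
  defines "C \<equiv> [:-r,1:]^Suc m * E"
  obtains U Y where "wronskian C B = [:-r,1:]^m * U" "poly U r = of_nat (Suc m) * poly E r * poly B r"
    "[:-r,1:] * ([:-r,1:] * wronskian2 C B) = [:-r,1:]^m * ([:-r,1:] * Y)"
proof -
  let ?q = "[:-r,1:]"
  define E1 where "E1 = of_nat (Suc m) * E + ?q * pderiv E"
  have q_pderiv_C: "?q * pderiv C = ?q^Suc m * E1" unfolding C_def E1_def by (rule linear_mult_pderiv_power_mult)
  then have C': "pderiv C = ?q^m * E1"
    unfolding power_Suc mult.assoc by (metis mult_left_cancel pCons_eq_0_iff zero_neq_one)
  define U where "U = B * E1 - ?q * E * pderiv B"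
  define Y where "Y = pderiv B * (of_nat (Suc m) * E1 + ?q * pderiv E1 - E1) - ?q * E1 * pderiv (pderiv B)"
  have "wronskian C B = B * (?q^m * E1) - C * pderiv B" unfolding wronskian_def C' ..
  also have "\<dots> = ?q^m * U" unfolding U_def C_def by (simp only: power_Suc) (simp add: algebra_simps)
  finally have "wronskian C B = ?q^m * U" .
  moreover have "poly U r = of_nat (Suc m) * poly E r * poly B r"
    unfolding U_def E1_def by (simp add: of_nat_poly algebra_simps)
  moreover have "?q * (?q * wronskian2 C B) = pderiv B * (?q * (?q * pderiv (pderiv C))) - ?q * (?q * pderiv C) * pderiv (pderiv B)"
    unfolding wronskian2_def right_diff_distrib by (simp only: mult_ac)
  then have "?q * (?q * wronskian2 C B) = ?q^m * (?q * Y)"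
    unfolding linear_sq_mult_pderiv2[OF q_pderiv_C] q_pderiv_C Y_def right_diff_distrib power_Suc by (simp only: mult_ac)
  ultimately show ?thesis by (rule that)
qed

lemma schwarzian_leading_term:
  fixes A B :: "'a::idom poly"
  assumes w: "wronskian A B = [:-r,1:]^m * U" and wronskian2_eq: "[:-r,1:] * ([:-r,1:] * wronskian2 A B) = [:-r,1:]^m * ([:-r,1:] * Y)"
  obtains V where "[:-r,1:] * ([:-r,1:] * schwarzian A B) = ([:-r,1:]^m)^2 * V"
    "poly V r = - (of_nat m * (of_nat m + 2) * (poly U r)^2)"
proof -
  let ?q = "[:-r,1:]" and ?w = "wronskian A B"
  define U1 where "U1 = of_nat m * U + ?q * pderiv U"
  define V where "V = 2 * U * (of_nat m * U1 + ?q * pderiv U1 - U1) + 4 * U * (?q * Y) - 3 * U1^2"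
  have q_pderiv_w: "?q * pderiv ?w = ?q^m * U1" unfolding w U1_def by (rule linear_mult_pderiv_power_mult)
  have "?q * (?q * schwarzian A B) = 2 * ?w * (?q * (?q * pderiv (pderiv ?w))) + 4 * ?w * (?q * (?q * wronskian2 A B))
     - 3 * (?q * pderiv ?w)^2"
    unfolding schwarzian_def right_diff_distrib distrib_left power2_eq_square by (simp only: mult_ac)
  also have "\<dots> = (?q^m)^2 * V"
    unfolding linear_sq_mult_pderiv2[OF q_pderiv_w] wronskian2_eq q_pderiv_w unfolding w V_def
    unfolding right_diff_distrib distrib_left power2_eq_square by (simp only: mult_ac)
  finally show ?thesis by (rule that) (simp add: V_def U1_def of_nat_poly algebra_simps power2_eq_square)
qed

lemma schwarzian_nonzero_at:
  fixes A B :: "'a::alg_closed_field poly"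
  assumes d: "d \<ge> 3" and char: "good_char TYPE('a) d" and deg: "degree A \<le> d-1" "degree B \<le> d-1"
    and B_nonroot: "poly B r \<noteq> 0" and root: "poly (wronskian A B) r = 0" and nz: "wronskian A B \<noteq> 0"
  shows "schwarzian A B \<noteq> 0"
proof
  assume schwarzian_0: "schwarzian A B = 0"
  let ?q = "[:-r,1:]"
  define C where "C = A - smult (poly A r / poly B r) B"
  have "degree C \<le> d - 1" unfolding C_def using deg by (meson degree_diff_le degree_smult_le order_trans)
  have wronskian_C: "wronskian C B = wronskian A B" unfolding C_def by (rule wronskian_diff_smult)
  have "C \<noteq> 0" using nz wronskian_C by (auto simp: wronskian_def pderiv_0)
  moreover have "poly C r = 0" using B_nonroot by (simp add: C_def)
  ultimately obtain m where m: "order r C = Suc m" using order_root[of C r] by (auto simp: gr0_conv_Suc)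
  have m_bound: "Suc m \<le> d - 1" using order_degree[OF \<open>C \<noteq> 0\<close>, of r] \<open>degree C \<le> d - 1\<close> m by simp
  obtain E where C_factor: "C = ?q^Suc m * E" and "\<not> ?q dvd E" using order_decomp[OF \<open>C \<noteq> 0\<close>, of r] m by auto
  then have E_nonroot: "poly E r \<noteq> 0" by (simp add: poly_eq_0_iff_dvd)
  obtain U Y where U: "wronskian C B = ?q^m * U" "poly U r = of_nat (Suc m) * poly E r * poly B r"
    and Y: "?q * (?q * wronskian2 C B) = ?q^m * (?q * Y)"
    using wronskian_at_root[of r m E B] unfolding C_factor[symmetric] by blast
  have U_nonroot: "poly U r \<noteq> 0" unfolding U(2) using good_char_of_nat[OF char, of "Suc m"] m_bound E_nonroot B_nonroot by simp
  then have m_pos: "0 < m" using root U(1) unfolding wronskian_C by (cases m) auto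
  obtain V where "?q * (?q * schwarzian C B) = (?q^m)^2 * V" and V: "poly V r = - (of_nat m * (of_nat m + 2) * (poly U r)^2)"
    using schwarzian_leading_term[OF U(1) Y] .
  moreover have "schwarzian C B = 0" unfolding C_def schwarzian_diff_smult by (rule schwarzian_0)
  ultimately have "V = 0" by simp
  then have "of_nat m * (of_nat m + 2) * (poly U r)^2 = 0" using V by simp
  moreover have "(of_nat m :: 'a) \<noteq> 0" using good_char_of_nat[OF char, of m] m_pos m_bound by auto
  moreover have "(of_nat m + 2 :: 'a) \<noteq> 0" using good_char_of_nat[OF char, of "m+2"] m_bound d by (simp add: add.commute)
  ultimately show False using U_nonroot by simp
qed

lemma schwarzian_nonzero:
  fixes A B :: "'a::alg_closed_field poly"
  assumes d: "d \<ge> 3" and char: "good_char TYPE('a) d" and deg: "degree A \<le> d-1" "degree B \<le> d-1"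
    and no_common_root: "\<And>r. poly A r = 0 \<Longrightarrow> poly B r \<noteq> 0"
    and top: "coeff A (d-1) \<noteq> 0 \<or> coeff B (d-1) \<noteq> 0"
  shows "schwarzian A B \<noteq> 0"
proof -
  have pderiv_nonzero: "pderiv (wronskian A B) \<noteq> 0" by (rule pderiv_wronskian_nonzero[OF d char no_common_root top])
  then have nz: "wronskian A B \<noteq> 0" by (auto simp: pderiv_0)
  have "degree (wronskian A B) > 0" using pderiv_nonzero by (metis degree_eq_zeroE gr0I pderiv_pCons pderiv_0 pCons_0_0 add_0)
  then obtain r where r: "poly (wronskian A B) r = 0" using alg_closed_imp_poly_has_root by blast
  show ?thesis
  proof (cases "poly B r = 0")
    case False
    then show ?thesis using schwarzian_nonzero_at[OF d char deg False r nz] by simp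
  next
    case True
    then have "poly A r \<noteq> 0" using no_common_root by auto
    then show ?thesis
      using schwarzian_nonzero_at[OF d char deg(2,1), of r] r nz by (simp add: wronskian_swap[of A B] schwarzian_swap[of A B])
  qed
qed

section \<open>Bezout on the product of two projective lines\<close>

lemma obtain_row_relation:
  fixes M :: "'a::field mat"
  assumes M: "M \<in> carrier_mat n n" and det: "Determinant.det M = 0"
  obtains v where "\<exists>i<n. v i \<noteq> 0" "\<And>j. j < n \<Longrightarrow> (\<Sum>i=0..<n. v i * M $$ (i,j)) = 0"
proof -
  have "Determinant.det (transpose_mat M) = 0" using Determinant.det_transpose[OF M] det by simp
  then obtain w where w: "w \<in> carrier_vec n" "w \<noteq> 0\<^sub>v n" "transpose_mat M *\<^sub>v w = 0\<^sub>v n"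
    using det_0_iff_vec_prod_zero[of "transpose_mat M" n] M by auto
  have "\<exists>i<n. vec_index w i \<noteq> 0" using w(1,2) by (auto simp: Matrix.vec_eq_iff)
  moreover have "(\<Sum>i=0..<n. vec_index w i * M $$ (i,j)) = 0" if "j < n" for j
  proof -
    have "vec_index (transpose_mat M *\<^sub>v w) j = (\<Sum>i=0..<n. M $$ (i,j) * vec_index w i)"
      using that w(1) M by (auto simp: scalar_prod_def)
    then show ?thesis using w(3) that by (simp add: mult.commute)
  qed
  ultimately show ?thesis by (rule that)
qed

lemma prod_column_divisors_dvd_det:
  fixes M :: "'a::comm_ring_1 mat"
  assumes M: "M \<in> carrier_mat n n" and dvd: "\<And>i j. i < n \<Longrightarrow> j < n \<Longrightarrow> c j dvd M $$ (i,j)"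
  shows "(\<Prod>j=0..<n. c j) dvd Determinant.det M"
  unfolding det_def'[OF M]
proof (rule dvd_sum)
  fix p assume "p \<in> {p. p permutes {0..<n}}"
  then have p: "p permutes {0..<n}" by simp
  have "(\<Prod>j=0..<n. c j) = (\<Prod>i=0..<n. c (p i))" using prod.permute[OF p, of c] by (simp add: o_def)
  also have "\<dots> dvd (\<Prod>i=0..<n. M $$ (i, p i))" using p by (intro prod_dvd_prod dvd) (auto simp: permutes_in_image)
  finally show "(\<Prod>j=0..<n. c j) dvd signof p * (\<Prod>i=0..<n. M $$ (i, p i))" by simp
qed

lemma degree_det_le_sum_row_degrees:
  fixes M :: "'a::idom poly mat"
  assumes M: "M \<in> carrier_mat n n" and deg: "\<And>i j. i < n \<Longrightarrow> j < n \<Longrightarrow> degree (M $$ (i,j)) \<le> r i"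
  shows "degree (Determinant.det M) \<le> (\<Sum>i=0..<n. r i)"
  unfolding det_def'[OF M]
proof (rule degree_sum_le)
  fix p assume "p \<in> {p. p permutes {0..<n}}"
  then have p: "p permutes {0..<n}" by simp
  have "degree (signof p * (\<Prod>i=0..<n. M $$ (i, p i))) \<le> degree (\<Prod>i=0..<n. M $$ (i, p i))" by (simp add: sign_def)
  also have "\<dots> \<le> (\<Sum>i=0..<n. degree (M $$ (i, p i)))"
    using degree_prod_sum_le[of "{0..<n}" "\<lambda>i. M $$ (i, p i)"] by (simp add: o_def)
  also have "\<dots> \<le> (\<Sum>i=0..<n. r i)" using p by (intro sum_mono deg) (auto simp: permutes_in_image)
  finally show "degree (signof p * (\<Prod>i=0..<n. M $$ (i, p i))) \<le> (\<Sum>i=0..<n. r i)" .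
qed (simp add: finite_permutations)

definition sylvester_row :: "nat \<Rightarrow> nat \<Rightarrow> 'a::comm_ring_1 poly \<Rightarrow> 'a poly \<Rightarrow> nat \<Rightarrow> 'a poly" where
  "sylvester_row a b G H i = (if i < b then monom 1 (b - Suc i) * G else monom 1 (a + b - Suc i) * H)"

lemma degree_sylvester_row:
  assumes "degree G \<le> a" "degree H \<le> b" "i < a + b"
  shows "degree (sylvester_row a b G H i) < a + b"
proof -
  have "degree (monom 1 k * P) \<le> k + degree P" for k and P :: "'a poly"
    by (meson add_mono degree_monom_le degree_mult_le le_refl order_trans)
  from this[of "b - Suc i" G] this[of "a + b - Suc i" H] show ?thesis
    using assms unfolding sylvester_row_def by (cases "i < b") auto
qed

lemma sylvester_mat_sub_eq_coeff_row:
  fixes G H :: "'a::comm_ring_1 poly"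
  assumes "degree G \<le> a" "degree H \<le> b" "i < a + b" "j < a + b"
  shows "sylvester_mat_sub a b G H $$ (i,j) = coeff (sylvester_row a b G H i) (a + b - Suc j)"
proof (cases "i < b")
  case True
  then show ?thesis using assms
    by (auto simp: sylvester_mat_sub_index sylvester_row_def coeff_monom_mult intro!: coeff_eq_0 arg_cong[of _ _ "coeff G"])
next
  case False
  then show ?thesis using assms
    by (auto simp: sylvester_mat_sub_index sylvester_row_def coeff_monom_mult intro!: coeff_eq_0 arg_cong[of _ _ "coeff H"])
qed

lemma degree_resultant_sub_le:
  fixes G H :: "'a::idom poly poly"
  assumes "\<And>j. degree (coeff G j) \<le> m" "\<And>j. degree (coeff H j) \<le> n"
  shows "degree (resultant_sub a b G H) \<le> b * m + a * n"
proof -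
  have "degree (resultant_sub a b G H) \<le> (\<Sum>i=0..<a+b. if i < b then m else n)"
    unfolding resultant_sub_def using assms
    by (intro degree_det_le_sum_row_degrees[OF sylvester_mat_sub_carrier]) (auto simp: sylvester_mat_sub_index)
  also have "\<dots> = (\<Sum>i=0..<b. if i < b then m else n) + (\<Sum>i=b..<a+b. if i < b then m else n)"
    by (rule sum.atLeastLessThan_concat[symmetric]) auto
  finally show ?thesis by simp
qed

lemma poly_resultant_sub:
  "poly (resultant_sub a b G H) x = resultant_sub a b (map_poly (\<lambda>p. poly p x) G) (map_poly (\<lambda>p. poly p x) H)"
  for x :: "'a::comm_ring_1"
  using comm_ring_hom.hom_det[OF poly_hom.comm_ring_hom_axioms, of x "sylvester_mat_sub a b G H"]
  by (simp add: resultant_sub_def sylvester_mat_sub_map)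

lemma sum_sylvester_rows:
  fixes G H :: "'a::comm_ring_1 poly"
  shows "(\<Sum>i=0..<a+b. smult (v i) (sylvester_row a b G H i))
    = (\<Sum>i<b. monom (v (b - Suc i)) i) * G + (\<Sum>i<a. monom (v (b + (a - Suc i))) i) * H"
proof -
  have "(\<Sum>i=0..<a+b. smult (v i) (sylvester_row a b G H i))
      = (\<Sum>i<b. smult (v i) (monom 1 (b - Suc i) * G)) + (\<Sum>i<a. smult (v (b + i)) (monom 1 (a - Suc i) * H))"
    using sum.atLeastLessThan_concat[of 0 b "a+b" "\<lambda>i. smult (v i) (sylvester_row a b G H i)"]
      sum.shift_bounds_nat_ivl[of "\<lambda>i. smult (v i) (sylvester_row a b G H i)" 0 b a]
    by (simp add: sylvester_row_def add.commute lessThan_atLeast0)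
  also have "(\<Sum>i<b. smult (v i) (monom 1 (b - Suc i) * G)) = (\<Sum>i<b. monom (v (b - Suc i)) i) * G"
    unfolding sum_distrib_right
    by (subst sum.nat_diff_reindex[symmetric]) (simp add: mult_smult_left[symmetric] smult_monom del: mult_smult_left)
  also have "(\<Sum>i<a. smult (v (b + i)) (monom 1 (a - Suc i) * H)) = (\<Sum>i<a. monom (v (b + (a - Suc i))) i) * H"
    unfolding sum_distrib_right
    by (subst sum.nat_diff_reindex[symmetric]) (simp add: mult_smult_left[symmetric] smult_monom del: mult_smult_left)
  finally show ?thesis .
qed

lemma sum_sylvester_rows_eq_0:
  fixes G H :: "'a::comm_ring_1 poly"
  assumes degree: "degree G \<le> a" "degree H \<le> b"
    and rel: "\<And>j. j < a + b \<Longrightarrow> (\<Sum>i=0..<a+b. v i * sylvester_mat_sub a b G H $$ (i,j)) = 0"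
  shows "(\<Sum>i=0..<a+b. smult (v i) (sylvester_row a b G H i)) = 0"
proof (rule poly_eqI)
  fix j
  show "coeff (\<Sum>i=0..<a+b. smult (v i) (sylvester_row a b G H i)) j = coeff 0 j"
  proof (cases "j < a + b")
    case True
    have "coeff (\<Sum>i=0..<a+b. smult (v i) (sylvester_row a b G H i)) j
        = (\<Sum>i=0..<a+b. v i * sylvester_mat_sub a b G H $$ (i, a + b - Suc j))"
      using True by (auto simp: coeff_sum sylvester_mat_sub_eq_coeff_row[OF degree] intro!: sum.cong)
    then show ?thesis using rel True by simp
  next
    case False
    then have "coeff (sylvester_row a b G H i) j = 0" if "i < a + b" for i
      using degree_sylvester_row[OF degree that] by (intro coeff_eq_0) simp
    then show ?thesis by (simp add: coeff_sum)
  qed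
qed

lemma resultant_sub_nonzero:
  fixes G H :: "'a::alg_closed_field poly"
  assumes dG: "degree G \<le> a" "coeff G a \<noteq> 0" and dH: "degree H \<le> b"
    and no_common_root: "\<And>r. poly G r = 0 \<Longrightarrow> poly H r \<noteq> 0"
  shows "resultant_sub a b G H \<noteq> 0"
proof
  assume "resultant_sub a b G H = 0"
  then obtain v where "\<exists>i<a+b. v i \<noteq> 0"
    and rel: "\<And>j. j < a + b \<Longrightarrow> (\<Sum>i=0..<a+b. v i * sylvester_mat_sub a b G H $$ (i,j)) = 0"
    unfolding resultant_sub_def using obtain_row_relation[OF sylvester_mat_sub_carrier] by blast
  define F where "F = (\<Sum>i<b. monom (v (b - Suc i)) i)"
  define K where "K = (\<Sum>i<a. monom (v (b + (a - Suc i))) i)"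
  have syzygy: "F * G = - (K * H)"
    using sum_sylvester_rows_eq_0[OF dG(1) dH rel] by (simp add: sum_sylvester_rows F_def K_def eq_neg_iff_add_eq_0)
  have "G \<noteq> 0" using dG by auto
  have "K = 0"
  proof (cases "a = 0")
    case False
    have "G dvd K * H" using syzygy by (metis dvd_minus_iff dvd_triv_right)
    then have "G dvd K" using dvd_if_no_common_root[OF \<open>G \<noteq> 0\<close>] no_common_root by blast
    moreover have "degree K < a" unfolding K_def using False
      by (intro degree_sum_less) (auto intro: le_less_trans[OF degree_monom_le])
    moreover have "degree G = a" using dG le_degree by (metis le_antisym)
    ultimately show ?thesis using dvd_imp_degree_le by (metis not_less)
  qed (simp add: K_def)
  then have "F = 0" using syzygy \<open>G \<noteq> 0\<close> by simp
  have "v i = 0" if "i < a + b" for i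
  proof (cases "i < b")
    case True
    then have "coeff F (b - Suc i) = v i" unfolding F_def coeff_sum by (simp add: sum.delta')
    then show ?thesis using \<open>F = 0\<close> by simp
  next
    case False
    then have "coeff K (a + b - Suc i) = v i" using that unfolding K_def coeff_sum by (auto simp: sum.delta')
    then show ?thesis using \<open>K = 0\<close> by simp
  qed
  then show False using \<open>\<exists>i<a+b. v i \<noteq> 0\<close> by blast
qed

definition interpolation_mat :: "nat \<Rightarrow> nat \<Rightarrow> (nat \<Rightarrow> 'a::comm_ring_1) \<Rightarrow> 'a mat" where
  "interpolation_mat n k y = Matrix.mat n n (\<lambda>(r,j). if j < k then y j ^ (n - Suc r) else if n - Suc r = j then 1 else 0)"

lemma poly_eq_sum_lessThan: "degree p < n \<Longrightarrow> poly p x = (\<Sum>r<n. coeff p r * x ^ r)"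
  for x :: "'a::comm_ring_1"
  by (subst poly_altdef, rule sum.mono_neutral_left) (auto simp: coeff_eq_0)

lemma interpolation_mat_combination:
  fixes p :: "'a::comm_ring_1 poly"
  assumes "degree p < n" "j < n"
  shows "(\<Sum>r=0..<n. coeff p (n - Suc r) * interpolation_mat n k y $$ (r,j)) = (if j < k then poly p (y j) else coeff p j)"
proof (cases "j < k")
  case True
  then have "(\<Sum>r=0..<n. coeff p (n - Suc r) * interpolation_mat n k y $$ (r,j)) = (\<Sum>r<n. coeff p (n - Suc r) * y j ^ (n - Suc r))"
    using assms(2) by (auto simp: interpolation_mat_def lessThan_atLeast0 intro!: sum.cong)
  also have "\<dots> = poly p (y j)" using sum.nat_diff_reindex[of "\<lambda>r. coeff p r * y j ^ r" n] poly_eq_sum_lessThan[OF assms(1)] by simp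
  finally show ?thesis using True by simp
next
  case False
  then have "(\<Sum>r=0..<n. coeff p (n - Suc r) * interpolation_mat n k y $$ (r,j)) = (\<Sum>r<n. if n - Suc r = j then coeff p (n - Suc r) else 0)"
    using assms(2) by (auto simp: interpolation_mat_def lessThan_atLeast0 intro!: sum.cong)
  also have "\<dots> = (\<Sum>r<n. if r = j then coeff p r else 0)"
    using sum.nat_diff_reindex[of "\<lambda>r. if r = j then coeff p r else 0" n] by simp
  finally show ?thesis using assms(2) False by simp
qed

lemma det_interpolation_mat_nonzero:
  fixes y :: "nat \<Rightarrow> 'a::field"
  assumes inj: "inj_on y {0..<k}" and k: "k \<le> n"
  shows "Determinant.det (interpolation_mat n k y) \<noteq> 0"
proof
  assume "Determinant.det (interpolation_mat n k y) = 0"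
  moreover have "interpolation_mat n k y \<in> carrier_mat n n" by (simp add: interpolation_mat_def)
  ultimately obtain v where "\<exists>i<n. v i \<noteq> 0"
    and rel: "\<And>j. j < n \<Longrightarrow> (\<Sum>r=0..<n. v r * interpolation_mat n k y $$ (r,j)) = 0"
    using obtain_row_relation by blast
  define p where "p = (\<Sum>r<n. monom (v (n - Suc r)) r)"
  have coeff_p: "coeff p r = (if r < n then v (n - Suc r) else 0)" for r unfolding p_def coeff_sum by (simp add: sum.delta')
  have "n \<noteq> 0" using \<open>\<exists>i<n. v i \<noteq> 0\<close> by auto
  moreover have "degree p \<le> n - 1" by (intro degree_le) (auto simp: coeff_p)
  ultimately have "degree p < n" by simp
  have entry_zero: "(if j < k then poly p (y j) else coeff p j) = 0" if "j < n" for j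
    unfolding interpolation_mat_combination[OF \<open>degree p < n\<close> that, symmetric] rel[OF that, symmetric]
    by (auto simp: coeff_p intro!: sum.cong)
  have "poly p (y j) = 0" if "j < k" for j using entry_zero[of j] k that by simp
  then have roots: "y ` {0..<k} \<subseteq> {t. poly p t = 0}" by auto
  have high: "coeff p j = 0" if "k \<le> j" for j using entry_zero[of j] coeff_p[of j] that by (auto split: if_splits)
  have "p = 0"
  proof (rule ccontr)
    assume "p \<noteq> 0"
    then have "card (y ` {0..<k}) \<le> card {t. poly p t = 0}" using roots poly_roots_finite by (intro card_mono)
    also have "\<dots> \<le> degree p" by (rule card_poly_roots_bound[OF \<open>p \<noteq> 0\<close>])
    finally show False using high[of "degree p"] \<open>p \<noteq> 0\<close> card_image[OF inj] by simp
  qed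
  then have "v i = 0" if "i < n" for i using coeff_p[of "n - Suc i"] that by simp
  then show False using \<open>\<exists>i<n. v i \<noteq> 0\<close> by blast
qed

lemma fibre_multiplicity_dvd_resultant_sub:
  fixes G H :: "'a::field poly poly"
  assumes dG: "degree G \<le> a" and dH: "degree H \<le> b" and k: "k \<le> a + b"
    and dvd: "\<And>j. j < k \<Longrightarrow> [:-x,1:]^m j dvd poly G (Y j)" "\<And>j. j < k \<Longrightarrow> [:-x,1:]^m j dvd poly H (Y j)"
    and inj: "inj_on (\<lambda>j. poly (Y j) x) {0..<k}"
  shows "[:-x,1:]^(\<Sum>j=0..<k. m j) dvd resultant_sub a b G H"
proof -
  let ?n = "a + b" and ?q = "[:-x,1:]"
  let ?S = "sylvester_mat_sub a b G H" and ?V = "interpolation_mat (a + b) k Y"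
  have V: "?V \<in> carrier_mat ?n ?n" by (simp add: interpolation_mat_def)
  define c where "c j = (if j < k then ?q ^ m j else 1)" for j
  have "c j dvd (?S * ?V) $$ (i,j)" if ij: "i < ?n" "j < ?n" for i j
  proof (cases "j < k")
    case True
    have "(?S * ?V) $$ (i,j) = (\<Sum>r=0..<?n. coeff (sylvester_row a b G H i) (?n - Suc r) * ?V $$ (r,j))"
      using ij V by (simp add: scalar_prod_def sylvester_mat_sub_eq_coeff_row[OF dG dH])
    also have "\<dots> = poly (sylvester_row a b G H i) (Y j)"
      unfolding interpolation_mat_combination[OF degree_sylvester_row[OF dG dH ij(1)] ij(2)] using True by simp
    finally show ?thesis using dvd[OF True] True by (auto simp: c_def sylvester_row_def)
  qed (simp add: c_def)
  then have "(\<Prod>j=0..<?n. c j) dvd Determinant.det (?S * ?V)"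
    by (intro prod_column_divisors_dvd_det mult_carrier_mat[OF sylvester_mat_sub_carrier V])
  moreover have "(\<Prod>j=0..<?n. c j) = (\<Prod>j=0..<k. c j)" by (rule prod.mono_neutral_right) (use k in \<open>auto simp: c_def\<close>)
  moreover have "\<dots> = ?q ^ (\<Sum>j=0..<k. m j)" unfolding power_sum by (rule prod.cong) (auto simp: c_def)
  ultimately have "?q ^ (\<Sum>j=0..<k. m j) dvd Determinant.det ?V * resultant_sub a b G H"
    using det_mult[OF sylvester_mat_sub_carrier V, of G H] by (simp add: resultant_sub_def mult.commute)
  moreover have "poly (Determinant.det ?V) x \<noteq> 0"
  proof -
    have "map_mat (\<lambda>p. poly p x) ?V = interpolation_mat ?n k (\<lambda>j. poly (Y j) x)"
      by (rule eq_matI) (auto simp: interpolation_mat_def)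
    then show ?thesis using det_interpolation_mat_nonzero[OF inj k] comm_ring_hom.hom_det[OF poly_hom.comm_ring_hom_axioms, of x ?V] by simp
  qed
  ultimately show ?thesis by (rule linear_power_dvd_cancel)
qed

lemma poly_map_poly_eval: "poly (map_poly (\<lambda>p. poly p x) P) (poly Q x) = poly (poly P Q) (x::'a::comm_ring_1)"
  by (induction P) (auto simp: map_poly_pCons)

lemma card_roots_in_fibre_le:
  fixes G :: "'a::idom poly poly"
  assumes "degree G \<le> a" "map_poly (\<lambda>p. poly p x) G \<noteq> 0" "inj_on (\<lambda>i. poly (Y i) x) J" "\<And>i. i \<in> J \<Longrightarrow> poly (poly G (Y i)) x = 0"
  shows "card J \<le> a"
proof -
  let ?g = "map_poly (\<lambda>p. poly p x) G"
  have "(\<lambda>i. poly (Y i) x) ` J \<subseteq> {t. poly ?g t = 0}" using assms(4) by (auto simp: poly_map_poly_eval)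
  then have "card J \<le> card {t. poly ?g t = 0}"
    using card_mono[OF poly_roots_finite[OF assms(2)]] card_image[OF assms(3)] by metis
  also have "\<dots> \<le> degree ?g" by (rule card_poly_roots_bound[OF assms(2)])
  also have "\<dots> \<le> a" using assms(1) degree_map_poly_le order_trans by blast
  finally show ?thesis .
qed

theorem bezout_bidegree:
  fixes G H :: "'a::alg_closed_field poly poly"
  assumes dG: "degree G \<le> a" and dH: "degree H \<le> b"
    and mG: "\<And>j. degree (coeff G j) \<le> m" and nH: "\<And>j. degree (coeff H j) \<le> n"
    and top: "poly (coeff G a) x0 \<noteq> 0"
    and no_common_root: "\<And>y. poly (poly G [:y:]) x0 = 0 \<Longrightarrow> poly (poly H [:y:]) x0 \<noteq> 0"
    and fin: "finite I"
    and dvdG: "\<And>i. i \<in> I \<Longrightarrow> [:-x i,1:]^k i dvd poly G (Y i)"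
    and dvdH: "\<And>i. i \<in> I \<Longrightarrow> [:-x i,1:]^k i dvd poly H (Y i)"
    and pos: "\<And>i. i \<in> I \<Longrightarrow> k i \<ge> 1"
    and nz: "\<And>i. i \<in> I \<Longrightarrow> map_poly (\<lambda>p. poly p (x i)) G \<noteq> 0"
    and inj: "inj_on (\<lambda>i. (x i, poly (Y i) (x i))) I"
  shows "(\<Sum>i\<in>I. k i) \<le> a * n + b * m"
proof -
  let ?R = "resultant_sub a b G H"
  have eval: "poly (map_poly (\<lambda>p. poly p x0) P) y = poly (poly P [:y:]) x0" for P y
    using poly_map_poly_eval[of x0 P "[:y:]"] by simp
  have "poly ?R x0 \<noteq> 0" unfolding poly_resultant_sub
    by (rule resultant_sub_nonzero[OF order_trans[OF degree_map_poly_le dG] _ order_trans[OF degree_map_poly_le dH]])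
      (use top no_common_root in \<open>simp_all add: coeff_map_poly eval\<close>)
  then have "?R \<noteq> 0" by auto
  have fibre: "[:-z,1:]^(\<Sum>i | i \<in> I \<and> x i = z. k i) dvd ?R" if "z \<in> x ` I" for z
  proof -
    let ?J = "{i. i \<in> I \<and> x i = z}"
    have "finite ?J" using fin by simp
    then obtain h where h: "bij_betw h {0..<card ?J} ?J" using ex_bij_betw_nat_finite by blast
    have in_fibre: "h j \<in> I \<and> x (h j) = z" if "j < card ?J" for j using bij_betwE[OF h] that by auto
    have inj_J: "inj_on (\<lambda>i. poly (Y i) z) ?J" by (rule inj_onI) (auto intro: inj_onD[OF inj])
    have "[:-z,1:] dvd poly G (Y i)" if "i \<in> ?J" for i
    proof -
      have "[:-z,1:]^1 dvd [:-z,1:]^k i" by (rule le_imp_power_dvd) (use pos that in auto)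
      then show ?thesis using dvdG[of i] that by (auto elim: dvd_trans)
    qed
    then have "card ?J \<le> a"
      using card_roots_in_fibre_le[OF dG _ inj_J] nz that by (auto simp: poly_eq_0_iff_dvd)
    moreover have "inj_on (\<lambda>j. poly (Y (h j)) z) {0..<card ?J}"
      using comp_inj_on[OF bij_betw_imp_inj_on[OF h], of "\<lambda>i. poly (Y i) z"] inj_J bij_betw_imp_surj_on[OF h]
      by (simp add: o_def)
    moreover have "[:-z,1:]^k (h j) dvd poly G (Y (h j))" "[:-z,1:]^k (h j) dvd poly H (Y (h j))" if "j < card ?J" for j
      using dvdG[of "h j"] dvdH[of "h j"] in_fibre[OF that] by auto
    ultimately have "[:-z,1:]^(\<Sum>j=0..<card ?J. k (h j)) dvd ?R"
      by (intro fibre_multiplicity_dvd_resultant_sub[OF dG dH]) auto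
    then show ?thesis using sum.reindex_bij_betw[OF h, of k] by simp
  qed
  have "(\<Sum>i\<in>I. k i) = (\<Sum>z\<in>x ` I. \<Sum>i | i \<in> I \<and> x i = z. k i)" by (rule sum.image_gen[OF fin])
  also have "\<dots> \<le> degree ?R" by (rule sum_multiplicities_le_degree[OF _ \<open>?R \<noteq> 0\<close> fibre]) (use fin in auto)
  also have "\<dots> \<le> b * m + a * n" by (rule degree_resultant_sub_le[OF mG nH])
  finally show ?thesis by simp
qed

section \<open>Forms and their polar forms\<close>

lemmas cart_eq = Finite_Cartesian_Product.vec_eq_iff

definition monom_at :: "nat \<times> nat \<times> nat \<times> nat \<Rightarrow> 'a::comm_ring_1^4 \<Rightarrow> 'a" where
  "monom_at m x = monom_eval m (x$1, x$2, x$3, x$4)"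

definition form_at :: "nat \<Rightarrow> 'a::comm_ring_1 form4 \<Rightarrow> 'a^4 \<Rightarrow> 'a" where
  "form_at d c x = (\<Sum>m\<in>mons d. c m * monom_at m x)"

definition homogeneous :: "nat \<Rightarrow> 'a::comm_ring_1 form4 \<Rightarrow> bool" where
  "homogeneous d c \<longleftrightarrow> (\<forall>m. m \<notin> mons d \<longrightarrow> c m = 0)"

definition exponent :: "4 \<Rightarrow> nat \<times> nat \<times> nat \<times> nat \<Rightarrow> nat" where
  "exponent r = (\<lambda>(i,j,k,l). if r = 1 then i else if r = 2 then j else if r = 3 then k else l)"
definition map_exponent :: "(nat \<Rightarrow> nat) \<Rightarrow> 4 \<Rightarrow> nat \<times> nat \<times> nat \<times> nat \<Rightarrow> nat \<times> nat \<times> nat \<times> nat" where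
  "map_exponent f r = (\<lambda>(i,j,k,l). if r = 1 then (f i,j,k,l) else if r = 2 then (i,f j,k,l)
     else if r = 3 then (i,j,f k,l) else (i,j,k,f l))"
abbreviation raise_exponent :: "4 \<Rightarrow> nat \<times> nat \<times> nat \<times> nat \<Rightarrow> nat \<times> nat \<times> nat \<times> nat" where
  "raise_exponent \<equiv> map_exponent Suc"
abbreviation lower_exponent :: "4 \<Rightarrow> nat \<times> nat \<times> nat \<times> nat \<Rightarrow> nat \<times> nat \<times> nat \<times> nat" where
  "lower_exponent \<equiv> map_exponent (\<lambda>n. n - 1)"

definition partial :: "4 \<Rightarrow> 'a::comm_ring_1 form4 \<Rightarrow> 'a form4" where
  "partial r c m = of_nat (Suc (exponent r m)) * c (raise_exponent r m)"

definition polar1 :: "nat \<Rightarrow> 'a::comm_ring_1 form4 \<Rightarrow> 'a^4 \<Rightarrow> 'a^4 \<Rightarrow> 'a" where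
  "polar1 d c x v = (\<Sum>i\<in>UNIV. v$i * form_at (d - 1) (partial i c) x)"
definition polar2 :: "nat \<Rightarrow> 'a::comm_ring_1 form4 \<Rightarrow> 'a^4 \<Rightarrow> 'a^4 \<Rightarrow> 'a^4 \<Rightarrow> 'a" where
  "polar2 d c x v w = (\<Sum>i\<in>UNIV. v$i * polar1 (d - 1) (partial i c) x w)"
definition polar3 :: "nat \<Rightarrow> 'a::comm_ring_1 form4 \<Rightarrow> 'a^4 \<Rightarrow> 'a^4 \<Rightarrow> 'a^4 \<Rightarrow> 'a^4 \<Rightarrow> 'a" where
  "polar3 d c x u v w = (\<Sum>i\<in>UNIV. u$i * polar2 (d - 1) (partial i c) x v w)"
definition polar4 :: "nat \<Rightarrow> 'a::comm_ring_1 form4 \<Rightarrow> 'a^4 \<Rightarrow> 'a^4 \<Rightarrow> 'a^4 \<Rightarrow> 'a^4 \<Rightarrow> 'a^4 \<Rightarrow> 'a" where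
  "polar4 d c x t u v w = (\<Sum>i\<in>UNIV. t$i * polar3 (d - 1) (partial i c) x u v w)"

lemma finite_mons [simp]: "finite (mons d)"
proof (rule finite_subset)
  show "mons d \<subseteq> {..d} \<times> {..d} \<times> {..d} \<times> {..d}" by (auto simp: mons_def)
qed auto

lemma partial_commute: "partial i (partial j c) = partial j (partial i c)"
  by (auto simp: partial_def exponent_def map_exponent_def fun_eq_iff)

lemma homogeneous_partial: "homogeneous d c \<Longrightarrow> homogeneous (d - 1) (partial i c)"
  by (cases d) (auto simp: homogeneous_def mons_def partial_def map_exponent_def)

lemma form_at_partial:
  assumes "homogeneous d c"
  shows "form_at (d - 1) (partial r c) x = (\<Sum>m\<in>mons d. c m * (of_nat (exponent r m) * monom_at (lower_exponent r m) x))"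
proof (cases d)
  case 0
  then have "mons d = {(0,0,0,0)}" by (auto simp: mons_def)
  then show ?thesis using assms 0
    by (auto simp: form_at_def partial_def exponent_def map_exponent_def homogeneous_def)
next
  case (Suc n)
  show ?thesis unfolding form_at_def
  proof (rule sum.reindex_bij_witness_not_neutral[where S'="{}" and T'="{m\<in>mons d. exponent r m = 0}"
        and i="lower_exponent r" and j="raise_exponent r"])
    show "finite {}" "finite {m \<in> mons d. exponent r m = 0}" by simp_all
  qed (use Suc in \<open>auto simp: mons_def exponent_def map_exponent_def partial_def ac_simps split: if_splits\<close>)
qed

lemma polar1_eq_sum_monom_at:
  assumes "homogeneous d c"
  shows "polar1 d c x v
    = (\<Sum>m\<in>mons d. c m * (\<Sum>r\<in>UNIV. v$r * (of_nat (exponent r m) * monom_at (lower_exponent r m) x)))"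
  unfolding polar1_def form_at_partial[OF assms] sum_distrib_left by (subst sum.swap) (simp add: mult.left_commute)

definition derivation :: "('a::comm_ring_1 \<Rightarrow> 'a) \<Rightarrow> bool" where
  "derivation \<delta> \<longleftrightarrow> (\<forall>a b. \<delta> (a + b) = \<delta> a + \<delta> b) \<and> (\<forall>a b. \<delta> (a * b) = a * \<delta> b + \<delta> a * b)"

definition map_coords :: "('a \<Rightarrow> 'b) \<Rightarrow> 'a^4 \<Rightarrow> 'b^4" where "map_coords h x = (\<chi> i. h (x$i))"
lemma map_coords_nth [simp]: "map_coords h x $ i = h (x$i)" by (simp add: map_coords_def)

context
  fixes \<delta> :: "'a::comm_ring_1 \<Rightarrow> 'a"
  assumes derivation: "derivation \<delta>"
begin

lemma derivation_add: "\<delta> (a + b) = \<delta> a + \<delta> b" and derivation_mult: "\<delta> (a * b) = a * \<delta> b + \<delta> a * b"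
  using derivation by (auto simp: derivation_def)
lemma derivation_0: "\<delta> 0 = 0" using derivation_add[of 0 0] by simp
lemma derivation_1: "\<delta> 1 = 0" using derivation_mult[of 1 1] by simp
lemma derivation_of_nat: "\<delta> (of_nat n) = 0"
  by (induction n) (auto simp: derivation_0 derivation_1 derivation_add)
lemma derivation_sum: "\<delta> (sum f A) = (\<Sum>i\<in>A. \<delta> (f i))"
  by (induction A rule: infinite_finite_induct) (auto simp: derivation_0 derivation_add)
lemma derivation_power: "\<delta> (a ^ n) = of_nat n * a ^ (n - 1) * \<delta> a"
proof (induction n)
  case (Suc n)
  then show ?case by (cases n) (auto simp: derivation_mult derivation_1 algebra_simps)
qed (simp add: derivation_1)

context
  fixes c :: "'a form4" and d :: nat
  assumes homogeneous: "homogeneous d c" and const: "\<And>m. \<delta> (c m) = 0"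
begin

lemma derivation_form_at: "\<delta> (form_at d c x) = polar1 d c x (map_coords \<delta> x)"
proof -
  have "\<delta> (monom_at m x) = (\<Sum>r\<in>UNIV. \<delta> (x$r) * (of_nat (exponent r m) * monom_at (lower_exponent r m) x))" for m
    by (cases m) (simp add: monom_at_def monom_eval_def exponent_def map_exponent_def derivation_mult derivation_power sum_4 algebra_simps)
  then show ?thesis
    by (simp add: polar1_eq_sum_monom_at[OF homogeneous] form_at_def derivation_sum derivation_mult const)
qed

lemma derivation_partial: "\<delta> (partial i c m) = 0"
  using const by (simp add: partial_def derivation_mult derivation_of_nat del: of_nat_Suc)

end

lemma derivation_polar1:
  assumes "homogeneous d c" "\<And>m. \<delta> (c m) = 0"
  shows "\<delta> (polar1 d c x v) = polar2 d c x v (map_coords \<delta> x) + polar1 d c x (map_coords \<delta> v)"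
  unfolding polar1_def[of d] polar2_def derivation_sum
  by (simp add: derivation_mult derivation_form_at[OF homogeneous_partial[OF assms(1)] derivation_partial[OF assms]] sum.distrib del: One_nat_def)

lemma derivation_polar2:
  assumes "homogeneous d c" "\<And>m. \<delta> (c m) = 0"
  shows "\<delta> (polar2 d c x v w) = polar3 d c x v w (map_coords \<delta> x) + polar2 d c x (map_coords \<delta> v) w + polar2 d c x v (map_coords \<delta> w)"
  unfolding polar2_def[of d] polar3_def derivation_sum
  by (simp add: derivation_mult derivation_polar1[OF homogeneous_partial[OF assms(1)] derivation_partial[OF assms]]
      sum.distrib algebra_simps del: One_nat_def)

lemma derivation_polar3:
  assumes "homogeneous d c" "\<And>m. \<delta> (c m) = 0"
  shows "\<delta> (polar3 d c x u v w) = polar4 d c x u v w (map_coords \<delta> x) + polar3 d c x (map_coords \<delta> u) v w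
     + polar3 d c x u (map_coords \<delta> v) w + polar3 d c x u v (map_coords \<delta> w)"
  unfolding polar3_def[of d] polar4_def derivation_sum
  by (simp add: derivation_mult derivation_polar2[OF homogeneous_partial[OF assms(1)] derivation_partial[OF assms]]
      sum.distrib algebra_simps del: One_nat_def)

end

lemma polar1_add: "polar1 d c x (v + w) = polar1 d c x v + polar1 d c x w"
  and polar1_scale: "polar1 d c x (a *s v) = a * polar1 d c x v"
  and polar1_diff: "polar1 d c x (v - w) = polar1 d c x v - polar1 d c x w"
  by (simp_all add: polar1_def sum.distrib sum_subtractf sum_distrib_left algebra_simps)

lemma polar2_add1: "polar2 d c x (v + v') w = polar2 d c x v w + polar2 d c x v' w"
  and polar2_scale1: "polar2 d c x (a *s v) w = a * polar2 d c x v w"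
  and polar2_diff1: "polar2 d c x (v - v') w = polar2 d c x v w - polar2 d c x v' w"
  by (simp_all add: polar2_def sum.distrib sum_subtractf sum_distrib_left algebra_simps)

lemma polar2_expand: "polar2 d c x v w = (\<Sum>i\<in>UNIV. \<Sum>j\<in>UNIV. v$i * w$j * form_at (d-2) (partial j (partial i c)) x)"
  by (simp add: polar2_def polar1_def sum_distrib_left mult.assoc numeral_2_eq_2)

lemma polar2_sym: "polar2 d c x v w = polar2 d c x w v"
  unfolding polar2_expand by (subst sum.swap) (simp add: partial_commute mult.commute)

lemma polar2_add2: "polar2 d c x w (v + v') = polar2 d c x w v + polar2 d c x w v'"
  and polar2_scale2: "polar2 d c x w (a *s v) = a * polar2 d c x w v"
  and polar2_diff2: "polar2 d c x w (v - v') = polar2 d c x w v - polar2 d c x w v'"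
  using polar2_add1 polar2_scale1 polar2_diff1 polar2_sym by metis+

lemma polar3_expand:
  "polar3 d c x u v w = (\<Sum>i\<in>UNIV. \<Sum>j\<in>UNIV. \<Sum>k\<in>UNIV. u$i * v$j * w$k * form_at (d-3) (partial k (partial j (partial i c))) x)"
  by (simp add: polar3_def polar2_expand sum_distrib_left mult.assoc numeral_3_eq_3)

lemma polar3_sym23: "polar3 d c x u v w = polar3 d c x u w v"
  by (simp add: polar3_def polar2_sym[of _ _ _ v])
lemma polar3_sym12: "polar3 d c x u v w = polar3 d c x v u w"
  unfolding polar3_expand by (subst sum.swap) (simp add: partial_commute mult.commute mult.left_commute)
lemma polar3_sym13: "polar3 d c x u v w = polar3 d c x w v u"
  using polar3_sym12 polar3_sym23 by metis

lemma polar3_add1: "polar3 d c x (v + v') w t = polar3 d c x v w t + polar3 d c x v' w t"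
  and polar3_scale1: "polar3 d c x (a *s v) w t = a * polar3 d c x v w t"
  and polar3_diff1: "polar3 d c x (v - v') w t = polar3 d c x v w t - polar3 d c x v' w t"
  by (simp_all add: polar3_def sum.distrib sum_subtractf sum_distrib_left algebra_simps)
lemma polar3_add2: "polar3 d c x w (v + v') t = polar3 d c x w v t + polar3 d c x w v' t"
  and polar3_scale2: "polar3 d c x w (a *s v) t = a * polar3 d c x w v t"
  and polar3_diff2: "polar3 d c x w (v - v') t = polar3 d c x w v t - polar3 d c x w v' t"
  using polar3_add1 polar3_scale1 polar3_diff1 polar3_sym12 by metis+
lemma polar3_add3: "polar3 d c x w t (v + v') = polar3 d c x w t v + polar3 d c x w t v'"
  and polar3_scale3: "polar3 d c x w t (a *s v) = a * polar3 d c x w t v"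
  and polar3_diff3: "polar3 d c x w t (v - v') = polar3 d c x w t v - polar3 d c x w t v'"
  using polar3_add1 polar3_scale1 polar3_diff1 polar3_sym13 by metis+

lemma polar4_sym12: "polar4 d c x t u v w = polar4 d c x u t v w"
  unfolding polar4_def polar3_def sum_distrib_left
  by (subst sum.swap) (simp add: partial_commute mult.commute mult.left_commute)
lemma polar4_sym23: "polar4 d c x t u v w = polar4 d c x t v u w"
  by (simp add: polar4_def polar3_sym12[of _ _ _ u])
lemma polar4_sym34: "polar4 d c x t u v w = polar4 d c x t u w v"
  by (simp add: polar4_def polar3_sym23[of _ _ _ _ v])
lemma polar4_scale1: "polar4 d c x (a *s v) w t s = a * polar4 d c x v w t s"
  and polar4_diff1: "polar4 d c x (v - v') w t s = polar4 d c x v w t s - polar4 d c x v' w t s"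
  by (simp_all add: polar4_def sum.distrib sum_subtractf sum_distrib_left algebra_simps)

lemmas polar_linear = polar1_add polar1_scale polar1_diff polar2_add1 polar2_scale1 polar2_diff1
  polar2_add2 polar2_scale2 polar2_diff2 polar3_add1 polar3_scale1 polar3_diff1 polar3_add2 polar3_scale2 polar3_diff2
  polar3_add3 polar3_scale3 polar3_diff3

lemma polar_zero [simp]: "polar1 d c x 0 = 0" "polar2 d c x 0 v = 0" "polar2 d c x v 0 = 0"
  "polar3 d c x 0 v w = 0" "polar3 d c x v 0 w = 0" "polar3 d c x v w 0 = 0"
  by (simp_all add: polar1_def polar2_def polar3_def)

lemma form_at_scale: "form_at d c (a *s x) = a ^ d * form_at d c x"
  unfolding form_at_def sum_distrib_left
  by (rule sum.cong) (auto simp: mons_def monom_at_def monom_eval_def power_mult_distrib power_add algebra_simps)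
lemma polar1_scale_point: "polar1 d c (a *s x) v = a^(d-1) * polar1 d c x v"
  unfolding polar1_def form_at_scale by (simp add: sum_distrib_left mult_ac)
lemma polar2_scale_point: "polar2 d c (a *s x) v w = a^(d-2) * polar2 d c x v w"
  unfolding polar2_expand form_at_scale by (simp add: sum_distrib_left mult_ac)

lemma euler1:
  assumes "homogeneous d c"
  shows "polar1 d c x x = of_nat d * form_at d c x"
proof -
  have "(\<Sum>r\<in>UNIV. x$r * (of_nat (exponent r m) * monom_at (lower_exponent r m) x)) = of_nat d * monom_at m x"
    if "m \<in> mons d" for m
  proof -
    have "x$r * (of_nat (exponent r m) * monom_at (lower_exponent r m) x) = of_nat (exponent r m) * monom_at m x" for r
    proof (cases "exponent r m")
      case (Suc n)
      then have "x$r * monom_at (lower_exponent r m) x = monom_at m x"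
        using exhaust_4[of r] by (cases m) (auto simp: exponent_def map_exponent_def monom_at_def monom_eval_def)
      then show ?thesis by (metis mult.left_commute)
    qed simp
    moreover have "(\<Sum>r\<in>UNIV. exponent r m) = d" using that by (auto simp: mons_def exponent_def sum_4)
    ultimately show ?thesis by (simp add: sum_distrib_right[symmetric] of_nat_sum[symmetric])
  qed
  then show ?thesis unfolding polar1_eq_sum_monom_at[OF assms]
    by (simp add: form_at_def sum_distrib_left mult.left_commute)
qed

lemma euler2:
  assumes "homogeneous d c"
  shows "polar2 d c x v x = of_nat (d - 1) * polar1 d c x v" "polar2 d c x x v = of_nat (d - 1) * polar1 d c x v"
proof -
  show "polar2 d c x v x = of_nat (d - 1) * polar1 d c x v"
    unfolding polar2_def polar1_def[of d] euler1[OF homogeneous_partial[OF assms]] sum_distrib_left by (simp add: mult_ac)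
  then show "polar2 d c x x v = of_nat (d - 1) * polar1 d c x v" by (simp add: polar2_sym)
qed

lemma euler3:
  assumes "homogeneous d c"
  shows "polar3 d c x v w x = of_nat (d - 2) * polar2 d c x v w" "polar3 d c x v x w = of_nat (d - 2) * polar2 d c x v w"
    "polar3 d c x x v w = of_nat (d - 2) * polar2 d c x v w"
proof -
  show eq: "polar3 d c x v w x = of_nat (d - 2) * polar2 d c x v w" for v w
    unfolding polar3_def polar2_def[of d] euler2(1)[OF homogeneous_partial[OF assms]] sum_distrib_left
    by (simp add: mult_ac numeral_2_eq_2)
  show "polar3 d c x v x w = of_nat (d - 2) * polar2 d c x v w" "polar3 d c x x v w = of_nat (d - 2) * polar2 d c x v w"
    using eq polar3_sym23 polar3_sym13 polar2_sym by metis+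
qed

context comm_ring_hom
begin

lemma form_at_hom: "hom (form_at d c x) = form_at d (\<lambda>m. hom (c m)) (map_coords hom x)"
  unfolding form_at_def hom_sum
  by (rule sum.cong) (auto simp: monom_at_def monom_eval_def hom_distribs)
lemma partial_hom: "(\<lambda>m. hom (partial i c m)) = partial i (\<lambda>m. hom (c m))"
  by (auto simp: partial_def hom_distribs fun_eq_iff)
lemma polar1_hom: "hom (polar1 d c x v) = polar1 d (\<lambda>m. hom (c m)) (map_coords hom x) (map_coords hom v)"
  by (simp add: polar1_def hom_distribs form_at_hom partial_hom)
lemma polar2_hom: "hom (polar2 d c x v w) = polar2 d (\<lambda>m. hom (c m)) (map_coords hom x) (map_coords hom v) (map_coords hom w)"
  by (simp add: polar2_def hom_distribs polar1_hom partial_hom)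
lemma polar3_hom:
  "hom (polar3 d c x u v w) = polar3 d (\<lambda>m. hom (c m)) (map_coords hom x) (map_coords hom u) (map_coords hom v) (map_coords hom w)"
  by (simp add: polar3_def hom_distribs polar2_hom partial_hom)
lemma polar4_hom: "hom (polar4 d c x t u v w)
    = polar4 d (\<lambda>m. hom (c m)) (map_coords hom x) (map_coords hom t) (map_coords hom u) (map_coords hom v) (map_coords hom w)"
  by (simp add: polar4_def hom_distribs polar3_hom partial_hom)
lemma homogeneous_hom: "homogeneous d c \<Longrightarrow> homogeneous d (\<lambda>m. hom (c m))"
  by (auto simp: homogeneous_def)

end

section \<open>Forms along lines\<close>

lemma const_poly_hom: "comm_ring_hom (\<lambda>a::'a::comm_ring_1. [:a:])" by unfold_locales auto

abbreviation const_form :: "'a::comm_ring_1 form4 \<Rightarrow> 'a poly form4" where "const_form c \<equiv> (\<lambda>m. [:c m:])"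
abbreviation const_vec :: "'a::comm_ring_1^4 \<Rightarrow> 'a poly^4" where "const_vec \<equiv> map_coords (\<lambda>a. [:a:])"
abbreviation eval_vec :: "'a::comm_ring_1 \<Rightarrow> 'a poly^4 \<Rightarrow> 'a^4" where "eval_vec a \<equiv> map_coords (\<lambda>p. poly p a)"
definition param_line :: "'a::comm_ring_1^4 \<Rightarrow> 'a^4 \<Rightarrow> 'a poly^4" where "param_line e f = (\<chi> i. [:e$i, f$i:])"

abbreviation form_along :: "nat \<Rightarrow> 'a::comm_ring_1 form4 \<Rightarrow> 'a^4 \<Rightarrow> 'a^4 \<Rightarrow> 'a poly" where
  "form_along d c e f \<equiv> form_at d (const_form c) (param_line e f)"
abbreviation polar1_along :: "nat \<Rightarrow> 'a::comm_ring_1 form4 \<Rightarrow> 'a^4 \<Rightarrow> 'a^4 \<Rightarrow> 'a^4 \<Rightarrow> 'a poly" where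
  "polar1_along d c e f v \<equiv> polar1 d (const_form c) (param_line e f) (const_vec v)"
abbreviation polar2_along :: "nat \<Rightarrow> 'a::comm_ring_1 form4 \<Rightarrow> 'a^4 \<Rightarrow> 'a^4 \<Rightarrow> 'a^4 \<Rightarrow> 'a^4 \<Rightarrow> 'a poly" where
  "polar2_along d c e f v w \<equiv> polar2 d (const_form c) (param_line e f) (const_vec v) (const_vec w)"
abbreviation polar3_along :: "nat \<Rightarrow> 'a::comm_ring_1 form4 \<Rightarrow> 'a^4 \<Rightarrow> 'a^4 \<Rightarrow> 'a^4 \<Rightarrow> 'a^4 \<Rightarrow> 'a^4 \<Rightarrow> 'a poly" where
  "polar3_along d c e f u v w \<equiv> polar3 d (const_form c) (param_line e f) (const_vec u) (const_vec v) (const_vec w)"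

lemma param_line_nth [simp]: "param_line e f $ i = [:e$i, f$i:]" by (simp add: param_line_def)

lemma eval_vec_simps [simp]: "eval_vec a (param_line e f) = e + a *s f" "eval_vec a (const_vec x) = x"
  "eval_vec a (q *s X) = poly q a *s eval_vec a X" "eval_vec a (X + Y) = eval_vec a X + eval_vec a Y"
  "eval_vec a (X - Y) = eval_vec a X - eval_vec a (Y :: 'a::comm_ring_1 poly^4)"
  by (simp_all add: cart_eq)

lemma poly_form_at: "poly (form_at d (const_form c) X) a = form_at d c (eval_vec a X)"
  and poly_polar1: "poly (polar1 d (const_form c) X U) a = polar1 d c (eval_vec a X) (eval_vec a U)"
  and poly_polar2: "poly (polar2 d (const_form c) X U V) a = polar2 d c (eval_vec a X) (eval_vec a U) (eval_vec a V)"
  and poly_polar3: "poly (polar3 d (const_form c) X U V W) a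
    = polar3 d c (eval_vec a X) (eval_vec a U) (eval_vec a V) (eval_vec a W)"
  and poly_polar4: "poly (polar4 d (const_form c) X T U V W) a
    = polar4 d c (eval_vec a X) (eval_vec a T) (eval_vec a U) (eval_vec a V) (eval_vec a W)"
  by (simp_all add: poly_hom.form_at_hom poly_hom.polar1_hom poly_hom.polar2_hom poly_hom.polar3_hom poly_hom.polar4_hom)

lemma partial_const_form: "partial i (const_form c) = const_form (partial i c)"
  using comm_ring_hom.partial_hom[OF const_poly_hom, of i c] by simp

lemma top_coeff_form_at:
  assumes "\<And>i. top_coeff 1 (X$i) (f$i)"
  shows "top_coeff d (form_at d (const_form c) X) (form_at d c f)"
  unfolding form_at_def
proof (rule top_coeff_sum)
  fix m assume "m \<in> mons d"
  then obtain i j k l where m: "m = (i,j,k,l)" and d: "d = i + j + k + l" by (cases m) (auto simp: mons_def)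
  have "top_coeff (0 + (i + j + k + l)) ([:c m:] * ((X$1)^i * (X$2)^j * (X$3)^k * (X$4)^l))
      (c m * ((f$1)^i * (f$2)^j * (f$3)^k * (f$4)^l))"
    using top_coeff_power[OF assms[of 1], of i] top_coeff_power[OF assms[of 2], of j]
      top_coeff_power[OF assms[of 3], of k] top_coeff_power[OF assms[of 4], of l]
    by (intro top_coeff_mult top_coeff_const) auto
  then show "top_coeff d ([:c m:] * monom_at m X) (c m * monom_at m f)"
    using m d by (simp add: monom_at_def monom_eval_def)
qed

lemma top_coeff_form_along: "top_coeff d (form_along d c e f) (form_at d c f)"
  by (rule top_coeff_form_at) (auto simp: top_coeff_def)
lemma top_coeff_polar1_along: "top_coeff (d - 1) (polar1_along d c e f v) (polar1 d c f v)"
  unfolding polar1_def partial_const_form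
  by (rule top_coeff_sum) (use top_coeff_mult[OF top_coeff_const top_coeff_form_along] in simp)

lemma derivation_pderiv: "derivation (pderiv :: 'a::idom poly \<Rightarrow> _)"
  by (auto simp: derivation_def pderiv_add pderiv_mult algebra_simps)
lemma homogeneous_const_form: "homogeneous d c \<Longrightarrow> homogeneous d (const_form c)" by (auto simp: homogeneous_def)
lemma map_coords_pderiv [simp]: "map_coords pderiv (param_line e f) = const_vec (f::'a::idom^4)"
  "map_coords pderiv (const_vec f) = (0::'a::idom poly^4)"
  by (simp_all add: cart_eq pderiv_pCons)

context
  fixes d :: nat and c :: "'a::idom form4"
  assumes homogeneous: "homogeneous d c"
begin

lemma pderiv_const_form: "pderiv (const_form c m) = 0" by (simp add: pderiv_pCons)
lemmas pderiv_form_at = derivation_form_at[OF derivation_pderiv homogeneous_const_form[OF homogeneous] pderiv_const_form]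
lemmas pderiv_polar1 = derivation_polar1[OF derivation_pderiv homogeneous_const_form[OF homogeneous] pderiv_const_form]
lemmas pderiv_polar2 = derivation_polar2[OF derivation_pderiv homogeneous_const_form[OF homogeneous] pderiv_const_form]
lemmas pderiv_polar3 = derivation_polar3[OF derivation_pderiv homogeneous_const_form[OF homogeneous] pderiv_const_form]

lemma pderiv_form_along: "pderiv (form_along d c e f) = polar1_along d c e f f"
  by (simp add: pderiv_form_at)
lemma pderiv_polar1_along: "pderiv (polar1_along d c e f v) = polar2_along d c e f v f"
  by (simp add: pderiv_polar1)
lemma pderiv_polar2_along: "pderiv (polar2_along d c e f v w) = polar3_along d c e f v w f"
  by (simp add: pderiv_polar2)

lemma coeff_form_along_0: "coeff (form_along d c e f) 0 = form_at d c e"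
  by (simp add: poly_0_coeff_0[symmetric] poly_form_at)

lemma coeff_form_along_1: "coeff (form_along d c e f) 1 = polar1 d c e f"
proof -
  have "coeff (form_along d c e f) 1 = poly (pderiv (form_along d c e f)) 0" by (simp add: poly_0_coeff_0 coeff_pderiv)
  then show ?thesis by (simp add: pderiv_form_along poly_polar1)
qed

lemma coeff_form_along_2: "2 * coeff (form_along d c e f) 2 = polar2 d c e f f"
proof -
  have "2 * coeff (form_along d c e f) 2 = poly (pderiv (pderiv (form_along d c e f))) 0"
    by (simp add: poly_0_coeff_0 coeff_pderiv numeral_2_eq_2)
  then show ?thesis by (simp add: pderiv_form_along pderiv_polar1_along poly_polar2)
qed

lemma coeff_form_along_3: "6 * coeff (form_along d c e f) 3 = polar3 d c e f f f"
proof -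
  have "6 * coeff (form_along d c e f) 3 = poly (pderiv (pderiv (pderiv (form_along d c e f)))) 0"
    by (simp add: poly_0_coeff_0 coeff_pderiv numeral_3_eq_3)
  then show ?thesis by (simp add: pderiv_form_along pderiv_polar1_along pderiv_polar2_along poly_polar3)
qed

lemma coeff_form_along_top_minus_1:
  assumes "d \<ge> 1"
  shows "coeff (form_along d c e f) (d - 1) = polar1 d c f e"
proof -
  let ?Q = "form_along d c e f"
  have "param_line e f = const_vec e + [:0,1:] *s const_vec f" by (simp add: cart_eq)
  then have "polar1 d (const_form c) (param_line e f) (param_line e f) = polar1_along d c e f e + [:0,1:] * pderiv ?Q"
    unfolding pderiv_form_along by (metis polar1_add polar1_scale)
  then have "of_nat d * ?Q = polar1_along d c e f e + [:0,1:] * pderiv ?Q"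
    using euler1[OF homogeneous_const_form[OF homogeneous]] by metis
  then have "coeff (of_nat d * ?Q) (d-1) = coeff (polar1_along d c e f e) (d-1) + coeff ([:0,1:] * pderiv ?Q) (d-1)" by simp
  moreover have "coeff ([:0,1:] * pderiv ?Q) (d-1) = of_nat (d - 1) * coeff ?Q (d-1)"
    by (cases "d - 1") (auto simp: coeff_pCons coeff_pderiv)
  moreover have "coeff (polar1_along d c e f e) (d-1) = polar1 d c f e"
    using top_coeff_polar1_along unfolding top_coeff_def by blast
  moreover have "(of_nat d :: 'a) = of_nat (d - 1) + 1" using assms by (cases d) auto
  ultimately show ?thesis by (simp add: of_nat_poly algebra_simps)
qed

lemma polar_eq_0_if_form_along_eq_0:
  assumes "form_along d c e f = 0"
  shows "polar1 d c e f = 0" "polar2 d c e f f = 0" "polar3 d c e f f f = 0"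
  using coeff_form_along_1[of e f] coeff_form_along_2[of e f] coeff_form_along_3[of e f] by (simp_all add: assms)

end

lemma form_at_eq_0_if_form_along_eq_0:
  fixes c :: "'a::field form4"
  assumes "form_along d c e f = 0"
  shows "form_at d c (s *s e + t *s f) = 0"
proof (cases "s = 0")
  case True
  have "form_at d c f = 0" using top_coeff_form_along[of d c e f] assms by (simp add: top_coeff_def)
  then show ?thesis using True by (simp add: form_at_scale)
next
  case False
  have "poly (form_along d c e f) (t / s) = 0" using assms by simp
  then have "form_at d c (e + (t / s) *s f) = 0" by (simp add: poly_form_at)
  moreover have "s *s e + t *s f = s *s (e + (t / s) *s f)" using False by (simp add: cart_eq algebra_simps)
  ultimately show ?thesis by (simp add: form_at_scale)
qed

lemma form_along_eq_0I:
  fixes c :: "'a::alg_closed_field form4"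
  assumes "finite S" "\<And>t. t \<notin> S \<Longrightarrow> form_at d c (e + t *s f) = 0"
  shows "form_along d c e f = 0"
  by (rule poly_eq_0_if_cofinitely_many_roots[OF assms(1)]) (simp add: poly_form_at assms(2))

lemma polar1_along_line_in_zero_set:
  fixes c :: "'a::alg_closed_field form4"
  assumes "homogeneous d c" "\<And>s t. form_at d c (s *s e + t *s f) = 0"
  shows "polar1 d c (e + z *s f) e = 0" "polar1 d c (e + z *s f) f = 0"
proof -
  have to_e: "form_at d c ((e + z *s f) + t *s e) = 0" and to_f: "form_at d c ((e + z *s f) + t *s f) = 0" for t
    using assms(2)[of "1 + t" z] assms(2)[of 1 "z + t"] by (simp_all add: algebra_simps vector_sadd_rdistrib)
  have "form_along d c (e + z *s f) e = 0" "form_along d c (e + z *s f) f = 0"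
    by (rule form_along_eq_0I[of "{}"]; simp add: to_e to_f)+
  then show "polar1 d c (e + z *s f) e = 0" "polar1 d c (e + z *s f) f = 0"
    by (auto intro: polar_eq_0_if_form_along_eq_0 assms(1))
qed

section \<open>Functions given by forms\<close>

definition is_form :: "nat \<Rightarrow> ('a::comm_ring_1^4 \<Rightarrow> 'a) \<Rightarrow> bool" where
  "is_form n F \<longleftrightarrow> (\<exists>g. homogeneous n g \<and> (\<forall>x. F x = form_at n g x))"

lemma is_formI: "(\<And>x. F x = form_at n g x) \<Longrightarrow> is_form n F"
  unfolding is_form_def
  by (rule exI[of _ "\<lambda>m. if m \<in> mons n then g m else 0"]) (auto simp: form_at_def homogeneous_def intro!: sum.cong)
lemma is_form_form_at: "is_form n (form_at n g)" by (rule is_formI) simp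

lemma is_form_add:
  assumes "is_form n F" "is_form n G"
  shows "is_form n (\<lambda>x. F x + G x)"
proof -
  obtain f g where "\<And>x. F x = form_at n f x" "\<And>x. G x = form_at n g x" using assms unfolding is_form_def by blast
  then show ?thesis by (intro is_formI[where g="\<lambda>m. f m + g m"]) (simp add: form_at_def sum.distrib algebra_simps)
qed
lemma is_form_0: "is_form n (\<lambda>x. 0)" by (rule is_formI[where g="\<lambda>m. 0"]) (simp add: form_at_def)
lemma is_form_cmult:
  assumes "is_form n F"
  shows "is_form n (\<lambda>x. a * F x)"
proof -
  obtain f where "\<And>x. F x = form_at n f x" using assms unfolding is_form_def by blast
  then show ?thesis by (intro is_formI[where g="\<lambda>m. a * f m"]) (simp add: form_at_def sum_distrib_left algebra_simps)
qed
lemma is_form_diff: "is_form n F \<Longrightarrow> is_form n G \<Longrightarrow> is_form n (\<lambda>x. F x - G x)"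
  using is_form_add[OF _ is_form_cmult[of n G "-1"]] by simp
lemma is_form_sum: "(\<And>i. i \<in> A \<Longrightarrow> is_form n (F i)) \<Longrightarrow> is_form n (\<lambda>x. \<Sum>i\<in>A. F i x)"
  by (induction A rule: infinite_finite_induct) (auto simp: is_form_0 is_form_add)

definition add_exponents :: "nat \<times> nat \<times> nat \<times> nat \<Rightarrow> nat \<times> nat \<times> nat \<times> nat \<Rightarrow> nat \<times> nat \<times> nat \<times> nat" where
  "add_exponents a b = (case a of (i,j,k,l) \<Rightarrow> case b of (i',j',k',l') \<Rightarrow> (i+i',j+j',k+k',l+l'))"

lemma is_form_mult:
  assumes "is_form m F" "is_form n G"
  shows "is_form (m + n) (\<lambda>x. F x * G x)"
proof -
  obtain f g where FG: "\<And>x. F x = form_at m f x" "\<And>x. G x = form_at n g x" using assms unfolding is_form_def by blast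
  define h where "h q = (\<Sum>(a,b)\<in>mons m \<times> mons n. if q = add_exponents a b then f a * g b else 0)" for q
  show ?thesis
  proof (rule is_formI[where g=h])
    fix x :: "'a^4"
    have "form_at (m+n) h x = (\<Sum>(a,b)\<in>mons m \<times> mons n. \<Sum>q\<in>mons (m+n).
        if q = add_exponents a b then f a * g b * monom_at q x else 0)"
      unfolding form_at_def h_def sum_distrib_right
      by (subst sum.swap) (auto simp: if_distrib[of "\<lambda>c. c * _"] intro!: sum.cong cong: if_cong)
    also have "\<dots> = (\<Sum>(a,b)\<in>mons m \<times> mons n. f a * g b * monom_at (add_exponents a b) x)"
    proof (intro sum.cong refl, clarify)
      fix a b assume "a \<in> mons m" "b \<in> mons n"
      then have "add_exponents a b \<in> mons (m + n)" by (auto simp: mons_def add_exponents_def)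
      then show "(\<Sum>q\<in>mons (m + n). if q = add_exponents a b then f a * g b * monom_at q x else 0)
          = f a * g b * monom_at (add_exponents a b) x"
        by simp
    qed
    also have "\<dots> = (\<Sum>(a,b)\<in>mons m \<times> mons n. (f a * monom_at a x) * (g b * monom_at b x))"
      by (intro sum.cong refl) (auto simp: monom_at_def monom_eval_def add_exponents_def power_add algebra_simps)
    also have "\<dots> = F x * G x" unfolding FG form_at_def sum_product sum.cartesian_product ..
    finally show "F x * G x = form_at (m+n) h x" by simp
  qed
qed

lemma is_form_const: "is_form 0 (\<lambda>x. a)"
  by (rule is_formI[where g="\<lambda>m. a"]) (simp add: form_at_def mons_def monom_at_def monom_eval_def)
lemma is_form_prod: "finite A \<Longrightarrow> (\<And>i. i \<in> A \<Longrightarrow> is_form (n i) (F i)) \<Longrightarrow> is_form (\<Sum>i\<in>A. n i) (\<lambda>x. \<Prod>i\<in>A. F i x)"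
  by (induction A rule: finite_induct) (auto simp: is_form_const is_form_mult)
lemma is_form_power: "is_form n F \<Longrightarrow> is_form (k * n) (\<lambda>x. F x ^ k)"
  by (induction k) (auto simp: is_form_const is_form_mult)

lemma is_form_coord: "is_form 1 (\<lambda>x. x $ i)"
proof (rule is_formI)
  fix x :: "'a^4"
  let ?m = "raise_exponent i (0,0,0,0)"
  have "?m \<in> mons 1" by (auto simp: mons_def map_exponent_def)
  then have "form_at 1 (\<lambda>m. if m = ?m then 1 else 0) x = monom_at ?m x"
    by (simp add: form_at_def if_distrib[of "\<lambda>a. a * _"] cong: if_cong)
  then show "x $ i = form_at 1 (\<lambda>m. if m = ?m then 1 else 0) x"
    using exhaust_4[of i] by (auto simp: map_exponent_def monom_at_def monom_eval_def)
qed

lemma is_form_comp: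
  assumes "\<And>i. is_form 1 (\<lambda>x. Y x $ i)"
  shows "is_form n (\<lambda>x. form_at n g (Y x))"
  unfolding form_at_def
proof (rule is_form_sum)
  fix m assume "m \<in> mons n"
  then obtain i j k l where m: "m = (i,j,k,l)" "n = i + j + k + l" by (cases m) (auto simp: mons_def)
  have "is_form (i*1 + j*1 + k*1 + l*1) (\<lambda>x. Y x$1^i * Y x$2^j * Y x$3^k * Y x$4^l)"
    by (intro is_form_mult is_form_power assms)
  then show "is_form n (\<lambda>x. g m * monom_at m (Y x))"
    using m by (auto simp: monom_at_def monom_eval_def intro: is_form_cmult)
qed

lemma is_form_det:
  assumes "\<And>k l. is_form (n k) (\<lambda>x. M x $ k $ l)"
  shows "is_form (\<Sum>k\<in>UNIV. n k) (\<lambda>x. det (M x :: 'a::comm_ring_1^4^4))"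
  unfolding Determinants.det_def by (intro is_form_sum is_form_cmult is_form_prod assms) auto

lemma is_form_polar1: "is_form (d-1) (\<lambda>x. polar1 d c x v)"
  unfolding polar1_def by (intro is_form_sum is_form_cmult is_form_form_at)

section \<open>Bases and lines\<close>

definition vec4 :: "'a \<Rightarrow> 'a \<Rightarrow> 'a \<Rightarrow> 'a \<Rightarrow> 'a^4" where
  "vec4 x1 x2 x3 x4 = (\<chi> i. if i = 1 then x1 else if i = 2 then x2 else if i = 3 then x3 else x4)"

lemma vec4_nth [simp]: "vec4 x1 x2 x3 x4 $ 1 = x1" "vec4 x1 x2 x3 x4 $ 2 = x2" "vec4 x1 x2 x3 x4 $ 3 = x3" "vec4 x1 x2 x3 x4 $ 4 = x4"
  by (simp_all add: vec4_def)
lemma vec4_eqI: "x$1 = y$1 \<Longrightarrow> x$2 = y$2 \<Longrightarrow> x$3 = y$3 \<Longrightarrow> x$4 = y$4 \<Longrightarrow> x = (y::'a^4)"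
  unfolding cart_eq forall_4 by simp
lemma vec4_eta: "vec4 (x$1) (x$2) (x$3) (x$4) = x"
  by (rule vec4_eqI) simp_all

definition indep2 :: "'a::field^4 \<Rightarrow> 'a^4 \<Rightarrow> bool" where
  "indep2 a b \<longleftrightarrow> (\<forall>s t. s *s a + t *s b = 0 \<longrightarrow> s = 0 \<and> t = 0)"
definition span2 :: "'a::field^4 \<Rightarrow> 'a^4 \<Rightarrow> ('a^4) set" where
  "span2 a b = {s *s a + t *s b |s t. True}"
definition basis4 :: "'a::field^4 \<Rightarrow> 'a^4 \<Rightarrow> 'a^4 \<Rightarrow> 'a^4 \<Rightarrow> bool" where
  "basis4 e f g h \<longleftrightarrow> (\<forall>a b p q. a *s e + b *s f + p *s g + q *s h = 0 \<longrightarrow> a = 0 \<and> b = 0 \<and> p = 0 \<and> q = 0)"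
definition rows4 :: "'a^4 \<Rightarrow> 'a^4 \<Rightarrow> 'a^4 \<Rightarrow> 'a^4 \<Rightarrow> 'a^4^4" where
  "rows4 p q r s = (\<chi> i. if i = 1 then p else if i = 2 then q else if i = 3 then r else s)"
definition det4 :: "'a::field^4 \<Rightarrow> 'a^4 \<Rightarrow> 'a^4 \<Rightarrow> 'a^4 \<Rightarrow> 'a" where "det4 p q r s = det (rows4 p q r s)"

lemma row_rows4 [simp]: "row 1 (rows4 p q r s) = p" "row 2 (rows4 p q r s) = q" "row 3 (rows4 p q r s) = r" "row 4 (rows4 p q r s) = s"
  by (simp_all add: Finite_Cartesian_Product.row_def rows4_def cart_eq)

lemma basis4_iff_det4: "basis4 p q r s \<longleftrightarrow> det4 p q r s \<noteq> 0"
proof -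
  have "det4 p q r s \<noteq> 0 \<longleftrightarrow> (\<forall>c. (\<Sum>i\<in>UNIV. c i *s row i (rows4 p q r s)) = 0 \<longrightarrow> (\<forall>i. c i = 0))"
    unfolding det4_def invertible_det_nz[symmetric] invertible_right_inverse matrix_right_invertible_independent_rows ..
  also have "\<dots> \<longleftrightarrow> basis4 p q r s"
  proof
    assume "\<forall>c. (\<Sum>i\<in>UNIV. c i *s row i (rows4 p q r s)) = 0 \<longrightarrow> (\<forall>i. c i = 0)"
    from this[rule_format, of "\<lambda>i. vec4 _ _ _ _ $ i"] show "basis4 p q r s"
      unfolding basis4_def by (simp add: sum_4) (metis vec4_nth)
  qed (simp add: basis4_def sum_4 forall_4)
  finally show ?thesis ..
qed

lemma basis4_zero: "basis4 e f g h \<Longrightarrow> a *s e + b *s f + p *s g + q *s h = 0 \<Longrightarrow> a = 0 \<and> b = 0 \<and> p = 0 \<and> q = 0"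
  unfolding basis4_def by blast

lemma basis4_span:
  assumes "basis4 e f g h"
  obtains a b p q where "x = a *s e + b *s f + p *s g + q *s h"
proof -
  let ?M = "Finite_Cartesian_Product.transpose (rows4 e f g h)"
  have "invertible ?M" using assms by (simp add: basis4_iff_det4 det4_def invertible_det_nz)
  then obtain N where "?M ** N = mat 1" by (auto simp: invertible_right_inverse)
  then have "x = ?M *v (N *v x)" by (simp add: matrix_vector_mul_assoc)
  then have "x = (\<Sum>i\<in>UNIV. (N *v x)$i *s row i (rows4 e f g h))"
    by (simp add: matrix_mult_sum column_def Finite_Cartesian_Product.row_def Finite_Cartesian_Product.transpose_def)
  then show ?thesis using that by (simp add: sum_4)
qed

lemma basis4_coords_eq:
  assumes "basis4 e f g h" "a *s e + b *s f + p *s g + q *s h = a' *s e + b' *s f + p' *s g + q' *s h"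
  shows "a = a' \<and> b = b' \<and> p = p' \<and> q = q'"
proof -
  have "(a - a') *s e + (b - b') *s f + (p - p') *s g + (q - q') *s h = 0"
    using assms(2) by (simp add: cart_eq algebra_simps)
  from basis4_zero[OF assms(1) this] show ?thesis by simp
qed

lemma indep2_neq: "indep2 a b \<Longrightarrow> a \<noteq> b"
  unfolding indep2_def by (metis add.right_inverse vector_sneg_minus1 vector_smult_lid zero_neq_one)

lemma basis4_extend:
  assumes "indep2 e f"
  obtains g h where "basis4 e f g h"
proof -
  have neq: "e \<noteq> f" using assms by (rule indep2_neq)
  have "vec.independent {e,f}"
    by (rule vec.independent_if_scalars_zero) (use assms neq in \<open>auto simp: indep2_def\<close>)
  then obtain B where B: "{e,f} \<subseteq> B" "vec.independent B" "vec.span B = (UNIV::('a^4) set)"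
    using vec.maximal_independent_subset_extend[of "{e,f}" UNIV] by (metis subset_UNIV top.extremum_uniqueI)
  have "card B = vec.dim (UNIV::('a^4) set)" using B by (metis vec.dim_eq_card vec.span_UNIV)
  then have card: "card B = 4" by (simp add: vec.dim_UNIV vec.dimension_def card_cart_basis)
  then have finite: "finite B" using card.infinite by fastforce
  then have "card (B - {e,f}) = 2" using card B(1) neq by (subst card_Diff_subset) auto
  then obtain g h where gh: "B - {e,f} = {g,h}" "g \<noteq> h" by (meson card_2_iff)
  then have B_eq: "B = {e,f,g,h}" and distinct: "e \<noteq> g" "e \<noteq> h" "f \<noteq> g" "f \<noteq> h" using B(1) by blast+
  have "basis4 e f g h"
    unfolding basis4_def
  proof (intro allI impI)
    fix a b p q assume zero: "a *s e + b *s f + p *s g + q *s h = 0"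
    define u where "u x = (if x = e then a else if x = f then b else if x = g then p else q)" for x
    have "(\<Sum>x\<in>B. u x *s x) = 0"
      unfolding B_eq using zero distinct neq gh(2) by (simp add: u_def add.assoc)
    then have "\<forall>x\<in>B. u x = 0" using B(2) finite vec.independentD by blast
    then show "a = 0 \<and> b = 0 \<and> p = 0 \<and> q = 0"
      unfolding B_eq using distinct neq gh(2) by (auto simp: u_def split: if_splits)
  qed
  then show ?thesis by (rule that)
qed

lemma basis4_shear:
  assumes "basis4 e f g h"
  shows "basis4 e f g (h + \<mu> *s g)"
  unfolding basis4_def
proof (intro allI impI)
  fix a b p q assume "a *s e + b *s f + p *s g + q *s (h + \<mu> *s g) = 0"
  then have "a *s e + b *s f + (p + q * \<mu>) *s g + q *s h = 0" by (simp add: cart_eq algebra_simps)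
  from basis4_zero[OF assms this] show "a = 0 \<and> b = 0 \<and> p = 0 \<and> q = 0" by auto
qed

lemma basis4_swap34:
  assumes "basis4 p q r s"
  shows "basis4 p q s r"
  unfolding basis4_def
proof (intro allI impI)
  fix a b c e assume "a *s p + b *s q + c *s s + e *s r = 0"
  then have "a *s p + b *s q + e *s r + c *s s = 0" by (simp add: ac_simps)
  from basis4_zero[OF assms this] show "a = 0 \<and> b = 0 \<and> c = 0 \<and> e = 0" by simp
qed

lemma basis4_indep2:
  assumes "basis4 p q r s"
  shows "indep2 p q" "indep2 r s" "indep2 p r"
  using basis4_zero[OF assms, of _ _ 0 0] basis4_zero[OF assms, of 0 0] basis4_zero[OF assms, of _ 0 _ 0]
  by (auto simp: indep2_def)

lemma indep2_nonzero: "indep2 a b \<Longrightarrow> a \<noteq> 0" "indep2 a b \<Longrightarrow> b \<noteq> 0"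
  unfolding indep2_def by (metis vec.scale_zero_right add.right_neutral add.left_neutral vec.scale_zero_left zero_neq_one)+
lemma indep2_sym: "indep2 a b \<Longrightarrow> indep2 b a"
  unfolding indep2_def by (metis add.commute)
lemma indep2_shift:
  assumes "indep2 a b"
  shows "indep2 b (a + t *s b)"
  unfolding indep2_def
proof (intro allI impI)
  fix r s assume "r *s b + s *s (a + t *s b) = 0"
  then have "s *s a + (r + s * t) *s b = 0" by (simp add: cart_eq algebra_simps)
  then have "s = 0 \<and> r + s * t = 0" using assms unfolding indep2_def by blast
  then show "r = 0 \<and> s = 0" by auto
qed

lemma obtain_multiple_if_not_indep2:
  assumes "\<not> indep2 x y" "x \<noteq> 0"
  obtains r where "y = r *s x"
proof -
  obtain s t where rel: "s *s x + t *s y = 0" "s \<noteq> 0 \<or> t \<noteq> 0" using assms(1) unfolding indep2_def by blast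
  then have "t \<noteq> 0" using assms(2) by (auto simp: vector_mul_eq_0)
  then have "y = (-s/t) *s x" using rel(1) by (simp add: cart_eq field_simps eq_neg_iff_add_eq_0 add.commute)
  then show ?thesis by (rule that)
qed

lemma span2I: "s *s a + t *s b \<in> span2 a b" by (auto simp: span2_def)
lemma span2E: assumes "x \<in> span2 a b" obtains s t where "x = s *s a + t *s b"
  using assms unfolding span2_def by blast
lemma span2_eq_span: "span2 a b = vec.span {a,b}"
  by (auto simp: span2_def vec.span_insert vec.span_singleton algebra_simps)
lemma subspace_span2: "vec.subspace (span2 a b)" by (simp add: span2_eq_span vec.subspace_span)
lemma span2_generators [simp]: "a \<in> span2 a b" "b \<in> span2 a b" "0 \<in> span2 a b" "a + t *s b \<in> span2 a b"
  using span2I[of 1 a 0 b] span2I[of 0 a 1 b] span2I[of 0 a 0 b] span2I[of 1 a t b] by auto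
lemmas span2_add = vec.subspace_add[OF subspace_span2]
lemmas span2_scale = vec.subspace_scale[OF subspace_span2]
lemma span2_subset: "x \<in> span2 a b \<Longrightarrow> y \<in> span2 a b \<Longrightarrow> span2 x y \<subseteq> span2 a b"
  by (auto elim!: span2E[of _ x y] intro: span2_add span2_scale)

lemma span2_eq_if_indep2:
  assumes xy: "indep2 x y" and x: "x \<in> span2 a b" and y: "y \<in> span2 a b"
  shows "span2 x y = span2 a b"
proof
  show "span2 x y \<subseteq> span2 a b" by (rule span2_subset[OF x y])
  obtain s t where x_eq: "x = s *s a + t *s b" using x by (rule span2E)
  obtain s' t' where y_eq: "y = s' *s a + t' *s b" using y by (rule span2E)
  define D where "D = s * t' - s' * t"
  have combinations: "t' *s x + (-t) *s y = D *s a" "s' *s x + (-s) *s y = (-D) *s b"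
    unfolding x_eq y_eq D_def by (simp_all add: cart_eq algebra_simps)
  have D: "D \<noteq> 0"
  proof
    assume "D = 0"
    then have "t = 0" "s = 0" using combinations xy unfolding indep2_def by (metis neg_equal_0_iff_equal vec.scale_zero_left)+
    then show False using x_eq indep2_nonzero(1)[OF xy] by simp
  qed
  have "a = (t'/D) *s x + (-t/D) *s y" "b = (-s'/D) *s x + (s/D) *s y"
    using combinations D by (simp_all add: cart_eq field_simps)
  then have "a \<in> span2 x y" "b \<in> span2 x y" using span2I by metis+
  then show "span2 a b \<subseteq> span2 x y" by (rule span2_subset)
qed

definition is_line :: "('a::field^4) set \<Rightarrow> bool" where "is_line L \<longleftrightarrow> (\<exists>a b. indep2 a b \<and> L = span2 a b)"
definition meets :: "('a::field^4) set \<Rightarrow> ('a^4) set \<Rightarrow> bool" where "meets L M \<longleftrightarrow> (\<exists>x. x \<noteq> 0 \<and> x \<in> L \<and> x \<in> M)"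
definition lines_in :: "nat \<Rightarrow> 'a::field form4 \<Rightarrow> ('a^4) set set" where
  "lines_in d c = {L. is_line L \<and> (\<forall>x\<in>L. form_at d c x = 0)}"

lemma is_line_subspace: "is_line L \<Longrightarrow> vec.subspace L"
  by (auto simp: is_line_def subspace_span2)
lemmas line_add = vec.subspace_add[OF is_line_subspace]
  and line_diff = vec.subspace_diff[OF is_line_subspace]
  and line_scale = vec.subspace_scale[OF is_line_subspace]

lemma line_eq_span2: "is_line L \<Longrightarrow> indep2 x y \<Longrightarrow> x \<in> L \<Longrightarrow> y \<in> L \<Longrightarrow> L = span2 x y"
  unfolding is_line_def using span2_eq_if_indep2 by blast
lemma is_line_span2: "indep2 a b \<Longrightarrow> is_line (span2 a b)" unfolding is_line_def by blast

lemma common_points_proportional: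
  assumes "is_line L" "is_line M" "L \<noteq> M" "x \<in> L" "x \<in> M" "y \<in> L" "y \<in> M" "x \<noteq> 0"
  obtains r where "y = r *s x"
  using obtain_multiple_if_not_indep2[of x y] line_eq_span2 assms by metis

lemma line_through_point:
  assumes "is_line L" "p \<in> L" "p \<noteq> 0"
  obtains v where "indep2 p v" "v \<in> L" "L = span2 p v"
proof -
  obtain a b where ab: "indep2 a b" "L = span2 a b" using assms(1) by (auto simp: is_line_def)
  have "indep2 p a \<or> indep2 p b"
  proof (rule ccontr)
    assume "\<not> ?thesis"
    then obtain r s where multiples: "a = r *s p" "b = s *s p" using obtain_multiple_if_not_indep2 assms(3) by metis
    then have "s *s a + (-r) *s b = 0" by (simp add: cart_eq)
    then have "r = 0" using ab(1) unfolding indep2_def by (metis neg_equal_0_iff_equal)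
    then show False using multiples(1) indep2_nonzero(1)[OF ab(1)] by simp
  qed
  then show ?thesis using that line_eq_span2[OF assms(1) _ assms(2)] ab by (metis span2_generators(1,2))
qed

lemma obtain_point_off_line:
  assumes "is_line L" "is_line K" "L \<noteq> K"
  obtains y where "y \<in> L" "y \<notin> K"
proof -
  obtain a b where ab: "indep2 a b" "L = span2 a b" using assms(1) unfolding is_line_def by blast
  have "a \<notin> K \<or> b \<notin> K" using line_eq_span2[OF assms(2) ab(1)] ab(2) assms(3) by blast
  then show ?thesis using that[of a] that[of b] ab(2) by auto
qed

lemma meets_sym: "meets L M \<Longrightarrow> meets M L" unfolding meets_def by blast

lemma basis4_if_skew:
  assumes indep: "indep2 a b" "indep2 a' b'" and skew: "\<not> meets (span2 a b) (span2 a' b')"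
  shows "basis4 a b a' b'"
  unfolding basis4_def
proof (intro allI impI)
  fix s t s' t' assume zero: "s *s a + t *s b + s' *s a' + t' *s b' = 0"
  then have "s *s a + t *s b = (-s') *s a' + (-t') *s b'" by (simp add: cart_eq eq_neg_iff_add_eq_0 algebra_simps)
  then have "s *s a + t *s b = 0" using skew span2I unfolding meets_def by metis
  then show "s = 0 \<and> t = 0 \<and> s' = 0 \<and> t' = 0" using zero indep unfolding indep2_def by simp
qed

lemma skew_if_basis4:
  assumes "basis4 p q r s"
  shows "\<not> meets (span2 p q) (span2 r s)"
proof
  assume "meets (span2 p q) (span2 r s)"
  then obtain a b a' b' where nonzero: "a *s p + b *s q \<noteq> 0" and eq: "a *s p + b *s q = a' *s r + b' *s s"
    unfolding meets_def by (metis span2E)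
  have "a *s p + b *s q + 0 *s r + 0 *s s = 0 *s p + 0 *s q + a' *s r + b' *s s" using eq by simp
  from basis4_coords_eq[OF assms this] show False using nonzero by simp
qed

lemma basis4_replace:
  assumes "basis4 p q a b" "h \<notin> span2 p q"
  shows "basis4 p q a h \<or> basis4 p q b h"
proof -
  obtain x y z w where h: "h = x *s p + y *s q + z *s a + w *s b" using assms(1) by (rule basis4_span)
  have "z \<noteq> 0 \<or> w \<noteq> 0" using h assms(2) span2I by fastforce
  moreover have "basis4 p q b h" if "z \<noteq> 0"
    unfolding basis4_def
  proof (intro allI impI)
    fix s t u v assume "s *s p + t *s q + u *s b + v *s h = 0"
    then have "(s + v * x) *s p + (t + v * y) *s q + (v * z) *s a + (u + v * w) *s b = 0" unfolding h by (simp add: cart_eq algebra_simps)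
    from basis4_zero[OF assms(1) this] show "s = 0 \<and> t = 0 \<and> u = 0 \<and> v = 0" using that by auto
  qed
  moreover have "basis4 p q a h" if "w \<noteq> 0"
    unfolding basis4_def
  proof (intro allI impI)
    fix s t u v assume "s *s p + t *s q + u *s a + v *s h = 0"
    then have "(s + v * x) *s p + (t + v * y) *s q + (u + v * z) *s a + (v * w) *s b = 0" unfolding h by (simp add: cart_eq algebra_simps)
    from basis4_zero[OF assms(1) this] show "s = 0 \<and> t = 0 \<and> u = 0 \<and> v = 0" using that by auto
  qed
  ultimately show ?thesis by blast
qed

section \<open>Generic choices\<close>

text \<open>Polynomial on every affine line: a substitute for multivariate polynomials in generic choices.\<close>
definition poly_on_lines :: "('a::field^'n \<Rightarrow> 'a) \<Rightarrow> bool" where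
  "poly_on_lines f \<longleftrightarrow> (\<forall>v w. \<exists>P. \<forall>t. f (v + t *s w) = poly P t)"
definition generic_family :: "('a::field^'n \<Rightarrow> 'a) set \<Rightarrow> bool" where
  "generic_family F \<longleftrightarrow> finite F \<and> (\<forall>f\<in>F. poly_on_lines f \<and> (\<exists>v. f v \<noteq> 0))"

lemma generic_family_Un: "generic_family F \<Longrightarrow> generic_family G \<Longrightarrow> generic_family (F \<union> G)"
  unfolding generic_family_def by blast
lemma generic_family_image:
  "finite I \<Longrightarrow> (\<And>i. i \<in> I \<Longrightarrow> poly_on_lines (h i)) \<Longrightarrow> (\<And>i. i \<in> I \<Longrightarrow> \<exists>v. h i v \<noteq> 0) \<Longrightarrow> generic_family (h ` I)"
  unfolding generic_family_def by blast

lemma generic_point: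
  fixes F :: "('a::alg_closed_field^'n \<Rightarrow> 'a) set"
  assumes "generic_family F"
  shows "\<exists>v. \<forall>f\<in>F. f v \<noteq> 0"
proof -
  have "finite F" using assms by (simp add: generic_family_def)
  then show ?thesis using assms
  proof (induction F rule: finite_induct)
    case (insert f F)
    then obtain v w where v: "\<forall>g\<in>F. g v \<noteq> 0" and w: "f w \<noteq> 0" by (auto simp: generic_family_def)
    have "\<exists>P. \<forall>t. g (v + t *s (w - v)) = poly P t" if "g \<in> insert f F" for g
      using insert.prems that by (auto simp: generic_family_def poly_on_lines_def)
    then obtain P where P: "\<And>g t. g \<in> insert f F \<Longrightarrow> g (v + t *s (w - v)) = poly (P g) t" by metis
    have "P g \<noteq> 0" if "g \<in> insert f F" for g
    proof -
      have "poly (P g) 0 = g v" "poly (P g) 1 = g w" using P[OF that, of 0] P[OF that, of 1] by simp_all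
      then show ?thesis using v w that by force
    qed
    then have "finite (\<Union>g\<in>insert f F. {t. poly (P g) t = 0})" using insert.hyps poly_roots_finite by auto
    then obtain t where "t \<notin> (\<Union>g\<in>insert f F. {t. poly (P g) t = 0})" by (rule obtain_outside_finite)
    then have "\<forall>g\<in>insert f F. g (v + t *s (w - v)) \<noteq> 0" using P by auto
    then show ?case by blast
  qed simp
qed

lemma poly_on_lines_const: "poly_on_lines (\<lambda>v. k)"
  unfolding poly_on_lines_def by (intro allI exI[of _ "[:k:]"]) simp
lemma poly_on_lines_coord: "poly_on_lines (\<lambda>v. v$i)"
  unfolding poly_on_lines_def
proof (intro allI)
  fix v w :: "'a^'b"
  show "\<exists>P. \<forall>t. (v + t *s w) $ i = poly P t" by (rule exI[of _ "[:v$i,w$i:]"]) simp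
qed
lemma poly_on_lines_add: "poly_on_lines f \<Longrightarrow> poly_on_lines g \<Longrightarrow> poly_on_lines (\<lambda>v. f v + g v)"
  unfolding poly_on_lines_def by (metis poly_add)
lemma poly_on_lines_diff: "poly_on_lines f \<Longrightarrow> poly_on_lines g \<Longrightarrow> poly_on_lines (\<lambda>v. f v - g v)"
  unfolding poly_on_lines_def by (metis poly_diff)
lemma poly_on_lines_mult: "poly_on_lines f \<Longrightarrow> poly_on_lines g \<Longrightarrow> poly_on_lines (\<lambda>v. f v * g v)"
  unfolding poly_on_lines_def by (metis poly_mult)
lemma poly_on_lines_sum: "(\<And>i. i \<in> I \<Longrightarrow> poly_on_lines (f i)) \<Longrightarrow> poly_on_lines (\<lambda>v. \<Sum>i\<in>I. f i v)"
  by (induction I rule: infinite_finite_induct) (auto intro: poly_on_lines_const poly_on_lines_add)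
lemma poly_on_lines_prod: "(\<And>i. i \<in> I \<Longrightarrow> poly_on_lines (f i)) \<Longrightarrow> poly_on_lines (\<lambda>v. \<Prod>i\<in>I. f i v)"
  by (induction I rule: infinite_finite_induct) (auto intro: poly_on_lines_const poly_on_lines_mult)

lemma poly_on_lines_det4:
  assumes "\<And>i. poly_on_lines (\<lambda>v. p v $ i)" "\<And>i. poly_on_lines (\<lambda>v. q v $ i)"
    "\<And>i. poly_on_lines (\<lambda>v. r v $ i)" "\<And>i. poly_on_lines (\<lambda>v. s v $ i)"
  shows "poly_on_lines (\<lambda>v. det4 (p v) (q v) (r v) (s v))"
proof -
  have "poly_on_lines (\<lambda>v. rows4 (p v) (q v) (r v) (s v) $ i $ j)" for i j
    using exhaust_4[of i] assms by (auto simp: rows4_def)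
  then show ?thesis
    unfolding det4_def Determinants.det_def
    by (intro poly_on_lines_sum poly_on_lines_mult poly_on_lines_prod poly_on_lines_const)
qed

context
  fixes M :: "'a::field^'n \<Rightarrow> 'a^4"
  assumes affine: "\<And>v w t. M (v + t *s w) = M v + t *s M w"
begin

lemma poly_on_lines_form_at: "poly_on_lines (\<lambda>v. form_at d c (M v))"
  unfolding poly_on_lines_def
proof (intro allI)
  fix v w
  show "\<exists>P. \<forall>t. form_at d c (M (v + t *s w)) = poly P t"
    by (rule exI[of _ "form_along d c (M v) (M w)"]) (simp add: poly_form_at affine)
qed

lemma poly_on_lines_polar1_point: "poly_on_lines (\<lambda>v. polar1 d c (M v) u)"
  unfolding poly_on_lines_def
proof (intro allI)
  fix v w
  show "\<exists>P. \<forall>t. polar1 d c (M (v + t *s w)) u = poly P t"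
    by (rule exI[of _ "polar1_along d c (M v) (M w) u"]) (simp add: poly_polar1 affine)
qed

lemma poly_on_lines_polar1_direction: "poly_on_lines (\<lambda>v. polar1 d c x (M v))"
  unfolding poly_on_lines_def
proof (intro allI)
  fix v w
  show "\<exists>P. \<forall>t. polar1 d c x (M (v + t *s w)) = poly P t"
    by (rule exI[of _ "[:polar1 d c x (M v), polar1 d c x (M w):]"]) (simp add: affine polar_linear)
qed

end

section \<open>Linear changes of coordinates\<close>

definition frame_map :: "'a::field^4 \<Rightarrow> 'a^4 \<Rightarrow> 'a^4 \<Rightarrow> 'a^4 \<Rightarrow> 'a^4 \<Rightarrow> 'a^4" where
  "frame_map h1 h2 h3 h4 x = x$1 *s h1 + x$2 *s h2 + x$3 *s h3 + x$4 *s h4"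

lemma frame_map_add: "frame_map h1 h2 h3 h4 (x + y) = frame_map h1 h2 h3 h4 x + frame_map h1 h2 h3 h4 y"
  and frame_map_scale: "frame_map h1 h2 h3 h4 (r *s x) = r *s frame_map h1 h2 h3 h4 x"
  and frame_map_vec4: "frame_map h1 h2 h3 h4 (vec4 s t p q) = s *s h1 + t *s h2 + p *s h3 + q *s h4"
  by (simp_all add: frame_map_def cart_eq algebra_simps)
lemma frame_map_0: "frame_map h1 h2 h3 h4 0 = 0"
  by (simp add: frame_map_def)
lemma frame_map_surj:
  assumes "basis4 h1 h2 h3 h4"
  obtains x where "frame_map h1 h2 h3 h4 x = y"
  using basis4_span[OF assms, of y] frame_map_vec4 by metis
lemma frame_map_inj:
  assumes "basis4 h1 h2 h3 h4" "frame_map h1 h2 h3 h4 x = frame_map h1 h2 h3 h4 y"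
  shows "x = y"
  using basis4_coords_eq[OF assms(1) assms(2)[unfolded frame_map_def]] by (simp add: vec4_eqI)
lemma frame_map_span2: "frame_map h1 h2 h3 h4 ` span2 a b = span2 (frame_map h1 h2 h3 h4 a) (frame_map h1 h2 h3 h4 b)"
  by (force simp: span2_def frame_map_add frame_map_scale)

lemma obtain_form_in_frame:
  fixes c :: "'a::alg_closed_field form4"
  assumes "homogeneous d c"
  obtains c' where "homogeneous d c'" "\<And>x. form_at d c' x = form_at d c (frame_map h1 h2 h3 h4 x)"
    "\<And>x v. polar1 d c' x v = polar1 d c (frame_map h1 h2 h3 h4 x) (frame_map h1 h2 h3 h4 v)"
proof -
  let ?f = "frame_map h1 h2 h3 h4"
  have "is_form 1 (\<lambda>x. ?f x $ i)" for i
  proof -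
    have "is_form 1 (\<lambda>x. (h1$i) * x$1 + (h2$i) * x$2 + (h3$i) * x$3 + (h4$i) * x$4)"
      by (intro is_form_add is_form_cmult is_form_coord)
    then show ?thesis by (simp add: frame_map_def mult.commute)
  qed
  then have "is_form d (\<lambda>x. form_at d c (?f x))" by (rule is_form_comp)
  then obtain c' where c': "homogeneous d c'" "\<And>x. form_at d c' x = form_at d c (?f x)" unfolding is_form_def by metis
  have "polar1 d c' x v = polar1 d c (?f x) (?f v)" for x v
  proof -
    have "form_along d c' x v = form_along d c (?f x) (?f v)"
      by (rule poly_ext) (simp add: poly_form_at c'(2) frame_map_add frame_map_scale)
    then show ?thesis using coeff_form_along_1[OF c'(1), of x v] coeff_form_along_1[OF assms, of "?f x" "?f v"] by simp
  qed
  then show ?thesis using that c' by metis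
qed

section \<open>The flecnodal covariant\<close>

definition hessian :: "nat \<Rightarrow> 'a::comm_ring_1 form4 \<Rightarrow> 'a^4 \<Rightarrow> 'a^4^4" where
  "hessian d c x = (\<chi> i j. form_at (d-2) (partial j (partial i c)) x)"

definition cofactor :: "'a::comm_ring_1^4^4 \<Rightarrow> 4 \<Rightarrow> 4 \<Rightarrow> 'a" where
  "cofactor M i j = det (\<chi> k. if k = i then axis j 1 else M$k)"

lemma sum_row_cofactor: "(\<Sum>j\<in>UNIV. M$k$j * cofactor M i j) = (if k = i then det M else 0)"
proof -
  have "(\<Sum>j\<in>UNIV. M$k$j * cofactor M i j)
     = (\<Sum>j\<in>UNIV. det (\<chi> l. if l = i then M$k$j *s axis j 1 else M$l))"
    unfolding cofactor_def by (simp add: det_row_mul)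
  also have "\<dots> = det (\<chi> l. if l = i then (\<Sum>j\<in>UNIV. M$k$j *s axis j 1) else M$l)"
    using det_linear_row_sum[of "UNIV::4 set" i "\<lambda>_ j. M$k$j *s axis j 1" "\<lambda>l. M$l"] by simp
  also have "\<dots> = det (\<chi> l. if l = i then M$k else M$l)" by (simp only: basis_expansion)
  also have "\<dots> = (if k = i then det M else 0)"
  proof (cases "k = i")
    case True
    then have "(\<chi> l. if l = i then M$k else M$l) = M" by (simp add: cart_eq)
    then show ?thesis using True by simp
  next
    case False
    then show ?thesis by (auto intro!: Determinants.det_identical_rows[of i k] simp: Finite_Cartesian_Product.row_def cart_eq)
  qed
  finally show ?thesis .
qed

lemma cofactor_eq_det_mult_inverse:
  assumes "G ** M = mat 1"
  shows "cofactor M i l = det M * G$l$i"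
proof -
  have "cofactor M i l = (\<Sum>j\<in>UNIV. (mat 1 :: 'a^4^4)$l$j * cofactor M i j)"
    by (simp add: Finite_Cartesian_Product.mat_def if_distrib[of "\<lambda>x. x * _"] sum.delta' cong: if_cong)
  also have "\<dots> = (\<Sum>j\<in>UNIV. (\<Sum>k\<in>UNIV. G$l$k * M$k$j) * cofactor M i j)"
    using assms by (simp add: matrix_matrix_mult_def cart_eq)
  also have "\<dots> = (\<Sum>k\<in>UNIV. G$l$k * (\<Sum>j\<in>UNIV. M$k$j * cofactor M i j))"
    unfolding sum_distrib_left sum_distrib_right by (subst sum.swap) (simp add: mult.assoc)
  also have "\<dots> = det M * G$l$i"
    unfolding sum_row_cofactor by (simp add: if_distrib[of "\<lambda>x. _ * x"] mult.commute cong: if_cong)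
  finally show ?thesis .
qed

lemma right_inverse_if_left_inverse:
  fixes N P :: "'a::comm_ring_1^4^4"
  assumes "N ** P = mat 1"
  shows "P ** N = mat 1"
proof -
  have unit: "det N * det P = 1" using det_mul[of N P] assms by simp
  define C where "C = (\<chi> i l. det N * cofactor P l i)"
  have "(P ** C)$k$i = (if k = i then 1 else 0)" for k i
  proof -
    have "(P ** C)$k$i = det N * (\<Sum>j\<in>UNIV. P$k$j * cofactor P i j)"
      by (simp add: matrix_matrix_mult_def C_def sum_distrib_left algebra_simps)
    then show ?thesis unfolding sum_row_cofactor by (simp add: unit)
  qed
  then have right: "P ** C = mat 1" by (simp add: cart_eq Finite_Cartesian_Product.mat_def)
  have "N = N ** (P ** C)" using right by (simp add: matrix_mul_rid)
  also have "\<dots> = C" using assms by (simp add: matrix_mul_assoc matrix_mul_lid)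
  finally show ?thesis using right by simp
qed

definition third_partial :: "nat \<Rightarrow> 'a::comm_ring_1 form4 \<Rightarrow> 'a^4 \<Rightarrow> 4 \<Rightarrow> 4 \<Rightarrow> 4 \<Rightarrow> 'a" where
  "third_partial d c x i j k = form_at (d-3) (partial k (partial j (partial i c))) x"
definition contract :: "(4 \<Rightarrow> 4 \<Rightarrow> 'a::comm_ring_1) \<Rightarrow> (4 \<Rightarrow> 4 \<Rightarrow> 'a) \<Rightarrow> 'a" where
  "contract A f = (\<Sum>i\<in>UNIV. \<Sum>l\<in>UNIV. A i l * f i l)"
definition hessian_trace :: "nat \<Rightarrow> 'a::comm_ring_1 form4 \<Rightarrow> 'a^4 \<Rightarrow> 4 \<Rightarrow> 'a" where
  "hessian_trace d c x i = contract (cofactor (hessian d c x)) (third_partial d c x i)"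
text \<open>In a frame of the tangent plane made of the two asymptotic directions v1, v2 this contraction
is a nonzero multiple of polar3(v1,v1,v1) polar3(v2,v2,v2) (\<open>flecnodal_eq\<close>), so that it vanishes where some line
has contact of order at least four.\<close>
definition flecnodal :: "nat \<Rightarrow> 'a::comm_ring_1 form4 \<Rightarrow> 'a^4 \<Rightarrow> 'a" where
  "flecnodal d c x = 4 * contract (cofactor (hessian d c x)) (\<lambda>i l. contract (cofactor (hessian d c x)) (\<lambda>j m.
       contract (cofactor (hessian d c x)) (\<lambda>k n. third_partial d c x i j k * third_partial d c x l m n)))
     - 3 * contract (cofactor (hessian d c x)) (\<lambda>i l. hessian_trace d c x i * hessian_trace d c x l)"
definition apolar_cubic :: "nat \<Rightarrow> 'a::comm_ring_1 form4 \<Rightarrow> 'a^4 \<Rightarrow> 'a^4 \<Rightarrow> 'a" where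
  "apolar_cubic d c x v = 4 * det (hessian d c x) * polar3 d c x v v v
     - 3 * polar2 d c x v v * (\<Sum>i\<in>UNIV. v$i * hessian_trace d c x i)"

lemma contract_linear: "contract A (\<lambda>i l. u * (\<Sum>t\<in>S. w t * f t i l)) = u * (\<Sum>t\<in>S. w t * contract A (f t))"
proof -
  have "contract A (\<lambda>i l. u * (\<Sum>t\<in>S. w t * f t i l)) = (\<Sum>i\<in>UNIV. \<Sum>t\<in>S. \<Sum>l\<in>UNIV. u * (w t * (A i l * f t i l)))"
    unfolding contract_def by (subst (2) sum.swap) (simp add: sum_distrib_left algebra_simps)
  also have "\<dots> = (\<Sum>t\<in>S. \<Sum>i\<in>UNIV. \<Sum>l\<in>UNIV. u * (w t * (A i l * f t i l)))" by (rule sum.swap)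
  finally show ?thesis unfolding contract_def by (simp add: sum_distrib_left)
qed

lemma polar3_eq_sum_third_partial:
  "polar3 d c x u v w = (\<Sum>i\<in>UNIV. u$i * (\<Sum>j\<in>UNIV. v$j * (\<Sum>k\<in>UNIV. w$k * third_partial d c x i j k)))"
  unfolding polar3_expand third_partial_def by (simp add: sum_distrib_left mult.assoc)

context comm_ring_hom
begin


lemma det_4_hom: "hom (det (M::'a^4^4)) = det (\<chi> i j. hom (M$i$j))"
  unfolding Determinants.det_def by (simp add: hom_sum hom_mult hom_of_int hom_prod)
lemma hessian_hom: "(\<chi> i j. hom (hessian d c x $ i $ j)) = hessian d (\<lambda>m. hom (c m)) (map_coords hom x)"
  by (simp add: hessian_def cart_eq form_at_hom partial_hom)
lemma cofactor_hom: "hom (cofactor M i j) = cofactor (\<chi> i j. hom (M$i$j)) i j"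
  unfolding cofactor_def det_4_hom by (rule arg_cong[of _ _ det]) (auto simp: cart_eq axis_def)
lemma third_partial_hom: "hom (third_partial d c x i j k) = third_partial d (\<lambda>m. hom (c m)) (map_coords hom x) i j k"
  by (simp add: third_partial_def form_at_hom partial_hom)
lemma contract_hom: "hom (contract A f) = contract (\<lambda>i j. hom (A i j)) (\<lambda>i j. hom (f i j))"
  by (simp add: contract_def hom_distribs)
lemma hessian_trace_hom: "hom (hessian_trace d c x i) = hessian_trace d (\<lambda>m. hom (c m)) (map_coords hom x) i"
  by (simp add: hessian_trace_def contract_hom cofactor_hom hessian_hom third_partial_hom)
lemma flecnodal_hom: "hom (flecnodal d c x) = flecnodal d (\<lambda>m. hom (c m)) (map_coords hom x)"
  by (simp add: flecnodal_def hom_numeral hom_minus hom_mult contract_hom cofactor_hom hessian_hom third_partial_hom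
      hessian_trace_hom)
lemma apolar_cubic_hom: "hom (apolar_cubic d c x v) = apolar_cubic d (\<lambda>m. hom (c m)) (map_coords hom x) (map_coords hom v)"
  by (simp add: apolar_cubic_def hom_numeral hom_minus  hom_mult det_4_hom hessian_hom polar2_hom polar3_hom
      hessian_trace_hom hom_sum)

end

lemma is_form_hessian: "is_form (d-2) (\<lambda>x. hessian d c x $ i $ j)"
  unfolding hessian_def by (simp add: is_form_form_at)
lemma is_form_det_hessian: "is_form (4*(d-2)) (\<lambda>x. det (hessian d c x))"
  using is_form_det[of "\<lambda>_. d - 2" "hessian d c", OF is_form_hessian] by simp
lemma is_form_cofactor_hessian: "is_form (3*(d-2)) (\<lambda>x. cofactor (hessian d c x) i j)"
proof -
  have "is_form (\<Sum>k\<in>(UNIV::4 set). if k = i then 0 else d-2) (\<lambda>x. cofactor (hessian d c x) i j)"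
    unfolding cofactor_def by (intro is_form_det) (auto simp: is_form_const is_form_hessian[unfolded One_nat_def])
  moreover have "(\<Sum>k\<in>(UNIV::4 set). if k = i then 0 else d-2) = 3*(d-2)" using exhaust_4[of i] by (auto simp: sum_4)
  ultimately show ?thesis by simp
qed
lemma is_form_third_partial: "is_form (d-3) (\<lambda>x. third_partial d c x i j k)"
  unfolding third_partial_def by (simp add: is_form_form_at)
lemma is_form_contract:
  "(\<And>i l. is_form n (\<lambda>x. f x i l)) \<Longrightarrow> is_form (3*(d-2) + n) (\<lambda>x. contract (cofactor (hessian d c x)) (f x))"
  unfolding contract_def by (intro is_form_sum is_form_mult is_form_cofactor_hessian)
lemma is_form_hessian_trace: "is_form (3*(d-2) + (d-3)) (\<lambda>x. hessian_trace d c x i)"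
  unfolding hessian_trace_def by (intro is_form_contract is_form_third_partial)

lemma is_form_flecnodal:
  assumes "d \<ge> 3"
  shows "is_form (11*d - 24) (flecnodal d c)"
proof -
  have degree_cubic: "11*d-24 = 3*(d-2) + (3*(d-2) + (3*(d-2) + ((d-3)+(d-3))))"
    and degree_trace: "11*d-24 = 3*(d-2) + ((3*(d-2) + (d-3)) + (3*(d-2) + (d-3)))" using assms by simp_all
  have "is_form (11*d-24) (\<lambda>x. 4 * contract (cofactor (hessian d c x)) (\<lambda>i l. contract (cofactor (hessian d c x)) (\<lambda>j m.
       contract (cofactor (hessian d c x)) (\<lambda>k n. third_partial d c x i j k * third_partial d c x l m n))))"
    unfolding degree_cubic by (intro is_form_cmult is_form_contract is_form_mult is_form_third_partial)
  moreover have "is_form (11*d-24) (\<lambda>x. 3 * contract (cofactor (hessian d c x)) (\<lambda>i l. hessian_trace d c x i * hessian_trace d c x l))"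
    unfolding degree_trace by (intro is_form_cmult is_form_contract is_form_mult is_form_hessian_trace)
  ultimately show ?thesis unfolding flecnodal_def by (rule is_form_diff)
qed

text \<open>Replaces the flecnodal form, which may vanish on the whole surface when every line is of the second kind.\<close>
definition apolar_form :: "nat \<Rightarrow> 'a::comm_ring_1 form4 \<Rightarrow> 'a^4 \<Rightarrow> 'a^4 \<Rightarrow> 'a^4 \<Rightarrow> 'a" where
  "apolar_form d c e g x = apolar_cubic d c x (polar1 d c x g *s e - polar1 d c x e *s g)"

lemma (in comm_ring_hom) apolar_form_hom: "hom (apolar_form d c e g x)
    = apolar_form d (\<lambda>m. hom (c m)) (map_coords hom e) (map_coords hom g) (map_coords hom x)"
proof -
  have "map_coords hom (a *s v - b *s w) = hom a *s map_coords hom v - hom b *s map_coords hom w" for a b v w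
    by (simp add: cart_eq hom_distribs)
  then show ?thesis by (simp add: apolar_form_def apolar_cubic_hom polar1_hom)
qed

lemma is_form_apolar_form:
  assumes "d \<ge> 3"
  shows "is_form (8*d - 14) (apolar_form d c e g)"
proof -
  define v where "v x = polar1 d c x g *s e - polar1 d c x e *s g" for x
  have v: "is_form (d-1) (\<lambda>x. v x $ i)" for i
    unfolding v_def
    by (auto simp: mult.commute[of _ "e$i"] mult.commute[of _ "g$i"] intro!: is_form_diff is_form_cmult is_form_polar1[unfolded One_nat_def])
  have degree_det: "8*d-14 = 4*(d-2) + ((d-1)+(d-1)+(d-1)+(d-3))"
    and degree_trace: "8*d-14 = ((d-1)+(d-1)+(d-2)) + ((d-1) + (3*(d-2) + (d-3)))" using assms by simp_all
  have "is_form (8*d-14) (\<lambda>x. 4 * (det (hessian d c x) * polar3 d c x (v x) (v x) (v x)))"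
    unfolding degree_det polar3_expand by (intro is_form_cmult is_form_mult is_form_det_hessian is_form_sum v is_form_form_at)
  moreover have "is_form (8*d-14) (\<lambda>x. 3 * (polar2 d c x (v x) (v x) * (\<Sum>i\<in>UNIV. v x $ i * hessian_trace d c x i)))"
    unfolding degree_trace polar2_expand by (intro is_form_cmult is_form_mult is_form_hessian_trace is_form_sum v is_form_form_at)
  ultimately show ?thesis unfolding apolar_form_def apolar_cubic_def v_def[symmetric] mult.assoc by (rule is_form_diff)
qed

section \<open>Asymptotic frames\<close>

definition dual_index :: "4 \<Rightarrow> 4" where "dual_index r = (if r = 1 then 2 else if r = 2 then 1 else if r = 3 then 4 else 3)"
lemma dual_index_simps [simp]: "dual_index 1 = 2" "dual_index 2 = 1" "dual_index 3 = 4" "dual_index 4 = 3"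
  by (simp_all add: dual_index_def)

text \<open>The point x, the asymptotic directions v1, v2 and a fourth vector b form a basis in which the Hessian
pairs x with b and v1 with v2; h and k invert the two pairings, which may lie in any commutative ring.\<close>
locale asymptotic_frame =
  fixes d :: nat and c :: "'a::comm_ring_1 form4" and x b v1 v2 :: "'a^4" and h k :: 'a
  assumes homogeneous: "homogeneous d c" and on_surface: "form_at d c x = 0"
    and tangent_v1: "polar1 d c x v1 = 0" and tangent_v2: "polar1 d c x v2 = 0"
    and asymptotic_v1: "polar2 d c x v1 v1 = 0" and asymptotic_v2: "polar2 d c x v2 v2 = 0"
    and k_inverse: "k * polar2 d c x v1 v2 = 1" and h_inverse: "h * polar2 d c x x b = 1"
    and isotropic_b: "polar2 d c x b b = 0" and b_orth_v1: "polar2 d c x b v1 = 0" and b_orth_v2: "polar2 d c x b v2 = 0"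
begin

definition frame_vec :: "4 \<Rightarrow> 'a^4" where "frame_vec r = (if r = 1 then x else if r = 2 then b else if r = 3 then v1 else v2)"
definition frame_weight :: "4 \<Rightarrow> 'a" where "frame_weight r = (if r = 1 \<or> r = 2 then h else k)"
lemma frame_simps: "frame_vec 1 = x" "frame_vec 2 = b" "frame_vec 3 = v1" "frame_vec 4 = v2"
  "frame_weight 1 = h" "frame_weight 2 = h" "frame_weight 3 = k" "frame_weight 4 = k"
  by (simp_all add: frame_vec_def frame_weight_def)

abbreviation H where "H \<equiv> det (hessian d c x)"

lemma polar2_x: "polar2 d c x x v = of_nat (d - 1) * polar1 d c x v"
  by (rule euler2(2)[OF homogeneous])
lemma polar2_frame: "polar2 d c x x v1 = 0" "polar2 d c x x v2 = 0" "polar2 d c x x x = 0"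
  "polar2 d c x v1 x = 0" "polar2 d c x v2 x = 0" "polar2 d c x v1 b = 0" "polar2 d c x v2 b = 0"
  "polar2 d c x b x = polar2 d c x x b" "polar2 d c x v2 v1 = polar2 d c x v1 v2"
  using polar2_x euler1[OF homogeneous, of x] polar2_sym[of d c x]
  by (simp_all add: on_surface tangent_v1 tangent_v2 b_orth_v1 b_orth_v2)
lemmas polar2_frame_values = polar2_frame asymptotic_v1 asymptotic_v2 isotropic_b b_orth_v1 b_orth_v2

lemma frame_weight_polar2:
  "frame_weight r * polar2 d c x (frame_vec (dual_index r)) (frame_vec s) = (if r = s then 1 else 0)"
  using exhaust_4[of r] exhaust_4[of s] by (auto simp: frame_simps polar2_frame_values h_inverse k_inverse)

definition frame_inverse :: "'a^4^4" where
  "frame_inverse = (\<chi> i j. \<Sum>r\<in>UNIV. frame_weight r * (frame_vec r$i * frame_vec (dual_index r)$j))"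

lemma frame_inverse_sym: "frame_inverse$i$j = frame_inverse$j$i"
  by (simp add: frame_inverse_def sum_4 frame_simps algebra_simps)

lemma frame_inverse_hessian: "frame_inverse ** hessian d c x = mat 1"
proof -
  define P :: "'a^4^4" where "P = (\<chi> i r. frame_vec r$i)"
  define N :: "'a^4^4" where "N = (\<chi> r j. frame_weight r * (\<Sum>i\<in>UNIV. frame_vec (dual_index r)$i * hessian d c x$i$j))"
  have polar2_hessian: "polar2 d c x v w = (\<Sum>j\<in>UNIV. (\<Sum>i\<in>UNIV. v$i * hessian d c x$i$j) * w$j)" for v w
    unfolding polar2_expand sum_distrib_right by (subst sum.swap) (simp add: hessian_def algebra_simps)
  have "(N ** P)$r$s = frame_weight r * polar2 d c x (frame_vec (dual_index r)) (frame_vec s)" for r s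
    unfolding polar2_hessian N_def P_def matrix_matrix_mult_def by (subst sum_distrib_left) (simp add: mult.assoc)
  then have "N ** P = mat 1" by (simp add: cart_eq Finite_Cartesian_Product.mat_def frame_weight_polar2)
  then have "P ** N = mat 1" by (rule right_inverse_if_left_inverse)
  moreover have "P ** N = frame_inverse ** hessian d c x"
    unfolding P_def N_def frame_inverse_def matrix_matrix_mult_def cart_eq
    by (auto simp: sum_distrib_left sum_distrib_right algebra_simps intro: sum.swap)
  ultimately show ?thesis by simp
qed

lemma det_hessian_unit: "det frame_inverse * H = 1"
  using det_mul[of frame_inverse "hessian d c x"] by (simp add: frame_inverse_hessian)

lemma tangent_decomposition:
  assumes "polar1 d c x v = 0"
  shows "v = (k * polar2 d c x v2 v) *s v1 + (k * polar2 d c x v1 v) *s v2 + (h * polar2 d c x b v) *s x"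
proof -
  let ?Hv = "hessian d c x *v v"
  have "v = frame_inverse *v ?Hv" by (simp add: matrix_vector_mul_assoc frame_inverse_hessian)
  from arg_cong[OF this, of "\<lambda>y. y $ _"] have v: "v$i = (\<Sum>j\<in>UNIV. frame_inverse$i$j * ?Hv$j)" for i
    by (simp add: matrix_vector_mult_def[of frame_inverse])
  have Hv: "(\<Sum>j\<in>UNIV. y$j * ?Hv$j) = polar2 d c x y v" for y
    unfolding polar2_expand by (simp add: matrix_vector_mult_def hessian_def sum_distrib_left algebra_simps)
  have "v$i = (\<Sum>r\<in>UNIV. frame_weight r * frame_vec r$i * polar2 d c x (frame_vec (dual_index r)) v)" for i
  proof -
    have "v$i = (\<Sum>j\<in>UNIV. \<Sum>r\<in>UNIV. frame_weight r * frame_vec r$i * (frame_vec (dual_index r)$j * ?Hv$j))"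
      unfolding v[of i] by (simp add: frame_inverse_def sum_distrib_right mult.assoc)
    also have "\<dots> = (\<Sum>r\<in>UNIV. \<Sum>j\<in>UNIV. frame_weight r * frame_vec r$i * (frame_vec (dual_index r)$j * ?Hv$j))" by (rule sum.swap)
    finally show ?thesis by (simp add: sum_distrib_left[symmetric] Hv)
  qed
  then show ?thesis by (simp add: cart_eq sum_4 frame_simps polar2_x assms algebra_simps)
qed

lemma cofactor_hessian:
  "cofactor (hessian d c x) i l = H * (\<Sum>r\<in>UNIV. frame_weight r * (frame_vec r$i * frame_vec (dual_index r)$l))"
  using cofactor_eq_det_mult_inverse[OF frame_inverse_hessian, of i l] frame_inverse_sym[of l i]
  by (simp add: frame_inverse_def)

lemma contract_hessian: "contract (cofactor (hessian d c x)) f = H *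
   (\<Sum>r\<in>UNIV. frame_weight r * (\<Sum>i\<in>UNIV. \<Sum>l\<in>UNIV. frame_vec r$i * frame_vec (dual_index r)$l * f i l))"
proof -
  have "contract (cofactor (hessian d c x)) f = H *
     (\<Sum>i\<in>UNIV. \<Sum>r\<in>UNIV. \<Sum>l\<in>UNIV. frame_weight r * (frame_vec r$i * frame_vec (dual_index r)$l * f i l))"
    unfolding contract_def cofactor_hessian
    by (subst (2) sum.swap) (simp add: sum_distrib_left sum_distrib_right mult.assoc)
  also have "(\<Sum>i\<in>UNIV. \<Sum>r\<in>UNIV. \<Sum>l\<in>UNIV. frame_weight r * (frame_vec r$i * frame_vec (dual_index r)$l * f i l))
     = (\<Sum>r\<in>UNIV. \<Sum>i\<in>UNIV. \<Sum>l\<in>UNIV. frame_weight r * (frame_vec r$i * frame_vec (dual_index r)$l * f i l))" by (rule sum.swap)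
  finally show ?thesis by (simp add: sum_distrib_left)
qed

lemma contract_hessian_product: "contract (cofactor (hessian d c x)) (\<lambda>i l. p i * q l) = H *
   (\<Sum>r\<in>UNIV. frame_weight r * ((\<Sum>i\<in>UNIV. frame_vec r$i * p i) * (\<Sum>l\<in>UNIV. frame_vec (dual_index r)$l * q l)))"
  unfolding contract_hessian sum_product by (simp add: algebra_simps)

lemma sum_hessian_trace:
  "(\<Sum>i\<in>UNIV. u$i * hessian_trace d c x i)
    = H * (\<Sum>r\<in>UNIV. frame_weight r * polar3 d c x u (frame_vec r) (frame_vec (dual_index r)))"
proof -
  have "(\<Sum>i\<in>UNIV. u$i * hessian_trace d c x i) = H * (\<Sum>i\<in>UNIV. \<Sum>r\<in>UNIV. frame_weight r *
     (u$i * (\<Sum>j\<in>UNIV. \<Sum>l\<in>UNIV. frame_vec r$j * frame_vec (dual_index r)$l * third_partial d c x i j l)))"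
    unfolding hessian_trace_def contract_hessian by (simp add: sum_distrib_left algebra_simps)
  also have "\<dots> = H * (\<Sum>r\<in>UNIV. \<Sum>i\<in>UNIV. frame_weight r *
     (u$i * (\<Sum>j\<in>UNIV. \<Sum>l\<in>UNIV. frame_vec r$j * frame_vec (dual_index r)$l * third_partial d c x i j l)))"
    by (subst sum.swap) (rule refl)
  finally show ?thesis unfolding polar3_eq_sum_third_partial by (simp add: sum_distrib_left mult.assoc)
qed

abbreviation T :: "4 \<Rightarrow> 4 \<Rightarrow> 4 \<Rightarrow> 'a" where
  "T r s t \<equiv> polar3 d c x (frame_vec r) (frame_vec s) (frame_vec t)"

lemma T_sym: "T r s t = T s r t" "T r s t = T r t s"
  by (rule polar3_sym12, rule polar3_sym23)

lemma polar3_x: "polar3 d c x x v w = of_nat (d - 2) * polar2 d c x v w"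
  "polar3 d c x v x w = of_nat (d - 2) * polar2 d c x v w" "polar3 d c x v w x = of_nat (d - 2) * polar2 d c x v w"
  by (simp_all add: euler3[OF homogeneous])

lemma T_values: "T 1 1 1 = 0" "T 1 1 2 = of_nat (d - 2) * polar2 d c x x b" "T 1 1 3 = 0" "T 1 1 4 = 0"
  "T 1 2 2 = 0" "T 1 2 3 = 0" "T 1 2 4 = 0" "T 1 3 3 = 0" "T 1 4 4 = 0" "T 1 3 4 = of_nat (d - 2) * polar2 d c x v1 v2"
  by (simp_all add: frame_simps polar3_x polar2_frame_values)

lemma cancel_pairings: "h * (e * polar2 d c x x b) = e" "k * (e * polar2 d c x v1 v2) = e"
  using h_inverse k_inverse by (metis mult.left_commute mult.right_neutral)+

lemma cubic_contraction:
  "contract (cofactor (hessian d c x)) (\<lambda>i l. contract (cofactor (hessian d c x)) (\<lambda>j m.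
      contract (cofactor (hessian d c x)) (\<lambda>q n. third_partial d c x i j q * third_partial d c x l m n)))
    = H^3 * (12 * h * k * of_nat (d-2) * T 2 3 4 + 2 * k^3 * T 3 3 3 * T 4 4 4 + 6 * k^3 * T 3 3 4 * T 3 4 4)"
proof -
  let ?p = "polar2 d c x v1 v2"
  have "contract (cofactor (hessian d c x)) (\<lambda>i l. contract (cofactor (hessian d c x)) (\<lambda>j m.
      contract (cofactor (hessian d c x)) (\<lambda>q n. third_partial d c x i j q * third_partial d c x l m n)))
    = H * (\<Sum>t\<in>UNIV. frame_weight t * (H * (\<Sum>s\<in>UNIV. frame_weight s * (H * (\<Sum>r\<in>UNIV. frame_weight r *
        (T r s t * T (dual_index r) (dual_index s) (dual_index t)))))))"
    unfolding contract_hessian_product contract_linear polar3_eq_sum_third_partial ..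
  also have "\<dots> = H^3 * (12 * h * k * (k * (of_nat (d-2) * ?p)) * T 2 3 4 + 2 * k^3 * T 3 3 3 * T 4 4 4 + 6 * k^3 * T 3 3 4 * T 3 4 4)"
    unfolding sum_4 dual_index_simps frame_simps(5-8) by (simp only: T_sym T_values) (simp add: power3_eq_cube algebra_simps)
  finally show ?thesis unfolding cancel_pairings .
qed

lemma trace_contraction:
  "contract (cofactor (hessian d c x)) (\<lambda>i l. hessian_trace d c x i * hessian_trace d c x l)
    = H^3 * (16 * h * k * of_nat (d-2) * T 2 3 4 + 8 * k^3 * T 3 3 4 * T 3 4 4)"
proof -
  define K where "K s = (\<Sum>r\<in>UNIV. frame_weight r * T s r (dual_index r))" for s
  have "K 1 = 2 * (h * (of_nat (d - 2) * polar2 d c x x b)) + 2 * (k * (of_nat (d - 2) * polar2 d c x v1 v2))"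
    "K 2 = 2 * k * T 2 3 4" "K 3 = 2 * k * T 3 3 4" "K 4 = 2 * k * T 3 4 4"
    unfolding K_def sum_4 dual_index_simps frame_simps(5-8)
    by (simp_all only: T_sym T_values) (simp_all add: algebra_simps)
  then have K: "K 1 = 4 * of_nat (d - 2)" "K 2 = 2 * k * T 2 3 4" "K 3 = 2 * k * T 3 3 4" "K 4 = 2 * k * T 3 4 4"
    unfolding cancel_pairings by simp_all
  have "contract (cofactor (hessian d c x)) (\<lambda>i l. hessian_trace d c x i * hessian_trace d c x l)
    = H * (\<Sum>s\<in>UNIV. frame_weight s * ((H * K s) * (H * K (dual_index s))))"
    unfolding contract_hessian_product sum_hessian_trace K_def ..
  also have "\<dots> = H^3 * (16 * h * k * of_nat (d-2) * T 2 3 4 + 8 * k^3 * T 3 3 4 * T 3 4 4)"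
    unfolding sum_4 dual_index_simps frame_simps(5-8) K by (simp add: power3_eq_cube algebra_simps)
  finally show ?thesis .
qed

theorem flecnodal_eq: "flecnodal d c x = 8 * (H * k)^3 * polar3 d c x v1 v1 v1 * polar3 d c x v2 v2 v2"
proof -
  have "flecnodal d c x = 8 * (H * k)^3 * T 3 3 3 * T 4 4 4"
    unfolding flecnodal_def cubic_contraction trace_contraction by (simp add: power3_eq_cube algebra_simps)
  then show ?thesis unfolding frame_simps .
qed

context
  fixes v :: "'a^4" and \<alpha> \<beta> \<pi> :: 'a
  assumes v: "v = \<alpha> *s v1 + \<beta> *s v2 + \<pi> *s x"
begin

lemma polar2_tangent: "polar2 d c x v v = 2 * \<alpha> * \<beta> * polar2 d c x v1 v2"
  unfolding v polar_linear by (simp add: polar2_frame_values algebra_simps)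

lemma polar3_asymptotic_sym: "polar3 d c x v1 v2 v1 = polar3 d c x v1 v1 v2" "polar3 d c x v2 v1 v1 = polar3 d c x v1 v1 v2"
  "polar3 d c x v2 v1 v2 = polar3 d c x v1 v2 v2" "polar3 d c x v2 v2 v1 = polar3 d c x v1 v2 v2"
  using polar3_sym12 polar3_sym13 polar3_sym23 by metis+

lemma polar3_tangent: "polar3 d c x v v v = \<alpha>^3 * polar3 d c x v1 v1 v1 + \<beta>^3 * polar3 d c x v2 v2 v2
    + 3 * \<alpha> * \<beta> * (\<alpha> * polar3 d c x v1 v1 v2 + \<beta> * polar3 d c x v1 v2 v2 + 2 * \<pi> * of_nat (d - 2) * polar2 d c x v1 v2)"
  unfolding v polar_linear polar3_asymptotic_sym polar3_x polar2_frame_values by (simp add: algebra_simps power3_eq_cube)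

lemma sum_hessian_trace_tangent: "(\<Sum>i\<in>UNIV. v$i * hessian_trace d c x i)
    = H * (4 * of_nat (d - 2) * \<pi> + 2 * k * (\<alpha> * polar3 d c x v1 v1 v2 + \<beta> * polar3 d c x v1 v2 v2))"
proof -
  let ?e = "of_nat (d - 2) :: 'a"
  have "(\<Sum>i\<in>UNIV. v$i * hessian_trace d c x i) = H * (2 * h * polar3 d c x v x b + 2 * k * polar3 d c x v v1 v2)"
    unfolding sum_hessian_trace
    by (simp add: sum_4 frame_simps polar3_sym23[of d c x v b x] polar3_sym23[of d c x v v2 v1] algebra_simps)
  also have "\<dots> = H * (2 * \<pi> * (h * (?e * polar2 d c x x b)) + 2 * \<pi> * (k * (?e * polar2 d c x v1 v2))
      + 2 * k * (\<alpha> * polar3 d c x v1 v1 v2 + \<beta> * polar3 d c x v1 v2 v2))"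
    unfolding v polar_linear polar3_asymptotic_sym polar3_x polar2_frame_values by (simp add: algebra_simps)
  finally show ?thesis unfolding cancel_pairings by (simp add: algebra_simps)
qed

theorem apolar_cubic_eq:
  "apolar_cubic d c x v = 4 * H * (\<alpha>^3 * polar3 d c x v1 v1 v1 + \<beta>^3 * polar3 d c x v2 v2 v2)"
proof -
  let ?p = "polar2 d c x v1 v2" and ?S = "\<alpha> * polar3 d c x v1 v1 v2 + \<beta> * polar3 d c x v1 v2 v2"
  have "2 * \<alpha> * \<beta> * ?p * (H * (4 * of_nat (d - 2) * \<pi> + 2 * k * ?S))
    = H * (8 * \<alpha> * \<beta> * of_nat (d - 2) * \<pi> * ?p + 4 * \<alpha> * \<beta> * ((k * ?p) * ?S))" by (simp add: algebra_simps)
  then have "2 * \<alpha> * \<beta> * ?p * (H * (4 * of_nat (d - 2) * \<pi> + 2 * k * ?S))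
    = H * (8 * \<alpha> * \<beta> * of_nat (d - 2) * \<pi> * ?p + 4 * \<alpha> * \<beta> * ?S)" unfolding k_inverse by simp
  then have "3 * polar2 d c x v v * (\<Sum>i\<in>UNIV. v$i * hessian_trace d c x i)
    = 3 * (H * (8 * \<alpha> * \<beta> * of_nat (d - 2) * \<pi> * ?p + 4 * \<alpha> * \<beta> * ?S))"
    unfolding polar2_tangent sum_hessian_trace_tangent by (simp only: mult.assoc)
  then show ?thesis
    unfolding apolar_cubic_def polar3_tangent by (simp add: algebra_simps)
qed

end

end

lemma asymptotic_frame_exists:
  fixes d :: nat and c :: "'a::comm_ring_1 form4"
  assumes homogeneous: "homogeneous d c" and on_surface: "form_at d c x = 0"
    and tangent: "polar1 d c x v1 = 0" "polar1 d c x v2 = 0"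
    and asymptotic: "polar2 d c x v1 v1 = 0" "polar2 d c x v2 v2 = 0"
    and k: "k * polar2 d c x v1 v2 = 1" and h: "h * polar2 d c x x b0 = 1" and half: "half * 2 = (1::'a)"
  shows "\<exists>b. asymptotic_frame d c x b v1 v2 h k"
proof -
  have x: "polar2 d c x x v1 = 0" "polar2 d c x x v2 = 0" "polar2 d c x x x = 0"
    using tangent euler1[OF homogeneous, of x] by (simp_all add: euler2[OF homogeneous] on_surface)
  have k': "k * polar2 d c x v2 v1 = 1" using k polar2_sym by metis
  define b1 where "b1 = b0 - (k * polar2 d c x b0 v2) *s v1 - (k * polar2 d c x b0 v1) *s v2"
  define s where "s = - (half * h * polar2 d c x b1 b1)"
  define b where "b = b1 + s *s x"
  have cancel_k: "k * a * polar2 d c x v1 v2 = a" "k * a * polar2 d c x v2 v1 = a" for a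
    using k k' by (metis mult.assoc mult.commute mult.right_neutral)+
  have b1_orth: "polar2 d c x b1 v1 = 0" "polar2 d c x b1 v2 = 0"
    unfolding b1_def polar_linear asymptotic cancel_k by simp_all
  have b1_x: "polar2 d c x x b1 = polar2 d c x x b0" unfolding b1_def polar_linear by (simp add: x)
  have b_x: "h * polar2 d c x x b = 1" unfolding b_def polar_linear b1_x by (simp add: x h)
  have "polar2 d c x b b = polar2 d c x b1 b1 + 2 * s * polar2 d c x x b0"
    unfolding b_def polar_linear by (simp add: x b1_x polar2_sym[of d c x b1 x] algebra_simps)
  also have "\<dots> = polar2 d c x b1 b1 - (half * 2) * (h * polar2 d c x x b0) * polar2 d c x b1 b1"
    unfolding s_def by (simp add: algebra_simps)
  finally have isotropic: "polar2 d c x b b = 0" unfolding half h by simp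
  have "polar2 d c x b v1 = 0" "polar2 d c x b v2 = 0" unfolding b_def polar_linear b1_orth by (simp_all add: x)
  with b_x isotropic have "asymptotic_frame d c x b v1 v2 h k"
    by unfold_locales (use assms in auto)
  then show ?thesis ..
qed

section \<open>A line on a smooth surface\<close>

definition smooth_form :: "nat \<Rightarrow> 'a::field form4 \<Rightarrow> bool" where
  "smooth_form d c \<longleftrightarrow> (\<forall>x. x \<noteq> 0 \<longrightarrow> form_at d c x = 0 \<longrightarrow> (\<exists>v. polar1 d c x v \<noteq> 0))"

text \<open>Segre's lines of the second kind: at every point the asymptotic direction v other than the line itself
also has contact of order at least four.\<close>
definition second_kind :: "nat \<Rightarrow> 'a::field form4 \<Rightarrow> ('a^4) set \<Rightarrow> bool" where
  "second_kind d c L \<longleftrightarrow> (\<forall>p\<in>L. \<forall>y\<in>L. \<forall>v. polar1 d c p v = 0 \<and> polar2 d c p v v = 0 \<and> polar2 d c p y v \<noteq> 0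
     \<longrightarrow> polar3 d c p v v v = 0)"

lemma obtain_orthogonal_multiple:
  fixes p q a b :: "'a::field"
  assumes "p * a + q * b = 0" "a = 0 \<Longrightarrow> b \<noteq> 0"
  obtains l where "p = l * b" "q = - (l * a)"
proof (cases "b = 0")
  case False
  have "q = - (p / b * a)" using assms(1) False by (simp add: field_simps eq_neg_iff_add_eq_0)
  then show ?thesis using that[of "p / b"] False by simp
next
  case True
  then have "a \<noteq> 0" using assms(2) by blast
  then show ?thesis using that[of "- q / a"] assms(1) True by simp
qed

lemma syzygy_zero_if_degree_less:
  fixes A B a b :: "'a::alg_closed_field poly"
  assumes "a * A + b * B = 0" "degree b < degree A" "\<And>r. poly A r = 0 \<Longrightarrow> poly B r \<noteq> 0"
  shows "a = 0" "b = 0"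
proof -
  have "A \<noteq> 0" using assms(2) by auto
  have "b * B = - a * A" using assms(1) by (simp add: eq_neg_iff_add_eq_0 add.commute)
  then have "A dvd b" using dvd_if_no_common_root[OF \<open>A \<noteq> 0\<close> _ assms(3)] by simp
  then show "b = 0" using assms(2) dvd_imp_degree_le[of A b] by (meson leD)
  then show "a = 0" using assms(1) \<open>A \<noteq> 0\<close> by simp
qed

locale surface =
  fixes d :: nat and c :: "'a::alg_closed_field form4"
  assumes homogeneous: "homogeneous d c" and degree_ge_3: "d \<ge> 3" and char: "good_char TYPE('a) d"
    and smooth: "smooth_form d c"
begin

lemma of_nat_nonzero: "0 < k \<Longrightarrow> k \<le> d \<Longrightarrow> (of_nat k :: 'a) \<noteq> 0"
  by (rule good_char_of_nat[OF char])
lemma numerals_nonzero: "(2::'a) \<noteq> 0" "(3::'a) \<noteq> 0" "(4::'a) \<noteq> 0" "(8::'a) \<noteq> 0"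
proof -
  show two: "(2::'a) \<noteq> 0" and "(3::'a) \<noteq> 0" using of_nat_nonzero[of 2] of_nat_nonzero[of 3] degree_ge_3 by simp_all
  have "(4::'a) = 2 * 2" "(8::'a) = 2 * 2 * 2" by simp_all
  then show "(4::'a) \<noteq> 0" "(8::'a) \<noteq> 0" using two by (metis mult_eq_0_iff)+
qed

lemma smooth_point: "x \<noteq> 0 \<Longrightarrow> form_at d c x = 0 \<Longrightarrow> \<exists>v. polar1 d c x v \<noteq> 0"
  using smooth unfolding smooth_form_def by blast

end

locale surface_line = surface d c for d :: nat and c :: "'a::alg_closed_field form4" +
  fixes e f g1 g2 :: "'a^4"
  assumes basis: "basis4 e f g1 g2" and on_surface: "\<And>s t. form_at d c (s *s e + t *s f) = 0"
begin

abbreviation point where "point z \<equiv> e + z *s f"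
abbreviation line_polar1 where "line_polar1 \<equiv> polar1 d (const_form c) (param_line e f)"
abbreviation line_polar2 where "line_polar2 \<equiv> polar2 d (const_form c) (param_line e f)"
abbreviation line_polar3 where "line_polar3 \<equiv> polar3 d (const_form c) (param_line e f)"

definition grad1 where "grad1 = line_polar1 (const_vec g1)"
definition grad2 where "grad2 = line_polar1 (const_vec g2)"
definition tangent_vec where "tangent_vec = grad2 *s const_vec g1 - grad1 *s const_vec g2"
text \<open>Vanishes at the points of the line where the tangent plane cuts the surface in a curve with a cusp, or worse.\<close>
definition parabolic where "parabolic = wronskian grad1 grad2"
definition tangent_polar2 where "tangent_polar2 = line_polar2 tangent_vec tangent_vec"
definition asymptotic_vec where "asymptotic_vec = (2 * parabolic) *s tangent_vec - tangent_polar2 *s const_vec f"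
text \<open>The third polar in the second asymptotic direction is 2 \<open>parabolic\<close> \<open>segre_poly\<close>; hence \<open>segre_poly\<close> vanishes
for lines of the second kind, and being of degree at most 8d - 14 it has a root wherever the line meets another one.\<close>
definition segre_poly where
  "segre_poly = 3 * tangent_polar2^2 * pderiv parabolic - 6 * parabolic * tangent_polar2 * line_polar3 tangent_vec tangent_vec (const_vec f)
     + 4 * parabolic^2 * line_polar3 tangent_vec tangent_vec tangent_vec"

abbreviation tangent_at where "tangent_at z \<equiv> eval_vec z tangent_vec"
abbreviation asymptotic_at where "asymptotic_at z \<equiv> eval_vec z asymptotic_vec"

lemma form_at_point: "form_at d c (point z) = 0" "form_at d c f = 0"
  using on_surface[of 1 z] on_surface[of 0 1] by simp_all
lemma form_along_eq_0: "form_along d c e f = 0"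
  by (rule poly_eq_0I) (simp add: poly_form_at form_at_point)
lemma line_polar1_spanning: "line_polar1 (const_vec e) = 0" "line_polar1 (const_vec f) = 0"
  by (rule poly_eq_0I, simp add: poly_polar1 polar1_along_line_in_zero_set[OF homogeneous on_surface])+
lemma line_polar2_ff: "line_polar2 (const_vec f) (const_vec f) = 0"
  using pderiv_polar1_along[OF homogeneous, of e f f] by (simp add: line_polar1_spanning)
lemma line_polar3_fff: "line_polar3 (const_vec f) (const_vec f) (const_vec f) = 0"
  using pderiv_polar2_along[OF homogeneous, of e f f f] by (simp add: line_polar2_ff)
lemma pderiv_grad: "pderiv grad1 = line_polar2 (const_vec g1) (const_vec f)" "pderiv grad2 = line_polar2 (const_vec g2) (const_vec f)"
  by (simp_all add: grad1_def grad2_def pderiv_polar1_along[OF homogeneous])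
lemma pderiv2_grad: "pderiv (pderiv grad1) = line_polar3 (const_vec g1) (const_vec f) (const_vec f)"
  "pderiv (pderiv grad2) = line_polar3 (const_vec g2) (const_vec f) (const_vec f)"
  by (simp_all add: pderiv_grad pderiv_polar2_along[OF homogeneous])
lemma pderiv3_grad:
  "pderiv (pderiv (pderiv grad1)) = polar4 d (const_form c) (param_line e f) (const_vec g1) (const_vec f) (const_vec f) (const_vec f)"
  "pderiv (pderiv (pderiv grad2)) = polar4 d (const_form c) (param_line e f) (const_vec g2) (const_vec f) (const_vec f) (const_vec f)"
  unfolding pderiv2_grad by (simp_all add: pderiv_polar3[OF homogeneous])

lemma line_polar1_tangent: "line_polar1 tangent_vec = 0"
  unfolding tangent_vec_def polar_linear grad1_def[symmetric] grad2_def[symmetric] by simp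
lemma line_polar2_f_tangent: "line_polar2 (const_vec f) tangent_vec = parabolic" "line_polar2 tangent_vec (const_vec f) = parabolic"
proof -
  show eq: "line_polar2 tangent_vec (const_vec f) = parabolic"
    unfolding tangent_vec_def polar_linear pderiv_grad[symmetric] parabolic_def wronskian_def ..
  then show "line_polar2 (const_vec f) tangent_vec = parabolic" using polar2_sym by metis
qed
lemma line_polar3_tangent_ff: "line_polar3 tangent_vec (const_vec f) (const_vec f) = pderiv parabolic"
  unfolding parabolic_def pderiv_wronskian tangent_vec_def polar_linear pderiv2_grad ..

lemma line_polar1_asymptotic: "line_polar1 asymptotic_vec = 0"
  unfolding asymptotic_vec_def polar_linear line_polar1_tangent line_polar1_spanning by simp
lemma line_polar2_f_asymptotic: "line_polar2 (const_vec f) asymptotic_vec = 2 * parabolic^2"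
  unfolding asymptotic_vec_def polar_linear line_polar2_f_tangent line_polar2_ff by (simp add: power2_eq_square)
lemma line_polar2_asymptotic: "line_polar2 asymptotic_vec asymptotic_vec = 0"
  unfolding asymptotic_vec_def polar_linear line_polar2_f_tangent line_polar2_ff tangent_polar2_def[symmetric] by (simp add: algebra_simps)
lemma line_polar3_asymptotic: "line_polar3 asymptotic_vec asymptotic_vec asymptotic_vec = 2 * parabolic * segre_poly"
proof -
  let ?f = "const_vec f"
  have sym: "line_polar3 tangent_vec ?f tangent_vec = line_polar3 tangent_vec tangent_vec ?f"
    "line_polar3 ?f tangent_vec tangent_vec = line_polar3 tangent_vec tangent_vec ?f"
    "line_polar3 ?f tangent_vec ?f = pderiv parabolic" "line_polar3 ?f ?f tangent_vec = pderiv parabolic"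
    using polar3_sym12 polar3_sym23 polar3_sym13 line_polar3_tangent_ff by metis+
  show ?thesis
    unfolding asymptotic_vec_def polar_linear sym line_polar3_tangent_ff line_polar3_fff segre_poly_def
    by (simp add: algebra_simps power2_eq_square)
qed

lemma polar1_point: "polar1 d c (point z) e = 0" "polar1 d c (point z) f = 0" "polar1 d c (point z) (tangent_at z) = 0"
    "polar1 d c (point z) (asymptotic_at z) = 0" "polar1 d c (point z) g1 = poly grad1 z" "polar1 d c (point z) g2 = poly grad2 z"
    "polar1 d c (point z) (point z) = 0"
  using arg_cong[OF line_polar1_spanning(1), of "\<lambda>p. poly p z"] arg_cong[OF line_polar1_spanning(2), of "\<lambda>p. poly p z"]
    arg_cong[OF line_polar1_tangent, of "\<lambda>p. poly p z"] arg_cong[OF line_polar1_asymptotic, of "\<lambda>p. poly p z"]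
  by (simp_all add: poly_polar1 grad1_def grad2_def polar_linear)
lemma polar2_point: "polar2 d c (point z) f f = 0" "polar2 d c (point z) f (tangent_at z) = poly parabolic z"
    "polar2 d c (point z) f (asymptotic_at z) = 2 * (poly parabolic z)^2"
    "polar2 d c (point z) (asymptotic_at z) f = 2 * (poly parabolic z)^2"
    "polar2 d c (point z) (asymptotic_at z) (asymptotic_at z) = 0"
    "polar2 d c (point z) f g1 = poly (pderiv grad1) z" "polar2 d c (point z) f g2 = poly (pderiv grad2) z"
  using arg_cong[OF line_polar2_ff, of "\<lambda>p. poly p z"] arg_cong[OF line_polar2_f_tangent(1), of "\<lambda>p. poly p z"]
    arg_cong[OF line_polar2_f_asymptotic, of "\<lambda>p. poly p z"] arg_cong[OF line_polar2_asymptotic, of "\<lambda>p. poly p z"]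
  by (simp_all add: poly_polar2 pderiv_grad polar2_sym[of d c _ g1 f] polar2_sym[of d c _ g2 f]
      polar2_sym[of d c _ "asymptotic_at z" f])
lemma polar2_point_point: "polar2 d c (point z) (point z) v = of_nat (d - 1) * polar1 d c (point z) v"
  by (rule euler2(2)[OF homogeneous])
lemma polar2_point_e: "polar2 d c (point z) f e = 0"
proof -
  have "polar2 d c (point z) f (point z) = 0" by (simp add: euler2(1)[OF homogeneous] polar1_point)
  then show ?thesis by (simp add: polar2_add2 polar2_scale2 polar2_point)
qed
lemma polar3_point: "polar3 d c (point z) f f f = 0"
    "polar3 d c (point z) (asymptotic_at z) (asymptotic_at z) (asymptotic_at z) = 2 * poly parabolic z * poly segre_poly z"
    "polar3 d c (point z) f f (tangent_at z) = poly (pderiv parabolic) z"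
    "polar3 d c (point z) f f g1 = poly (pderiv (pderiv grad1)) z" "polar3 d c (point z) f f g2 = poly (pderiv (pderiv grad2)) z"
  using arg_cong[OF line_polar3_fff, of "\<lambda>p. poly p z"] arg_cong[OF line_polar3_asymptotic, of "\<lambda>p. poly p z"]
    arg_cong[OF line_polar3_tangent_ff, of "\<lambda>p. poly p z"]
  by (simp_all add: poly_polar3 pderiv2_grad polar3_sym13[of d c _ f f g1] polar3_sym13[of d c _ f f g2]
      polar3_sym13[of d c _ f f "tangent_at z"])

lemma point_nonzero: "point z \<noteq> 0"
  using basis4_zero[OF basis, of 1 z 0 0] by auto
lemma f_nonzero: "f \<noteq> 0"
  using basis4_zero[OF basis, of 0 1 0 0] by auto
lemma line_indep2: "indep2 e f" by (rule basis4_indep2[OF basis])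
lemma grad_no_common_root: "poly grad1 z = 0 \<Longrightarrow> poly grad2 z \<noteq> 0"
proof
  assume roots: "poly grad1 z = 0" "poly grad2 z = 0"
  obtain v where v: "polar1 d c (point z) v \<noteq> 0" using smooth_point[OF point_nonzero form_at_point(1)] by blast
  obtain a b p q where "v = a *s e + b *s f + p *s g1 + q *s g2" by (rule basis4_span[OF basis])
  then show False using v by (simp add: polar_linear polar1_point roots)
qed
lemma obtain_transversal:
  obtains g where "polar1 d c (point z) g \<noteq> 0"
  using grad_no_common_root[of z] polar1_point(5,6) by metis

lemma top_coeff_grad: "top_coeff (d-1) grad1 (polar1 d c f g1)" "top_coeff (d-1) grad2 (polar1 d c f g2)"
  unfolding grad1_def grad2_def by (rule top_coeff_polar1_along)+
lemma degree_grad: "degree grad1 \<le> d - 1" "degree grad2 \<le> d - 1"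
  using top_coeff_grad by (auto simp: top_coeff_def)
lemma top_coeff_grad_nonzero: "coeff grad1 (d-1) \<noteq> 0 \<or> coeff grad2 (d-1) \<noteq> 0"
proof (rule ccontr)
  assume "\<not> ?thesis"
  then have zero: "polar1 d c f g1 = 0" "polar1 d c f g2 = 0" using top_coeff_grad by (auto simp: top_coeff_def)
  have line: "polar1 d c f e = 0" "polar1 d c f f = 0"
    using top_coeff_polar1_along[of d c e f e] top_coeff_polar1_along[of d c e f f] by (simp_all add: line_polar1_spanning top_coeff_def)
  obtain v where v: "polar1 d c f v \<noteq> 0" using smooth_point[OF f_nonzero form_at_point(2)] by blast
  obtain a b p q where "v = a *s e + b *s f + p *s g1 + q *s g2" by (rule basis4_span[OF basis])
  then show False using v by (simp add: polar_linear zero line)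
qed

lemma pderiv_parabolic_nonzero: "pderiv parabolic \<noteq> 0"
  unfolding parabolic_def by (rule pderiv_wronskian_nonzero[OF degree_ge_3 char grad_no_common_root top_coeff_grad_nonzero])
lemma parabolic_nonzero: "parabolic \<noteq> 0"
  using pderiv_parabolic_nonzero by auto
lemma schwarzian_grad_nonzero: "schwarzian grad1 grad2 \<noteq> 0"
  by (rule schwarzian_nonzero[OF degree_ge_3 char degree_grad grad_no_common_root top_coeff_grad_nonzero])

lemma linear_syzygy_zero:
  assumes "degree a \<le> 1" "degree b \<le> 1" "a * grad1 + b * grad2 = 0"
  shows "a = 0 \<and> b = 0"
proof (cases "coeff grad1 (d-1) = 0")
  case False
  then have "degree b < degree grad1" using le_degree[of grad1 "d-1"] assms(2) degree_ge_3 by linarith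
  then show ?thesis using syzygy_zero_if_degree_less[OF assms(3)] grad_no_common_root by blast
next
  case True
  then have "degree a < degree grad2" using top_coeff_grad_nonzero le_degree[of grad2 "d-1"] assms(1) degree_ge_3 by fastforce
  then show ?thesis
    using syzygy_zero_if_degree_less[of b grad2 a grad1] assms(3) grad_no_common_root by (metis add.commute)
qed

theorem linear_tangent_field_in_line:
  assumes "\<And>t. t \<notin> S \<Longrightarrow> polar1 d c (point t) (y0 + t *s y1) = 0" "finite S"
  shows "y0 \<in> span2 e f" "y1 \<in> span2 e f"
proof -
  obtain a0 b0 p0 q0 where y0: "y0 = a0 *s e + b0 *s f + p0 *s g1 + q0 *s g2" by (rule basis4_span[OF basis])
  obtain a1 b1 p1 q1 where y1: "y1 = a1 *s e + b1 *s f + p1 *s g1 + q1 *s g2" by (rule basis4_span[OF basis])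
  have "[:p0,p1:] * grad1 + [:q0,q1:] * grad2 = 0"
  proof (rule poly_eq_0_if_cofinitely_many_roots[OF assms(2)])
    fix t assume "t \<notin> S"
    from assms(1)[OF this] show "poly ([:p0,p1:] * grad1 + [:q0,q1:] * grad2) t = 0"
      unfolding y0 y1 polar_linear by (simp add: polar1_point algebra_simps)
  qed
  then have "[:p0,p1:] = 0 \<and> [:q0,q1:] = 0" by (intro linear_syzygy_zero) auto
  then show "y0 \<in> span2 e f" "y1 \<in> span2 e f" unfolding y0 y1 span2_def by auto
qed

lemma obtain_tangent_coords:
  assumes "polar1 d c (point z) v = 0"
  obtains a b l where "v = a *s e + b *s f + l *s tangent_at z"
proof -
  obtain a b p q where v: "v = a *s e + b *s f + p *s g1 + q *s g2" by (rule basis4_span[OF basis])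
  have "p * poly grad1 z + q * poly grad2 z = 0" using assms unfolding v polar_linear by (simp add: polar1_point)
  then obtain l where "p = l * poly grad2 z" "q = - (l * poly grad1 z)"
    by (rule obtain_orthogonal_multiple) (rule grad_no_common_root)
  then have "v = a *s e + b *s f + l *s tangent_at z" unfolding v by (simp add: tangent_vec_def cart_eq algebra_simps)
  then show ?thesis by (rule that)
qed

lemma polar2_f_eq_0_if_parabolic:
  assumes "poly parabolic z = 0" "polar1 d c (point z) v = 0"
  shows "polar2 d c (point z) f v = 0"
proof -
  obtain a b l where v: "v = a *s e + b *s f + l *s tangent_at z" using assms(2) by (rule obtain_tangent_coords)
  show ?thesis unfolding v polar_linear by (simp add: polar2_point polar2_point_e assms(1))
qed

lemma obtain_asymptotic_frame:
  assumes "poly parabolic z \<noteq> 0"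
  obtains b h k where "asymptotic_frame d c (point z) b f (asymptotic_at z) h k"
proof -
  obtain g where g: "polar1 d c (point z) g \<noteq> 0" by (rule obtain_transversal)
  let ?k = "1 / (2 * (poly parabolic z)^2)" and ?h = "1 / (of_nat (d-1) * polar1 d c (point z) g)"
  have k: "?k * polar2 d c (point z) f (asymptotic_at z) = 1" unfolding polar2_point using assms numerals_nonzero by simp
  have h: "?h * polar2 d c (point z) (point z) g = 1"
    unfolding polar2_point_point using g of_nat_nonzero[of "d-1"] degree_ge_3 by simp
  show ?thesis
    using asymptotic_frame_exists[OF homogeneous form_at_point(1) polar1_point(2,4) polar2_point(1,5) k h, of "1/2"]
      numerals_nonzero that by auto
qed

lemma segre_poly_eq_0_if_second_kind:
  assumes "second_kind d c (span2 e f)"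
  shows "segre_poly = 0"
proof (rule poly_eq_0_if_cofinitely_many_roots)
  show "finite {z. poly parabolic z = 0}" by (rule poly_roots_finite[OF parabolic_nonzero])
  fix z assume "z \<notin> {z. poly parabolic z = 0}"
  then have nonzero: "poly parabolic z \<noteq> 0" by simp
  have "polar3 d c (point z) (asymptotic_at z) (asymptotic_at z) (asymptotic_at z) = 0"
    using assms span2_generators(2,4) polar1_point(4) polar2_point(3,5) nonzero numerals_nonzero(1)
    unfolding second_kind_def by (metis mult_eq_0_iff power_eq_0_iff)
  then show "poly segre_poly z = 0" unfolding polar3_point using nonzero numerals_nonzero by simp
qed

lemma segre_poly_nonzero:
  assumes "y \<in> span2 e f" and tangent: "polar1 d c (point z) v = 0" and asymptotic: "polar2 d c (point z) v v = 0"
    and "polar2 d c (point z) y v \<noteq> 0" "polar3 d c (point z) v v v \<noteq> 0"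
  shows "segre_poly \<noteq> 0"
proof
  assume segre_0: "segre_poly = 0"
  obtain s t where "y = s *s e + t *s f" using assms(1) by (rule span2E)
  then have y: "y = s *s point z + (t - s * z) *s f" by (simp add: cart_eq algebra_simps)
  have "polar2 d c (point z) y v = (t - s * z) * polar2 d c (point z) f v"
    unfolding y polar2_add1[of d c "point z" "s *s point z"] polar2_scale1 polar2_point_point tangent by simp
  then have f_v: "polar2 d c (point z) f v \<noteq> 0" using assms(4) by auto
  then have "poly parabolic z \<noteq> 0" using polar2_f_eq_0_if_parabolic[OF _ tangent] by blast
  then obtain b h k where "asymptotic_frame d c (point z) b f (asymptotic_at z) h k" by (rule obtain_asymptotic_frame)
  then interpret frame: asymptotic_frame d c "point z" b f "asymptotic_at z" h k .
  obtain \<alpha> \<beta> \<pi> where v: "v = \<alpha> *s f + \<beta> *s asymptotic_at z + \<pi> *s point z"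
    using frame.tangent_decomposition[OF tangent] by blast
  have pairing: "polar2 d c (point z) f (asymptotic_at z) \<noteq> 0" using frame.k_inverse by auto
  have "\<beta> \<noteq> 0" using f_v unfolding v polar_linear by (auto simp: polar2_point polar2_point_e)
  then have "\<alpha> = 0" using asymptotic pairing numerals_nonzero unfolding frame.polar2_tangent[OF v] by simp
  then have "polar3 d c (point z) v v v = 0" unfolding frame.polar3_tangent[OF v] polar3_point segre_0 by simp
  then show False using assms(5) by simp
qed

end

context surface
begin

lemma line_chart:
  assumes "indep2 e f" "span2 e f \<in> lines_in d c"
  shows "\<exists>g1 g2. surface_line d c e f g1 g2"
proof -
  obtain g1 g2 where "basis4 e f g1 g2" by (rule basis4_extend[OF assms(1)])
  then have "surface_line d c e f g1 g2"
    using assms(2) by unfold_locales (auto simp: lines_in_def span2I)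
  then show ?thesis by blast
qed

lemma lines_in_is_line: "L \<in> lines_in d c \<Longrightarrow> is_line L"
  by (simp add: lines_in_def)

lemma obtain_line_chart:
  assumes "L \<in> lines_in d c"
  obtains e f g1 g2 where "surface_line d c e f g1 g2" "L = span2 e f"
  using line_chart lines_in_is_line[OF assms] assms unfolding is_line_def by metis

lemma obtain_line_chart_at:
  assumes "L \<in> lines_in d c" "p \<in> L" "p \<noteq> 0"
  obtains f g1 g2 where "surface_line d c p f g1 g2" "L = span2 p f"
  using line_chart line_through_point[OF lines_in_is_line[OF assms(1)] assms(2,3)] assms(1) by metis

end

section \<open>Dual numbers\<close>

datatype 'a dual = Dual (re: 'a) (im: 'a)

instantiation dual :: (comm_ring_1) comm_ring_1
begin
definition "0 = Dual 0 0"
definition "1 = Dual 1 0"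
definition "x + y = Dual (re x + re y) (im x + im y)"
definition "x - y = Dual (re x - re y) (im x - im y)"
definition "- x = Dual (- re x) (- im x)"
definition "x * y = Dual (re x * re y) (re x * im y + im x * re y)"
instance
  by standard (auto simp: zero_dual_def one_dual_def plus_dual_def minus_dual_def uminus_dual_def times_dual_def algebra_simps)
end

lemma dual_sel [simp]: "re 0 = 0" "im 0 = 0" "re 1 = 1" "im 1 = 0" "re (x + y) = re x + re y" "im (x + y) = im x + im y"
  "re (x - y) = re x - re y" "im (x - y) = im x - im y" "re (- x) = - re x" "im (- x) = - im x"
  "re (x * y) = re x * re y" "im (x * y) = re x * im y + im x * re y"
  by (simp_all add: zero_dual_def one_dual_def plus_dual_def minus_dual_def uminus_dual_def times_dual_def)

lemma dual_unit:
  assumes "re (x::'a::field dual) \<noteq> 0"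
  shows "Dual (1 / re x) (- im x / (re x)^2) * x = 1"
  using assms by (simp add: dual.expand times_dual_def one_dual_def power2_eq_square)
lemma re_nonzero_if_unit: "a * b = (1::'a::field dual) \<Longrightarrow> re a \<noteq> 0" "a * b = (1::'a dual) \<Longrightarrow> re b \<noteq> 0"
  by (metis dual_sel(3,11) mult_zero_left mult_zero_right zero_neq_one)+

interpretation re: comm_ring_hom "re :: 'a::comm_ring_1 dual \<Rightarrow> 'a" by unfold_locales auto

definition jet :: "'a::comm_ring_1 poly \<Rightarrow> 'a dual" where "jet p = Dual (coeff p 0) (coeff p 1)"
interpretation jet: comm_ring_hom "jet :: 'a::comm_ring_1 poly \<Rightarrow> 'a dual"
  by unfold_locales (auto simp: jet_def zero_dual_def one_dual_def plus_dual_def times_dual_def coeff_mult)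
interpretation const_dual: comm_ring_hom "\<lambda>a::'a::comm_ring_1. Dual a 0"
  by unfold_locales (auto simp: zero_dual_def one_dual_def plus_dual_def times_dual_def)

definition dual_vec :: "'a^4 \<Rightarrow> 'a^4 \<Rightarrow> 'a dual^4" where "dual_vec p w = (\<chi> i. Dual (p$i) (w$i))"
lemma dual_vec_nth [simp]: "dual_vec p w $ i = Dual (p$i) (w$i)" by (simp add: dual_vec_def)
abbreviation dual_form :: "'a::comm_ring_1 form4 \<Rightarrow> 'a dual form4" where "dual_form c \<equiv> (\<lambda>m. Dual (c m) 0)"

lemma map_coords_dual_simps [simp]: "map_coords jet (param_line p w) = dual_vec p w" "map_coords jet (const_vec p) = dual_vec p 0"
  "map_coords re (dual_vec p w) = p" "jet [:a:] = Dual a 0" "(\<lambda>a. re (Dual a b)) = (\<lambda>a. a)"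
  by (simp_all add: cart_eq jet_def)

lemma jet_eq: "jet p = Dual (poly p 0) (poly (pderiv p) (0::'a::idom))"
  by (simp add: jet_def poly_0_coeff_0 coeff_pderiv)

context
  fixes d :: nat and c :: "'a::idom form4"
  assumes homogeneous: "homogeneous d c"
begin

lemma form_at_dual: "form_at d (dual_form c) (dual_vec p w) = Dual (form_at d c p) (polar1 d c p w)"
  using jet.form_at_hom[of d "const_form c" "param_line p w"]
  by (simp add: jet_eq[of "form_at d _ _"] pderiv_form_along[OF homogeneous] poly_form_at poly_polar1)
lemma polar1_dual: "polar1 d (dual_form c) (dual_vec p w) (dual_vec v v') = Dual (polar1 d c p v) (polar2 d c p v w + polar1 d c p v')"
  using jet.polar1_hom[of d "const_form c" "param_line p w" "param_line v v'"]
  by (simp add: jet_eq[of "polar1 d _ _ _"] pderiv_polar1[OF homogeneous] poly_polar1 poly_polar2)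
lemma polar2_dual: "polar2 d (dual_form c) (dual_vec p w) (dual_vec v v') (dual_vec y y')
    = Dual (polar2 d c p v y) (polar3 d c p v y w + polar2 d c p v' y + polar2 d c p v y')"
  using jet.polar2_hom[of d "const_form c" "param_line p w" "param_line v v'" "param_line y y'"]
  by (simp add: jet_eq[of "polar2 d _ _ _ _"] pderiv_polar2[OF homogeneous] poly_polar2 poly_polar3)
lemma polar3_dual: "polar3 d (dual_form c) (dual_vec p w) (dual_vec v v') (dual_vec y y') (dual_vec t t')
    = Dual (polar3 d c p v y t) (polar4 d c p v y t w + polar3 d c p v' y t + polar3 d c p v y' t + polar3 d c p v y t')"
  using jet.polar3_hom[of d "const_form c" "param_line p w" "param_line v v'" "param_line y y'" "param_line t t'"]
  by (simp add: jet_eq[of "polar3 d _ _ _ _ _"] pderiv_polar3[OF homogeneous] poly_polar3 poly_polar4)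

end

lemma dual_form_representation:
  fixes \<phi> :: "'a::alg_closed_field form4"
  assumes "\<And>x. G x = form_at n \<phi> x" "\<And>t. poly P t = G (p + t *s w)"
  shows "form_at n (dual_form \<phi>) (dual_vec p w) = jet P"
proof -
  have "form_along n \<phi> p w = P" by (rule poly_ext) (simp add: poly_form_at assms)
  then show ?thesis using jet.form_at_hom[of n "const_form \<phi>" "param_line p w"] by simp
qed

section \<open>The flecnodal form along a line\<close>

context surface_line
begin

abbreviation dual_point where "dual_point z \<equiv> dual_vec (point z) (tangent_at z)"

lemmas dual_polars = form_at_dual[OF homogeneous] polar1_dual[OF homogeneous] polar2_dual[OF homogeneous] polar3_dual[OF homogeneous]

lemma polar4_fff_tangent: "polar4 d c (point z) f f f (tangent_at z)
    = poly grad2 z * poly (pderiv (pderiv (pderiv grad1))) z - poly grad1 z * poly (pderiv (pderiv (pderiv grad2))) z"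
proof -
  have "polar4 d c (point z) f f f (tangent_at z) = polar4 d c (point z) (tangent_at z) f f f"
    by (metis polar4_sym12 polar4_sym23 polar4_sym34)
  then show ?thesis unfolding pderiv3_grad by (simp add: tangent_vec_def polar4_diff1 polar4_scale1 poly_polar4)
qed

lemma line_direction_lift:
  assumes nonparabolic: "poly parabolic z \<noteq> 0"
  obtains \<eta> where "polar1 d c (point z) \<eta> = - poly parabolic z"
    "2 * polar2 d c (point z) f \<eta> = - poly (pderiv parabolic) z"
    "(polar4 d c (point z) f f f (tangent_at z) + 3 * polar3 d c (point z) f f \<eta>) * (2 * poly parabolic z)
      = poly (schwarzian grad1 grad2) z"
proof -
  define a0 b0 a1 b1 a2 b2 a3 b3 where vals: "a0 = poly grad1 z" "b0 = poly grad2 z"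
    "a1 = poly (pderiv grad1) z" "b1 = poly (pderiv grad2) z"
    "a2 = poly (pderiv (pderiv grad1)) z" "b2 = poly (pderiv (pderiv grad2)) z"
    "a3 = poly (pderiv (pderiv (pderiv grad1))) z" "b3 = poly (pderiv (pderiv (pderiv grad2))) z"
  define u0 u1 where u_defs: "u0 = b0 * a1 - a0 * b1" "u1 = b0 * a2 - a0 * b2"
  have u: "poly parabolic z = u0" "poly (pderiv parabolic) z = u1"
    unfolding parabolic_def pderiv_wronskian u_defs vals by (simp_all add: wronskian_def)
  have u2: "poly (pderiv (pderiv parabolic)) z = b0 * a3 - a0 * b3 + b1 * a2 - a1 * b2"
    unfolding parabolic_def pderiv_wronskian by (simp add: pderiv_diff pderiv_mult vals algebra_simps)
  define r where "r = u1 / (2 * u0)"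
  have r: "r * (2 * u0) = u1" unfolding r_def using nonparabolic u numerals_nonzero by simp
  define \<eta> where "\<eta> = (b1 - r * b0) *s g1 + (r * a0 - a1) *s g2"
  have polars: "polar1 d c (point z) \<eta> = - u0" "polar2 d c (point z) f \<eta> = - (r * u0)"
    "polar3 d c (point z) f f \<eta> = b1 * a2 - a1 * b2 - r * u1"
    unfolding \<eta>_def polar_linear by (simp_all add: polar1_point polar2_point polar3_point vals[symmetric] u_defs algebra_simps)
  have "poly (schwarzian grad1 grad2) z = 2 * u0 * (b0 * a3 - a0 * b3 + b1 * a2 - a1 * b2) + 4 * u0 * (b1 * a2 - a1 * b2) - 3 * u1^2"
    unfolding schwarzian_def parabolic_def[symmetric] wronskian2_def
    by (simp only: poly_diff poly_add poly_mult poly_power u u2 vals[symmetric]) simp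
  also have "\<dots> = (b0 * a3 - a0 * b3 + 3 * (b1 * a2 - a1 * b2)) * (2 * u0) - 3 * (r * (2 * u0)) * u1"
    unfolding r by (simp add: power2_eq_square algebra_simps)
  also have "\<dots> = (b0 * a3 - a0 * b3 + 3 * polar3 d c (point z) f f \<eta>) * (2 * u0)"
    unfolding polars by (simp add: algebra_simps)
  finally have "(polar4 d c (point z) f f f (tangent_at z) + 3 * polar3 d c (point z) f f \<eta>) * (2 * u0) = poly (schwarzian grad1 grad2) z"
    unfolding polar4_fff_tangent vals ..
  moreover have "2 * polar2 d c (point z) f \<eta> = - u1" unfolding polars r[symmetric] by simp
  ultimately show ?thesis using that polars(1) unfolding u by blast
qed

lemma asymptotic_lift:
  assumes nonparabolic: "poly parabolic z \<noteq> 0"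
  obtains y where "polar1 d c (point z) y = - polar2 d c (point z) (asymptotic_at z) w"
    "2 * polar2 d c (point z) (asymptotic_at z) y = - polar3 d c (point z) (asymptotic_at z) (asymptotic_at z) w"
proof -
  let ?v = "asymptotic_at z" and ?u = "2 * (poly parabolic z)^2"
  obtain g where g: "polar1 d c (point z) g \<noteq> 0" by (rule obtain_transversal)
  have u: "?u \<noteq> 0" using nonparabolic numerals_nonzero by simp
  define \<mu> where "\<mu> = - polar2 d c (point z) ?v w / polar1 d c (point z) g"
  define l where "l = - (polar3 d c (point z) ?v ?v w / 2 + \<mu> * polar2 d c (point z) ?v g) / ?u"
  define y where "y = l *s f + \<mu> *s g"
  have "polar1 d c (point z) y = - polar2 d c (point z) ?v w"
    unfolding y_def polar_linear polar1_point \<mu>_def using g by simp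
  moreover have "l * ?u = - (polar3 d c (point z) ?v ?v w / 2 + \<mu> * polar2 d c (point z) ?v g)"
    unfolding l_def using u by simp
  then have "polar2 d c (point z) ?v y = - (polar3 d c (point z) ?v ?v w / 2)"
    unfolding y_def polar_linear polar2_point by simp
  then have "2 * polar2 d c (point z) ?v y = - polar3 d c (point z) ?v ?v w" using numerals_nonzero by simp
  ultimately show ?thesis by (rule that)
qed

text \<open>Over the dual numbers, to first order in a tangent direction across the line, both asymptotic directions extend,
and the third polar in the direction of the line becomes a multiple of the Schwarzian.\<close>
lemma obtain_dual_frame:
  assumes nonparabolic: "poly parabolic z \<noteq> 0"
  obtains \<eta> y b h k s where
    "asymptotic_frame d (dual_form c) (dual_point z) b (dual_vec f \<eta>) (dual_vec (asymptotic_at z) y) h k"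
    "polar3 d (dual_form c) (dual_point z) (dual_vec f \<eta>) (dual_vec f \<eta>) (dual_vec f \<eta>) = Dual 0 s"
    "s * (2 * poly parabolic z) = poly (schwarzian grad1 grad2) z"
proof -
  let ?p = "point z" and ?v = "asymptotic_at z" and ?c = "dual_form c" and ?x = "dual_point z"
  obtain \<eta> where \<eta>: "polar1 d c ?p \<eta> = - poly parabolic z" "2 * polar2 d c ?p f \<eta> = - poly (pderiv parabolic) z"
    "(polar4 d c ?p f f f (tangent_at z) + 3 * polar3 d c ?p f f \<eta>) * (2 * poly parabolic z) = poly (schwarzian grad1 grad2) z"
    by (rule line_direction_lift[OF nonparabolic])
  obtain y where y: "polar1 d c ?p y = - polar2 d c ?p ?v (tangent_at z)" "2 * polar2 d c ?p ?v y = - polar3 d c ?p ?v ?v (tangent_at z)"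
    by (rule asymptotic_lift[OF nonparabolic])
  have on_surface: "form_at d ?c ?x = 0" unfolding dual_polars form_at_point polar1_point by simp
  have tangent: "polar1 d ?c ?x (dual_vec f \<eta>) = 0" "polar1 d ?c ?x (dual_vec ?v y) = 0"
    unfolding dual_polars polar1_point polar2_point \<eta> y by simp_all
  have double: "a + t + t = 0" if "2 * t = - a" for a t :: 'a
    using that by (metis add.assoc add.right_inverse mult_2)
  have asymptotic: "polar2 d ?c ?x (dual_vec f \<eta>) (dual_vec f \<eta>) = 0" "polar2 d ?c ?x (dual_vec ?v y) (dual_vec ?v y) = 0"
    unfolding dual_polars polar2_point polar3_point polar2_sym[of d c ?p \<eta> f] polar2_sym[of d c ?p y ?v]
    by (simp_all add: double[OF \<eta>(2)] double[OF y(2)])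
  have "re (polar2 d ?c ?x (dual_vec f \<eta>) (dual_vec ?v y)) \<noteq> 0"
    unfolding dual_polars polar2_point using nonparabolic numerals_nonzero by simp
  from dual_unit[OF this] obtain k where k: "k * polar2 d ?c ?x (dual_vec f \<eta>) (dual_vec ?v y) = 1" by blast
  obtain g where g: "polar1 d c ?p g \<noteq> 0" by (rule obtain_transversal)
  have "re (polar2 d ?c ?x ?x (dual_vec g 0)) \<noteq> 0"
    unfolding dual_polars polar2_point_point using g of_nat_nonzero[of "d-1"] degree_ge_3 by simp
  from dual_unit[OF this] obtain h where h: "h * polar2 d ?c ?x ?x (dual_vec g 0) = 1" by blast
  have half: "Dual (1/2) 0 * 2 = (1::'a dual)"
    using const_dual.hom_mult[of "1/2 :: 'a" 2] numerals_nonzero by (simp add: const_dual.hom_numeral)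
  obtain b where "asymptotic_frame d ?c ?x b (dual_vec f \<eta>) (dual_vec ?v y) h k"
    using asymptotic_frame_exists[OF const_dual.homogeneous_hom[OF homogeneous] on_surface tangent asymptotic k h half] by blast
  moreover have "polar3 d ?c ?x (dual_vec f \<eta>) (dual_vec f \<eta>) (dual_vec f \<eta>)
      = Dual 0 (polar4 d c ?p f f f (tangent_at z) + 3 * polar3 d c ?p f f \<eta>)"
    unfolding dual_polars polar3_point polar3_sym13[of d c ?p \<eta> f f] polar3_sym23[of d c ?p f \<eta> f]
    by (simp add: algebra_simps)
  ultimately show ?thesis using \<eta>(3) that by blast
qed

lemma flecnodal_dual:
  assumes nonparabolic: "poly parabolic z \<noteq> 0"
  obtains \<rho> where "\<rho> \<noteq> 0" "flecnodal d (dual_form c) (dual_point z) = Dual 0 (\<rho> * poly (schwarzian grad1 grad2) z * poly segre_poly z)"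
proof -
  obtain \<eta> y b h k s where
    "asymptotic_frame d (dual_form c) (dual_point z) b (dual_vec f \<eta>) (dual_vec (asymptotic_at z) y) h k"
    and line: "polar3 d (dual_form c) (dual_point z) (dual_vec f \<eta>) (dual_vec f \<eta>) (dual_vec f \<eta>) = Dual 0 s"
    and s: "s * (2 * poly parabolic z) = poly (schwarzian grad1 grad2) z"
    by (rule obtain_dual_frame[OF nonparabolic])
  then interpret frame: asymptotic_frame d "dual_form c" "dual_point z" b "dual_vec f \<eta>" "dual_vec (asymptotic_at z) y" h k by simp
  define \<rho> where "\<rho> = re (8 * (frame.H * k)^3)"
  have "\<rho> \<noteq> 0"
    using re_nonzero_if_unit(2)[OF frame.det_hessian_unit] re_nonzero_if_unit(1)[OF frame.k_inverse] numerals_nonzero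
    by (simp add: \<rho>_def power3_eq_cube re.hom_numeral)
  moreover have "flecnodal d (dual_form c) (dual_point z) = Dual 0 (\<rho> * s * (2 * poly parabolic z * poly segre_poly z))"
    unfolding frame.flecnodal_eq line \<rho>_def by (rule dual.expand) (simp add: dual_polars polar3_point mult.assoc)
  moreover have "\<rho> * s * (2 * poly parabolic z * poly segre_poly z) = \<rho> * poly (schwarzian grad1 grad2) z * poly segre_poly z"
    unfolding s[symmetric] by (simp add: algebra_simps)
  ultimately show ?thesis using that by metis
qed

lemma apolar_form_dual:
  assumes nonparabolic: "poly parabolic z \<noteq> 0" and "z \<noteq> 0" and g: "polar1 d c (point z) g \<noteq> 0"
  obtains \<rho> where "\<rho> \<noteq> 0"
    "apolar_form d (dual_form c) (dual_vec e 0) (dual_vec g 0) (dual_point z) = Dual 0 (\<rho> * poly (schwarzian grad1 grad2) z)"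
proof -
  obtain \<eta> y b h k s where
    "asymptotic_frame d (dual_form c) (dual_point z) b (dual_vec f \<eta>) (dual_vec (asymptotic_at z) y) h k"
    and line: "polar3 d (dual_form c) (dual_point z) (dual_vec f \<eta>) (dual_vec f \<eta>) (dual_vec f \<eta>) = Dual 0 s"
    and s: "s * (2 * poly parabolic z) = poly (schwarzian grad1 grad2) z"
    by (rule obtain_dual_frame[OF nonparabolic])
  then interpret frame: asymptotic_frame d "dual_form c" "dual_point z" b "dual_vec f \<eta>" "dual_vec (asymptotic_at z) y" h k by simp
  let ?D = "polar1 d (dual_form c) (dual_point z)"
  define v where "v = ?D (dual_vec g 0) *s dual_vec e 0 - ?D (dual_vec e 0) *s dual_vec g 0"
  have tangent: "?D v = 0" unfolding v_def polar_linear by (simp add: mult.commute)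
  obtain \<alpha> \<beta> \<pi> where coords: "\<alpha> = k * polar2 d (dual_form c) (dual_point z) (dual_vec (asymptotic_at z) y) v"
    "\<beta> = k * polar2 d (dual_form c) (dual_point z) (dual_vec f \<eta>) v"
    and v: "v = \<alpha> *s dual_vec f \<eta> + \<beta> *s dual_vec (asymptotic_at z) y + \<pi> *s dual_point z"
    using frame.tangent_decomposition[OF tangent] by blast
  have "map_coords re v = polar1 d c (point z) g *s e" by (simp add: v_def cart_eq dual_polars polar1_point)
  then have re_polar2: "re (polar2 d (dual_form c) (dual_point z) (dual_vec p p') v) = polar1 d c (point z) g * polar2 d c (point z) p e" for p p'
    using re.polar2_hom[of d "dual_form c" "dual_point z" "dual_vec p p'" v] by (simp add: polar_linear)
  have polar2_e: "polar2 d c (point z) p e = of_nat (d-1) * polar1 d c (point z) p - z * polar2 d c (point z) p f" for p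
    using euler2(1)[OF homogeneous, of "point z" p] by (simp add: polar2_add2 polar2_scale2 algebra_simps)
  have "re \<beta> = 0" unfolding coords by (simp add: re_polar2 polar2_e polar1_point polar2_point)
  then have \<beta>_cube: "\<beta>^3 = 0" by (simp add: power3_eq_cube dual.expand)
  have re_\<alpha>: "re \<alpha> \<noteq> 0"
    unfolding coords using re_nonzero_if_unit(1)[OF frame.k_inverse] g \<open>z \<noteq> 0\<close> nonparabolic numerals_nonzero
    by (simp add: re_polar2 polar2_e polar1_point polar2_point)
  define \<rho> where "\<rho> = re (4 * frame.H * \<alpha>^3)"
  have "\<rho> \<noteq> 0"
    using re_nonzero_if_unit(2)[OF frame.det_hessian_unit] re_\<alpha> numerals_nonzero
    by (simp add: \<rho>_def power3_eq_cube re.hom_numeral)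
  moreover have "apolar_form d (dual_form c) (dual_vec e 0) (dual_vec g 0) (dual_point z) = Dual 0 (\<rho> * s)"
    unfolding apolar_form_def v_def[symmetric] frame.apolar_cubic_eq[OF v] \<beta>_cube line \<rho>_def
    by (rule dual.expand) (simp add: mult.assoc)
  moreover have "\<rho> * s = \<rho> / (2 * poly parabolic z) * poly (schwarzian grad1 grad2) z"
    unfolding s[symmetric] using nonparabolic numerals_nonzero by simp
  ultimately show ?thesis using that[of "\<rho> / (2 * poly parabolic z)"] nonparabolic numerals_nonzero by simp
qed

lemma flecnodal_eq_0_if_nonparabolic: "poly parabolic z \<noteq> 0 \<Longrightarrow> flecnodal d c (point z) = 0"
  using obtain_asymptotic_frame asymptotic_frame.flecnodal_eq polar3_point(1) by (metis mult_zero_left mult_zero_right)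

lemma apolar_cubic_eq_0_if_nonparabolic:
  assumes "segre_poly = 0" "poly parabolic z \<noteq> 0" "polar1 d c (point z) v = 0"
  shows "apolar_cubic d c (point z) v = 0"
proof -
  obtain b h k where "asymptotic_frame d c (point z) b f (asymptotic_at z) h k"
    using assms(2) by (rule obtain_asymptotic_frame)
  then interpret frame: asymptotic_frame d c "point z" b f "asymptotic_at z" h k .
  show ?thesis
    unfolding frame.apolar_cubic_eq[OF frame.tangent_decomposition[OF assms(3)]] polar3_point assms(1) by simp
qed

lemma form_eq_0_on_line:
  assumes "\<And>z. poly parabolic z \<noteq> 0 \<Longrightarrow> form_at n \<phi> (point z) = 0" "x \<in> span2 e f"
  shows "form_at n \<phi> x = 0"
proof -
  have "form_along n \<phi> e f = 0"
    by (rule form_along_eq_0I[OF poly_roots_finite[OF parabolic_nonzero]]) (use assms(1) in simp)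
  then show ?thesis using assms(2) by (auto elim!: span2E intro: form_at_eq_0_if_form_along_eq_0)
qed

lemma polar1_tangent_flecnodal:
  assumes "homogeneous n \<phi>" "\<And>x. flecnodal d c x = form_at n \<phi> x" "poly parabolic z \<noteq> 0"
  obtains \<rho> where "\<rho> \<noteq> 0"
    "polar1 n \<phi> (point z) (tangent_at z) = \<rho> * poly (schwarzian grad1 grad2) z * poly segre_poly z"
proof -
  let ?X = "param_line (point z) (tangent_at z)"
  have "poly (flecnodal d (const_form c) ?X) t = flecnodal d c (point z + t *s tangent_at z)" for t
    by (simp add: poly_hom.flecnodal_hom)
  from dual_form_representation[OF assms(2) this]
  have "form_at n (dual_form \<phi>) (dual_point z) = flecnodal d (dual_form c) (dual_point z)"
    by (simp add: jet.flecnodal_hom)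
  then show ?thesis using flecnodal_dual[OF assms(3)] that unfolding form_at_dual[OF assms(1)] by (metis dual.inject)
qed

lemma polar1_tangent_apolar_form:
  assumes "homogeneous n \<psi>" "\<And>x. apolar_form d c e g x = form_at n \<psi> x"
    "poly parabolic z \<noteq> 0" "z \<noteq> 0" "polar1 d c (point z) g \<noteq> 0"
  obtains \<rho> where "\<rho> \<noteq> 0" "polar1 n \<psi> (point z) (tangent_at z) = \<rho> * poly (schwarzian grad1 grad2) z"
proof -
  let ?X = "param_line (point z) (tangent_at z)"
  have "poly (apolar_form d (const_form c) (const_vec e) (const_vec g) ?X) t = apolar_form d c e g (point z + t *s tangent_at z)" for t
    by (simp add: poly_hom.apolar_form_hom)
  from dual_form_representation[OF assms(2) this]
  have "form_at n (dual_form \<psi>) (dual_point z) = apolar_form d (dual_form c) (dual_vec e 0) (dual_vec g 0) (dual_point z)"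
    by (simp add: jet.apolar_form_hom)
  then show ?thesis using apolar_form_dual[OF assms(3-5)] that unfolding form_at_dual[OF assms(1)] by (metis dual.inject)
qed

end

definition finite_on_line :: "('a::field^4) set \<Rightarrow> ('a^4) set \<Rightarrow> bool" where
  "finite_on_line L X \<longleftrightarrow> (\<forall>a b. indep2 a b \<and> L = span2 a b \<longrightarrow> finite {t. a + t *s b \<in> X})"
definition tangential_along :: "nat \<Rightarrow> 'a::field form4 \<Rightarrow> nat \<Rightarrow> 'a form4 \<Rightarrow> ('a^4) set \<Rightarrow> bool" where
  "tangential_along d c n \<phi> L \<longleftrightarrow> finite_on_line L {p. \<exists>w. polar1 d c p w = 0 \<and> polar1 n \<phi> p w \<noteq> 0}"

lemma (in surface_line) not_tangential_alongI:
  assumes "P \<noteq> 0" "\<And>z. poly P z \<noteq> 0 \<Longrightarrow> polar1 n \<phi> (point z) (tangent_at z) \<noteq> 0"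
  shows "\<not> tangential_along d c n \<phi> (span2 e f)"
proof
  assume "tangential_along d c n \<phi> (span2 e f)"
  then have "finite {t. \<exists>w. polar1 d c (point t) w = 0 \<and> polar1 n \<phi> (point t) w \<noteq> 0}"
    using line_indep2 unfolding tangential_along_def finite_on_line_def mem_Collect_eq by blast
  then obtain z where "poly P z \<noteq> 0" "\<not> (\<exists>w. polar1 d c (point z) w = 0 \<and> polar1 n \<phi> (point z) w \<noteq> 0)"
    using obtain_nonroot[OF assms(1)] by blast
  then show False using assms(2) polar1_point(3) by blast
qed

context surface
begin

lemma polar2_at_0: "polar2 d c 0 v w = 0"
  using polar2_scale_point[of d c 0 0 v w] degree_ge_3 by (simp add: power_0_left)

lemma obtain_chart_if_not_second_kind:
  assumes L: "L \<in> lines_in d c" and "\<not> second_kind d c L"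
  obtains e f g1 g2 where "surface_line d c e f g1 g2" "L = span2 e f" "surface_line.segre_poly d c e f g1 g2 \<noteq> 0"
proof -
  obtain p y v where p: "p \<in> L" and y: "y \<in> L" and polars: "polar1 d c p v = 0" "polar2 d c p v v = 0"
    "polar2 d c p y v \<noteq> 0" "polar3 d c p v v v \<noteq> 0"
    using assms(2) unfolding second_kind_def by blast
  then have "p \<noteq> 0" using polar2_at_0 by auto
  then obtain f g1 g2 where line: "surface_line d c p f g1 g2" and span: "L = span2 p f"
    using obtain_line_chart_at[OF L p] by blast
  then interpret surface_line d c p f g1 g2 by simp
  have "segre_poly \<noteq> 0" by (rule segre_poly_nonzero[of y 0 v]) (use y span polars in simp_all)
  then show ?thesis using that line span by blast
qed

theorem apolar_form_eq_0_on_second_kind: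
  assumes "\<And>x. apolar_form d c a g x = form_at n \<psi> x" and L: "L \<in> lines_in d c" "second_kind d c L" "x \<in> L"
  shows "form_at n \<psi> x = 0"
proof -
  obtain e f g1 g2 where "surface_line d c e f g1 g2" and span: "L = span2 e f" using L(1) by (rule obtain_line_chart)
  then interpret surface_line d c e f g1 g2 by simp
  have segre_0: "segre_poly = 0" using segre_poly_eq_0_if_second_kind L(2) span by simp
  show ?thesis
  proof (rule form_eq_0_on_line)
    fix z assume "poly parabolic z \<noteq> 0"
    from apolar_cubic_eq_0_if_nonparabolic[OF segre_0 this] show "form_at n \<psi> (point z) = 0"
      unfolding assms(1)[symmetric] apolar_form_def by (simp add: polar1_diff polar1_scale mult.commute)
  qed (use L(3) span in simp)
qed

theorem apolar_form_not_tangential_along: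
  assumes "L \<in> lines_in d c"
  obtains e g where "\<And>n \<psi>. homogeneous n \<psi> \<Longrightarrow> (\<And>x. apolar_form d c e g x = form_at n \<psi> x) \<Longrightarrow> \<not> tangential_along d c n \<psi> L"
proof -
  obtain e f g1 g2 where "surface_line d c e f g1 g2" and span: "L = span2 e f" using assms by (rule obtain_line_chart)
  then interpret surface_line d c e f g1 g2 by simp
  obtain g where "polar1 d c (point 0) g \<noteq> 0" by (rule obtain_transversal)
  then have "poly (polar1_along d c e f g) 0 \<noteq> 0" by (simp add: poly_polar1)
  then have g: "polar1_along d c e f g \<noteq> 0" by auto
  have "\<not> tangential_along d c n \<psi> L" if "homogeneous n \<psi>" "\<And>x. apolar_form d c e g x = form_at n \<psi> x" for n \<psi>
    unfolding span
  proof (rule not_tangential_alongI)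
    show "[:0,1:] * parabolic * schwarzian grad1 grad2 * polar1_along d c e f g \<noteq> 0"
      using parabolic_nonzero schwarzian_grad_nonzero g by simp
    fix z assume z: "poly ([:0,1:] * parabolic * schwarzian grad1 grad2 * polar1_along d c e f g) z \<noteq> 0"
    then have "poly parabolic z \<noteq> 0" "z \<noteq> 0" "polar1 d c (point z) g \<noteq> 0" by (auto simp: poly_polar1)
    from polar1_tangent_apolar_form[OF that this]
    obtain \<rho> where "\<rho> \<noteq> 0" "polar1 n \<psi> (point z) (tangent_at z) = \<rho> * poly (schwarzian grad1 grad2) z" .
    then show "polar1 n \<psi> (point z) (tangent_at z) \<noteq> 0" using z by simp
  qed
  then show ?thesis by (rule that)
qed

end

locale flecnodal_surface = surface d c for d :: nat and c :: "'a::alg_closed_field form4" +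
  fixes n :: nat and \<phi> :: "'a form4"
  assumes homogeneous_flecnodal: "homogeneous n \<phi>" and flecnodal: "\<And>x. flecnodal d c x = form_at n \<phi> x"
    and degree_flecnodal: "n = 11 * d - 24"
begin

lemma flecnodal_zero_on_lines:
  assumes "L \<in> lines_in d c" "x \<in> L"
  shows "form_at n \<phi> x = 0"
proof -
  obtain e f g1 g2 where "surface_line d c e f g1 g2" and span: "L = span2 e f" using assms(1) by (rule obtain_line_chart)
  then interpret surface_line d c e f g1 g2 by simp
  show ?thesis
    by (rule form_eq_0_on_line) (use flecnodal_eq_0_if_nonparabolic assms(2) span flecnodal in auto)
qed

lemma tangential_along_if_second_kind:
  assumes "L \<in> lines_in d c" "second_kind d c L"
  shows "tangential_along d c n \<phi> L"
  unfolding tangential_along_def finite_on_line_def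
proof (intro allI impI)
  fix e f assume chart: "indep2 e f \<and> L = span2 e f"
  then obtain g1 g2 where "surface_line d c e f g1 g2" using line_chart assms(1) by blast
  then interpret surface_line d c e f g1 g2 .
  have segre_0: "segre_poly = 0" using segre_poly_eq_0_if_second_kind assms(2) chart by simp
  have "polar1 n \<phi> (point z) w = 0" if z: "poly parabolic z \<noteq> 0" and tangent: "polar1 d c (point z) w = 0" for z w
  proof -
    obtain a b l where w: "w = a *s e + b *s f + l *s tangent_at z" using tangent by (rule obtain_tangent_coords)
    have "form_at n \<phi> (s *s e + t *s f) = 0" for s t
      using flecnodal_zero_on_lines[OF assms(1)] chart span2I by blast
    note along = polar1_along_line_in_zero_set[OF homogeneous_flecnodal this]
    have "polar1 n \<phi> (point z) (tangent_at z) = 0"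
      using polar1_tangent_flecnodal[OF homogeneous_flecnodal flecnodal z] segre_0 by (metis mult_zero_right poly_0)
    then show ?thesis unfolding w polar_linear by (simp add: along)
  qed
  then have "{t. point t \<in> {p. \<exists>w. polar1 d c p w = 0 \<and> polar1 n \<phi> p w \<noteq> 0}} \<subseteq> {t. poly parabolic t = 0}" by blast
  then show "finite {t. point t \<in> {p. \<exists>w. polar1 d c p w = 0 \<and> polar1 n \<phi> p w \<noteq> 0}}"
    using poly_roots_finite[OF parabolic_nonzero] finite_subset by blast
qed

lemma not_tangential_along_if_first_kind:
  assumes "L \<in> lines_in d c" "\<not> second_kind d c L"
  shows "\<not> tangential_along d c n \<phi> L"
proof -
  obtain e f g1 g2 where "surface_line d c e f g1 g2" and span: "L = span2 e f"
    and segre: "surface_line.segre_poly d c e f g1 g2 \<noteq> 0"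
    using assms by (rule obtain_chart_if_not_second_kind)
  then interpret surface_line d c e f g1 g2 by simp
  show ?thesis
    unfolding span
  proof (rule not_tangential_alongI)
    show "parabolic * schwarzian grad1 grad2 * segre_poly \<noteq> 0"
      using parabolic_nonzero schwarzian_grad_nonzero segre by simp
    fix z assume z: "poly (parabolic * schwarzian grad1 grad2 * segre_poly) z \<noteq> 0"
    then have "poly parabolic z \<noteq> 0" by simp
    from polar1_tangent_flecnodal[OF homogeneous_flecnodal flecnodal this]
    obtain \<rho> where "\<rho> \<noteq> 0" "polar1 n \<phi> (point z) (tangent_at z) = \<rho> * poly (schwarzian grad1 grad2) z * poly segre_poly z" .
    then show "polar1 n \<phi> (point z) (tangent_at z) \<noteq> 0" using z by simp
  qed
qed

end

section \<open>Segre's bound on the lines meeting a line of the first kind\<close>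

lemma top_coeff_polar2:
  assumes "\<And>i. top_coeff k (U$i) (u$i)" "\<And>i. top_coeff l (V$i) (v$i)"
  shows "top_coeff (k + l + (d - 2)) (polar2 d (const_form c) (param_line e f) U V) (polar2 d c f u v)"
  unfolding polar2_expand partial_const_form by (intro top_coeff_sum top_coeff_mult assms top_coeff_form_along)
lemma top_coeff_polar3:
  assumes "\<And>i. top_coeff k (U$i) (u$i)" "\<And>i. top_coeff l (V$i) (v$i)" "\<And>i. top_coeff m (W$i) (w$i)"
  shows "top_coeff (k + l + m + (d - 3)) (polar3 d (const_form c) (param_line e f) U V W) (polar3 d c f u v w)"
  unfolding polar3_expand partial_const_form by (intro top_coeff_sum top_coeff_mult assms top_coeff_form_along)

lemma (in surface_line) degree_segre_poly: "degree segre_poly \<le> 8 * d - 14"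
proof -
  define \<tau> where "\<tau> = polar1 d c f g2 *s g1 - polar1 d c f g1 *s g2"
  define w where "w = polar2 d c f \<tau> \<tau>"
  have top_f: "top_coeff 0 (const_vec f $ i) (f$i)" for i by (simp add: top_coeff_const)
  have "top_coeff (d-1+0) (grad2 * [:g1$i:] - grad1 * [:g2$i:]) (polar1 d c f g2 * g1$i - polar1 d c f g1 * g2$i)" for i
    by (intro top_coeff_diff top_coeff_mult top_coeff_grad top_coeff_const)
  then have top_tangent: "top_coeff (d-1) (tangent_vec $ i) (\<tau>$i)" for i by (simp add: tangent_vec_def \<tau>_def)
  have "polar2 d c f f \<tau> = 0" by (simp add: euler2[OF homogeneous] \<tau>_def polar_linear)
  moreover have exponent: "0 + (d-1) + (d-2) = Suc (2*d-4)" using degree_ge_3 by simp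
  ultimately have "top_coeff (Suc (2*d-4)) parabolic 0"
    using top_coeff_polar2[OF top_f top_tangent, of d c e f] unfolding line_polar2_f_tangent exponent by simp
  then obtain U where U: "top_coeff (2*d-4) parabolic U" using top_coeff_Suc_0 by blast
  then have U': "top_coeff (2*d-5) (pderiv parabolic) (of_nat (2*d-4) * U)"
    using top_coeff_pderiv[OF U] degree_ge_3 by (simp add: numeral_eq_Suc)
  have exponents: "d-1+(d-1)+(d-2) = 3*d-4" "d-1+(d-1)+0+(d-3) = 3*d-5" "d-1+(d-1)+(d-1)+(d-3) = 4*d-6"
    using degree_ge_3 by simp_all
  have top_polar2: "top_coeff (3*d-4) tangent_polar2 w"
    using top_coeff_polar2[OF top_tangent top_tangent, of d c e f] unfolding exponents tangent_polar2_def w_def .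
  have top_polar3_f: "top_coeff (3*d-5) (line_polar3 tangent_vec tangent_vec (const_vec f)) (of_nat (d-2) * w)"
    using top_coeff_polar3[OF top_tangent top_tangent top_f, of d c e f] unfolding exponents w_def euler3[OF homogeneous] .
  obtain s where top_polar3: "top_coeff (4*d-6) (line_polar3 tangent_vec tangent_vec tangent_vec) s"
    using top_coeff_polar3[OF top_tangent top_tangent top_tangent, of d c e f] unfolding exponents by blast
  have "top_coeff (0 + ((3*d-4) + (3*d-4)) + (2*d-5)) (3 * (tangent_polar2 * tangent_polar2) * pderiv parabolic)
      (3 * (w * w) * (of_nat (2*d-4) * U))"
    by (intro top_coeff_mult top_coeff_numeral top_polar2 U')
  moreover have "top_coeff (0 + (2*d-4) + (3*d-4) + (3*d-5)) (6 * parabolic * tangent_polar2 * line_polar3 tangent_vec tangent_vec (const_vec f))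
      (6 * U * w * (of_nat (d-2) * w))"
    by (intro top_coeff_mult top_coeff_numeral top_polar2 U top_polar3_f)
  moreover have "top_coeff (8*d-13) (4 * (parabolic * parabolic) * line_polar3 tangent_vec tangent_vec tangent_vec) 0"
    by (rule top_coeff_0_if_less[OF top_coeff_mult[OF top_coeff_mult[OF top_coeff_numeral top_coeff_mult[OF U U]] top_polar3]])
      (use degree_ge_3 in simp)
  moreover have "0 + ((3*d-4) + (3*d-4)) + (2*d-5) = 8*d-13" "0 + (2*d-4) + (3*d-4) + (3*d-5) = 8*d-13" using degree_ge_3 by auto
  ultimately have "top_coeff (8*d-13) segre_poly (3 * (w * w) * (of_nat (2*d-4) * U) - 6 * U * w * (of_nat (d-2) * w) + 0)"
    unfolding segre_poly_def power2_eq_square by (intro top_coeff_add top_coeff_diff) simp_all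
  moreover have "(of_nat (2*d-4) :: 'a) = 2 * of_nat (d-2)" using degree_ge_3 by (simp add: of_nat_diff algebra_simps)
  moreover have "8*d-13 = Suc (8*d-14)" using degree_ge_3 by simp
  ultimately have "top_coeff (Suc (8*d-14)) segre_poly 0" by (simp add: algebra_simps)
  then show ?thesis using top_coeff_Suc_0 unfolding top_coeff_def by metis
qed

lemma coeff_poly_at_linear:
  fixes t :: "'a::comm_ring_1"
  shows "coeff (poly P [:0,t:]) M = (\<Sum>j\<le>M. coeff (coeff P j) (M - j) * t^j)"
proof (induction P arbitrary: M)
  case (pCons q P)
  show ?case
  proof (cases M)
    case (Suc m)
    then have "coeff (poly (pCons q P) [:0,t:]) M = coeff q (Suc m) + t * (\<Sum>j\<le>m. coeff (coeff P j) (m - j) * t^j)"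
      by (simp add: pCons.IH)
    then show ?thesis unfolding Suc by (simp add: sum.atMost_Suc_shift sum_distrib_left mult_ac del: sum.atMost_Suc)
  qed simp
qed simp

lemma homogeneous_part_eq_0_on_line:
  fixes P :: "'a::alg_closed_field poly poly"
  assumes "\<And>r. poly (poly P [:r:]) (\<alpha> * r) = 0"
  shows "(\<Sum>j\<le>M. coeff (coeff P j) (M - j) * \<alpha>^(M - j)) = 0"
proof -
  let ?R = "map_poly (\<lambda>q. q \<circ>\<^sub>p [:0,\<alpha>:]) P"
  have "poly (poly ?R [:0,1:]) r = poly (poly P [:r:]) (\<alpha> * r)" for r
    by (induction P) (simp_all add: map_poly_pCons poly_pcompose mult.commute)
  then have "poly ?R [:0,1:] = 0" using assms by (intro poly_eq_0I) simp
  then show ?thesis using coeff_poly_at_linear[of ?R 1 M] by (simp add: coeff_map_poly coeff_pcompose_linear mult.commute)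
qed

lemma coeff_eq_0_if_zero_on_lines:
  fixes P :: "'a::alg_closed_field poly poly"
  assumes "finite S" "coeff P 0 = 0" "\<And>\<alpha> r. \<alpha> \<in> S \<Longrightarrow> poly (poly P [:r:]) (\<alpha> * r) = 0" "1 \<le> j" "i + j \<le> card S"
  shows "coeff (coeff P j) i = 0"
proof -
  define M where "M = i + j"
  define h where "h = (\<Sum>n\<le>M. monom (coeff (coeff P (M - n)) n) n)"
  have coeff_h: "coeff h n = (if n \<le> M then coeff (coeff P (M - n)) n else 0)" for n
    unfolding h_def coeff_sum by simp
  have roots: "S \<subseteq> {\<alpha>. poly h \<alpha> = 0}"
  proof
    fix \<alpha> assume "\<alpha> \<in> S"
    have "poly h \<alpha> = (\<Sum>j\<le>M. coeff (coeff P j) (M - j) * \<alpha>^(M - j))"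
      unfolding h_def poly_sum poly_monom
      by (rule sum.reindex_bij_witness[of _ "\<lambda>j. M - j" "\<lambda>n. M - n"]) auto
    then show "\<alpha> \<in> {\<alpha>. poly h \<alpha> = 0}" using homogeneous_part_eq_0_on_line[OF assms(3)[OF \<open>\<alpha> \<in> S\<close>]] by simp
  qed
  have "h = 0"
  proof (rule ccontr)
    assume "h \<noteq> 0"
    have "M \<le> degree h"
      using card_mono[OF poly_roots_finite[OF \<open>h \<noteq> 0\<close>] roots] card_poly_roots_bound[OF \<open>h \<noteq> 0\<close>] assms(5) unfolding M_def by linarith
    then have "coeff h (degree h) = 0" using coeff_h assms(2) by simp
    then show False using \<open>h \<noteq> 0\<close> by simp
  qed
  then show ?thesis using coeff_h[of i] unfolding M_def by simp
qed

context surface_line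
begin

context
  fixes z :: 'a and S :: "'a set"
  assumes grad2: "poly grad2 z \<noteq> 0" and finite: "finite S"
    and lines: "\<And>\<alpha> t. \<alpha> \<in> S \<Longrightarrow> form_at d c (point z + t *s (\<alpha> *s f + tangent_at z)) = 0"
begin

lemma linear_power_dvd_polars:
  defines "\<tau> \<equiv> const_vec (tangent_at z)"
  shows "[:-z,1:]^card S dvd line_polar1 \<tau>" "[:-z,1:]^(card S - 1) dvd line_polar2 \<tau> \<tau>"
    "[:-z,1:]^(card S - 2) dvd line_polar3 \<tau> \<tau> \<tau>"
proof -
  let ?Y = "param_line (point z) f"
  define P where "P = form_along d (const_form c) ?Y \<tau>"
  note homogeneous_const = homogeneous_const_form[OF homogeneous]
  note coeffs = coeff_form_along_0[OF homogeneous_const, of ?Y \<tau>] coeff_form_along_1[OF homogeneous_const, of ?Y \<tau>]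
    coeff_form_along_2[OF homogeneous_const, of ?Y \<tau>] coeff_form_along_3[OF homogeneous_const, of ?Y \<tau>]
  have on_line: "form_at d c (point z + s *s f) = 0" for s
    using form_at_point(1)[of "z + s"] by (simp add: add.assoc vector_sadd_rdistrib)
  have "coeff P 0 = 0"
    unfolding P_def coeffs by (rule poly_eq_0I) (simp add: poly_form_at on_line)
  moreover have "poly (poly P [:r:]) (\<alpha> * r) = 0" if "\<alpha> \<in> S" for \<alpha> r
    using lines[OF that, of r] by (simp add: P_def \<tau>_def poly_form_at algebra_simps vec.scale_right_distrib)
  ultimately have zero: "coeff (coeff P j) i = 0" if "1 \<le> j" "i + j \<le> card S" for i j
    using coeff_eq_0_if_zero_on_lines[OF finite] that by blast
  have shift: "point z + s *s f = point (z + s)" for s by (simp add: cart_eq algebra_simps)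
  have "coeff P 1 = line_polar1 \<tau> \<circ>\<^sub>p [:z,1:]"
    unfolding P_def coeffs by (rule poly_ext) (simp add: \<tau>_def poly_polar1 poly_pcompose shift)
  then have "coeff (line_polar1 \<tau> \<circ>\<^sub>p [:z,1:]) i = 0" if "i < card S" for i using zero[of 1 i] that by simp
  then show "[:-z,1:]^card S dvd line_polar1 \<tau>" by (rule linear_power_dvd_if_pcompose_coeffs_0)
  have "2 * coeff P 2 = line_polar2 \<tau> \<tau> \<circ>\<^sub>p [:z,1:]"
    unfolding P_def coeffs by (rule poly_ext) (simp add: \<tau>_def poly_polar2 poly_pcompose shift)
  from this[symmetric] have "coeff (line_polar2 \<tau> \<tau> \<circ>\<^sub>p [:z,1:]) i = 0" if "i < card S - 1" for i
    using zero[of 2 i] that by (simp add: numeral_poly)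
  then show "[:-z,1:]^(card S - 1) dvd line_polar2 \<tau> \<tau>" by (rule linear_power_dvd_if_pcompose_coeffs_0)
  have "6 * coeff P 3 = line_polar3 \<tau> \<tau> \<tau> \<circ>\<^sub>p [:z,1:]"
    unfolding P_def coeffs by (rule poly_ext) (simp add: \<tau>_def poly_polar3 poly_pcompose shift)
  from this[symmetric] have "coeff (line_polar3 \<tau> \<tau> \<tau> \<circ>\<^sub>p [:z,1:]) i = 0" if "i < card S - 2" for i
    using zero[of 3 i] that by (simp add: numeral_poly)
  then show "[:-z,1:]^(card S - 2) dvd line_polar3 \<tau> \<tau> \<tau>" by (rule linear_power_dvd_if_pcompose_coeffs_0)
qed

lemma obtain_tangent_vec_decomposition:
  obtains \<beta> \<gamma> where "tangent_vec = \<beta> *s const_vec (tangent_at z) - \<gamma> *s const_vec g2" "[:-z,1:]^card S dvd \<gamma>"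
proof -
  let ?\<tau> = "const_vec (tangent_at z)" and ?b = "poly grad2 z"
  define \<beta> \<gamma> where "\<beta> = smult (1/?b) grad2" and "\<gamma> = smult (1/?b) (line_polar1 ?\<tau>)"
  have "line_polar1 ?\<tau> = smult ?b grad1 - smult (poly grad1 z) grad2"
    by (rule poly_ext) (simp add: poly_polar1 tangent_vec_def polar_linear polar1_point)
  then have grads: "grad1 = smult (poly grad1 z) \<beta> + \<gamma>" "grad2 = smult ?b \<beta>"
    unfolding \<beta>_def \<gamma>_def using grad2 by (simp_all add: smult_diff_right)
  have "tangent_vec = smult ?b \<beta> *s const_vec g1 - (smult (poly grad1 z) \<beta> + \<gamma>) *s const_vec g2"
    unfolding tangent_vec_def using grads by simp
  also have "\<dots> = \<beta> *s ?\<tau> - \<gamma> *s const_vec g2"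
    by (simp add: cart_eq tangent_vec_def algebra_simps smult_diff_left)
  finally show ?thesis using that linear_power_dvd_polars(1) by (simp add: \<gamma>_def dvd_smult)
qed

lemma linear_power_dvd_tangent_polars:
  shows "[:-z,1:]^(card S - 1) dvd parabolic" "[:-z,1:]^(card S - 2) dvd pderiv parabolic"
    "[:-z,1:]^(card S - 1) dvd tangent_polar2" "[:-z,1:]^(card S - 2) dvd line_polar3 tangent_vec tangent_vec (const_vec f)"
    "[:-z,1:]^(card S - 2) dvd line_polar3 tangent_vec tangent_vec tangent_vec"
proof -
  let ?g = "const_vec g2" and ?f = "const_vec f"
  define \<tau> where "\<tau> = const_vec (tangent_at z)"
  obtain \<beta> \<gamma> where tangent: "tangent_vec = \<beta> *s \<tau> - \<gamma> *s ?g" and \<gamma>: "[:-z,1:]^card S dvd \<gamma>"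
    using obtain_tangent_vec_decomposition unfolding \<tau>_def by metis
  have pderiv_\<tau>: "pderiv (line_polar1 \<tau>) = line_polar2 \<tau> ?f" "pderiv (line_polar2 \<tau> \<tau>) = line_polar3 \<tau> \<tau> ?f"
    unfolding \<tau>_def by (rule pderiv_polar1_along[OF homogeneous] pderiv_polar2_along[OF homogeneous])+
  note polars = linear_power_dvd_polars[folded \<tau>_def]
  have dvd_\<gamma>: "[:-z,1:]^i dvd \<gamma>" if "i \<le> card S" for i using \<gamma> that by (meson dvd_trans le_imp_power_dvd)
  have dvd_pderiv: "[:-z,1:]^(i - 1) dvd pderiv Q" if "[:-z,1:]^i dvd Q" for i Q
    using linear_power_dvd_pderiv[of z "i - 1" Q] that by (cases i) auto
  have "parabolic = \<beta> * pderiv (line_polar1 \<tau>) - \<gamma> * line_polar2 ?g ?f"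
    unfolding line_polar2_f_tangent(2)[symmetric] tangent polar_linear pderiv_\<tau> ..
  then show parabolic: "[:-z,1:]^(card S - 1) dvd parabolic"
    using dvd_pderiv[OF polars(1)] dvd_\<gamma>[of "card S - 1"] by (simp add: dvd_diff)
  show "[:-z,1:]^(card S - 2) dvd pderiv parabolic" using dvd_pderiv[OF parabolic] by (simp add: numeral_2_eq_2)
  have "tangent_polar2 = \<beta> * \<beta> * line_polar2 \<tau> \<tau> - \<gamma> * (2 * \<beta> * line_polar2 \<tau> ?g - \<gamma> * line_polar2 ?g ?g)"
    unfolding tangent_polar2_def tangent polar_linear polar2_sym[of d "const_form c" _ ?g \<tau>] by (simp add: algebra_simps)
  then show "[:-z,1:]^(card S - 1) dvd tangent_polar2"
    using polars(2) dvd_\<gamma>[of "card S - 1"] by (simp add: dvd_diff)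
  have "line_polar3 tangent_vec tangent_vec ?f = \<beta> * \<beta> * pderiv (line_polar2 \<tau> \<tau>)
      - \<gamma> * (2 * \<beta> * line_polar3 \<tau> ?g ?f - \<gamma> * line_polar3 ?g ?g ?f)"
    unfolding tangent polar_linear pderiv_\<tau> polar3_sym12[of d "const_form c" _ ?g \<tau>]
    by (simp add: algebra_simps)
  then show "[:-z,1:]^(card S - 2) dvd line_polar3 tangent_vec tangent_vec ?f"
    using dvd_pderiv[OF polars(2)] dvd_\<gamma>[of "card S - 2"] by (simp add: dvd_diff numeral_2_eq_2)
  have "line_polar3 tangent_vec tangent_vec tangent_vec = \<beta> * \<beta> * \<beta> * line_polar3 \<tau> \<tau> \<tau>
      - \<gamma> * (3 * \<beta> * \<beta> * line_polar3 \<tau> \<tau> ?g - 3 * \<beta> * \<gamma> * line_polar3 \<tau> ?g ?g + \<gamma> * \<gamma> * line_polar3 ?g ?g ?g)"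
    unfolding tangent polar_linear polar3_sym12[of d "const_form c" _ ?g \<tau>] polar3_sym13[of d "const_form c" _ ?g ?g \<tau>]
      polar3_sym23[of d "const_form c" _ \<tau> ?g \<tau>]
    by (simp add: algebra_simps)
  then show "[:-z,1:]^(card S - 2) dvd line_polar3 tangent_vec tangent_vec tangent_vec"
    using polars(3) dvd_\<gamma>[of "card S - 2"] by (simp add: dvd_diff)
qed

lemma segre_poly_root:
  assumes "\<alpha> \<in> S"
  shows "poly segre_poly z = 0"
proof -
  let ?v = "\<alpha> *s f + tangent_at z" and ?t = "tangent_at z"
  have "form_along d c (point z) ?v = 0" by (rule poly_eq_0I) (simp add: poly_form_at lines[OF assms])
  note polars = polar_eq_0_if_form_along_eq_0(2,3)[OF homogeneous this]
  have sym: "polar2 d c (point z) ?t f = poly parabolic z" "polar3 d c (point z) f ?t ?t = polar3 d c (point z) ?t ?t f"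
    "polar3 d c (point z) ?t f ?t = polar3 d c (point z) ?t ?t f"
    "polar3 d c (point z) ?t f f = poly (pderiv parabolic) z" "polar3 d c (point z) f ?t f = poly (pderiv parabolic) z"
    using polar2_point(2) polar2_sym polar3_point(3) polar3_sym12 polar3_sym23 polar3_sym13 by metis+
  have polar2: "polar2 d c (point z) ?t ?t = - 2 * \<alpha> * poly parabolic z"
    using polars(1) unfolding polar_linear sym by (simp add: polar2_point algebra_simps eq_neg_iff_add_eq_0)
  have polar3: "3 * \<alpha>^2 * poly (pderiv parabolic) z + 3 * \<alpha> * polar3 d c (point z) ?t ?t f + polar3 d c (point z) ?t ?t ?t = 0"
    using polars(2) unfolding polar_linear sym by (simp add: polar3_point algebra_simps power2_eq_square)
  have "poly segre_poly z = 3 * (polar2 d c (point z) ?t ?t)^2 * poly (pderiv parabolic) z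
      - 6 * poly parabolic z * polar2 d c (point z) ?t ?t * polar3 d c (point z) ?t ?t f
      + 4 * (poly parabolic z)^2 * polar3 d c (point z) ?t ?t ?t"
    by (simp add: segre_poly_def tangent_polar2_def poly_polar2 poly_polar3)
  also have "\<dots> = 4 * (poly parabolic z)^2 * (3 * \<alpha>^2 * poly (pderiv parabolic) z
      + 3 * \<alpha> * polar3 d c (point z) ?t ?t f + polar3 d c (point z) ?t ?t ?t)"
    unfolding polar2 by (simp add: algebra_simps power2_eq_square)
  finally show ?thesis unfolding polar3 by simp
qed

theorem linear_power_dvd_segre_poly: "[:-z,1:]^card S dvd segre_poly"
proof -
  consider "card S = 0" | "card S = 1" | "card S \<ge> 2" by linarith
  then show ?thesis
  proof cases
    case 2
    then show ?thesis using segre_poly_root by (auto simp: card_1_singleton_iff poly_eq_0_iff_dvd)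
  next
    case 3
    let ?q = "[:-z,1:]" and ?k = "card S"
    have dvd_product: "?q^?k dvd x * y * t" if "?q^(?k-1) dvd x" "?q^(?k-1) dvd y" "?q^(?k-2) dvd t" for x y t
    proof -
      have "?q^((?k-1)+(?k-1)+(?k-2)) dvd x * y * t" unfolding power_add by (intro mult_dvd_mono that)
      moreover have "?k \<le> (?k-1)+(?k-1)+(?k-2)" using 3 by simp
      ultimately show ?thesis by (meson dvd_trans le_imp_power_dvd)
    qed
    have "segre_poly = 3 * (tangent_polar2 * tangent_polar2 * pderiv parabolic)
        - 6 * (parabolic * tangent_polar2 * line_polar3 tangent_vec tangent_vec (const_vec f))
        + 4 * (parabolic * parabolic * line_polar3 tangent_vec tangent_vec tangent_vec)"
      by (simp add: segre_poly_def power2_eq_square algebra_simps)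
    then show ?thesis
      by (simp only:) (intro dvd_add dvd_diff dvd_mult[OF dvd_product] linear_power_dvd_tangent_polars)
  qed simp
qed

end

lemma line_through_point_eq_span2:
  assumes L: "L \<in> lines_in d c" "L \<noteq> span2 e f" "point z \<in> L"
  obtains \<alpha> where "L = span2 (point z) (\<alpha> *s f + tangent_at z)"
proof -
  have line: "is_line L" using L(1) by (simp add: lines_in_def)
  obtain v where v: "indep2 (point z) v" "v \<in> L" "L = span2 (point z) v"
    by (rule line_through_point[OF line L(3) point_nonzero])
  have "form_at d c (s *s point z + t *s v) = 0" for s t
    using L(1) span2I[of s "point z" t v] unfolding v(3)[symmetric] by (simp add: lines_in_def)
  from polar1_along_line_in_zero_set(2)[OF homogeneous this, of 0] have "polar1 d c (point z) v = 0" by simp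
  then obtain x y q where coords: "v = x *s e + y *s f + q *s tangent_at z" by (rule obtain_tangent_coords)
  have "q \<noteq> 0"
  proof
    assume "q = 0"
    then have "v \<in> span2 e f" unfolding coords by (simp add: span2I)
    then have "span2 e f = L" using span2_eq_if_indep2[OF v(1), of e f] v(3) by simp
    then show False using L(2) by simp
  qed
  define \<alpha> where "\<alpha> = (y - x * z) / q"
  have direction: "\<alpha> *s f + tangent_at z = (1/q) *s v - (x/q) *s point z"
    unfolding coords \<alpha>_def using \<open>q \<noteq> 0\<close> by (simp add: cart_eq field_simps)
  have "indep2 (point z) (\<alpha> *s f + tangent_at z)"
    unfolding indep2_def
  proof (intro allI impI)
    fix s t assume "s *s point z + t *s (\<alpha> *s f + tangent_at z) = 0"
    then have "(s - t * (x/q)) *s point z + (t/q) *s v = 0" unfolding direction by (simp add: cart_eq algebra_simps)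
    then have "s - t * (x/q) = 0 \<and> t/q = 0" using v(1) unfolding indep2_def by blast
    then show "s = 0 \<and> t = 0" using \<open>q \<noteq> 0\<close> by auto
  qed
  moreover have "\<alpha> *s f + tangent_at z \<in> L"
    unfolding direction using line_diff[OF line] line_scale[OF line] L(3) v(2) by blast
  ultimately show ?thesis using that line_eq_span2[OF line] L(3) by blast
qed

lemma obtain_chart_grad2_nonzero:
  assumes "finite Z"
  obtains h where "surface_line d c e f g1 h" "\<And>z. z \<in> Z \<Longrightarrow> poly (surface_line.grad2 d c e f h) z \<noteq> 0"
proof -
  obtain \<mu> where \<mu>: "\<mu> \<notin> (\<lambda>z. - poly grad2 z / poly grad1 z) ` Z"
    using obtain_outside_finite[OF finite_imageI[OF assms]] by blast
  interpret sheared: surface_line d c e f g1 "g2 + \<mu> *s g1"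
    by unfold_locales (auto intro: basis4_shear[OF basis] on_surface)
  have "poly sheared.grad2 z \<noteq> 0" if "z \<in> Z" for z
  proof -
    have "poly sheared.grad2 z = poly grad2 z + \<mu> * poly grad1 z"
      using sheared.polar1_point(6)[of z] by (simp add: polar1_add[of d c _ g2] polar1_scale[of d c _ \<mu> g1] polar1_point)
    moreover have "poly grad2 z + \<mu> * poly grad1 z \<noteq> 0"
    proof (cases "poly grad1 z = 0")
      case False
      moreover have "\<mu> \<noteq> - poly grad2 z / poly grad1 z" using \<mu> that by auto
      ultimately show ?thesis by (simp add: field_simps eq_neg_iff_add_eq_0 add.commute)
    qed (use grad_no_common_root in simp)
    ultimately show ?thesis by simp
  qed
  then show ?thesis using that sheared.surface_line_axioms by blast
qed

lemma card_lines_meeting_le_degree_segre_poly: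
  assumes segre: "segre_poly \<noteq> 0" and M: "finite M" "M \<subseteq> lines_in d c - {span2 e f}"
    and on: "\<And>L. L \<in> M \<Longrightarrow> point (\<zeta> L) \<in> L" and grad2: "\<And>L. L \<in> M \<Longrightarrow> poly grad2 (\<zeta> L) \<noteq> 0"
  shows "card M \<le> degree segre_poly"
proof -
  have "\<exists>\<alpha>. L = span2 (point (\<zeta> L)) (\<alpha> *s f + tangent_at (\<zeta> L))" if "L \<in> M" for L
  proof -
    have "L \<in> lines_in d c" "L \<noteq> span2 e f" using M(2) that by auto
    from line_through_point_eq_span2[OF this on[OF that]] show ?thesis by metis
  qed
  then obtain \<alpha> where \<alpha>: "\<And>L. L \<in> M \<Longrightarrow> L = span2 (point (\<zeta> L)) (\<alpha> L *s f + tangent_at (\<zeta> L))" by metis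
  define S where "S z = \<alpha> ` {L\<in>M. \<zeta> L = z}" for z
  have card_S: "card (S z) = card {L\<in>M. \<zeta> L = z}" for z
    unfolding S_def
  proof (rule card_image, rule inj_onI)
    fix L L' assume "L \<in> {L\<in>M. \<zeta> L = z}" "L' \<in> {L\<in>M. \<zeta> L = z}" "\<alpha> L = \<alpha> L'"
    then show "L = L'" using \<alpha>[of L] \<alpha>[of L'] by auto
  qed
  have dvd: "[:-z,1:]^card (S z) dvd segre_poly" if z: "z \<in> \<zeta> ` M" for z
  proof (rule linear_power_dvd_segre_poly)
    show "poly grad2 z \<noteq> 0" using grad2 z by auto
    show "finite (S z)" unfolding S_def using M(1) by simp
    fix \<beta> t assume "\<beta> \<in> S z"
    then obtain L where L: "L \<in> M" "\<zeta> L = z" "\<beta> = \<alpha> L" unfolding S_def by auto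
    then have "point z + t *s (\<beta> *s f + tangent_at z) \<in> L" using \<alpha>[OF L(1)] span2_generators(4) by metis
    then show "form_at d c (point z + t *s (\<beta> *s f + tangent_at z)) = 0" using L(1) M(2) by (auto simp: lines_in_def)
  qed
  have "card M = (\<Sum>z\<in>\<zeta> ` M. card {L\<in>M. \<zeta> L = z})"
    using sum.image_gen[OF M(1), of "\<lambda>_. 1::nat" \<zeta>] by simp
  also have "\<dots> = (\<Sum>z\<in>\<zeta> ` M. card (S z))" unfolding card_S ..
  also have "\<dots> \<le> degree segre_poly" by (rule sum_multiplicities_le_degree[OF _ segre dvd]) (use M(1) in auto)
  finally show ?thesis .
qed

end

lemma obtain_generator_off_lines:
  fixes p v :: "'a::alg_closed_field^4"
  assumes indep: "indep2 p v" and M: "finite M" "\<And>L. L \<in> M \<Longrightarrow> is_line L \<and> L \<noteq> span2 p v"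
  obtains f where "indep2 p f" "span2 p f = span2 p v" "\<And>L. L \<in> M \<Longrightarrow> f \<notin> L"
proof -
  have unique: "s = t" if L: "L \<in> M" and on: "v + s *s p \<in> L" "v + t *s p \<in> L" for s t L
  proof (rule ccontr)
    assume "s \<noteq> t"
    have line: "is_line L" using M(2) L by blast
    have "(v + s *s p) - (v + t *s p) = (s - t) *s p" by (simp add: cart_eq algebra_simps)
    then have "p = (1/(s - t)) *s ((v + s *s p) - (v + t *s p))" using \<open>s \<noteq> t\<close> by simp
    then have p: "p \<in> L" using line_scale[OF line] line_diff[OF line] on by metis
    have "v = (v + s *s p) - s *s p" by simp
    then have "v \<in> L" using line_scale[OF line] line_diff[OF line] on p by metis
    then show False using line_eq_span2[OF line indep] p M(2)[OF L] by blast
  qed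
  have "finite {t. v + t *s p \<in> L}" if "L \<in> M" for L
  proof (cases "{t. v + t *s p \<in> L} = {}")
    case False
    then obtain s where "v + s *s p \<in> L" by blast
    then have "{t. v + t *s p \<in> L} \<subseteq> {s}" using unique[OF that] by blast
    then show ?thesis by (rule finite_subset) simp
  qed simp
  then have "finite (\<Union>L\<in>M. {t. v + t *s p \<in> L})" using M(1) by blast
  then obtain t where t: "t \<notin> (\<Union>L\<in>M. {t. v + t *s p \<in> L})" by (rule obtain_outside_finite)
  have "indep2 p (v + t *s p)" by (rule indep2_shift[OF indep2_sym[OF indep]])
  moreover have "span2 p (v + t *s p) = span2 p v"
    by (rule span2_eq_if_indep2[OF calculation]) (use span2I[of t p 1 v] in \<open>simp_all add: add.commute\<close>)
  ultimately show ?thesis using that t by blast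
qed

context surface
begin

theorem card_lines_meeting_first_kind_le:
  assumes L0: "L0 \<in> lines_in d c" "\<not> second_kind d c L0"
    and M: "finite M" "M \<subseteq> lines_in d c - {L0}" "\<And>L. L \<in> M \<Longrightarrow> meets L L0"
  shows "card M \<le> 8 * d - 14"
proof -
  have line: "is_line L" if "L \<in> M" for L using M(2) that by (auto simp: lines_in_def)
  obtain p y v where p: "p \<in> L0" and y: "y \<in> L0" and polars: "polar1 d c p v = 0" "polar2 d c p v v = 0"
    "polar2 d c p y v \<noteq> 0" "polar3 d c p v v v \<noteq> 0"
    using L0(2) unfolding second_kind_def by blast
  have "p \<noteq> 0" using polars(3) polar2_at_0 by auto
  then obtain w where w: "indep2 p w" "L0 = span2 p w" using line_through_point[OF lines_in_is_line[OF L0(1)] p] by blast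
  obtain f where f: "indep2 p f" "span2 p f = span2 p w" "\<And>L. L \<in> M \<Longrightarrow> f \<notin> L"
    by (rule obtain_generator_off_lines[OF w(1) M(1)]) (use M(2) line w(2) in auto)
  have L0_eq: "L0 = span2 p f" using f(2) w(2) by simp
  obtain g1 g2 where "surface_line d c p f g1 g2" using line_chart[OF f(1)] L0(1) L0_eq by blast
  then interpret chart: surface_line d c p f g1 g2 .
  have "\<exists>z. p + z *s f \<in> L" if L: "L \<in> M" for L
  proof -
    obtain x where x: "x \<noteq> 0" "x \<in> L" "x \<in> span2 p f" using M(3)[OF L] L0_eq by (auto simp: meets_def)
    obtain s t where x_eq: "x = s *s p + t *s f" using x(3) by (rule span2E)
    have "s \<noteq> 0"
    proof
      assume "s = 0"
      then have "f = (1/t) *s x" using x(1) x_eq by (auto simp: cart_eq)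
      then show False using f(3)[OF L] line_scale[OF line[OF L] x(2)] by metis
    qed
    then have "p + (t/s) *s f = (1/s) *s x" unfolding x_eq by (simp add: cart_eq field_simps)
    then show ?thesis using line_scale[OF line[OF L] x(2)] by metis
  qed
  then obtain \<zeta> where \<zeta>: "\<And>L. L \<in> M \<Longrightarrow> p + \<zeta> L *s f \<in> L" by metis
  obtain h where "surface_line d c p f g1 h" and grad2: "\<And>z. z \<in> \<zeta> ` M \<Longrightarrow> poly (surface_line.grad2 d c p f h) z \<noteq> 0"
    using chart.obtain_chart_grad2_nonzero[OF finite_imageI[OF M(1)]] by blast
  then interpret surface_line d c p f g1 h by simp
  have "segre_poly \<noteq> 0" by (rule segre_poly_nonzero[of y 0 v]) (use y L0_eq polars in simp_all)
  then have "card M \<le> degree segre_poly"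
    by (rule card_lines_meeting_le_degree_segre_poly[where \<zeta>=\<zeta>]) (use M(1,2) \<zeta> grad2 L0_eq in auto)
  also have "\<dots> \<le> 8 * d - 14" by (rule degree_segre_poly)
  finally show ?thesis .
qed

end

section \<open>Coplanar lines\<close>

definition span3 :: "'a::field^4 \<Rightarrow> 'a^4 \<Rightarrow> 'a^4 \<Rightarrow> ('a^4) set" where
  "span3 e f g = {r *s e + s *s f + t *s g |r s t. True}"

lemma span3I: "r *s e + s *s f + t *s g \<in> span3 e f g" by (auto simp: span3_def)
lemma span3E: assumes "x \<in> span3 e f g" obtains r s t where "x = r *s e + s *s f + t *s g"
  using assms unfolding span3_def by blast
lemma span3_eq_span: "span3 e f g = vec.span {e,f,g}"
  unfolding vec.span_insert[of e] span2_eq_span[symmetric] span3_def span2_def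
  by (simp add: set_eq_iff diff_eq_eq ac_simps)
lemma subspace_span3: "vec.subspace (span3 e f g)" by (simp add: span3_eq_span vec.subspace_span)
lemma span3_generators [simp]: "e \<in> span3 e f g" "f \<in> span3 e f g" "g \<in> span3 e f g"
  by (simp_all add: span3_eq_span vec.span_base)
lemma span2_subset_subspace: "vec.subspace V \<Longrightarrow> x \<in> V \<Longrightarrow> y \<in> V \<Longrightarrow> span2 x y \<subseteq> V"
  by (auto elim!: span2E intro: vec.subspace_add vec.subspace_scale)

lemma obtain_line_coords_in_plane:
  assumes L: "is_line L" "L \<subseteq> span3 e f k" and off: "\<And>r. r *s k \<in> L \<Longrightarrow> r = 0"
  obtains l1 l2 where "e + l1 *s k \<in> L" "f + l2 *s k \<in> L"
proof -
  obtain a b where ab: "indep2 a b" "L = span2 a b" using L(1) by (auto simp: is_line_def)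
  have "a \<in> span3 e f k" "b \<in> span3 e f k" using L(2) ab(2) by auto
  then obtain a1 a2 a3 b1 b2 b3 where coords: "a = a1 *s e + a2 *s f + a3 *s k" "b = b1 *s e + b2 *s f + b3 *s k"
    by (metis span3E)
  define D where "D = a1 * b2 - a2 * b1"
  have combinations: "b2 *s a + (- a2) *s b = D *s e + (a3 * b2 - a2 * b3) *s k"
    "(- b1) *s a + a1 *s b = D *s f + (a1 * b3 - a3 * b1) *s k"
    unfolding coords D_def by (simp_all add: cart_eq algebra_simps)
  have in_L: "D *s e + (a3 * b2 - a2 * b3) *s k \<in> L" "D *s f + (a1 * b3 - a3 * b1) *s k \<in> L"
    unfolding combinations[symmetric] ab(2) by (rule span2I)+
  have "D \<noteq> 0"
  proof
    assume "D = 0"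
    then have "a3 * b2 - a2 * b3 = 0" "a1 * b3 - a3 * b1 = 0" using in_L by (auto intro!: off simp del: right_minus_eq)
    then have "b2 *s a + (- a2) *s b = 0" "(- b1) *s a + a1 *s b = 0" using combinations \<open>D = 0\<close> by simp_all
    then have "a2 = 0" "a1 = 0" using ab(1) unfolding indep2_def by (metis neg_equal_0_iff_equal)+
    then have "a = a3 *s k" using coords by simp
    then show False using off[of a3] ab indep2_nonzero(1)[OF ab(1)] by auto
  qed
  then have "e + ((a3 * b2 - a2 * b3)/D) *s k = (1/D) *s (D *s e + (a3 * b2 - a2 * b3) *s k)"
    "f + ((a1 * b3 - a3 * b1)/D) *s k = (1/D) *s (D *s f + (a1 * b3 - a3 * b1) *s k)"
    by (simp_all add: cart_eq field_simps)
  then show ?thesis using that in_L line_scale[OF L(1)] by metis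
qed

lemma obtain_separating_point:
  fixes P :: "'a::alg_closed_field poly set"
  assumes "finite P"
  obtains y where "inj_on (\<lambda>p. poly p y) P"
proof -
  have "finite (\<Union>p\<in>P. \<Union>q\<in>P - {p}. {y. poly (p - q) y = 0})"
    by (intro finite_UN_I finite_Diff assms poly_roots_finite) auto
  then obtain y where "y \<notin> (\<Union>p\<in>P. \<Union>q\<in>P - {p}. {y. poly (p - q) y = 0})" by (rule obtain_outside_finite)
  then have "inj_on (\<lambda>p. poly p y) P" by (intro inj_onI) auto
  then show ?thesis by (rule that)
qed

context surface
begin

lemma polar1_eq_0_in_line:
  assumes "L \<in> lines_in d c" "p \<in> L" "v \<in> L"
  shows "polar1 d c p v = 0"
proof -
  have "p + t *s v \<in> L" for t using assms line_add[OF lines_in_is_line] line_scale[OF lines_in_is_line] by blast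
  then have "form_along d c p v = 0"
    by (intro poly_eq_0I) (use assms(1) in \<open>simp add: poly_form_at lines_in_def\<close>)
  then show ?thesis by (rule polar_eq_0_if_form_along_eq_0(1)[OF homogeneous])
qed

end

context surface_line
begin

lemma span3_not_in_surface:
  assumes "g \<notin> span2 e f"
  obtains k where "k \<in> span3 e f g" "form_at d c k \<noteq> 0"
proof (rule ccontr)
  assume none: "\<not> thesis"
  have zero: "form_at d c k = 0" if "k \<in> span3 e f g" for k
    using none \<open>\<And>k. k \<in> span3 e f g \<Longrightarrow> form_at d c k \<noteq> 0 \<Longrightarrow> thesis\<close> that by blast
  have "polar1 d c (point s) (g + s *s 0) = 0" for s
  proof -
    have "form_along d c (point s) g = 0"
      by (rule poly_eq_0I) (use zero[OF span3I[of 1 e s f _ g]] in \<open>simp add: poly_form_at\<close>)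
    then show ?thesis using polar_eq_0_if_form_along_eq_0(1)[OF homogeneous] by simp
  qed
  then show False using linear_tangent_field_in_line(1)[of "{}" g 0] assms by simp
qed

lemma indep2_translate_off_surface:
  assumes k: "form_at d c k \<noteq> 0"
  shows "indep2 (e + r *s k) (f + u *s k)"
  unfolding indep2_def
proof (intro allI impI)
  fix s t assume "s *s (e + r *s k) + t *s (f + u *s k) = 0"
  then have multiple: "s *s e + t *s f = (-(s * r + t * u)) *s k" by (simp add: cart_eq algebra_simps eq_neg_iff_add_eq_0)
  then have "form_at d c ((-(s * r + t * u)) *s k) = 0" using on_surface by metis
  then have "-(s * r + t * u) = 0" using k by (simp add: form_at_scale)
  then have "s *s e + t *s f = 0" using multiple by (metis vec.scale_zero_left)
  then show "s = 0 \<and> t = 0" using line_indep2 unfolding indep2_def by blast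
qed

lemma obtain_apex_off_surface:
  assumes "g \<notin> span2 e f"
  obtains k where "form_at d c k \<noteq> 0" "span3 e f g \<subseteq> span3 e f k"
proof -
  obtain k where k: "k \<in> span3 e f g" "form_at d c k \<noteq> 0" by (rule span3_not_in_surface[OF assms])
  obtain x0 y0 t0 where k_eq: "k = x0 *s e + y0 *s f + t0 *s g" using k(1) by (rule span3E)
  have "t0 \<noteq> 0" using k(2) k_eq on_surface by auto
  then have "g = (-x0/t0) *s e + (-y0/t0) *s f + (1/t0) *s k" unfolding k_eq by (simp add: cart_eq field_simps)
  then have "g \<in> span3 e f k" using span3I by metis
  then have "span3 e f g \<subseteq> span3 e f k" unfolding span3_eq_span[of e f g]
    by (intro vec.span_minimal subspace_span3) auto
  then show ?thesis using that k(2) by blast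
qed

lemma card_lines_in_span3_le:
  assumes g: "g \<notin> span2 e f" and M: "finite M" "M \<subseteq> lines_in d c" "\<And>L. L \<in> M \<Longrightarrow> L \<subseteq> span3 e f g"
  shows "card M \<le> d"
proof -
  obtain k where k: "form_at d c k \<noteq> 0" and plane: "span3 e f g \<subseteq> span3 e f k" by (rule obtain_apex_off_surface[OF g])
  have k_multiple: "r = 0" if "form_at d c (r *s k) = 0" for r
    using that k by (simp add: form_at_scale)
  have line: "is_line L" and zero: "\<And>x. x \<in> L \<Longrightarrow> form_at d c x = 0" if "L \<in> M" for L
    using that M(2) by (auto simp: lines_in_def)
  have "\<exists>l1 l2. e + l1 *s k \<in> L \<and> f + l2 *s k \<in> L" if L: "L \<in> M" for L
    using obtain_line_coords_in_plane[OF line[OF L]] M(3)[OF L] plane zero[OF L] k_multiple by (metis subset_trans)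
  then obtain l1 l2 where coords: "\<And>L. L \<in> M \<Longrightarrow> e + l1 L *s k \<in> L \<and> f + l2 L *s k \<in> L" by metis
  define p where "p L = [:l1 L, l2 L:]" for L
  have L_eq: "L = span2 (e + l1 L *s k) (f + l2 L *s k)" if "L \<in> M" for L
    using line_eq_span2[OF line[OF that] indep2_translate_off_surface[OF k]] coords[OF that] by blast
  have inj: "inj_on p M"
  proof (rule inj_onI)
    fix L L' assume "L \<in> M" "L' \<in> M" "p L = p L'"
    then show "L = L'" using L_eq[of L] L_eq[of L'] by (simp add: p_def)
  qed
  obtain y where y: "inj_on (\<lambda>q. poly q y) (p ` M)" by (rule obtain_separating_point[OF finite_imageI[OF M(1)]])
  define Q where "Q = form_along d c (point y) k"
  have "top_coeff d Q (form_at d c k)" unfolding Q_def by (rule top_coeff_form_along)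
  then have Q: "Q \<noteq> 0" "degree Q \<le> d" using k by (auto simp: top_coeff_def)
  have root: "poly Q (poly (p L) y) = 0" if L: "L \<in> M" for L
  proof -
    have "point y + poly (p L) y *s k = (e + l1 L *s k) + y *s (f + l2 L *s k)" by (simp add: p_def cart_eq algebra_simps)
    then have "point y + poly (p L) y *s k \<in> L" using coords[OF L] line_add line_scale line[OF L] by metis
    then show ?thesis using zero[OF L] by (simp add: Q_def poly_form_at)
  qed
  have "card M = card ((\<lambda>q. poly q y) ` p ` M)" using card_image[OF y] card_image[OF inj] by simp
  also have "\<dots> \<le> card {x. poly Q x = 0}" using root by (intro card_mono poly_roots_finite[OF Q(1)]) auto
  also have "\<dots> \<le> d" using card_poly_roots_bound[OF Q(1)] Q(2) by linarith
  finally show ?thesis .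
qed

lemma tangent_plane_subset_span3:
  assumes tangent: "polar1 d c (point z) g = 0" "polar1 d c (point z) v = 0" and g: "g \<notin> span2 e f"
  shows "v \<in> span3 e f g"
proof -
  obtain a b l where g_eq: "g = a *s e + b *s f + l *s tangent_at z" using tangent(1) by (rule obtain_tangent_coords)
  obtain a' b' l' where v_eq: "v = a' *s e + b' *s f + l' *s tangent_at z" using tangent(2) by (rule obtain_tangent_coords)
  have "l \<noteq> 0" using g g_eq span2I[of a e b f] by auto
  then have "v = (a' - l' * a / l) *s e + (b' - l' * b / l) *s f + (l' / l) *s g"
    unfolding v_eq g_eq by (simp add: cart_eq field_simps)
  then show ?thesis using span3I by metis
qed

end

context surface
begin

lemma line_in_plane_of_meeting_lines:
  assumes chart: "surface_line d c e f g1 g2" and g: "g \<in> L2" "L2 = span2 e g" and g_off: "g \<notin> span2 e f"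
    and L: "L2 \<in> lines_in d c" "L \<in> lines_in d c" "meets L (span2 e f)" "meets L L2"
  shows "L \<subseteq> span3 e f g"
proof -
  interpret surface_line d c e f g1 g2 by fact
  have e: "e \<in> L2" using g(2) by simp
  have line: "is_line L" by (rule lines_in_is_line[OF L(2)])
  obtain x where x: "x \<noteq> 0" "x \<in> L" "x \<in> span2 e f" using L(3) by (auto simp: meets_def)
  obtain y where y: "y \<noteq> 0" "y \<in> L" "y \<in> L2" using L(4) by (auto simp: meets_def)
  have sides: "span2 e f \<subseteq> span3 e f g" "L2 \<subseteq> span3 e f g"
    unfolding g(2) by (rule span2_subset_subspace[OF subspace_span3]; simp)+
  show ?thesis
  proof (cases "indep2 x y")
    case True
    then show ?thesis
      using line_eq_span2[OF line True] span2_subset_subspace[OF subspace_span3] x y sides by blast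
  next
    case False
    then obtain r where "y = r *s x" using obtain_multiple_if_not_indep2 x(1) by blast
    then have "y \<in> span2 e f" using x(3) span2_scale by metis
    then obtain r' where r': "y = r' *s e"
      using common_points_proportional[OF is_line_span2[OF line_indep2] lines_in_is_line[OF L(1)], of e y] g(1) g_off e y(3) point_nonzero[of 0]
      by auto
    then have "e = (1/r') *s y" using y(1) by (auto simp: cart_eq)
    then have e_L: "e \<in> L" using line_scale[OF line y(2)] by metis
    show ?thesis
    proof
      fix v assume "v \<in> L"
      then show "v \<in> span3 e f g"
        using tangent_plane_subset_span3[OF _ _ g_off, of 0 v] polar1_eq_0_in_line[OF L(1) e g(1)] polar1_eq_0_in_line[OF L(2) e_L]
        by simp
    qed
  qed
qed

lemma card_lines_meeting_two_meeting_lines_le: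
  assumes L: "L1 \<in> lines_in d c" "L2 \<in> lines_in d c" "L1 \<noteq> L2" "meets L1 L2"
    and M: "finite M" "M \<subseteq> lines_in d c" "\<And>L. L \<in> M \<Longrightarrow> meets L L1 \<and> meets L L2"
  shows "card (M \<union> {L1, L2}) \<le> d"
proof -
  obtain e where e: "e \<noteq> 0" "e \<in> L1" "e \<in> L2" using L(4) by (auto simp: meets_def)
  obtain f g1 g2 where chart: "surface_line d c e f g1 g2" and f: "L1 = span2 e f"
    by (rule obtain_line_chart_at[OF L(1) e(2,1)])
  interpret surface_line d c e f g1 g2 by fact
  obtain g where g: "indep2 e g" "g \<in> L2" "L2 = span2 e g" by (rule line_through_point[OF lines_in_is_line[OF L(2)] e(3,1)])
  have g_off: "g \<notin> span2 e f"
    using line_eq_span2[OF lines_in_is_line[OF L(1)] g(1) e(2)] g(3) f L(3) by blast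
  show ?thesis
  proof (rule card_lines_in_span3_le[OF g_off])
    show "finite (M \<union> {L1, L2})" "M \<union> {L1, L2} \<subseteq> lines_in d c" using M L by auto
    fix L assume "L \<in> M \<union> {L1, L2}"
    then consider "L = L1" | "L = L2" | "L \<in> M" by blast
    then show "L \<subseteq> span3 e f g"
    proof cases
      case 3
      then show ?thesis
        using line_in_plane_of_meeting_lines[OF chart g(2,3) g_off L(2)] M(2,3) f by blast
    qed (simp_all add: f g(3) span2_subset_subspace[OF subspace_span3])
  qed
qed

lemma card_pairwise_meeting_lines_le:
  assumes M: "finite M" "M \<subseteq> lines_in d c" "\<And>L L'. L \<in> M \<Longrightarrow> L' \<in> M \<Longrightarrow> meets L L'"
  shows "card M \<le> d"
proof (cases "card M \<le> 1")
  case False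
  then obtain L1 L2 where L: "L1 \<in> M" "L2 \<in> M" "L1 \<noteq> L2" using M(1) by (metis card_le_Suc0_iff_eq One_nat_def)
  have "card (M \<union> {L1,L2}) \<le> d" by (rule card_lines_meeting_two_meeting_lines_le) (use L M in auto)
  moreover have "M \<union> {L1,L2} = M" using L by auto
  ultimately show ?thesis by simp
qed (use degree_ge_3 in simp)

end

section \<open>Cubic surfaces have no lines of the second kind\<close>

context surface_line
begin

lemma asymptotic_line_in_cubic:
  assumes "d = 3" "segre_poly = 0"
  shows "form_along d c (point z) (asymptotic_at z) = 0"
proof -
  let ?Q = "form_along d c (point z) (asymptotic_at z)"
  note coeffs = coeff_form_along_0[OF homogeneous] coeff_form_along_1[OF homogeneous]
  have "coeff ?Q 0 = 0" "coeff ?Q 1 = 0"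
    unfolding coeffs by (simp_all add: form_at_point polar1_point)
  moreover have "coeff ?Q 2 = 0"
    using coeff_form_along_2[OF homogeneous, of "point z" "asymptotic_at z"] numerals_nonzero by (simp add: polar2_point)
  moreover have "coeff ?Q 3 = 0"
  proof -
    have "2 * 3 * coeff ?Q 3 = 0"
      using coeff_form_along_3[OF homogeneous, of "point z" "asymptotic_at z"] by (simp add: polar3_point assms(2))
    then show ?thesis using numerals_nonzero by (metis mult_eq_0_iff)
  qed
  moreover have "degree ?Q \<le> 3" using top_coeff_form_along[of d c] assms(1) by (auto simp: top_coeff_def)
  ultimately have "coeff ?Q n = 0" for n
  proof -
    consider "n = 0" | "n = 1" | "n = 2" | "n = 3" | "n > 3" by linarith
    then show ?thesis using \<open>coeff ?Q 0 = 0\<close> \<open>coeff ?Q 1 = 0\<close> \<open>coeff ?Q 2 = 0\<close> \<open>coeff ?Q 3 = 0\<close> \<open>degree ?Q \<le> 3\<close>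
      by cases (auto intro: coeff_eq_0)
  qed
  then show ?thesis by (simp add: poly_eqI)
qed

lemma asymptotic_off_line:
  assumes "poly parabolic z \<noteq> 0" "s *s point z + t *s asymptotic_at z = b *s f"
  shows "s = 0 \<and> t = 0"
proof -
  let ?k = "2 * t * poly parabolic z"
  have "s *s e + (s * z - t * poly tangent_polar2 z) *s f + (?k * poly grad2 z) *s g1 + (- (?k * poly grad1 z)) *s g2
      = s *s point z + t *s asymptotic_at z"
    by (simp add: asymptotic_vec_def tangent_vec_def cart_eq algebra_simps)
  also have "\<dots> = 0 *s e + b *s f + 0 *s g1 + 0 *s g2" using assms(2) by simp
  finally have "s = 0 \<and> ?k * poly grad2 z = 0 \<and> - (?k * poly grad1 z) = 0" using basis4_coords_eq[OF basis] by blast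
  then show ?thesis using assms(1) numerals_nonzero grad_no_common_root[of z] by auto
qed

lemma cubic_segre_poly_nonzero:
  assumes "d = 3"
  shows "segre_poly \<noteq> 0"
proof
  assume segre_0: "segre_poly = 0"
  note asymptotic_line = asymptotic_line_in_cubic[OF assms segre_0]
  obtain z where z: "poly parabolic z \<noteq> 0" using obtain_nonroot[OF parabolic_nonzero, of "{}"] by blast
  have "indep2 (point z) (asymptotic_at z)" unfolding indep2_def using asymptotic_off_line[OF z, of _ _ 0] by auto
  then obtain h1 h2 where "basis4 (point z) (asymptotic_at z) h1 h2" by (rule basis4_extend)
  then interpret ruling: surface_line d c "point z" "asymptotic_at z" h1 h2
    by unfold_locales (use form_at_eq_0_if_form_along_eq_0[OF asymptotic_line] in auto)
  define y where "y = eval_vec z (map_coords pderiv asymptotic_vec)"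
  have "polar1 d c (ruling.point t) (f + t *s y) = 0" for t
  proof -
    let ?Y = "param_line e f + [:t:] *s asymptotic_vec"
    have "form_at d (const_form c) ?Y = 0"
    proof (rule poly_eq_0I)
      fix x
      have "poly (form_along d c (point x) (asymptotic_at x)) t = 0" by (simp add: asymptotic_line)
      then show "poly (form_at d (const_form c) ?Y) x = 0" by (simp add: poly_form_at)
    qed
    then have "polar1 d (const_form c) ?Y (map_coords pderiv ?Y) = 0"
      using pderiv_form_at[OF homogeneous, of ?Y] by simp
    moreover have "map_coords pderiv ?Y = const_vec f + [:t:] *s map_coords pderiv asymptotic_vec"
      by (simp add: cart_eq pderiv_add pderiv_smult pderiv_pCons)
    ultimately have "poly (polar1 d (const_form c) ?Y (const_vec f + [:t:] *s map_coords pderiv asymptotic_vec)) z = 0" by simp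
    then show ?thesis unfolding poly_polar1 by (simp add: y_def)
  qed
  then have "f \<in> span2 (point z) (asymptotic_at z)" using ruling.linear_tangent_field_in_line(1)[of "{}" f y] by simp
  then obtain s t where "f = s *s point z + t *s asymptotic_at z" by (rule span2E)
  then have "s = 0 \<and> t = 0" using asymptotic_off_line[OF z, of s t 1] by simp
  then show False using f_nonzero \<open>f = _\<close> by simp
qed

end

lemma (in surface) cubic_not_second_kind:
  assumes "d = 3" "L \<in> lines_in d c"
  shows "\<not> second_kind d c L"
proof -
  obtain e f g1 g2 where "surface_line d c e f g1 g2" and L: "L = span2 e f" using assms(2) by (rule obtain_line_chart)
  then interpret surface_line d c e f g1 g2 by simp
  show ?thesis using cubic_segre_poly_nonzero[OF assms(1)] segre_poly_eq_0_if_second_kind L by blast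
qed

section \<open>Transversals of three skew lines\<close>

lemma obtain_regulus_basis:
  assumes lines: "is_line m1" "is_line m2" "is_line m3" and skew: "\<not> meets m1 m2" "\<not> meets m1 m3" "\<not> meets m2 m3"
  obtains x1 y1 x2 y2 where "basis4 x1 y1 x2 y2" "m1 = span2 x1 y1" "m2 = span2 x2 y2" "m3 = span2 (x1 + x2) (y1 + y2)"
proof -
  obtain a b where m1: "indep2 a b" "m1 = span2 a b" using lines(1) by (auto simp: is_line_def)
  obtain a' b' where m2: "indep2 a' b'" "m2 = span2 a' b'" using lines(2) by (auto simp: is_line_def)
  obtain x y where m3: "indep2 x y" "m3 = span2 x y" using lines(3) by (auto simp: is_line_def)
  have basis: "basis4 a b a' b'" by (rule basis4_if_skew) (use m1 m2 skew(1) in auto)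
  have split: "\<exists>v1\<in>m1. \<exists>v2\<in>m2. v = v1 + v2" for v
  proof -
    obtain p q r s where "v = p *s a + q *s b + r *s a' + s *s b'" using basis by (rule basis4_span)
    then have "v = (p *s a + q *s b) + (r *s a' + s *s b')" by (simp add: add.assoc)
    then show ?thesis using m1 m2 span2I by blast
  qed
  obtain x1 x2 where x: "x1 \<in> m1" "x2 \<in> m2" "x = x1 + x2" using split by blast
  obtain y1 y2 where y: "y1 \<in> m1" "y2 \<in> m2" "y = y1 + y2" using split by blast
  have disjoint: "s = 0 \<and> t = 0" if "s *s x + t *s y \<in> m1 \<or> s *s x + t *s y \<in> m2" for s t
    using that skew(2,3) m3 span2I[of s x t y] unfolding meets_def indep2_def by blast
  have sum: "s *s x + t *s y = (s *s x1 + t *s y1) + (s *s x2 + t *s y2)" for s t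
    unfolding x y by (simp add: cart_eq algebra_simps)
  have in_m: "s *s x1 + t *s y1 \<in> m1" "s *s x2 + t *s y2 \<in> m2" for s t
    using x y line_add line_scale lines by blast+
  have indep: "indep2 x1 y1" "indep2 x2 y2"
    unfolding indep2_def using disjoint in_m sum by (metis add_0, metis add_0_right)
  have span: "m1 = span2 x1 y1" "m2 = span2 x2 y2"
    using line_eq_span2[OF lines(1) indep(1)] line_eq_span2[OF lines(2) indep(2)] x y by auto
  have "basis4 x1 y1 x2 y2" by (rule basis4_if_skew[OF indep]) (use span skew(1) in simp)
  then show ?thesis using that span m3(2) x(3) y(3) by simp
qed

lemma basis4_indep2_combinations:
  assumes basis: "basis4 e f g h" and "a \<noteq> 0 \<or> b \<noteq> 0" "p \<noteq> 0 \<or> q \<noteq> 0"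
  shows "indep2 (a *s e + b *s f) (p *s g + q *s h)"
  unfolding indep2_def
proof (intro allI impI)
  fix u v assume "u *s (a *s e + b *s f) + v *s (p *s g + q *s h) = 0"
  then have "(u * a) *s e + (u * b) *s f + (v * p) *s g + (v * q) *s h = 0" by (simp add: cart_eq algebra_simps)
  from basis4_zero[OF basis this] show "u = 0 \<and> v = 0" using assms(2,3) by auto
qed

lemma transversal_of_regulus:
  fixes x1 y1 x2 y2 :: "'a::field^4"
  assumes basis: "basis4 x1 y1 x2 y2" and L: "is_line L" "meets L (span2 x1 y1)" "meets L (span2 x2 y2)" "meets L (span2 (x1 + x2) (y1 + y2))"
  shows "L = span2 y1 y2 \<or> (\<exists>z. L = span2 (x1 + z *s y1) (x2 + z *s y2))"
proof -
  obtain p1 p2 where p: "p1 *s x1 + p2 *s y1 \<noteq> 0" "p1 *s x1 + p2 *s y1 \<in> L" using L(2) unfolding meets_def by (metis span2E)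
  obtain q1 q2 where q: "q1 *s x2 + q2 *s y2 \<noteq> 0" "q1 *s x2 + q2 *s y2 \<in> L" using L(3) unfolding meets_def by (metis span2E)
  obtain s r where o: "s *s (x1 + x2) + r *s (y1 + y2) \<noteq> 0" "s *s (x1 + x2) + r *s (y1 + y2) \<in> L"
    using L(4) unfolding meets_def by (metis span2E)
  have "indep2 (p1 *s x1 + p2 *s y1) (q1 *s x2 + q2 *s y2)"
    by (rule basis4_indep2_combinations[OF basis]) (use p(1) q(1) in auto)
  then have "L = span2 (p1 *s x1 + p2 *s y1) (q1 *s x2 + q2 *s y2)" using line_eq_span2[OF L(1)] p(2) q(2) by blast
  then obtain k1 k2 where "s *s (x1 + x2) + r *s (y1 + y2) = k1 *s (p1 *s x1 + p2 *s y1) + k2 *s (q1 *s x2 + q2 *s y2)"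
    using o(2) by (metis span2E)
  then have "s *s x1 + r *s y1 + s *s x2 + r *s y2 = (k1 * p1) *s x1 + (k1 * p2) *s y1 + (k2 * q1) *s x2 + (k2 * q2) *s y2"
    by (simp add: cart_eq algebra_simps)
  from basis4_coords_eq[OF basis this] have coords: "s = k1 * p1" "r = k1 * p2" "s = k2 * q1" "r = k2 * q2" by auto
  have "s *s x1 + r *s y1 = k1 *s (p1 *s x1 + p2 *s y1)" unfolding coords(1,2) by (simp add: cart_eq algebra_simps)
  moreover have "s *s x2 + r *s y2 = k2 *s (q1 *s x2 + q2 *s y2)" unfolding coords(3,4) by (simp add: cart_eq algebra_simps)
  ultimately have in_L: "s *s x1 + r *s y1 \<in> L" "s *s x2 + r *s y2 \<in> L" using line_scale[OF L(1)] p(2) q(2) by metis+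
  note indep = basis4_indep2_combinations[OF basis]
  show ?thesis
  proof (cases "s = 0")
    case True
    then have "r \<noteq> 0" using o(1) by auto
    then have "y1 = (1/r) *s (s *s x1 + r *s y1)" "y2 = (1/r) *s (s *s x2 + r *s y2)" using True by simp_all
    then have "y1 \<in> L" "y2 \<in> L" using line_scale[OF L(1)] in_L by metis+
    then show ?thesis using line_eq_span2[OF L(1)] indep[of 0 1 0 1] by simp
  next
    case False
    then have "x1 + (r/s) *s y1 = (1/s) *s (s *s x1 + r *s y1)" "x2 + (r/s) *s y2 = (1/s) *s (s *s x2 + r *s y2)"
      by (simp_all add: cart_eq field_simps)
    then have "x1 + (r/s) *s y1 \<in> L" "x2 + (r/s) *s y2 \<in> L" using line_scale[OF L(1)] in_L by metis+
    then show ?thesis using line_eq_span2[OF L(1)] indep[of 1 "r/s" 1 "r/s"] by auto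
  qed
qed

lemma (in surface_line) regulus_not_in_surface: "\<exists>t. form_along d c (e + t *s g1) (f + t *s g2) \<noteq> 0"
proof (rule ccontr)
  assume "\<not> ?thesis"
  then have "poly (form_along d c (e + t *s g1) (f + t *s g2)) z = 0" for t z by simp
  then have zero: "form_at d c ((e + t *s g1) + z *s (f + t *s g2)) = 0" for t z by (simp add: poly_form_at)
  have "polar1 d c (point z) (g1 + z *s g2) = 0" for z
  proof -
    have "form_at d c (point z + t *s (g1 + z *s g2)) = 0" for t
      using zero[of t z] by (simp add: algebra_simps vec.scale_right_distrib)
    then have "form_along d c (point z) (g1 + z *s g2) = 0"
      by (intro poly_eq_0I) (simp add: poly_form_at)
    then show ?thesis by (rule polar_eq_0_if_form_along_eq_0(1)[OF homogeneous])
  qed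
  then have "g1 \<in> span2 e f" using linear_tangent_field_in_line(1)[of "{}" g1 g2] by simp
  then obtain s t where "g1 = s *s e + t *s f" by (rule span2E)
  then have "s *s e + t *s f + (-1) *s g1 + 0 *s g2 = 0" by simp
  from basis4_zero[OF basis this] show False by simp
qed

lemma (in surface) card_transversals_of_skew_triple_le:
  assumes m: "m1 \<in> lines_in d c" "m2 \<in> lines_in d c" "m3 \<in> lines_in d c" "\<not> meets m1 m2" "\<not> meets m1 m3" "\<not> meets m2 m3"
    and M: "M \<subseteq> lines_in d c" "\<And>L. L \<in> M \<Longrightarrow> meets L m1 \<and> meets L m2 \<and> meets L m3"
  shows "card M \<le> d + 1"
proof -
  obtain x1 y1 x2 y2 where basis: "basis4 x1 y1 x2 y2" and span: "m1 = span2 x1 y1" "m2 = span2 x2 y2" "m3 = span2 (x1 + x2) (y1 + y2)"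
    using obtain_regulus_basis[of m1 m2 m3] m lines_in_is_line by metis
  have "form_at d c (s *s x1 + t *s y1) = 0" for s t using m(1) span2I unfolding span(1) lines_in_def by blast
  then interpret surface_line d c x1 y1 x2 y2
    by unfold_locales (use basis in auto)
  obtain t where nonzero: "form_along d c (x1 + t *s x2) (y1 + t *s y2) \<noteq> 0" using regulus_not_in_surface by blast
  define P where "P = form_along d c (x1 + t *s x2) (y1 + t *s y2)"
  let ?T = "insert (span2 y1 y2) ((\<lambda>z. span2 (x1 + z *s y1) (x2 + z *s y2)) ` {z. poly P z = 0})"
  have "L \<in> ?T" if L: "L \<in> M" for L
  proof -
    have "form_at d c ((x1 + t *s x2) + z *s (y1 + t *s y2)) = 0" if "L = span2 (x1 + z *s y1) (x2 + z *s y2)" for z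
    proof -
      have "(x1 + t *s x2) + z *s (y1 + t *s y2) = 1 *s (x1 + z *s y1) + t *s (x2 + z *s y2)" by (simp add: cart_eq algebra_simps)
      then have "(x1 + t *s x2) + z *s (y1 + t *s y2) \<in> L" unfolding that using span2I by metis
      then show ?thesis using M(1) L by (auto simp: lines_in_def)
    qed
    then have "poly P z = 0" if "L = span2 (x1 + z *s y1) (x2 + z *s y2)" for z using that by (simp add: P_def poly_form_at)
    then show ?thesis
      using transversal_of_regulus[OF basis lines_in_is_line] M L span by blast
  qed
  then have "card M \<le> card ?T"
    using poly_roots_finite nonzero by (intro card_mono) (auto simp: P_def)
  also have "\<dots> \<le> Suc (card ((\<lambda>z. span2 (x1 + z *s y1) (x2 + z *s y2)) ` {z. poly P z = 0}))" by (rule card_insert_le_m1) simp_all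
  also have "\<dots> \<le> Suc (card {z. poly P z = 0})" using card_image_le poly_roots_finite nonzero by (auto simp: P_def)
  also have "\<dots> \<le> d + 1"
    using card_poly_roots_bound[of P] nonzero top_coeff_form_along[of d c "x1 + t *s x2" "y1 + t *s y2"]
    by (simp add: P_def top_coeff_def)
  finally show ?thesis .
qed

section \<open>Irreducibility and plane sections\<close>

context comm_semiring_hom
begin

lemma eval_poly_pCons: "eval_poly hom (pCons a p) x = hom a + x * eval_poly hom p x"
  by (simp add: eval_poly_def hom_distribs)
lemma eval_poly_1: "eval_poly hom 1 x = 1"
  by (simp add: eval_poly_def)

end

lemma (in comm_ring_hom) eval_poly_mult: "eval_poly hom (p * q) x = eval_poly hom p x * eval_poly hom q x"
proof -
  interpret m: map_poly_comm_ring_hom hom ..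
  show ?thesis by (simp add: eval_poly_def m.hom_mult)
qed
lemma (in comm_ring_hom) eval_poly_hom: "comm_ring_hom (\<lambda>p. eval_poly hom p x)"
  by unfold_locales (simp_all add: eval_poly_1 eval_poly_mult)

lemma hom_eval_poly:
  assumes "comm_ring_hom h" "comm_ring_hom \<kappa>"
  shows "h (eval_poly \<kappa> p x) = eval_poly (\<lambda>a. h (\<kappa> a)) p (h x)"
proof -
  interpret h: comm_ring_hom h by fact
  interpret \<kappa>: comm_ring_hom \<kappa> by fact
  interpret h\<kappa>: comm_ring_hom "\<lambda>a. h (\<kappa> a)" by unfold_locales (simp_all add: hom_distribs)
  show ?thesis
    by (induction p) (simp_all add: \<kappa>.eval_poly_pCons h\<kappa>.eval_poly_pCons h.hom_add h.hom_mult)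
qed

definition eval3 :: "('a::comm_ring_1 \<Rightarrow> 'b::comm_ring_1) \<Rightarrow> 'b \<Rightarrow> 'b \<Rightarrow> 'b \<Rightarrow> 'a poly poly poly \<Rightarrow> 'b" where
  "eval3 \<kappa> x y z = (\<lambda>P. eval_poly (\<lambda>Q. eval_poly (\<lambda>q. eval_poly \<kappa> q x) Q y) P z)"

text \<open>The affine equation on x1 = 1, in K[x2][x3][x4].\<close>
definition dehom :: "nat \<Rightarrow> 'a::comm_ring_1 form4 \<Rightarrow> 'a poly poly poly" where
  "dehom d c = form_at d (\<lambda>m. [:[:[:c m:]:]:]) (vec4 1 [:[:[:0,1:]:]:] [:[:0,1:]:] [:0,1:])"

context comm_ring_hom
begin

lemma eval3_hom: "comm_ring_hom (eval3 hom x y z)"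
  unfolding eval3_def by (intro comm_ring_hom.eval_poly_hom eval_poly_hom)

lemma eval3_simps: "eval3 hom x y z [:[:[:r:]:]:] = hom r" "eval3 hom x y z [:[:[:0,1:]:]:] = x"
  "eval3 hom x y z [:[:0,1:]:] = y" "eval3 hom x y z [:0,1:] = z" "eval3 hom x y z 1 = 1"
proof -
  interpret h1: comm_ring_hom "\<lambda>q. eval_poly hom q x" by (rule eval_poly_hom)
  interpret h2: comm_ring_hom "\<lambda>Q. eval_poly (\<lambda>q. eval_poly hom q x) Q y" by (rule h1.eval_poly_hom)
  show "eval3 hom x y z [:[:[:r:]:]:] = hom r" "eval3 hom x y z [:[:[:0,1:]:]:] = x"
    "eval3 hom x y z [:[:0,1:]:] = y" "eval3 hom x y z [:0,1:] = z" "eval3 hom x y z 1 = 1"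
    by (simp_all add: eval3_def eval_poly_pCons h1.eval_poly_pCons h2.eval_poly_pCons eval_poly_1 h1.eval_poly_1 h2.eval_poly_1)
qed

lemma eval3_dehom: "eval3 hom x y z (dehom d c) = form_at d (\<lambda>m. hom (c m)) (vec4 1 x y z)"
proof -
  have "map_coords (eval3 hom x y z) (vec4 1 [:[:[:0,1:]:]:] [:[:0,1:]:] [:0,1:]) = vec4 1 x y z"
    by (rule vec4_eqI) (simp_all only: map_coords_nth vec4_nth eval3_simps)
  then show ?thesis unfolding dehom_def comm_ring_hom.form_at_hom[OF eval3_hom] by (simp add: eval3_simps)
qed

lemma hom_eval3:
  assumes "comm_ring_hom \<kappa>"
  shows "hom (eval3 \<kappa> x y z P) = eval3 (\<lambda>a. hom (\<kappa> a)) (hom x) (hom y) (hom z) P"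
proof -
  note inner = comm_ring_hom.eval_poly_hom[OF assms]
  show ?thesis
    unfolding eval3_def hom_eval_poly[OF comm_ring_hom_axioms comm_ring_hom.eval_poly_hom[OF inner]]
      hom_eval_poly[OF comm_ring_hom_axioms inner] hom_eval_poly[OF comm_ring_hom_axioms assms] ..
qed

end

lemma id_hom: "comm_ring_hom (\<lambda>a::'a::comm_ring_1. a)"
  by unfold_locales auto
lemma const2_hom: "comm_ring_hom (\<lambda>a::'a::comm_ring_1. [:[:a:]:])"
  by unfold_locales auto

lemma eval3_ext:
  fixes P :: "'a::alg_closed_field poly poly poly"
  assumes "\<And>x y z. eval3 (\<lambda>a. a) x y z P = k"
  shows "P = [:[:[:k:]:]:]"
proof -
  interpret e: comm_ring_hom "eval3 (\<lambda>a::'a. a) x y z" for x y z by (rule comm_ring_hom.eval3_hom[OF id_hom])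
  define R where "R = P - [:[:[:k:]:]:]"
  have zero: "eval3 (\<lambda>a. a) x y z R = 0" for x y z
    unfolding R_def e.hom_minus assms by (simp add: comm_ring_hom.eval3_simps[OF id_hom])
  have eval_id: "eval_poly (\<lambda>a. a) q x = poly q x" for q and x :: 'a by (simp add: eval_poly_def map_poly_idI)
  have "coeff (coeff R l) m = 0" for l m
  proof (rule poly_eq_0I)
    fix x
    have "map_poly (\<lambda>Q. poly (map_poly (\<lambda>q. poly q x) Q) y) R = 0" for y
      by (rule poly_eq_0I) (use zero[of x y] in \<open>simp add: eval3_def eval_id eval_poly_def\<close>)
    then have "coeff (map_poly (\<lambda>Q. poly (map_poly (\<lambda>q. poly q x) Q) y) R) l = 0" for y by simp
    then have "map_poly (\<lambda>q. poly q x) (coeff R l) = 0" by (intro poly_eq_0I) (simp add: coeff_map_poly)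
    then have "coeff (map_poly (\<lambda>q. poly q x) (coeff R l)) m = 0" by simp
    then show "poly (coeff (coeff R l) m) x = 0" by (simp add: coeff_map_poly)
  qed
  then have "R = 0" by (intro poly_eqI) simp
  then show ?thesis by (simp add: R_def)
qed

lemma obtain_pseudo_gcd:
  fixes f g :: "'b::idom poly"
  assumes "f \<noteq> 0"
  obtains a b a1 q1 a2 q2 where "a * f + b * g \<noteq> 0"
    "a1 \<noteq> 0" "smult a1 f = (a * f + b * g) * q1" "a2 \<noteq> 0" "smult a2 g = (a * f + b * g) * q2"
proof -
  define I where "I = {a * f + b * g | a b. True}"
  have "1 * f + 0 * g \<in> I" "0 * f + 1 * g \<in> I" unfolding I_def by blast+
  then have f: "f \<in> I" and g: "g \<in> I" by simp_all
  obtain m where m: "m \<in> I" "m \<noteq> 0" and least: "\<And>h. h \<in> I \<Longrightarrow> h \<noteq> 0 \<Longrightarrow> degree m \<le> degree h"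
    using f assms ex_has_least_nat[of "\<lambda>h. h \<in> I \<and> h \<noteq> 0" f degree] by blast
  have ideal: "h * k + h' * k' \<in> I" if h: "h \<in> I" "h' \<in> I" for h h' k k'
  proof -
    obtain a b a' b' where "h = a * f + b * g" "h' = a' * f + b' * g" using h unfolding I_def by blast
    then have "h * k + h' * k' = (a * k + a' * k') * f + (b * k + b' * k') * g" by (simp add: algebra_simps)
    then show ?thesis unfolding I_def by blast
  qed
  have pseudo_dvd: "\<exists>a q. a \<noteq> 0 \<and> smult a h = m * q" if "h \<in> I" for h
  proof -
    obtain a q where aq: "a \<noteq> 0" "smult a h = m * q + pseudo_mod h m" using pseudo_mod(1)[OF m(2), of h] by blast
    have "pseudo_mod h m = h * [:a:] + m * (- q)" using aq(2) by (simp add: algebra_simps)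
    then have "pseudo_mod h m \<in> I" using ideal[OF that m(1)] by metis
    then have "pseudo_mod h m = 0" using least pseudo_mod(2)[OF m(2), of h] by (metis not_less)
    then show ?thesis using aq by auto
  qed
  show ?thesis using pseudo_dvd[OF f] pseudo_dvd[OF g] m that unfolding I_def by blast
qed

lemma obtain_elimination:
  fixes f g :: "'b::idom poly"
  assumes prime: "prime_elem f" and not_dvd: "\<not> f dvd g"
  obtains a b r where "r \<noteq> 0" "[:r:] = a * f + b * g"
proof -
  have "f \<noteq> 0" using prime by (simp add: prime_elem_def)
  obtain a b a1 q1 a2 q2 where m: "a * f + b * g \<noteq> 0" and f: "a1 \<noteq> 0" "smult a1 f = (a * f + b * g) * q1"
    and g: "a2 \<noteq> 0" "smult a2 g = (a * f + b * g) * q2"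
    using obtain_pseudo_gcd[OF \<open>f \<noteq> 0\<close>] by blast
  define m where "m = a * f + b * g"
  have "f dvd m * q1" using f(2) unfolding m_def by (metis dvd_refl dvd_smult)
  then consider "f dvd m" | "f dvd q1" using prime by (metis prime_elem_dvd_multD)
  then have "degree f = 0 \<or> degree m = 0"
  proof cases
    case 1
    then have "f dvd [:a2:] * g" using g(2) unfolding m_def by simp
    then have "f dvd [:a2:]" using prime not_dvd by (metis prime_elem_dvd_multD)
    then have "degree f \<le> degree [:a2:]" using dvd_imp_degree_le g(1) by (metis pCons_eq_0_iff)
    then show ?thesis by simp
  next
    case 2
    then obtain k where "q1 = f * k" by blast
    then have "f * [:a1:] = f * (m * k)" using f(2) unfolding m_def by (simp add: algebra_simps)
    then have "[:a1:] = m * k" using \<open>f \<noteq> 0\<close> by (metis mult_left_cancel)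
    then have "degree m \<le> degree [:a1:]" using dvd_imp_degree_le f(1) by (metis dvd_triv_left pCons_eq_0_iff)
    then show ?thesis by simp
  qed
  then show ?thesis
  proof
    assume "degree f = 0"
    then obtain r where "f = [:r:]" by (metis degree_eq_zeroE)
    then show ?thesis using that[of r 1 0] \<open>f \<noteq> 0\<close> by auto
  next
    assume "degree m = 0"
    then obtain r where "m = [:r:]" by (metis degree_eq_zeroE)
    then show ?thesis using that[of r a b] m unfolding m_def by auto
  qed
qed

locale affine_chart = surface_line d c a b "axis 3 1" "axis 4 1"
  for d :: nat and c :: "'a::alg_closed_field form4" and a b :: "'a^4" +
  assumes ab_coords: "a$1 = 1" "a$2 = 0" "b$1 = 0" "b$2 = 1"
begin

abbreviation on_line where "on_line \<equiv> eval3 (\<lambda>k. [:k:]) [:0,1:] [:a$3,b$3:] [:a$4,b$4:]"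
text \<open>Restriction to the points a + s b + t (0,0,p,q), as a polynomial in t over K[s].\<close>
abbreviation on_plane where
  "on_plane p q \<equiv> eval3 (\<lambda>k. [:[:k:]:]) [:[:0,1:]:] [:[:a$3,b$3:],[:p:]:] [:[:a$4,b$4:],[:q:]:]"
abbreviation on_ray :: "'a^3 \<Rightarrow> 'a poly poly poly \<Rightarrow> 'a poly" where
  "on_ray v \<equiv> eval3 (\<lambda>k. [:k:]) [:0, v$1:] [:a$3, v$2:] [:a$4, v$3:]"

sublocale line: comm_ring_hom on_line
  by (rule comm_ring_hom.eval3_hom[OF const_poly_hom])
sublocale plane: comm_ring_hom "on_plane p q" for p q
  by (rule comm_ring_hom.eval3_hom[OF const2_hom])
sublocale ray: comm_ring_hom "on_ray v" for v
  by (rule comm_ring_hom.eval3_hom[OF const_poly_hom])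
sublocale eval: comm_ring_hom "eval3 (\<lambda>k::'a. k) x y z" for x y z
  by (rule comm_ring_hom.eval3_hom[OF id_hom])

lemma eval_dehom: "eval3 (\<lambda>k. k) x y z (dehom n \<phi>) = form_at n \<phi> (vec4 1 x y z)"
  by (rule comm_ring_hom.eval3_dehom[OF id_hom])

lemma dehom_nonzero: "dehom d c \<noteq> 0"
proof
  assume "dehom d c = 0"
  then have zero: "form_at d c (vec4 1 x y z) = 0" for x y z using eval_dehom[of x y z d c] by simp
  have affine: "form_at d c x = 0" if "x$1 \<noteq> 0" for x
  proof -
    have "x = x$1 *s vec4 1 (x$2 / x$1) (x$3 / x$1) (x$4 / x$1)" by (rule vec4_eqI) (use that in simp_all)
    then show ?thesis using zero form_at_scale by (metis mult_zero_right)
  qed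
  have "a \<noteq> 0" using ab_coords by auto
  then obtain v where v: "polar1 d c a v \<noteq> 0" using smooth_point form_at_point(1)[of 0] by auto
  have "form_along d c a v = 0"
  proof (rule form_along_eq_0I)
    show "finite {t. poly [:1, v$1:] t = 0}" by (rule poly_roots_finite) simp
  qed (rule affine, simp add: ab_coords)
  then show False using polar_eq_0_if_form_along_eq_0(1)[OF homogeneous] v by blast
qed

lemma on_plane_dehom: "on_plane p q (dehom d c) = form_along d (const_form c) (param_line a b) (const_vec (vec4 0 0 p q))"
proof -
  have "vec4 1 [:[:0,1:]:] [:[:a$3,b$3:],[:p:]:] [:[:a$4,b$4:],[:q:]:] = param_line (param_line a b) (const_vec (vec4 0 0 p q))"
    by (rule vec4_eqI) (simp_all add: ab_coords)
  then show ?thesis unfolding comm_ring_hom.eval3_dehom[OF const2_hom] by simp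
qed

lemma coeff_on_plane_dehom: "coeff (on_plane p q (dehom d c)) 0 = 0" "coeff (on_plane p q (dehom d c)) 1 = smult p grad1 + smult q grad2"
proof -
  note homogeneous_const = homogeneous_const_form[OF homogeneous]
  show "coeff (on_plane p q (dehom d c)) 0 = 0"
    unfolding on_plane_dehom coeff_form_along_0[OF homogeneous_const] by (rule form_along_eq_0)
  have "const_vec (vec4 0 0 p q) = [:p:] *s const_vec (axis 3 1) + [:q:] *s const_vec (axis 4 1)"
    by (rule vec4_eqI) (simp_all add: axis_def)
  then show "coeff (on_plane p q (dehom d c)) 1 = smult p grad1 + smult q grad2"
    unfolding on_plane_dehom coeff_form_along_1[OF homogeneous_const] by (simp add: polar_linear grad1_def grad2_def)
qed

lemma coeff_on_plane_0: "coeff (on_plane p q P) 0 = on_line P"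
  unfolding poly_0_coeff_0[symmetric] poly_hom.hom_eval3[OF const2_hom] by simp

lemma poly_on_ray: "poly (on_ray v P) s = eval3 (\<lambda>k. k) (s * v$1) (a$3 + s * v$2) (a$4 + s * v$3) P"
  unfolding poly_hom.hom_eval3[OF const_poly_hom] by simp

lemma poly_on_lines_coeff_on_ray: "poly_on_lines (\<lambda>v. coeff (on_ray v P) M)"
  unfolding poly_on_lines_def
proof (intro allI)
  fix v w :: "'a^3"
  define Q where "Q = eval3 (\<lambda>k::'a. [:[:k:]:]) [:0, [:v$1, w$1:]:] [:[:a$3:], [:v$2, w$2:]:] [:[:a$4:], [:v$3, w$3:]:] P"
  have "map_poly (\<lambda>p. poly p t) Q = on_ray (v + t *s w) P" for t
  proof -
    interpret m: map_poly_comm_ring_hom "\<lambda>p::'a poly. poly p t" ..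
    show ?thesis unfolding Q_def m.hom_eval3[OF const2_hom] by (simp add: Polynomial.map_poly_pCons)
  qed
  then have "coeff (on_ray (v + t *s w) P) M = poly (coeff Q M) t" for t by (metis coeff_map_poly poly_0)
  then show "\<exists>R. \<forall>t. coeff (on_ray (v + t *s w) P) M = poly R t" by blast
qed

lemma poly_on_lines_on_ray_1: "poly_on_lines (\<lambda>v. poly (on_ray v P) 1)"
  unfolding poly_on_lines_def
proof (intro allI)
  fix v w :: "'a^3"
  define Q where "Q = eval3 (\<lambda>k::'a. [:k:]) [:v$1, w$1:] [:a$3 + v$2, w$2:] [:a$4 + v$3, w$3:] P"
  have "poly (on_ray (v + t *s w) P) 1 = poly Q t" for t
    unfolding Q_def poly_hom.hom_eval3[OF const_poly_hom] by (simp add: algebra_simps)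
  then show "\<exists>R. \<forall>t. poly (on_ray (v + t *s w) P) 1 = poly R t" by blast
qed

lemma eq_const_if_on_rays_const:
  assumes "\<And>v. poly (on_ray v P) 1 = k"
  shows "P = [:[:[:k:]:]:]"
proof (rule eval3_ext)
  fix x y z
  show "eval3 (\<lambda>k. k) x y z P = k"
    using assms[of "vector [x, y - a$3, z - a$4]"] unfolding poly_on_ray by (simp add: vector_3)
qed

lemma degree_on_ray_dehom: "degree (on_ray v (dehom d c)) \<le> d"
proof -
  let ?x = "vec4 1 0 (a$3) (a$4)" and ?w = "vec4 0 (v$1) (v$2) (v$3)"
  have "vec4 1 [:0, v$1:] [:a$3, v$2:] [:a$4, v$3:] = param_line ?x ?w" by (rule vec4_eqI) simp_all
  then have "on_ray v (dehom d c) = form_along d c ?x ?w" unfolding comm_ring_hom.eval3_dehom[OF const_poly_hom] by simp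
  then show ?thesis using top_coeff_form_along[of d c ?x ?w] by (simp add: top_coeff_def)
qed

context
  fixes F G
  assumes factors: "dehom d c = F * G" and F_zero: "on_line F = 0"
begin

lemma coeff_on_plane_factor: "smult p grad1 + smult q grad2 = coeff (on_plane p q F) 1 * on_line G"
proof -
  have "coeff (on_plane p q (dehom d c)) 1
      = coeff (on_plane p q F) 0 * coeff (on_plane p q G) 1 + coeff (on_plane p q F) 1 * coeff (on_plane p q G) 0"
    unfolding factors plane.hom_mult by (simp add: coeff_mult)
  then show ?thesis unfolding coeff_on_plane_dehom coeff_on_plane_0 F_zero by simp
qed

lemma obtain_on_plane_factor_top_coeff:
  obtains p q where "coeff (coeff (on_plane p q F) 1) (d-1) \<noteq> 0"
proof -
  have "poly (on_line G) r \<noteq> 0" for r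
  proof
    assume zero: "poly (on_line G) r = 0"
    have "poly grad1 r = 0" using arg_cong[OF coeff_on_plane_factor[of 1 0], of "\<lambda>p. poly p r"] zero by simp
    moreover have "poly grad2 r = 0" using arg_cong[OF coeff_on_plane_factor[of 0 1], of "\<lambda>p. poly p r"] zero by simp
    ultimately show False using grad_no_common_root by blast
  qed
  then have "degree (on_line G) = 0" using alg_closed_imp_poly_has_root by blast
  then obtain k where k: "on_line G = [:k:]" by (metis degree_eq_zeroE)
  have "coeff (smult 1 grad1 + smult 0 grad2) (d-1) \<noteq> 0 \<or> coeff (smult 0 grad1 + smult 1 grad2) (d-1) \<noteq> 0"
    using top_coeff_grad_nonzero by (simp del: One_nat_def)
  then show ?thesis using that[of 1 0] that[of 0 1] unfolding coeff_on_plane_factor k by auto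
qed

lemma on_ray_factor_top_coeff: "\<exists>v. coeff (on_ray v F) d \<noteq> 0"
proof -
  obtain p q where top: "coeff (coeff (on_plane p q F) 1) (d-1) \<noteq> 0" by (rule obtain_on_plane_factor_top_coeff)
  define h where "h = on_plane p q F"
  define R where "R = (\<Sum>j\<le>d. monom (coeff (coeff h j) (d - j)) j)"
  have "coeff (on_ray (vector [1, b$3 + t * p, b$4 + t * q]) F) d = poly R t" for t
  proof -
    have "on_ray (vector [1, b$3 + t * p, b$4 + t * q]) F = poly h [:0,t:]"
      unfolding h_def poly_hom.hom_eval3[OF const2_hom] by (simp add: vector_3 algebra_simps)
    then show ?thesis by (simp add: coeff_poly_at_linear R_def poly_sum poly_monom)
  qed
  moreover have "coeff R 1 \<noteq> 0" unfolding R_def coeff_sum using top degree_ge_3 by (simp add: h_def)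
  then have "R \<noteq> 0" by auto
  ultimately show ?thesis using poly_eq_0I[of R] by metis
qed

theorem cofactor_dvd_1: "G dvd 1"
proof (rule ccontr)
  assume not_unit: "\<not> G dvd 1"
  define k where "k = eval3 (\<lambda>k. k) 0 (a$3) (a$4) G"
  have nonconst: "\<exists>v. poly (on_ray v G) 1 - k \<noteq> 0"
  proof (rule ccontr)
    assume "\<not> ?thesis"
    then have G: "G = [:[:[:k:]:]:]" by (intro eq_const_if_on_rays_const) simp
    have "G \<noteq> 0" using dehom_nonzero factors by auto
    then have "k \<noteq> 0" using G by (metis pCons_0_0)
    then have "[:[:[:k:]:]:] * [:[:[:1 / k:]:]:] = 1" by simp
    then have "G * [:[:[:1 / k:]:]:] = 1" using G by metis
    then show False using not_unit by (metis dvd_triv_left)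
  qed
  have nonzero: "\<exists>v. poly (on_ray v (dehom d c)) 1 \<noteq> 0"
    using eq_const_if_on_rays_const[of "dehom d c" 0] dehom_nonzero by auto
  have "generic_family {\<lambda>v. coeff (on_ray v F) d, \<lambda>v. poly (on_ray v G) 1 - k, \<lambda>v. poly (on_ray v (dehom d c)) 1}"
    unfolding generic_family_def
    using on_ray_factor_top_coeff nonconst nonzero poly_on_lines_coeff_on_ray poly_on_lines_on_ray_1
      poly_on_lines_diff[OF poly_on_lines_on_ray_1 poly_on_lines_const] by auto
  from generic_point[OF this] obtain v where v: "coeff (on_ray v F) d \<noteq> 0" "poly (on_ray v G) 1 \<noteq> k" "poly (on_ray v (dehom d c)) 1 \<noteq> 0"
    by auto
  have product: "on_ray v (dehom d c) = on_ray v F * on_ray v G" unfolding factors by (rule ray.hom_mult)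
  have "degree (on_ray v F) \<ge> d" using v(1) le_degree by blast
  moreover have "degree (on_ray v G) \<ge> 1"
  proof (rule ccontr)
    assume "\<not> ?thesis"
    then obtain l where "on_ray v G = [:l:]" by (metis degree_eq_zeroE less_one not_le)
    then have "poly (on_ray v G) 1 = poly (on_ray v G) 0" by simp
    then show False using v(2) unfolding poly_on_ray k_def by simp
  qed
  moreover have "degree (on_ray v (dehom d c)) = degree (on_ray v F) + degree (on_ray v G)"
    unfolding product using v(3) product by (intro degree_mult_eq) auto
  ultimately show False using degree_on_ray_dehom[of v] by simp
qed

end

theorem prime_dehom: "prime_elem (dehom d c)"
proof -
  have "irreducible (dehom d c)"
  proof (rule irreducibleI)
    show "dehom d c \<noteq> 0" by (rule dehom_nonzero)
    have "vec4 1 0 (a$3) (a$4) = 1 *s a + 0 *s b" by (rule vec4_eqI) (simp_all add: ab_coords)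
    then have "eval3 (\<lambda>k. k) 0 (a$3) (a$4) (dehom d c) = 0" unfolding eval_dehom using on_surface by metis
    then show "\<not> dehom d c dvd 1" using eval.hom_dvd_1 by (metis dvd_0_left zero_neq_one)
    fix F G assume factors: "dehom d c = F * G"
    have "on_line (dehom d c) = 0" using coeff_on_plane_dehom(1) coeff_on_plane_0 by metis
    then have "on_line F = 0 \<or> on_line G = 0" unfolding factors line.hom_mult by simp
    then show "F dvd 1 \<or> G dvd 1"
      using cofactor_dvd_1[OF factors] cofactor_dvd_1[of G F] factors by (auto simp: mult.commute)
  qed
  then show ?thesis by simp
qed

theorem dehom_not_dvd:
  assumes \<phi>: "homogeneous n \<phi>" "\<And>s t. form_at n \<phi> (s *s a + t *s b) = 0"
    and w: "polar1 d c (point z) w = 0" "polar1 n \<phi> (point z) w \<noteq> 0"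
  shows "\<not> dehom d c dvd dehom n \<phi>"
proof
  assume "dehom d c dvd dehom n \<phi>"
  then obtain G where G: "dehom n \<phi> = dehom d c * G" by blast
  define p w' where "p = point z" and "w' = w - w$1 *s p"
  have coords: "p$1 = 1" "w'$1 = 0" by (simp_all add: p_def w'_def ab_coords)
  have "form_at n \<phi> p = 0" using \<phi>(2)[of 1 z] by (simp add: p_def)
  then have "polar1 n \<phi> p p = 0" by (simp add: euler1[OF \<phi>(1)])
  then have w': "polar1 d c p w' = 0" "polar1 n \<phi> p w' \<noteq> 0"
    using w polar1_point(7)[of z] unfolding w'_def polar1_diff polar1_scale p_def[symmetric] by simp_all
  let ?h = "eval3 (\<lambda>k. [:k:]) [:p$2, w'$2:] [:p$3, w'$3:] [:p$4, w'$4:]"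
  interpret h: comm_ring_hom ?h by (rule comm_ring_hom.eval3_hom[OF const_poly_hom])
  have "vec4 1 [:p$2, w'$2:] [:p$3, w'$3:] [:p$4, w'$4:] = param_line p w'" by (rule vec4_eqI) (simp_all add: coords)
  then have "form_along n \<phi> p w' = form_along d c p w' * ?h G"
    using arg_cong[OF G, of ?h] unfolding h.hom_mult comm_ring_hom.eval3_dehom[OF const_poly_hom] by simp
  moreover have "coeff (form_along d c p w') 0 = 0" "coeff (form_along d c p w') 1 = 0"
    unfolding coeff_form_along_0[OF homogeneous] coeff_form_along_1[OF homogeneous] using form_at_point(1) w'(1) by (simp_all add: p_def)
  ultimately have "coeff (form_along n \<phi> p w') 1 = 0" by (simp add: coeff_mult)
  then show False using w'(2) unfolding coeff_form_along_1[OF \<phi>(1)] by simp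
qed

end

lemma finite_if_all_equal:
  assumes "\<And>x y. x \<in> S \<Longrightarrow> y \<in> S \<Longrightarrow> x = y"
  shows "finite S"
proof (cases "S = {}")
  case False
  then obtain x where "x \<in> S" by blast
  then have "S \<subseteq> {x}" using assms by blast
  then show ?thesis by (rule finite_subset) simp
qed simp

context surface
begin

lemma finite_lines_through_point:
  assumes "e \<noteq> 0"
  shows "finite {L \<in> lines_in d c. e \<in> L}"
proof (rule finite_if_finite_subsets_card_bdd[THEN conjunct1])
  fix M assume "M \<subseteq> {L \<in> lines_in d c. e \<in> L}" "finite M"
  then show "card M \<le> d" using assms by (intro card_pairwise_meeting_lines_le) (auto simp: meets_def)
qed

lemma finite_vertical_lines: "finite {x. \<exists>y. \<forall>z. form_at d c (vec4 1 x y z) = 0}"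
proof (rule finite_subset)
  let ?e = "vec4 0 0 0 1 :: 'a^4"
  have e: "?e \<noteq> 0" by (metis vec4_nth(4) zero_index zero_neq_one)
  have indep: "indep2 (vec4 1 x y 0) ?e" for x y
    unfolding indep2_def
  proof (intro allI impI)
    fix s t assume "s *s vec4 1 x y 0 + t *s ?e = 0"
    from arg_cong[OF this, of "\<lambda>v. v$1"] arg_cong[OF this, of "\<lambda>v. v$4"] show "s = 0 \<and> t = 0" by simp
  qed
  show "{x. \<exists>y. \<forall>z. form_at d c (vec4 1 x y z) = 0} \<subseteq> (\<Union>L\<in>{L \<in> lines_in d c. ?e \<in> L}. {x. \<exists>y. vec4 1 x y 0 \<in> L})"
  proof clarify
    fix x y assume zero: "\<forall>z. form_at d c (vec4 1 x y z) = 0"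
    have "vec4 1 x y 0 + z *s ?e = vec4 1 x y z" for z by (rule vec4_eqI) simp_all
    then have "form_along d c (vec4 1 x y 0) ?e = 0" by (intro poly_eq_0I) (simp add: poly_form_at zero)
    then have "form_at d c v = 0" if "v \<in> span2 (vec4 1 x y 0) ?e" for v
      using that form_at_eq_0_if_form_along_eq_0 by (auto elim!: span2E)
    then have "span2 (vec4 1 x y 0) ?e \<in> lines_in d c" by (simp add: lines_in_def is_line_span2[OF indep])
    then show "x \<in> (\<Union>L\<in>{L \<in> lines_in d c. ?e \<in> L}. {x. \<exists>y. vec4 1 x y 0 \<in> L})" by (auto intro!: exI[of _ y])
  qed
  show "finite (\<Union>L\<in>{L \<in> lines_in d c. ?e \<in> L}. {x. \<exists>y. vec4 1 x y 0 \<in> L})"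
  proof (rule finite_UN_I[OF finite_lines_through_point[OF e]])
    fix L assume L: "L \<in> {L \<in> lines_in d c. ?e \<in> L}"
    have "x = x'" if "vec4 1 x y 0 \<in> L" "vec4 1 x' y' 0 \<in> L" for x y x' y'
    proof -
      have "vec4 1 x' y' 0 \<in> span2 (vec4 1 x y 0) ?e"
        using line_eq_span2[OF _ indep that(1)] L that(2) by (auto simp: lines_in_def)
      then obtain s t where st: "vec4 1 x' y' 0 = s *s vec4 1 x y 0 + t *s ?e" by (rule span2E)
      from arg_cong[OF st, of "\<lambda>v. v$1"] arg_cong[OF st, of "\<lambda>v. v$2"] show ?thesis by simp
    qed
    then show "finite {x. \<exists>y. vec4 1 x y 0 \<in> L}" by (intro finite_if_all_equal) blast
  qed
qed

end

theorem (in affine_chart) finite_plane_sections: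
  assumes "\<not> dehom d c dvd dehom n \<phi>"
  obtains S where "finite S" "\<And>x. x \<notin> S \<Longrightarrow> finite {(y,z). form_at d c (vec4 1 x y z) = 0 \<and> form_at n \<phi> (vec4 1 x y z) = 0}"
proof -
  obtain P Q r where r: "r \<noteq> 0" "[:r:] = P * dehom d c + Q * dehom n \<phi>" by (rule obtain_elimination[OF prime_dehom assms])
  define r_at where "r_at x = map_poly (\<lambda>q. poly q x) r" for x
  have root: "poly (r_at x) y = 0" if "form_at d c (vec4 1 x y z) = 0" "form_at n \<phi> (vec4 1 x y z) = 0" for x y z
  proof -
    have "eval3 (\<lambda>k. k) x y z [:r:] = 0" unfolding r(2) eval.hom_add eval.hom_mult eval_dehom using that by simp
    then show ?thesis by (simp add: eval3_def eval_poly_def Polynomial.map_poly_pCons map_poly_idI r_at_def)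
  qed
  obtain j where j: "coeff r j \<noteq> 0" using r(1) by (metis leading_coeff_0_iff)
  let ?S = "{x. poly (coeff r j) x = 0} \<union> {x. \<exists>y. \<forall>z. form_at d c (vec4 1 x y z) = 0}"
  have "finite {(y,z). form_at d c (vec4 1 x y z) = 0 \<and> form_at n \<phi> (vec4 1 x y z) = 0}" if x: "x \<notin> ?S" for x
  proof (rule finite_subset)
    show "{(y,z). form_at d c (vec4 1 x y z) = 0 \<and> form_at n \<phi> (vec4 1 x y z) = 0}
       \<subseteq> (SIGMA y:{y. poly (r_at x) y = 0}. {z. form_at d c (vec4 1 x y z) = 0})" using root by auto
    show "finite (SIGMA y:{y. poly (r_at x) y = 0}. {z. form_at d c (vec4 1 x y z) = 0})"
    proof (rule finite_SigmaI)
      have "coeff (r_at x) j \<noteq> 0" using x by (simp add: r_at_def coeff_map_poly)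
      then have "r_at x \<noteq> 0" by auto
      then show "finite {y. poly (r_at x) y = 0}" by (rule poly_roots_finite)
      fix y
      obtain z where z: "form_at d c (vec4 1 x y z) \<noteq> 0" using x by blast
      have "vec4 1 x y 0 + t *s vec4 0 0 0 1 = vec4 1 x y t" for t by (rule vec4_eqI) simp_all
      then have form_value: "poly (form_along d c (vec4 1 x y 0) (vec4 0 0 0 1)) t = form_at d c (vec4 1 x y t)" for t
        by (simp add: poly_form_at)
      then have "form_along d c (vec4 1 x y 0) (vec4 0 0 0 1) \<noteq> 0" using z by (metis poly_0)
      then show "finite {z. form_at d c (vec4 1 x y z) = 0}" unfolding form_value[symmetric] by (rule poly_roots_finite)
    qed
  qed
  moreover have "finite ?S" using poly_roots_finite[OF j] finite_vertical_lines by simp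
  ultimately show ?thesis by (rule that[rotated])
qed

section \<open>Quadrics through coordinate lines\<close>

abbreviation edge :: "4 \<Rightarrow> 4 \<Rightarrow> ('a::field^4) set" where "edge i j \<equiv> span2 (axis i 1) (axis j 1)"
definition net_edges :: "('a::field^4) set set" where "net_edges = {edge 1 2, edge 3 4, edge 1 3}"

text \<open>The quadrics containing the three net edges form a net parametrised by \<open>v\<close>.\<close>
definition net_form :: "'a::field^3 \<Rightarrow> 'a^4 \<Rightarrow> 'a" where
  "net_form v p = v$3 * (p$2 * p$3) - v$1 * (p$1 * p$4) - v$2 * (p$2 * p$4)"
definition net_bilin :: "'a::field^3 \<Rightarrow> 'a^4 \<Rightarrow> 'a^4 \<Rightarrow> 'a" where
  "net_bilin v p q = v$3 * (p$2 * q$3 + p$3 * q$2) - v$1 * (p$1 * q$4 + p$4 * q$1) - v$2 * (p$2 * q$4 + p$4 * q$2)"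

lemma mem_edge:
  assumes "i \<noteq> j"
  shows "x \<in> edge i j \<longleftrightarrow> (\<forall>k. k \<noteq> i \<longrightarrow> k \<noteq> j \<longrightarrow> x$k = 0)"
proof
  assume "\<forall>k. k \<noteq> i \<longrightarrow> k \<noteq> j \<longrightarrow> x$k = 0"
  then have "x = x$i *s axis i 1 + x$j *s axis j 1" using assms by (auto simp: cart_eq axis_def)
  then show "x \<in> edge i j" using span2I by metis
qed (auto simp: axis_def elim: span2E)

lemma mem_net_edges:
  "x \<in> edge 1 2 \<longleftrightarrow> x$3 = 0 \<and> x$4 = 0" "x \<in> edge 3 4 \<longleftrightarrow> x$1 = 0 \<and> x$2 = 0" "x \<in> edge 1 3 \<longleftrightarrow> x$2 = 0 \<and> x$4 = 0"
  by (simp_all add: mem_edge forall_4)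

lemma net_edges_distinct:
  "(edge 1 2 :: ('a::field^4) set) \<noteq> edge 3 4" "(edge 1 2 :: ('a^4) set) \<noteq> edge 1 3" "(edge 3 4 :: ('a^4) set) \<noteq> edge 1 3"
proof -
  let ?x = "axis 2 1 :: 'a^4" and ?y = "axis 4 1 :: 'a^4"
  have "?x \<in> edge 1 2" "?x \<notin> edge 3 4" "?x \<notin> edge 1 3" "?y \<in> edge 3 4" "?y \<notin> edge 1 3"
    unfolding mem_net_edges by (simp_all add: axis_def)
  then show "(edge 1 2 :: ('a^4) set) \<noteq> edge 3 4" "(edge 1 2 :: ('a^4) set) \<noteq> edge 1 3" "(edge 3 4 :: ('a^4) set) \<noteq> edge 1 3"
    by metis+
qed

lemma indep2_axis: "i \<noteq> j \<Longrightarrow> indep2 (axis i 1) (axis j (1::'a::field) :: 'a^4)"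
  by (auto simp: indep2_def cart_eq axis_def)

lemma is_line_net_edge: "K \<in> net_edges \<Longrightarrow> is_line K"
  by (auto simp: net_edges_def intro!: is_line_span2 indep2_axis)

lemma net_edge_meets_another:
  assumes "K \<in> net_edges"
  shows "\<exists>K'\<in>net_edges. K' \<noteq> K \<and> meets K K'"
proof -
  have "axis i 1 \<noteq> (0::'a^4)" for i by (simp add: axis_eq_0_iff)
  then have "meets (edge 1 2 :: ('a^4) set) (edge 1 3)" "meets (edge 3 4 :: ('a^4) set) (edge 1 3)"
    unfolding meets_def using span2_generators(1,2) by blast+
  then show ?thesis using assms meets_sym net_edges_distinct unfolding net_edges_def by (metis insert_iff singletonD)
qed

lemma net_form_line: "net_form v (p + t *s q) = net_form v p + t * net_bilin v p q + t^2 * net_form v q"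
  unfolding net_form_def net_bilin_def by (simp add: power2_eq_square algebra_simps)

lemma poly_on_lines_net: "poly_on_lines (\<lambda>v. net_form v p)" "poly_on_lines (\<lambda>v. net_bilin v p q)"
  unfolding net_form_def net_bilin_def
  by (intro poly_on_lines_diff poly_on_lines_mult poly_on_lines_coord poly_on_lines_const)+

lemma net_form_eq_0_on_edges: "p \<in> \<Union>net_edges \<Longrightarrow> net_form v p = 0"
  by (auto simp: net_edges_def mem_net_edges net_form_def)

lemma net_form_nonzero_off_edges:
  assumes "p \<notin> \<Union>net_edges"
  shows "\<exists>v. net_form v p \<noteq> 0"
proof -
  have "p$2 * p$3 \<noteq> 0 \<or> p$1 * p$4 \<noteq> 0 \<or> p$2 * p$4 \<noteq> 0" using assms by (auto simp: net_edges_def mem_net_edges)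
  moreover have "net_form (vector [0,0,1]) p = p$2 * p$3" "net_form (vector [1,0,0]) p = - (p$1 * p$4)"
    "net_form (vector [0,1,0]) p = - (p$2 * p$4)" by (simp_all add: net_form_def vector_3)
  ultimately show ?thesis by (metis neg_equal_0_iff_equal)
qed

lemma net_bilin_nonzero:
  assumes p: "p \<notin> \<Union>net_edges" and q: "K \<in> net_edges" "q \<in> K" and unique: "\<And>K'. K' \<in> net_edges \<Longrightarrow> q \<in> K' \<Longrightarrow> K' = K"
  shows "\<exists>v. net_bilin v p q \<noteq> 0"
proof -
  have "q \<in> edge 1 2 \<and> q \<notin> edge 3 4 \<and> q \<notin> edge 1 3 \<or> q \<in> edge 3 4 \<and> q \<notin> edge 1 2 \<and> q \<notin> edge 1 3
      \<or> q \<in> edge 1 3 \<and> q \<notin> edge 1 2 \<and> q \<notin> edge 3 4"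
    using q unique net_edges_distinct unfolding net_edges_def by (metis insert_iff singletonD)
  then have "p$2 * q$3 + p$3 * q$2 \<noteq> 0 \<or> p$1 * q$4 + p$4 * q$1 \<noteq> 0 \<or> p$2 * q$4 + p$4 * q$2 \<noteq> 0"
    using p unfolding net_edges_def by (auto simp: mem_net_edges)
  moreover have "net_bilin (vector [0,0,1]) p q = p$2 * q$3 + p$3 * q$2"
    "net_bilin (vector [1,0,0]) p q = - (p$1 * q$4 + p$4 * q$1)"
    "net_bilin (vector [0,1,0]) p q = - (p$2 * q$4 + p$4 * q$2)" by (simp_all add: net_bilin_def vector_3)
  ultimately show ?thesis by (metis neg_equal_0_iff_equal)
qed

lemma net_discriminant_nonzero:
  assumes indep: "indep2 p q" and skew: "\<not> meets (span2 p q) (edge 1 3)"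
  shows "\<exists>v. (net_bilin v p q)^2 - 4 * net_form v p * net_form v q \<noteq> 0"
proof
  have zero: "s = 0 \<and> t = 0" if "s *s p + t *s q \<in> edge 1 3" for s t
    using that skew indep span2I unfolding meets_def indep2_def by blast
  have "p$2 * q$4 - p$4 * q$2 \<noteq> 0"
  proof
    assume "p$2 * q$4 - p$4 * q$2 = 0"
    then have "q$2 *s p + (- p$2) *s q \<in> edge 1 3" "q$4 *s p + (- p$4) *s q \<in> edge 1 3"
      unfolding mem_net_edges by (simp_all add: algebra_simps)
    from zero[OF this(1)] zero[OF this(2)] have "1 *s p + 0 *s q \<in> edge 1 3" unfolding mem_net_edges by simp
    from zero[OF this] show False by simp
  qed
  moreover have "(net_bilin (vector [0,1,0]) p q)^2 - 4 * net_form (vector [0,1,0]) p * net_form (vector [0,1,0]) q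
      = (p$2 * q$4 - p$4 * q$2)^2"
    by (simp add: net_bilin_def net_form_def vector_3 power2_eq_square algebra_simps)
  ultimately show "(net_bilin (vector [0,1,0]) p q)^2 - 4 * net_form (vector [0,1,0]) p * net_form (vector [0,1,0]) q \<noteq> 0" by simp
qed

definition lines_met :: "('a::field^4) set set \<Rightarrow> ('a^4) set \<Rightarrow> nat" where "lines_met E L = card {K \<in> E. meets L K}"
abbreviation edges_met :: "('a::field^4) set \<Rightarrow> nat" where "edges_met \<equiv> lines_met net_edges"

lemma obtain_param_avoiding_edges:
  assumes L: "is_line L" and few: "edges_met L \<le> 1"
  obtains (skew) a b where "indep2 a b" "L = span2 a b" "\<And>t. a + t *s b \<notin> \<Union>net_edges" "edges_met L = 0" "b \<notin> \<Union>net_edges"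
    | (incident) a b K where "indep2 a b" "L = span2 a b" "\<And>t. a + t *s b \<notin> \<Union>net_edges" "edges_met L = 1"
      "K \<in> net_edges" "b \<in> K" "\<And>K'. K' \<in> net_edges \<Longrightarrow> b \<in> K' \<Longrightarrow> K' = K"
proof -
  have finite: "finite {K \<in> net_edges. meets L K}" by (simp add: net_edges_def)
  have nonzero: "a + t *s b \<noteq> 0" "b \<noteq> 0" if "indep2 a b" for a b :: "'a^4" and t
    using indep2_nonzero[OF indep2_shift[OF that]] by blast+
  show thesis
  proof (cases "edges_met L = 0")
    case True
    obtain a b where ab: "indep2 a b" "L = span2 a b" using L unfolding is_line_def by blast
    have "x \<notin> \<Union>net_edges" if "x \<in> L" "x \<noteq> 0" for x
      using True finite that unfolding lines_met_def meets_def by auto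
    then show ?thesis using skew[OF ab _ True] nonzero[OF ab(1)] ab(2) by simp
  next
    case False
    then have one: "edges_met L = 1" using few by simp
    then obtain K where K: "{K \<in> net_edges. meets L K} = {K}" unfolding lines_met_def by (rule card_1_singletonE)
    then have "K \<in> net_edges" "meets L K" by blast+
    have unique: "K' = K" if "x \<in> L" "x \<noteq> 0" "K' \<in> net_edges" "x \<in> K'" for x K'
      using that K unfolding meets_def by blast
    obtain b where b: "b \<noteq> 0" "b \<in> L" "b \<in> K" using \<open>meets L K\<close> unfolding meets_def by blast
    obtain a where a: "indep2 b a" "a \<in> L" "L = span2 b a" by (rule line_through_point[OF L b(2,1)])
    note indep = indep2_sym[OF a(1)]
    have span: "L = span2 a b" by (rule line_eq_span2[OF L indep a(2) b(2)])
    have "a \<notin> K"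
    proof
      assume "a \<in> K"
      then have "L = K" using line_eq_span2[OF is_line_net_edge[OF \<open>K \<in> net_edges\<close>] indep] b(3) span by simp
      then show False using net_edge_meets_another[OF \<open>K \<in> net_edges\<close>] K by blast
    qed
    then have "a + t *s b \<notin> K" for t
      using line_diff[OF is_line_net_edge[OF \<open>K \<in> net_edges\<close>], of "a + t *s b" "t *s b"]
        line_scale[OF is_line_net_edge[OF \<open>K \<in> net_edges\<close>] b(3)] by fastforce
    then have "a + t *s b \<notin> \<Union>net_edges" for t
      using unique[of "a + t *s b"] nonzero(1)[OF indep] span by auto
    then show ?thesis using incident[OF indep span _ one \<open>K \<in> net_edges\<close> b(3)] unique[OF b(2,1)] by blast
  qed
qed

lemma obtain_param_with_net_roots:
  fixes L :: "('a::alg_closed_field^4) set"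
  assumes L: "is_line L" "edges_met L \<le> 1" and two: "(2::'a) \<noteq> 0"
  obtains a b F where "indep2 a b" "L = span2 a b" "\<And>t. a + t *s b \<notin> \<Union>net_edges" "generic_family F"
    "\<And>v. \<forall>f\<in>F. f v \<noteq> 0 \<Longrightarrow> \<exists>T. finite T \<and> card T = 2 - edges_met L \<and> (\<forall>t\<in>T. net_form v (a + t *s b) = 0)"
  using L
proof (cases rule: obtain_param_avoiding_edges)
  case (skew a b)
  let ?disc = "\<lambda>v. net_bilin v a b * net_bilin v a b - 4 * net_form v a * net_form v b"
  have "\<not> meets L (edge 1 3)"
    using skew(4) unfolding lines_met_def net_edges_def by (auto simp: card_eq_0_iff)
  then have "\<exists>v. ?disc v \<noteq> 0" using net_discriminant_nonzero[OF skew(1)] skew(2) unfolding power2_eq_square by blast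
  moreover have "\<exists>v. net_form v b \<noteq> 0" by (rule net_form_nonzero_off_edges[OF skew(5)])
  ultimately have generic: "generic_family {?disc, \<lambda>v. net_form v b}"
    unfolding generic_family_def
    by (auto intro!: poly_on_lines_diff poly_on_lines_mult poly_on_lines_net poly_on_lines_const)
  have "\<exists>T. finite T \<and> card T = 2 - edges_met L \<and> (\<forall>t\<in>T. net_form v (a + t *s b) = 0)"
    if v: "\<forall>f\<in>{?disc, \<lambda>v. net_form v b}. f v \<noteq> 0" for v
  proof -
    obtain T where "card T = 2" "finite T" "\<And>t. t \<in> T \<Longrightarrow> net_form v a + t * net_bilin v a b + t^2 * net_form v b = 0"
      using quadratic_two_roots[of "net_form v b" "net_bilin v a b" "net_form v a"] v two by (auto simp: power2_eq_square)
    then show ?thesis using skew(4) unfolding net_form_line by auto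
  qed
  then show ?thesis using that[OF skew(1-3) generic] by blast
next
  case (incident a b K)
  have "a \<notin> \<Union>net_edges" using incident(3)[of 0] by simp
  from net_bilin_nonzero[OF this incident(5-7)] have "\<exists>v. net_bilin v a b \<noteq> 0" .
  then have generic: "generic_family {\<lambda>v. net_bilin v a b}"
    unfolding generic_family_def by (auto intro: poly_on_lines_net)
  have "net_form v b = 0" for v using net_form_eq_0_on_edges incident(5,6) by blast
  then have "net_form v (a + (- net_form v a / net_bilin v a b) *s b) = 0" if "net_bilin v a b \<noteq> 0" for v
    unfolding net_form_line using that by simp
  then have "\<exists>T. finite T \<and> card T = 2 - edges_met L \<and> (\<forall>t\<in>T. net_form v (a + t *s b) = 0)"
    if "\<forall>f\<in>{\<lambda>v. net_bilin v a b}. f v \<noteq> 0" for v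
    using that incident(4) by (intro exI[of _ "{- net_form v a / net_bilin v a b}"]) simp
  then show ?thesis using that[OF incident(1-3) generic] by blast
qed

lemma inj_on_normalized_points:
  assumes indep: "indep2 a b" and nonzero: "\<And>t. t \<in> T \<Longrightarrow> (a + t *s b)$i \<noteq> 0"
  shows "inj_on (\<lambda>t. (1 / (a + t *s b)$i) *s (a + t *s b)) T"
proof (rule inj_onI)
  fix s t assume st: "s \<in> T" "t \<in> T" "(1 / (a + s *s b)$i) *s (a + s *s b) = (1 / (a + t *s b)$i) *s (a + t *s b)"
  define k l where "k = (a + s *s b)$i" and "l = (a + t *s b)$i"
  have "k \<noteq> 0" "l \<noteq> 0" using nonzero st(1,2) unfolding k_def l_def by blast+
  moreover have "(1/k) *s (a + s *s b) = (1/l) *s (a + t *s b)" using st(3) unfolding k_def l_def .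
  ultimately have "(l - k) *s a + (l * s - k * t) *s b = 0" by (simp add: cart_eq field_simps)
  then have "l - k = 0 \<and> l * s - k * t = 0" using indep unfolding indep2_def by blast
  then show "s = t" using \<open>l \<noteq> 0\<close> by auto
qed

lemma obtain_residual_points:
  fixes L :: "('a::alg_closed_field^4) set"
  assumes L: "is_line L" "edges_met L \<le> 1" and two: "(2::'a) \<noteq> 0"
    and X: "finite_on_line L X" "\<And>r p. r \<noteq> 0 \<Longrightarrow> p \<in> X \<Longrightarrow> r *s p \<in> X" "\<And>p. p$1 = 0 \<Longrightarrow> p \<in> X"
  obtains F where "generic_family F"
    "\<And>v. \<forall>f\<in>F. f v \<noteq> 0 \<Longrightarrow> \<exists>R\<subseteq>L - X. finite R \<and> card R = 2 - edges_met L
      \<and> (\<forall>p\<in>R. p$1 = 1 \<and> net_form v p = 0 \<and> p \<notin> \<Union>net_edges)"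
proof -
  obtain a b F where indep: "indep2 a b" and span: "L = span2 a b" and off: "\<And>t. a + t *s b \<notin> \<Union>net_edges"
    and F: "generic_family F"
    and roots: "\<And>v. \<forall>f\<in>F. f v \<noteq> 0 \<Longrightarrow> \<exists>T. finite T \<and> card T = 2 - edges_met L \<and> (\<forall>t\<in>T. net_form v (a + t *s b) = 0)"
    by (rule obtain_param_with_net_roots[OF L two]) (rule that)
  define p where "p = (\<lambda>t. (1 / (a + t *s b)$1) *s (a + t *s b))"
  let ?bad = "{t. a + t *s b \<in> X}"
  let ?G = "(\<lambda>t v. net_form v (a + t *s b)) ` ?bad"
  have "finite ?bad" using X(1) indep span unfolding finite_on_line_def by blast
  then have "generic_family ?G"
    by (rule generic_family_image) (rule poly_on_lines_net net_form_nonzero_off_edges off)+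
  then have "generic_family (F \<union> ?G)" by (rule generic_family_Un[OF F])
  moreover have "\<exists>R\<subseteq>L - X. finite R \<and> card R = 2 - edges_met L \<and> (\<forall>p\<in>R. p$1 = 1 \<and> net_form v p = 0 \<and> p \<notin> \<Union>net_edges)"
    if v: "\<forall>f\<in>F \<union> ?G. f v \<noteq> 0" for v
  proof -
    have "\<forall>f\<in>F. f v \<noteq> 0" using v by blast
    from roots[OF this] obtain T where T: "finite T" "card T = 2 - edges_met L" "\<And>t. t \<in> T \<Longrightarrow> net_form v (a + t *s b) = 0"
      by blast
    have good: "a + t *s b \<notin> X" if "t \<in> T" for t
    proof
      assume "a + t *s b \<in> X"
      then have "(\<lambda>v. net_form v (a + t *s b)) \<in> F \<union> ?G" by blast
      from v[rule_format, OF this] T(3)[OF that] show False by contradiction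
    qed
    then have nonzero: "(a + t *s b)$1 \<noteq> 0" if "t \<in> T" for t using X(3) that by blast
    have multiple: "a + t *s b = (a + t *s b)$1 *s p t" if "t \<in> T" for t using nonzero[OF that] by (simp add: p_def)
    have "inj_on p T" unfolding p_def by (rule inj_on_normalized_points[OF indep nonzero])
    have "p t \<in> L - X \<and> p t $ 1 = 1 \<and> net_form v (p t) = 0 \<and> p t \<notin> \<Union>net_edges" if t: "t \<in> T" for t
    proof -
      define k q where "k = (a + t *s b)$1" and "q = p t"
      have q: "a + t *s b = k *s q" "q = (1/k) *s (a + t *s b)" "k \<noteq> 0"
        using multiple[OF t] nonzero[OF t] by (simp_all add: k_def q_def p_def)
      have "net_form v (k *s q) = k^2 * net_form v q" by (simp add: net_form_def power2_eq_square algebra_simps)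
      moreover have "q \<in> L" unfolding q(2) span by (rule span2_scale) simp
      moreover have "q \<notin> X" using X(2)[OF q(3), of q] good[OF t] q(1) by metis
      moreover have "q \<notin> \<Union>net_edges" using off[of t] unfolding q(1) by (auto intro: line_scale is_line_net_edge)
      moreover have "q$1 = 1" using q(1,3) unfolding k_def by (metis mult_cancel_left1 vector_smult_component)
      ultimately show ?thesis using T(3)[OF t] q(1,3) by (simp add: q_def)
    qed
    then show ?thesis using T(1,2) card_image[OF \<open>inj_on p T\<close>] by (intro exI[of _ "p ` T"]) auto
  qed
  ultimately show ?thesis by (rule that)
qed

definition base_point :: "'a::comm_ring_1 \<Rightarrow> 'a^4" where "base_point x = vec4 1 x 0 0"
definition fibre_dir :: "'a::comm_ring_1^3 \<Rightarrow> 'a \<Rightarrow> 'a^4" where "fibre_dir v x = vec4 0 0 (v$1 + v$2 * x) (v$3 * x)"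

lemma fibre_dir_affine: "fibre_dir (v + t *s w) x = fibre_dir v x + t *s fibre_dir w (x::'a::field)"
  by (rule vec4_eqI) (simp_all add: fibre_dir_def algebra_simps)

lemma fibre_dir_surj:
  assumes "x \<noteq> (0::'a::field)"
  obtains v where "fibre_dir v x = vec4 0 0 \<alpha> \<beta>"
  using that[of "vector [\<alpha>, 0, \<beta> / x]"] assms by (simp add: fibre_dir_def vector_3)

lemma net_quadric_point:
  assumes v: "v$1 \<noteq> 0" "v$3 \<noteq> 0" and p: "net_form v p = 0" "p$1 = 1" "p \<notin> \<Union>net_edges"
  obtains y where "p = base_point (p$2) + y *s fibre_dir v (p$2)" "y \<noteq> 0" "p$2 \<noteq> 0"
proof -
  define x where "x = p$2"
  have ruling: "v$3 * x * p$3 = (v$1 + v$2 * x) * p$4" using p(1,2) by (simp add: net_form_def x_def algebra_simps)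
  have "x \<noteq> 0" using ruling v(1) p(3) unfolding net_edges_def x_def by (auto simp: mem_net_edges)
  define y where "y = p$4 / (v$3 * x)"
  have p4: "p$4 = y * (v$3 * x)" using v \<open>x \<noteq> 0\<close> by (simp add: y_def)
  have "v$3 * x * p$3 = v$3 * x * (y * (v$1 + v$2 * x))" unfolding ruling p4 by (simp add: algebra_simps)
  then have p3: "p$3 = y * (v$1 + v$2 * x)" using v(2) \<open>x \<noteq> 0\<close> by simp
  have "p = base_point (p$2) + y *s fibre_dir v (p$2)"
    by (rule vec4_eqI) (simp_all add: base_point_def fibre_dir_def p(2) p3[unfolded x_def] p4[unfolded x_def])
  moreover have "y \<noteq> 0" using p3 p4 p(3) unfolding net_edges_def by (auto simp: mem_net_edges)
  ultimately show ?thesis using \<open>x \<noteq> 0\<close> that unfolding x_def by blast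
qed

text \<open>Pulling back along \<open>(x, y) \<mapsto> base_point x + y *s fibre_dir v x\<close> gives a polynomial in \<open>y\<close> over \<open>K[x]\<close>.\<close>
definition base_poly :: "'a::comm_ring_1 poly^4" where "base_poly = vec4 1 [:0,1:] 0 0"
definition fibre_poly :: "'a::comm_ring_1^3 \<Rightarrow> 'a poly^4" where "fibre_poly v = vec4 0 0 [:v$1, v$2:] [:0, v$3:]"
definition pullback :: "nat \<Rightarrow> 'a::comm_ring_1 form4 \<Rightarrow> 'a^3 \<Rightarrow> 'a poly poly" where
  "pullback k f v = form_along k (const_form f) base_poly (fibre_poly v)"

lemma eval_vec_base_fibre [simp]: "eval_vec x base_poly = base_point x" "eval_vec x (fibre_poly v) = fibre_dir v x"
  by (rule vec4_eqI; simp add: base_poly_def base_point_def fibre_poly_def fibre_dir_def mult.commute)+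

lemma poly_pullback: "poly (pullback k f v) Y = form_at k (const_form f) (base_poly + Y *s fibre_poly v)"
  unfolding pullback_def by (simp add: poly_form_at)
lemma poly_poly_pullback: "poly (poly (pullback k f v) Y) x = form_at k f (base_point x + poly Y x *s fibre_dir v x)"
  by (simp add: poly_pullback poly_form_at)

lemma pullback_fibre: "map_poly (\<lambda>p. poly p x) (pullback k f v) = form_along k f (base_point x) (fibre_dir v x)"
proof -
  interpret m: map_poly_comm_ring_hom "\<lambda>p::'a poly. poly p x" ..
  have eval: "map_poly (\<lambda>p. poly p x) [:q, q':] = [:poly q x, poly q' x:]" "map_poly (\<lambda>p. poly p x) [:q:] = [:poly q x:]" for q q'
    by (simp_all add: Polynomial.map_poly_pCons)
  have "map_coords (map_poly (\<lambda>p. poly p x)) (param_line base_poly (fibre_poly v)) = param_line (eval_vec x base_poly) (eval_vec x (fibre_poly v))"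
    unfolding cart_eq by (simp only: map_coords_nth param_line_nth eval) simp
  then show ?thesis unfolding pullback_def m.form_at_hom eval by simp
qed

lemma poly_coeff_pullback: "poly (coeff (pullback k f v) j) x = coeff (form_along k f (base_point x) (fibre_dir v x)) j"
  unfolding pullback_fibre[symmetric] by (simp add: coeff_map_poly)

definition coeffs_degree_le :: "nat \<Rightarrow> 'a::comm_ring_1 poly poly \<Rightarrow> bool" where
  "coeffs_degree_le m P \<longleftrightarrow> (\<forall>j. degree (coeff P j) \<le> m)"

lemma coeffs_degree_le_mult:
  assumes "coeffs_degree_le m P" "coeffs_degree_le k Q"
  shows "coeffs_degree_le (m + k) (P * Q)"
  unfolding coeffs_degree_le_def coeff_mult
proof (intro allI degree_sum_le)
  fix j i
  have "degree (coeff P i * coeff Q (j - i)) \<le> degree (coeff P i) + degree (coeff Q (j - i))" by (rule degree_mult_le)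
  also have "\<dots> \<le> m + k" using assms unfolding coeffs_degree_le_def by (meson add_mono)
  finally show "degree (coeff P i * coeff Q (j - i)) \<le> m + k" .
qed auto

lemma coeffs_degree_le_const: "degree a \<le> m \<Longrightarrow> coeffs_degree_le m [:a:]"
  by (auto simp: coeffs_degree_le_def coeff_pCons split: nat.splits)
lemma coeffs_degree_le_power: "coeffs_degree_le m P \<Longrightarrow> coeffs_degree_le (k * m) (P ^ k)"
  by (induction k) (auto simp: coeffs_degree_le_const[of 1, unfolded one_pCons[symmetric]] intro: coeffs_degree_le_mult)

lemma coeffs_degree_le_form_at:
  assumes "\<And>i. coeffs_degree_le 1 (X$i)"
  shows "coeffs_degree_le d (form_at d (const_form (const_form c)) X)"
proof -
  have "coeffs_degree_le d ([:[:c m:]:] * monom_at m X)" if mons: "m \<in> mons d" for m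
  proof -
    obtain i j k l where m: "m = (i,j,k,l)" and d: "d = i + j + k + l" using mons by (cases m) (auto simp: mons_def)
    have "coeffs_degree_le (0 + (i*1 + j*1 + k*1 + l*1)) ([:[:c m:]:] * ((X$1)^i * (X$2)^j * (X$3)^k * (X$4)^l))"
      by (intro coeffs_degree_le_mult coeffs_degree_le_power coeffs_degree_le_const assms) simp
    then show ?thesis using m d by (simp add: monom_at_def monom_eval_def)
  qed
  then show ?thesis unfolding form_at_def coeffs_degree_le_def coeff_sum by (auto intro!: degree_sum_le)
qed

lemma coeffs_degree_le_pullback: "coeffs_degree_le k (pullback k f v)"
  unfolding pullback_def
proof (rule coeffs_degree_le_form_at)
  fix i :: 4
  have "degree (base_poly$i :: 'a poly) \<le> 1" "degree (fibre_poly v$i) \<le> 1"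
    using exhaust_4[of i] by (auto simp: base_poly_def fibre_poly_def)
  then show "coeffs_degree_le 1 (param_line base_poly (fibre_poly v) $ i)"
    by (auto simp: coeffs_degree_le_def coeff_pCons split: nat.splits simp del: One_nat_def)
qed

lemma factor_monomial:
  fixes P :: "'a::idom poly poly"
  assumes degree: "degree P \<le> D" "coeffs_degree_le k P"
    and divisible: "\<And>j. j < e \<Longrightarrow> coeff P j = 0" "\<And>i j. i < e' \<Longrightarrow> coeff (coeff P j) i = 0"
  obtains G where "P = monom (monom 1 e') e * G" "degree G \<le> D - e" "coeffs_degree_le (k - e') G"
proof -
  define G where "G = map_poly (poly_shift e') (poly_shift e P)"
  have coeff_G: "coeff (coeff G j) i = coeff (coeff P (j + e)) (i + e')" for i j
    unfolding G_def by (simp add: coeff_map_poly coeff_poly_shift poly_eq_iff add.commute)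
  have "P = monom (monom 1 e') e * G"
    unfolding poly_eq_iff coeff_monom_mult using divisible by (auto simp: poly_eq_iff coeff_monom_mult coeff_G)
  moreover have "degree G \<le> D - e"
  proof (rule degree_le, intro allI impI)
    fix j assume "j > D - e"
    then have "coeff P (j + e) = 0" using degree(1) by (intro coeff_eq_0) auto
    then show "coeff G j = 0" by (simp add: poly_eq_iff coeff_G)
  qed
  moreover have "coeffs_degree_le (k - e') G"
    unfolding coeffs_degree_le_def
  proof (intro allI degree_le impI)
    fix i j assume "i > k - e'"
    moreover have "degree (coeff P (j + e)) \<le> k" using degree(2) unfolding coeffs_degree_le_def by blast
    ultimately have "degree (coeff P (j + e)) < i + e'" by linarith
    then show "coeff (coeff G j) i = 0" unfolding coeff_G by (rule coeff_eq_0)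
  qed
  ultimately show ?thesis by (rule that)
qed

lemma obtain_reduced_pullback:
  fixes f :: "'a::alg_closed_field form4"
  assumes e: "e \<le> 1" "e' \<le> 1"
    and skew_edges: "\<And>x. e = 1 \<Longrightarrow> x \<in> edge 1 2 \<union> edge 3 4 \<Longrightarrow> form_at k f x = 0"
    and third_edge: "\<And>x. e' = 1 \<Longrightarrow> x \<in> edge 1 3 \<Longrightarrow> form_at k f x = 0"
  obtains G where "pullback k f v = monom (monom 1 e') e * G" "degree G \<le> k - 2 * e" "coeffs_degree_le (k - e') G"
proof -
  note along = poly_coeff_pullback[of k f v]
  have coeff_0: "coeff (pullback k f v) j = 0" if "j < e" for j
  proof (rule poly_eq_0I)
    fix x :: 'a
    have "base_point x \<in> edge 1 2" unfolding mem_net_edges by (simp add: base_point_def)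
    then have "poly (coeff (pullback k f v) 0) x = 0"
      using that e skew_edges poly_poly_pullback[of k f v 0 x] by (simp add: poly_0_coeff_0)
    moreover have "j = 0" using that e(1) by linarith
    ultimately show "poly (coeff (pullback k f v) j) x = 0" by simp
  qed
  have coeff_at_0: "coeff (coeff (pullback k f v) j) i = 0" if "i < e'" for i j
  proof -
    have "base_point 0 + y *s fibre_dir v 0 \<in> edge 1 3" for y unfolding mem_net_edges by (simp add: base_point_def fibre_dir_def)
    then have "form_along k f (base_point 0) (fibre_dir v 0) = 0"
      using that e third_edge by (intro poly_eq_0I) (simp add: poly_form_at)
    then have "poly (coeff (pullback k f v) j) 0 = 0" unfolding along by simp
    moreover have "i = 0" using that e(2) by linarith
    ultimately show ?thesis by (simp add: poly_0_coeff_0)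
  qed
  have "degree (pullback k f v) \<le> k - e"
  proof (rule degree_le, intro allI impI, rule poly_eq_0I)
    fix j x assume j: "j > k - e"
    have "fibre_dir v x \<in> edge 3 4" unfolding mem_net_edges by (simp add: fibre_dir_def)
    then have "e = 1 \<Longrightarrow> form_at k f (fibre_dir v x) = 0" using skew_edges by blast
    then show "poly (coeff (pullback k f v) j) x = 0"
      using top_coeff_form_along[of k f "base_point x" "fibre_dir v x"] j e coeff_eq_0
      unfolding along top_coeff_def by (cases "j = k") (fastforce simp: le_Suc_eq)+
  qed
  from factor_monomial[OF this coeffs_degree_le_pullback coeff_0 coeff_at_0] show ?thesis
    using that by (metis diff_diff_left mult_2)
qed

lemma obtain_tangent_section:
  fixes v :: "'a::alg_closed_field^3"
  assumes p: "p = base_point x + y *s fibre_dir v x" and forms: "homogeneous d c" "homogeneous n \<phi>"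
    and on: "form_at d c p = 0" "form_at n \<phi> p = 0" and transversal: "polar1 d c p (fibre_dir v x) \<noteq> 0"
    and tangent: "\<And>w. polar1 d c p w = 0 \<Longrightarrow> polar1 n \<phi> p w = 0"
  obtains Y where "poly Y x = y" "[:-x,1:]^2 dvd poly (pullback d c v) Y" "[:-x,1:]^2 dvd poly (pullback n \<phi> v) Y"
proof -
  define b where "b = vec4 0 1 (y * v$2) (y * v$3)"
  define \<eta> where "\<eta> = - polar1 d c p b / polar1 d c p (fibre_dir v x)"
  define w where "w = b + \<eta> *s fibre_dir v x"
  define Y where "Y = [:y - \<eta> * x, \<eta>:]"
  define X where "X = base_poly + Y *s fibre_poly v"
  have Y: "poly Y x = y" "pderiv Y = [:\<eta>:]" by (simp_all add: Y_def pderiv_pCons)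
  have X: "eval_vec x X = p" unfolding X_def eval_vec_simps eval_vec_base_fibre Y p ..
  have X': "eval_vec x (map_coords pderiv X) = w"
    by (rule vec4_eqI) (simp_all add: X_def base_poly_def fibre_poly_def w_def b_def fibre_dir_def
        pderiv_add pderiv_mult pderiv_pCons pderiv_smult Y algebra_simps)
  have "polar1 d c p w = 0" unfolding w_def polar_linear \<eta>_def using transversal by simp
  moreover from this have "polar1 n \<phi> p w = 0" by (rule tangent)
  moreover have "[:-x,1:]^2 dvd poly (pullback k f v) Y"
    if "homogeneous k f" "form_at k f p = 0" "polar1 k f p w = 0" for k f
    unfolding poly_pullback X_def[symmetric]
    by (rule linear_square_dvdI) (use that in \<open>simp_all add: pderiv_form_at poly_form_at poly_polar1 X X'\<close>)
  ultimately show ?thesis using that Y(1) forms on by blast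
qed

lemma pullback_fibre_nonzero:
  fixes c :: "'a::alg_closed_field form4"
  assumes "homogeneous d c" and p: "p = base_point x + y *s fibre_dir v x" "polar1 d c p (fibre_dir v x) \<noteq> 0"
  shows "map_poly (\<lambda>p. poly p x) (pullback d c v) \<noteq> 0"
proof
  assume "map_poly (\<lambda>p. poly p x) (pullback d c v) = 0"
  then have "form_along d c (base_point x) (fibre_dir v x) = 0" unfolding pullback_fibre .
  from arg_cong[OF this, of pderiv] have "poly (polar1_along d c (base_point x) (fibre_dir v x) (fibre_dir v x)) y = 0"
    unfolding pderiv_form_along[OF assms(1)] by simp
  then show False using p by (simp add: poly_polar1)
qed

section \<open>Counting points on a generic quadric\<close>

lemma finite_on_line_Un: "finite_on_line L X \<Longrightarrow> finite_on_line L Y \<Longrightarrow> finite_on_line L (X \<union> Y)"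
  unfolding finite_on_line_def by (simp add: Collect_disj_eq)

lemma finite_on_line_Union:
  assumes "finite M" "\<And>K. K \<in> M \<Longrightarrow> finite_on_line L K"
  shows "finite_on_line L (\<Union>M)"
  using assms by (induction M rule: finite_induct) (auto simp: finite_on_line_def intro: finite_on_line_Un[unfolded finite_on_line_def])

lemma finite_on_line_hyperplane:
  assumes "x \<in> L" "x$i \<noteq> 0"
  shows "finite_on_line L {p. p$i = 0}"
  unfolding finite_on_line_def
proof (intro allI impI, elim conjE)
  fix a b assume "L = span2 a b"
  then have "[:a$i, b$i:] \<noteq> 0" using assms by (auto elim!: span2E)
  from poly_roots_finite[OF this] show "finite {t. a + t *s b \<in> {p. p$i = 0}}" by simp
qed

lemma finite_on_line_other_line:
  assumes "is_line L" "is_line K" "L \<noteq> K"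
  shows "finite_on_line L K"
  unfolding finite_on_line_def
proof (intro allI impI, elim conjE)
  fix a b assume indep: "indep2 a b" and span: "L = span2 a b"
  have "s = t" if st: "a + s *s b \<in> K" "a + t *s b \<in> K" for s t
  proof -
    have "a + s *s b \<noteq> 0" using indep2_nonzero(2)[OF indep2_shift[OF indep]] by blast
    then obtain k where "a + t *s b = k *s (a + s *s b)"
      using common_points_proportional[OF assms, of "a + s *s b" "a + t *s b"] st span by auto
    then have "(1 - k) *s a + (t - k * s) *s b = 0" by (simp add: cart_eq algebra_simps)
    then have "1 - k = 0 \<and> t - k * s = 0" using indep unfolding indep2_def by blast
    then show ?thesis by auto
  qed
  then show "finite {t. a + t *s b \<in> K}" by (intro finite_if_all_equal) blast
qed

lemma not_net_edge_if_edges_met_le_1: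
  assumes "edges_met L \<le> 1"
  shows "L \<notin> net_edges"
proof
  assume L: "L \<in> net_edges"
  then obtain K where K: "K \<in> net_edges" "K \<noteq> L" "meets L K" using net_edge_meets_another by blast
  have "axis i 1 \<noteq> (0::'a^4)" for i by (simp add: axis_eq_0_iff)
  then have "meets L L" using L span2_generators(1) unfolding net_edges_def meets_def by blast
  then have "{L, K} \<subseteq> {K \<in> net_edges. meets L K}" using L K by blast
  then have "card {L, K} \<le> edges_met L" unfolding lines_met_def by (rule card_mono[rotated]) (simp add: net_edges_def)
  then show False using K(2) assms by simp
qed

lemma not_both_skew_edges_met:
  assumes "edges_met L \<le> 1"
  shows "\<not> meets L (edge 3 4) \<or> \<not> meets L (edge 1 2)"
proof (rule ccontr)
  assume "\<not> ?thesis"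
  then have "{edge 3 4, edge 1 2} \<subseteq> {K \<in> net_edges. meets L K}" by (auto simp: net_edges_def)
  then have "card {edge 3 4, edge 1 2 :: ('a^4) set} \<le> edges_met L"
    unfolding lines_met_def by (rule card_mono[rotated]) (simp add: net_edges_def)
  then show False using assms net_edges_distinct(1)[where 'a='a] by simp
qed

text \<open>A line stable under the projection from one skew edge onto the other would meet both or coincide with one of them.\<close>
lemma exists_point_projected_off_line:
  assumes L: "is_line L" and few: "edges_met L \<le> 1"
  shows "\<exists>x\<in>L. vec4 0 0 (x$3) (x$4) \<notin> L"
proof (rule ccontr)
  define proj where "proj = (\<lambda>x::'a^4. vec4 0 0 (x$3) (x$4))"
  assume "\<not> ?thesis"
  then have stable: "proj x \<in> L" "x - proj x \<in> L" if "x \<in> L" for x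
    using that line_diff[OF L] unfolding proj_def by blast+
  have edges: "proj x \<in> edge 3 4" "x - proj x \<in> edge 1 2" for x unfolding mem_net_edges by (simp_all add: proj_def)
  consider "\<And>x. x \<in> L \<Longrightarrow> proj x = 0" | "\<And>x. x \<in> L \<Longrightarrow> x - proj x = 0"
    using stable edges not_both_skew_edges_met[OF few] unfolding meets_def by metis
  then have "L \<subseteq> edge 1 2 \<or> L \<subseteq> edge 3 4"
    using edges by cases (metis diff_zero subsetI, metis eq_iff_diff_eq_0 subsetI)
  then obtain K where K: "K \<in> net_edges" "L \<subseteq> K" unfolding net_edges_def by blast
  obtain a b where ab: "indep2 a b" "L = span2 a b" using L unfolding is_line_def by blast
  then have "a \<in> K" "b \<in> K" using K(2) span2_generators(1,2) by blast+
  from line_eq_span2[OF is_line_net_edge[OF K(1)] ab(1) this] have "L \<in> net_edges" using K(1) ab(2) by simp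
  then show False using not_net_edge_if_edges_met_le_1[OF few] by blast
qed

context surface
begin

lemma finite_on_line_fibre_tangent:
  assumes L: "L \<in> lines_in d c" and few: "edges_met L \<le> 1"
  shows "finite_on_line L {p. polar1 d c p (vec4 0 0 (p$3) (p$4)) = 0}"
  unfolding finite_on_line_def
proof (intro allI impI, elim conjE)
  define proj where "proj = (\<lambda>p::'a^4. vec4 0 0 (p$3) (p$4))"
  fix a b assume indep: "indep2 a b" and span: "L = span2 a b"
  let ?Q = "polar1 d (const_form c) (param_line a b) (param_line (proj a) (proj b))"
  have proj_line: "proj (a + t *s b) = proj a + t *s proj b" for t unfolding proj_def by (rule vec4_eqI) simp_all
  have "?Q \<noteq> 0"
  proof
    assume "?Q = 0"
    then have tangent: "polar1 d c (a + t *s b) (proj a + t *s proj b) = 0" for t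
      using poly_polar1[of d c "param_line a b" "param_line (proj a) (proj b)" t] by simp
    obtain g1 g2 where "surface_line d c a b g1 g2" using line_chart indep L span by blast
    then interpret surface_line d c a b g1 g2 .
    have gen: "proj a \<in> L" "proj b \<in> L"
      unfolding span using linear_tangent_field_in_line[of "{}" "proj a" "proj b"] tangent by auto
    have "proj x \<in> L" if x: "x \<in> L" for x
    proof -
      obtain s t where "x = s *s a + t *s b" using x unfolding span by (rule span2E)
      then have "proj x = s *s proj a + t *s proj b" unfolding proj_def by (intro vec4_eqI) simp_all
      then show ?thesis using gen line_add line_scale lines_in_is_line[OF L] by metis
    qed
    then show False using exists_point_projected_off_line[OF lines_in_is_line[OF L] few] unfolding proj_def by blast
  qed
  from poly_roots_finite[OF this] show "finite {t. a + t *s b \<in> {p. polar1 d c p (vec4 0 0 (p$3) (p$4)) = 0}}"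
    by (simp add: poly_polar1 flip: proj_line) (simp add: proj_def)
qed

end

lemma obtain_coordinate_basis:
  assumes "is_line L" "\<not> meets L (edge 3 4)"
  obtains a b where "indep2 a b" "L = span2 a b" "a$1 = 1" "a$2 = 0" "b$1 = 0" "b$2 = 1"
proof -
  obtain p q where indep: "indep2 p q" and span: "L = span2 p q" using assms(1) unfolding is_line_def by blast
  define D where "D = p$1 * q$2 - p$2 * q$1"
  have zero: "s = 0 \<and> t = 0" if "s *s p + t *s q \<in> edge 3 4" for s t
    using that assms(2) indep span2I unfolding span meets_def indep2_def by blast
  have D: "D \<noteq> 0"
  proof
    assume "D = 0"
    then have "q$2 *s p + (- p$2) *s q \<in> edge 3 4" "q$1 *s p + (- p$1) *s q \<in> edge 3 4"
      unfolding mem_net_edges D_def by (simp_all add: algebra_simps)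
    from zero[OF this(1)] zero[OF this(2)] have "1 *s p + 0 *s q \<in> edge 3 4" unfolding mem_net_edges by simp
    from zero[OF this] show False by simp
  qed
  define a b where "a = (q$2/D) *s p + (- p$2/D) *s q" and "b = (- q$1/D) *s p + (p$1/D) *s q"
  have coords: "a$1 = 1" "a$2 = 0" "b$1 = 0" "b$2 = 1"
    using D unfolding a_def b_def by (simp_all add: field_simps) (simp_all add: D_def algebra_simps)
  have ab: "indep2 a b"
    unfolding indep2_def
  proof (intro allI impI)
    fix s t assume zero: "s *s a + t *s b = 0"
    from arg_cong[OF zero, of "\<lambda>v. v$1"] arg_cong[OF zero, of "\<lambda>v. v$2"] show "s = 0 \<and> t = 0" by (simp add: coords)
  qed
  moreover have "L = span2 a b"
    using line_eq_span2[OF assms(1) ab] span2I unfolding span a_def b_def by metis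
  ultimately show ?thesis using that coords by blast
qed

locale weighted_lines = surface d c for d :: nat and c :: "'a::alg_closed_field form4" +
  fixes n :: nat and \<phi> :: "'a form4" and M :: "('a^4) set set" and m :: "('a^4) set \<Rightarrow> nat"
  assumes homogeneous_form: "homogeneous n \<phi>" and finite_lines: "finite M" and lines: "M \<subseteq> lines_in d c"
    and form_zero: "\<And>L x. L \<in> M \<Longrightarrow> x \<in> L \<Longrightarrow> form_at n \<phi> x = 0"
    and weight: "\<And>L. L \<in> M \<Longrightarrow> m L = 1 \<or> m L = 2 \<and> tangential_along d c n \<phi> L"
begin

lemma is_line: "L \<in> M \<Longrightarrow> is_line L"
  using lines lines_in_is_line by blast

end

text \<open>The flags record the common factor \<open>y^e x^e'\<close> that the edges on the surface split off the pulled back forms.\<close>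
locale quadric_net = weighted_lines d c n \<phi> M m
  for d :: nat and c :: "'a::alg_closed_field form4" and n \<phi> M m +
  fixes e e' :: nat and L0 :: "('a^4) set"
  assumes flags: "e \<le> 1" "e' \<le> 1"
    and skew_edges: "\<And>x. e = 1 \<Longrightarrow> x \<in> edge 1 2 \<union> edge 3 4 \<Longrightarrow> form_at d c x = 0 \<and> form_at n \<phi> x = 0"
    and third_edge: "\<And>x. e' = 1 \<Longrightarrow> x \<in> edge 1 3 \<Longrightarrow> form_at d c x = 0 \<and> form_at n \<phi> x = 0"
    and edges_off_surface: "e = 0 \<Longrightarrow> \<exists>x\<in>edge 1 2. form_at d c x \<noteq> 0" "e = 0 \<Longrightarrow> \<exists>x\<in>edge 3 4. form_at d c x \<noteq> 0"
    and L0: "L0 \<in> lines_in d c" "\<not> meets L0 (edge 3 4)" "\<And>x. x \<in> L0 \<Longrightarrow> form_at n \<phi> x = 0" "\<not> tangential_along d c n \<phi> L0"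
    and few: "\<And>L. L \<in> M \<Longrightarrow> edges_met L \<le> 1" and affine: "\<And>L. L \<in> M \<Longrightarrow> \<exists>x\<in>L. x$1 \<noteq> 0"
begin

definition common_zeros :: "'a \<Rightarrow> ('a \<times> 'a) set" where
  "common_zeros x = {(y,z). form_at d c (vec4 1 x y z) = 0 \<and> form_at n \<phi> (vec4 1 x y z) = 0}"

lemma obtain_finite_common_zeros:
  obtains S where "finite S" "\<And>x. x \<notin> S \<Longrightarrow> finite (common_zeros x)"
proof -
  have line: "is_line L0" by (rule lines_in_is_line[OF L0(1)])
  obtain a b where indep: "indep2 a b" and span: "L0 = span2 a b" and coords: "a$1 = 1" "a$2 = 0" "b$1 = 0" "b$2 = 1"
    by (rule obtain_coordinate_basis[OF line L0(2)])
  have "basis4 a b (axis 3 1) (axis 4 1)"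
    using basis4_if_skew[OF indep indep2_axis] L0(2) span by simp
  moreover have on: "form_at d c (s *s a + t *s b) = 0" "form_at n \<phi> (s *s a + t *s b) = 0" for s t
    using L0(1,3) span span2I unfolding lines_in_def by blast+
  ultimately interpret affine_chart d c a b by unfold_locales (use coords in auto)
  let ?X = "{p. \<exists>w. polar1 d c p w = 0 \<and> polar1 n \<phi> p w \<noteq> 0}"
  obtain p q where pq: "indep2 p q" "L0 = span2 p q" "infinite {t. p + t *s q \<in> ?X}"
    using L0(4) unfolding tangential_along_def finite_on_line_def by blast
  have "finite_on_line L0 {p. p$1 = 0}" by (rule finite_on_line_hyperplane[of a]) (simp_all add: span coords)
  then have "finite {t. p + t *s q \<in> {p. p$1 = 0}}" using pq unfolding finite_on_line_def by blast
  then have "\<not> {t. p + t *s q \<in> ?X} \<subseteq> {t. p + t *s q \<in> {p. p$1 = 0}}" using pq(3) by (meson finite_subset)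
  then obtain t where t: "p + t *s q \<in> ?X" "(p + t *s q)$1 \<noteq> 0" by blast
  obtain k l where kl: "p + t *s q = k *s a + l *s b" using pq(2) span span2_generators(4) by (metis span2E)
  have "k \<noteq> 0" using t(2) unfolding kl by (simp add: coords)
  then have "p + t *s q = k *s point (l/k)" unfolding kl by (simp add: cart_eq field_simps)
  then obtain w where "polar1 d c (point (l/k)) w = 0" "polar1 n \<phi> (point (l/k)) w \<noteq> 0"
    using t(1) \<open>k \<noteq> 0\<close> by (auto simp: polar1_scale_point)
  from dehom_not_dvd[OF homogeneous_form on(2) this] show ?thesis
    by (rule finite_plane_sections) (rule that[unfolded common_zeros_def])
qed

lemma base_point_in_edge: "base_point x \<in> edge 1 2" and fibre_dir_in_edge: "fibre_dir v x \<in> edge 3 4"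
  unfolding mem_net_edges by (simp_all add: base_point_def fibre_dir_def)

lemma skew_edges_in_surface: "e = 1 \<Longrightarrow> edge 1 2 \<in> lines_in d c" "e = 1 \<Longrightarrow> edge 3 4 \<in> lines_in d c"
  using skew_edges is_line_net_edge unfolding lines_in_def net_edges_def by blast+

lemma obtain_good_fibre:
  obtains x where "x \<noteq> 0" "finite (common_zeros x)" "e = 0 \<Longrightarrow> form_at d c (base_point x) \<noteq> 0"
proof -
  obtain S where S: "finite S" "\<And>x. x \<notin> S \<Longrightarrow> finite (common_zeros x)" by (rule obtain_finite_common_zeros) (rule that)
  define Q where "Q = (if e = 0 then form_along d c (axis 1 1) (axis 2 1) else 1)"
  have "form_along d c (axis 1 1) (axis 2 1) \<noteq> 0" if "e = 0"
    using edges_off_surface(1)[OF that] form_at_eq_0_if_form_along_eq_0 by (blast elim: span2E)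
  then have "Q \<noteq> 0" by (simp add: Q_def)
  then obtain x where x: "poly Q x \<noteq> 0" "x \<notin> insert 0 S" using S(1) by (meson finite.insertI obtain_nonroot)
  have "axis 1 1 + x *s axis 2 1 = base_point x" by (rule vec4_eqI) (simp_all add: base_point_def axis_def)
  then have "form_at d c (base_point x) \<noteq> 0" if "e = 0" using x(1) that by (simp add: Q_def poly_form_at)
  then show ?thesis using that[of x] x(2) S(2) by blast
qed

definition fibre_family :: "'a \<Rightarrow> ('a^3 \<Rightarrow> 'a) set" where
  "fibre_family x = {\<lambda>v. v$1, \<lambda>v. v$3} \<union> (\<lambda>(y,z) v. y * (v$3 * x) - z * (v$1 + v$2 * x)) ` (common_zeros x - {(0,0)})
     \<union> (if e = 1 then {\<lambda>v. polar1 d c (base_point x) (fibre_dir v x), \<lambda>v. polar1 d c (fibre_dir v x) (base_point x)}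
        else {\<lambda>v. form_at d c (fibre_dir v x)})"

lemma polar1_base_fibre_nonzero:
  assumes "e = 1" "x \<noteq> 0"
  shows "\<exists>v. polar1 d c (base_point x) (fibre_dir v x) \<noteq> 0"
proof -
  have "base_point x \<noteq> 0" unfolding base_point_def by (metis vec4_nth(1) zero_index zero_neq_one)
  then obtain y where y: "polar1 d c (base_point x) y \<noteq> 0" using smooth_point skew_edges assms(1) base_point_in_edge by blast
  obtain v where v: "fibre_dir v x = vec4 0 0 (y$3) (y$4)" by (rule fibre_dir_surj[OF assms(2)])
  have "vec4 (y$1) (y$2) 0 0 \<in> edge 1 2" unfolding mem_net_edges by simp
  then have "polar1 d c (base_point x) (vec4 (y$1) (y$2) 0 0) = 0"
    by (rule polar1_eq_0_in_line[OF skew_edges_in_surface(1)[OF assms(1)] base_point_in_edge])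
  moreover have "y = vec4 (y$1) (y$2) 0 0 + fibre_dir v x" unfolding v by (rule vec4_eqI) simp_all
  ultimately show ?thesis using y by (metis polar1_add add_0)
qed

lemma polar1_fibre_base_nonzero:
  assumes "e = 1" "x \<noteq> 0"
  shows "\<exists>v. polar1 d c (fibre_dir v x) (base_point x) \<noteq> 0"
proof (rule ccontr)
  assume tangent: "\<not> ?thesis"
  obtain g1 g2 where "surface_line d c (axis 3 1) (axis 4 1) g1 g2"
    using line_chart[OF indep2_axis skew_edges_in_surface(2)[OF assms(1)]] by auto
  then interpret surface_line d c "axis 3 1" "axis 4 1" g1 g2 .
  have "polar1 d c (point t) (base_point x + t *s 0) = 0" for t
  proof -
    obtain v where "fibre_dir v x = vec4 0 0 1 t" by (rule fibre_dir_surj[OF assms(2)])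
    moreover have "point t = vec4 0 0 1 t" by (rule vec4_eqI) (simp_all add: axis_def)
    ultimately show ?thesis using tangent by simp metis
  qed
  then have "base_point x \<in> edge 3 4" by (rule linear_tangent_field_in_line(1)[of "{}"]) simp
  then show False unfolding mem_net_edges by (simp add: base_point_def)
qed

lemma generic_fibre_family:
  assumes x: "x \<noteq> 0" "finite (common_zeros x)"
  shows "generic_family (fibre_family x)"
  unfolding fibre_family_def
proof (intro generic_family_Un)
  show "generic_family {\<lambda>v::'a^3. v$1, \<lambda>v. v$3}"
    unfolding generic_family_def
  proof (intro conjI ballI)
    show "\<exists>v. f v \<noteq> 0" if "f \<in> {\<lambda>v::'a^3. v$1, \<lambda>v. v$3}" for f
      using that by (intro exI[of _ "vector [1,0,1]"]) (auto simp: vector_3)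
  qed (auto intro: poly_on_lines_coord)
  show "generic_family ((\<lambda>(y,z) v::'a^3. y * (v$3 * x) - z * (v$1 + v$2 * x)) ` (common_zeros x - {(0,0)}))"
  proof (rule generic_family_image)
    fix yz assume "yz \<in> common_zeros x - {(0,0)}"
    then obtain y z where yz: "yz = (y,z)" "y \<noteq> 0 \<or> z \<noteq> 0" by (cases yz) auto
    show "poly_on_lines ((\<lambda>(y,z) v::'a^3. y * (v$3 * x) - z * (v$1 + v$2 * x)) yz)"
      unfolding yz by (simp, intro poly_on_lines_diff poly_on_lines_add poly_on_lines_mult poly_on_lines_coord poly_on_lines_const)
    have "\<exists>v::'a^3. y * (v$3 * x) - z * (v$1 + v$2 * x) \<noteq> 0"
    proof (cases "y = 0")
      case True
      then show ?thesis using yz(2) by (intro exI[of _ "vector [1,0,0]"]) (simp add: vector_3)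
    next
      case False
      then show ?thesis using x(1) by (intro exI[of _ "vector [0,0,1]"]) (simp add: vector_3)
    qed
    then show "\<exists>v. (\<lambda>(y,z) v::'a^3. y * (v$3 * x) - z * (v$1 + v$2 * x)) yz v \<noteq> 0" unfolding yz(1) by simp
  qed (use x(2) in simp)
  show "generic_family (if e = 1 then {\<lambda>v. polar1 d c (base_point x) (fibre_dir v x), \<lambda>v. polar1 d c (fibre_dir v x) (base_point x)}
      else {\<lambda>v. form_at d c (fibre_dir v x)})"
  proof (cases "e = 1")
    case True
    then show ?thesis
      unfolding generic_family_def using polar1_base_fibre_nonzero polar1_fibre_base_nonzero x(1)
      by (auto intro!: poly_on_lines_polar1_direction poly_on_lines_polar1_point fibre_dir_affine)
  next
    case False
    then obtain y where y: "y \<in> edge 3 4" "form_at d c y \<noteq> 0" using edges_off_surface(2) flags(1) by (cases e) auto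
    obtain v where "fibre_dir v x = vec4 0 0 (y$3) (y$4)" by (rule fibre_dir_surj[OF x(1)])
    moreover have "y = vec4 0 0 (y$3) (y$4)" using y(1) unfolding mem_net_edges by (intro vec4_eqI) simp_all
    ultimately have "form_at d c (fibre_dir v x) \<noteq> 0" using y(2) by simp
    then show ?thesis unfolding generic_family_def using False by (auto intro!: poly_on_lines_form_at fibre_dir_affine)
  qed
qed

context
  fixes v x0 G H
  assumes x0: "x0 \<noteq> 0" "e = 0 \<Longrightarrow> form_at d c (base_point x0) \<noteq> 0" and v: "\<forall>f\<in>fibre_family x0. f v \<noteq> 0"
    and G: "pullback d c v = monom (monom 1 e') e * G" and H: "pullback n \<phi> v = monom (monom 1 e') e * H"
begin

lemma generic_nonzero: "v$1 \<noteq> 0" "v$3 \<noteq> 0"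
  "e = 1 \<Longrightarrow> polar1 d c (base_point x0) (fibre_dir v x0) \<noteq> 0" "e = 1 \<Longrightarrow> polar1 d c (fibre_dir v x0) (base_point x0) \<noteq> 0"
  "e \<noteq> 1 \<Longrightarrow> form_at d c (fibre_dir v x0) \<noteq> 0"
  using v unfolding fibre_family_def by auto

lemma poly_reduced_pullback:
  "poly (pullback d c v) Y = monom 1 e' * Y^e * poly G Y" "poly (pullback n \<phi> v) Y = monom 1 e' * Y^e * poly H Y"
  unfolding G H by (simp_all add: poly_monom)

lemma coeff_fibre: "x0^e' * poly (coeff G j) x0 = coeff (form_along d c (base_point x0) (fibre_dir v x0)) (j + e)"
  unfolding poly_coeff_pullback[symmetric] G by (simp add: coeff_monom_mult poly_monom)

lemma reduced_top_coeff_nonzero: "poly (coeff G (d - 2 * e)) x0 \<noteq> 0"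
proof -
  have "coeff (form_along d c (base_point x0) (fibre_dir v x0)) (d - 2 * e + e) \<noteq> 0"
  proof (cases "e = 1")
    case True
    then have "d - 2 * e + e = d - 1" "1 \<le> d" using degree_ge_3 by simp_all
    then show ?thesis using coeff_form_along_top_minus_1[OF homogeneous] generic_nonzero(4)[OF True] by metis
  next
    case False
    then have "e = 0" using flags by simp
    then show ?thesis using generic_nonzero(5)[OF False] top_coeff_form_along[of d c "base_point x0" "fibre_dir v x0"] by (simp add: top_coeff_def)
  qed
  then show ?thesis using coeff_fibre[of "d - 2 * e"] by auto
qed

lemma reduced_no_common_root:
  assumes roots: "poly (poly G [:z:]) x0 = 0" "poly (poly H [:z:]) x0 = 0"
  shows False
proof -
  define y y' where "y = z * (v$1 + v$2 * x0)" and "y' = z * (v$3 * x0)"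
  have "form_at d c (base_point x0 + z *s fibre_dir v x0) = 0" "form_at n \<phi> (base_point x0 + z *s fibre_dir v x0) = 0"
    using roots poly_poly_pullback[of d c v "[:z:]" x0] poly_poly_pullback[of n \<phi> v "[:z:]" x0]
    by (simp_all add: poly_reduced_pullback)
  moreover have "base_point x0 + z *s fibre_dir v x0 = vec4 1 x0 y y'"
    by (rule vec4_eqI) (simp_all add: base_point_def fibre_dir_def y_def y'_def)
  ultimately have "(y, y') \<in> common_zeros x0" by (simp add: common_zeros_def)
  moreover have "y * (v$3 * x0) - y' * (v$1 + v$2 * x0) = 0" by (simp add: y_def y'_def algebra_simps)
  moreover have "(\<lambda>(y,z) v::'a^3. y * (v$3 * x0) - z * (v$1 + v$2 * x0)) (y, y') \<in> fibre_family x0"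
    if "(y, y') \<in> common_zeros x0 - {(0,0)}" unfolding fibre_family_def using that by blast
  ultimately have "(y, y') = (0, 0)" using v by fastforce
  then have "z = 0" using generic_nonzero(2) x0(1) by (simp add: y'_def)
  then have zero: "coeff (form_along d c (base_point x0) (fibre_dir v x0)) e = 0"
    using roots(1) coeff_fibre[of 0] by (simp add: poly_0_coeff_0)
  show False
  proof (cases "e = 1")
    case True
    then show False using zero generic_nonzero(3) coeff_form_along_1[OF homogeneous] by metis
  next
    case False
    then have "e = 0" using flags by simp
    then show False using zero x0(2) coeff_form_along_0[OF homogeneous] by simp
  qed
qed

lemma obtain_local_section:
  assumes p: "p$1 = 1" "net_form v p = 0" "p \<notin> \<Union>net_edges" "form_at d c p = 0" "form_at n \<phi> p = 0"
    and transversal: "polar1 d c p (vec4 0 0 (p$3) (p$4)) \<noteq> 0"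
    and k: "k = 1 \<or> k = 2 \<and> (\<forall>w. polar1 d c p w = 0 \<longrightarrow> polar1 n \<phi> p w = 0)"
  obtains Y where "p = base_point (p$2) + poly Y (p$2) *s fibre_dir v (p$2)"
    "[:-(p$2),1:]^k dvd poly G Y" "[:-(p$2),1:]^k dvd poly H Y" "map_poly (\<lambda>q. poly q (p$2)) G \<noteq> 0"
proof -
  obtain y where y: "p = base_point (p$2) + y *s fibre_dir v (p$2)" "y \<noteq> 0" "p$2 \<noteq> 0"
    by (rule net_quadric_point[OF generic_nonzero(1,2) p(2,1,3)])
  define x where "x = p$2"
  have p_eq: "p = base_point x + y *s fibre_dir v x" using y(1) unfolding x_def .
  have "vec4 0 0 (p$3) (p$4) = y *s fibre_dir v x"
    by (subst p_eq, subst p_eq) (rule vec4_eqI, simp_all add: base_point_def fibre_dir_def)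
  then have transversal': "polar1 d c p (fibre_dir v x) \<noteq> 0" using transversal by (auto simp: polar1_scale)
  have "\<exists>Y. poly Y x = y \<and> [:-x,1:]^k dvd poly (pullback d c v) Y \<and> [:-x,1:]^k dvd poly (pullback n \<phi> v) Y"
  proof (cases "k = 1")
    case True
    have "poly (poly (pullback d c v) [:y:]) x = 0" "poly (poly (pullback n \<phi> v) [:y:]) x = 0"
      using p(4,5) p_eq by (simp_all add: poly_poly_pullback)
    then show ?thesis unfolding True poly_eq_0_iff_dvd by (intro exI[of _ "[:y:]"]) simp
  next
    case False
    then obtain Y where "poly Y x = y" "[:-x,1:]^2 dvd poly (pullback d c v) Y" "[:-x,1:]^2 dvd poly (pullback n \<phi> v) Y"
      using obtain_tangent_section[OF p_eq homogeneous homogeneous_form p(4,5) transversal'] k by blast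
    then show ?thesis using False k by auto
  qed
  then obtain Y where Y: "poly Y x = y" "[:-x,1:]^k dvd poly (pullback d c v) Y" "[:-x,1:]^k dvd poly (pullback n \<phi> v) Y" by blast
  have "poly (monom 1 e' * Y^e) x \<noteq> 0" using Y(1) y(2,3) by (simp add: poly_monom x_def)
  then have "[:-x,1:]^k dvd poly G Y" "[:-x,1:]^k dvd poly H Y"
    using linear_power_dvd_cancel Y(2,3) unfolding poly_reduced_pullback by blast+
  moreover have "map_poly (\<lambda>q. poly q x) G \<noteq> 0"
  proof
    assume zero: "map_poly (\<lambda>q. poly q x) G = 0"
    have "poly (map_poly (\<lambda>q. poly q x) (pullback d c v)) z = 0" for z
      using poly_map_poly_eval[of x "pullback d c v" "[:z:]"] poly_map_poly_eval[of x G "[:z:]"] zero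
      by (simp add: poly_reduced_pullback)
    then show False using pullback_fibre_nonzero[OF homogeneous p_eq transversal'] poly_eq_0I by blast
  qed
  ultimately show ?thesis using that[of Y] p_eq Y(1) unfolding x_def by simp
qed

end

theorem sum_multiplicities_on_quadric_le:
  fixes q :: "'i \<Rightarrow> 'a^4"
  assumes x0: "x0 \<noteq> 0" "e = 0 \<Longrightarrow> form_at d c (base_point x0) \<noteq> 0" "\<forall>f\<in>fibre_family x0. f v \<noteq> 0"
    and I: "finite I" "inj_on q I"
    and on_quadric: "\<And>i. i \<in> I \<Longrightarrow> q i $ 1 = 1 \<and> net_form v (q i) = 0 \<and> q i \<notin> \<Union>net_edges"
    and on_forms: "\<And>i. i \<in> I \<Longrightarrow> form_at d c (q i) = 0 \<and> form_at n \<phi> (q i) = 0"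
    and transversal: "\<And>i. i \<in> I \<Longrightarrow> polar1 d c (q i) (vec4 0 0 (q i $ 3) (q i $ 4)) \<noteq> 0"
    and k: "\<And>i. i \<in> I \<Longrightarrow> k i = 1 \<or> k i = 2 \<and> (\<forall>w. polar1 d c (q i) w = 0 \<longrightarrow> polar1 n \<phi> (q i) w = 0)"
  shows "(\<Sum>i\<in>I. k i) \<le> (d - 2 * e) * (n - e') + (n - 2 * e) * (d - e')"
proof -
  obtain G where G: "pullback d c v = monom (monom 1 e') e * G" "degree G \<le> d - 2 * e" "coeffs_degree_le (d - e') G"
    by (rule obtain_reduced_pullback[OF flags, of d c v]) (use skew_edges third_edge in auto)
  obtain H where H: "pullback n \<phi> v = monom (monom 1 e') e * H" "degree H \<le> n - 2 * e" "coeffs_degree_le (n - e') H"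
    by (rule obtain_reduced_pullback[OF flags, of n \<phi> v]) (use skew_edges third_edge in auto)
  note generic = x0(1) x0(2) x0(3) G(1) H(1)
  have "\<exists>Y. q i = base_point (q i $ 2) + poly Y (q i $ 2) *s fibre_dir v (q i $ 2)
      \<and> [:-(q i $ 2),1:]^k i dvd poly G Y \<and> [:-(q i $ 2),1:]^k i dvd poly H Y \<and> map_poly (\<lambda>p. poly p (q i $ 2)) G \<noteq> 0"
    if i: "i \<in> I" for i
    by (rule obtain_local_section[OF generic, of "q i" "k i"]) (use on_quadric on_forms transversal k i in blast)+
  then obtain Y where Y: "\<And>i. i \<in> I \<Longrightarrow> q i = base_point (q i $ 2) + poly (Y i) (q i $ 2) *s fibre_dir v (q i $ 2)"
    "\<And>i. i \<in> I \<Longrightarrow> [:-(q i $ 2),1:]^k i dvd poly G (Y i)" "\<And>i. i \<in> I \<Longrightarrow> [:-(q i $ 2),1:]^k i dvd poly H (Y i)"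
    "\<And>i. i \<in> I \<Longrightarrow> map_poly (\<lambda>p. poly p (q i $ 2)) G \<noteq> 0" by metis
  show ?thesis
  proof (rule bezout_bidegree[OF G(2) H(2) _ _ reduced_top_coeff_nonzero[OF generic] _ I(1) Y(2,3) _ Y(4)])
    show "degree (coeff G j) \<le> d - e'" "degree (coeff H j) \<le> n - e'" for j
      using G(3) H(3) unfolding coeffs_degree_le_def by blast+
    show "poly (poly H [:z:]) x0 \<noteq> 0" if "poly (poly G [:z:]) x0 = 0" for z
      using reduced_no_common_root[OF generic that] by blast
    show "k i \<ge> 1" if "i \<in> I" for i using k[OF that] by auto
    show "inj_on (\<lambda>i. (q i $ 2, poly (Y i) (q i $ 2))) I"
    proof (rule inj_onI)
      fix i j assume "i \<in> I" "j \<in> I" "(q i $ 2, poly (Y i) (q i $ 2)) = (q j $ 2, poly (Y j) (q j $ 2))"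
      then have "q i = q j" using Y(1)[of i] Y(1)[of j] by (metis prod.inject)
      then show "i = j" using I(2) \<open>i \<in> I\<close> \<open>j \<in> I\<close> by (blast dest: inj_onD)
    qed
  qed
qed

definition bad_points :: "('a^4) set \<Rightarrow> ('a^4) set" where
  "bad_points L = {p. p$1 = 0} \<union> {p. polar1 d c p (vec4 0 0 (p$3) (p$4)) = 0} \<union> \<Union>(M - {L})
     \<union> (if m L = 2 then {p. \<exists>w. polar1 d c p w = 0 \<and> polar1 n \<phi> p w \<noteq> 0} else {})"

lemma finite_bad_points:
  assumes L: "L \<in> M"
  shows "finite_on_line L (bad_points L)"
  unfolding bad_points_def
proof (intro finite_on_line_Un)
  show "finite_on_line L {p. p$1 = 0}" using affine[OF L] finite_on_line_hyperplane by blast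
  show "finite_on_line L {p. polar1 d c p (vec4 0 0 (p$3) (p$4)) = 0}"
    using finite_on_line_fibre_tangent few[OF L] L lines by blast
  show "finite_on_line L (\<Union>(M - {L}))"
    by (rule finite_on_line_Union) (use finite_lines is_line L finite_on_line_other_line in auto)
  show "finite_on_line L (if m L = 2 then {p. \<exists>w. polar1 d c p w = 0 \<and> polar1 n \<phi> p w \<noteq> 0} else {})"
    using weight[OF L] by (auto simp: tangential_along_def) (simp add: finite_on_line_def)
qed

lemma bad_points_scale:
  assumes "r \<noteq> 0" "p \<in> bad_points L"
  shows "r *s p \<in> bad_points L"
proof -
  have "vec4 0 0 ((r *s p)$3) ((r *s p)$4) = r *s vec4 0 0 (p$3) (p$4)" by (rule vec4_eqI) simp_all
  moreover have "r *s p \<in> K" if "p \<in> K" "K \<in> M" for K using line_scale is_line that by blast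
  ultimately show ?thesis
    using assms unfolding bad_points_def by (auto simp: polar1_scale_point polar1_scale split: if_splits)
qed

lemma obtain_residual_quadric:
  assumes x0: "x0 \<noteq> 0" "finite (common_zeros x0)"
  obtains v R where "\<forall>f\<in>fibre_family x0. f v \<noteq> 0"
    "\<forall>L\<in>M. R L \<subseteq> L - bad_points L \<and> finite (R L) \<and> card (R L) = 2 - edges_met L
      \<and> (\<forall>p\<in>R L. p$1 = 1 \<and> net_form v p = 0 \<and> p \<notin> \<Union>net_edges)"
proof -
  let ?residual = "\<lambda>v L R. R \<subseteq> L - bad_points L \<and> finite R \<and> card R = 2 - edges_met L
    \<and> (\<forall>p\<in>R. p$1 = 1 \<and> net_form v p = 0 \<and> p \<notin> \<Union>net_edges)"
  have "\<exists>F. generic_family F \<and> (\<forall>v. (\<forall>f\<in>F. f v \<noteq> 0) \<longrightarrow> (\<exists>R. ?residual v L R))" if L: "L \<in> M" for L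
  proof -
    have "is_line L" using L by (rule is_line)
    then obtain F where "generic_family F" "\<And>v. \<forall>f\<in>F. f v \<noteq> 0 \<Longrightarrow> \<exists>R\<subseteq>L - bad_points L. finite R \<and> card R = 2 - edges_met L
      \<and> (\<forall>p\<in>R. p$1 = 1 \<and> net_form v p = 0 \<and> p \<notin> \<Union>net_edges)"
      using few[OF L] numerals_nonzero(1) finite_bad_points[OF L] bad_points_scale
      by (rule obtain_residual_points) (auto simp: bad_points_def)
    then show ?thesis by metis
  qed
  then obtain F where F: "\<And>L. L \<in> M \<Longrightarrow> generic_family (F L)"
    "\<And>L v. L \<in> M \<Longrightarrow> \<forall>f\<in>F L. f v \<noteq> 0 \<Longrightarrow> \<exists>R. ?residual v L R" by metis
  have "generic_family (fibre_family x0 \<union> (\<Union>L\<in>M. F L))"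
    using generic_fibre_family[OF x0] F(1) finite_lines unfolding generic_family_def by auto
  then obtain v where v: "\<forall>f\<in>fibre_family x0 \<union> (\<Union>L\<in>M. F L). f v \<noteq> 0" using generic_point by blast
  have "\<exists>R. ?residual v L R" if "L \<in> M" for L by (rule F(2)[OF that]) (use v that in blast)
  then have "\<forall>L\<in>M. \<exists>R. ?residual v L R" ..
  from bchoice[OF this] obtain R where "\<forall>L\<in>M. ?residual v L (R L)" ..
  moreover have "\<forall>f\<in>fibre_family x0. f v \<noteq> 0" using v by blast
  ultimately show ?thesis using that by blast
qed

theorem sum_residual_weights_le: "(\<Sum>L\<in>M. (2 - edges_met L) * m L) \<le> (d - 2 * e) * (n - e') + (n - 2 * e) * (d - e')"
proof -
  obtain x0 where x0: "x0 \<noteq> 0" "finite (common_zeros x0)" "e = 0 \<Longrightarrow> form_at d c (base_point x0) \<noteq> 0"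
    by (rule obtain_good_fibre) (rule that)
  obtain v R where v: "\<forall>f\<in>fibre_family x0. f v \<noteq> 0"
    and R: "\<forall>L\<in>M. R L \<subseteq> L - bad_points L \<and> finite (R L) \<and> card (R L) = 2 - edges_met L
      \<and> (\<forall>p\<in>R L. p$1 = 1 \<and> net_form v p = 0 \<and> p \<notin> \<Union>net_edges)"
    by (rule obtain_residual_quadric[OF x0(1,2)])
  have "(\<Sum>i\<in>Sigma M R. m (fst i)) \<le> (d - 2 * e) * (n - e') + (n - 2 * e) * (d - e')"
  proof (rule sum_multiplicities_on_quadric_le[OF x0(1,3)])
    show "\<forall>f\<in>fibre_family x0. f v \<noteq> 0" by (rule v)
    show "finite (Sigma M R)" using finite_lines R by auto
    have "L = K" if "L \<in> M" "K \<in> M" "p \<in> R L" "p \<in> R K" for L K p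
    proof (rule ccontr)
      assume "L \<noteq> K"
      then have "p \<in> \<Union>(M - {K})" using R that by blast
      then show False using R that unfolding bad_points_def by blast
    qed
    then show "inj_on snd (Sigma M R)" by (auto simp: inj_on_def)
    fix i assume "i \<in> Sigma M R"
    then obtain L p where i: "i = (L, p)" "L \<in> M" "p \<in> R L" by auto
    then have p: "p \<in> L" "p \<notin> bad_points L" using R by blast+
    show "snd i $ 1 = 1 \<and> net_form v (snd i) = 0 \<and> snd i \<notin> \<Union>net_edges" using R i by simp
    show "form_at d c (snd i) = 0 \<and> form_at n \<phi> (snd i) = 0" using p(1) i(1,2) lines form_zero by (auto simp: lines_in_def)
    show "polar1 d c (snd i) (vec4 0 0 (snd i $ 3) (snd i $ 4)) \<noteq> 0" using p(2) i(1) by (simp add: bad_points_def)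
    show "m (fst i) = 1 \<or> m (fst i) = 2 \<and> (\<forall>w. polar1 d c (snd i) w = 0 \<longrightarrow> polar1 n \<phi> (snd i) w = 0)"
      using weight[OF i(2)] p(2) i(1) by (auto simp: bad_points_def split: if_splits)
  qed
  moreover have "(\<Sum>i\<in>Sigma M R. m (fst i)) = (\<Sum>L\<in>M. \<Sum>p\<in>R L. m L)"
    by (subst sum.Sigma) (use finite_lines R in \<open>auto simp: case_prod_beta\<close>)
  moreover have "\<dots> = (\<Sum>L\<in>M. (2 - edges_met L) * m L)" using R by (intro sum.cong) auto
  ultimately show ?thesis by simp
qed

end

section \<open>Weighted line counts in a frame\<close>

lemma frame_map_axis [simp]:
  "frame_map h1 h2 h3 h4 (axis 1 1) = h1" "frame_map h1 h2 h3 h4 (axis 2 1) = h2"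
  "frame_map h1 h2 h3 h4 (axis 3 1) = h3" "frame_map h1 h2 h3 h4 (axis 4 1) = h4"
  by (simp_all add: frame_map_def axis_def)

definition frame_edges :: "'a::field^4 \<Rightarrow> 'a^4 \<Rightarrow> 'a^4 \<Rightarrow> 'a^4 \<Rightarrow> ('a^4) set set" where
  "frame_edges h1 h2 h3 h4 = {span2 h1 h2, span2 h3 h4, span2 h1 h3}"

context
  fixes h1 h2 h3 h4 :: "'a::field^4"
  assumes basis: "basis4 h1 h2 h3 h4"
begin

abbreviation coords_in_frame :: "('a^4) set \<Rightarrow> ('a^4) set" where
  "coords_in_frame L \<equiv> frame_map h1 h2 h3 h4 -` L"

lemma inj_frame_map: "inj (frame_map h1 h2 h3 h4)"
  using frame_map_inj[OF basis] by (rule injI)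

lemma surj_frame_map: "surj (frame_map h1 h2 h3 h4)"
  using frame_map_surj[OF basis] unfolding surj_def by metis

lemma frame_map_eq_0_iff: "frame_map h1 h2 h3 h4 x = 0 \<longleftrightarrow> x = 0"
  using frame_map_inj[OF basis, of x 0] frame_map_0 by metis

lemma indep2_frame_map: "indep2 (frame_map h1 h2 h3 h4 a) (frame_map h1 h2 h3 h4 b) \<longleftrightarrow> indep2 a b"
  unfolding indep2_def frame_map_scale[symmetric] frame_map_add[symmetric] frame_map_eq_0_iff ..

lemma coords_in_frame_span2: "coords_in_frame (span2 (frame_map h1 h2 h3 h4 a) (frame_map h1 h2 h3 h4 b)) = span2 a b"
  unfolding frame_map_span2[symmetric] by (rule inj_vimage_image_eq[OF inj_frame_map])

lemma coords_in_frame_edges: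
  "coords_in_frame (span2 h1 h2) = edge 1 2" "coords_in_frame (span2 h3 h4) = edge 3 4" "coords_in_frame (span2 h1 h3) = edge 1 3"
  using coords_in_frame_span2[of "axis 1 1" "axis 2 1"] coords_in_frame_span2[of "axis 3 1" "axis 4 1"]
    coords_in_frame_span2[of "axis 1 1" "axis 3 1"] by simp_all

lemma inj_coords_in_frame: "inj coords_in_frame"
  by (rule injI) (metis surj_frame_map surj_image_vimage_eq)

lemma is_line_coords_in_frame:
  assumes "is_line L"
  shows "is_line (coords_in_frame L)"
proof -
  obtain p q where pq: "indep2 p q" "L = span2 p q" using assms unfolding is_line_def by blast
  obtain a where a: "frame_map h1 h2 h3 h4 a = p" by (rule frame_map_surj[OF basis])
  obtain b where b: "frame_map h1 h2 h3 h4 b = q" by (rule frame_map_surj[OF basis])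
  show ?thesis
    using is_line_span2 pq(1) unfolding pq(2) a[symmetric] b[symmetric] coords_in_frame_span2 indep2_frame_map by blast
qed

lemma meets_coords_in_frame: "meets (coords_in_frame L) (coords_in_frame K) \<longleftrightarrow> meets L K"
proof
  assume "meets L K"
  then obtain y where y: "y \<noteq> 0" "y \<in> L" "y \<in> K" unfolding meets_def by blast
  obtain x where "frame_map h1 h2 h3 h4 x = y" by (rule frame_map_surj[OF basis])
  then show "meets (coords_in_frame L) (coords_in_frame K)"
    unfolding meets_def using y frame_map_0 by (intro exI[of _ x]) auto
qed (unfold meets_def, metis frame_map_eq_0_iff vimage_eq)

lemma edges_met_coords_in_frame: "edges_met (coords_in_frame L) = lines_met (frame_edges h1 h2 h3 h4) L"
proof -
  have "{K \<in> net_edges. meets (coords_in_frame L) K} = coords_in_frame ` {K \<in> frame_edges h1 h2 h3 h4. meets L K}"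
    unfolding net_edges_def frame_edges_def coords_in_frame_edges[symmetric] by (auto simp: meets_coords_in_frame)
  then show ?thesis unfolding lines_met_def by (simp add: card_image inj_on_subset[OF inj_coords_in_frame])
qed

lemma finite_on_line_coords_in_frame: "finite_on_line (coords_in_frame L) (coords_in_frame X) \<longleftrightarrow> finite_on_line L X"
proof
  assume fin: "finite_on_line (coords_in_frame L) (coords_in_frame X)"
  show "finite_on_line L X"
    unfolding finite_on_line_def
  proof (intro allI impI, elim conjE)
    fix p q assume pq: "indep2 p q" "L = span2 p q"
    obtain a where a: "frame_map h1 h2 h3 h4 a = p" by (rule frame_map_surj[OF basis])
    obtain b where b: "frame_map h1 h2 h3 h4 b = q" by (rule frame_map_surj[OF basis])
    have "indep2 a b" "coords_in_frame L = span2 a b"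
      using pq unfolding a[symmetric] b[symmetric] by (simp_all add: indep2_frame_map coords_in_frame_span2)
    then have "finite {t. a + t *s b \<in> coords_in_frame X}" using fin unfolding finite_on_line_def by blast
    then show "finite {t. p + t *s q \<in> X}" by (simp add: frame_map_add frame_map_scale a b)
  qed
next
  assume fin: "finite_on_line L X"
  show "finite_on_line (coords_in_frame L) (coords_in_frame X)"
    unfolding finite_on_line_def
  proof (intro allI impI, elim conjE)
    fix a b assume ab: "indep2 a b" "coords_in_frame L = span2 a b"
    then have "L = span2 (frame_map h1 h2 h3 h4 a) (frame_map h1 h2 h3 h4 b)"
      unfolding frame_map_span2[symmetric] by (metis surj_frame_map surj_image_vimage_eq)
    then show "finite {t. a + t *s b \<in> coords_in_frame X}"
      using fin ab(1) unfolding finite_on_line_def by (simp add: frame_map_add frame_map_scale indep2_frame_map)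
  qed
qed

lemma tangential_along_coords_in_frame:
  assumes "\<And>x v. polar1 d c' x v = polar1 d c (frame_map h1 h2 h3 h4 x) (frame_map h1 h2 h3 h4 v)"
    and "\<And>x v. polar1 n \<phi>' x v = polar1 n \<phi> (frame_map h1 h2 h3 h4 x) (frame_map h1 h2 h3 h4 v)"
  shows "tangential_along d c' n \<phi>' (coords_in_frame L) \<longleftrightarrow> tangential_along d c n \<phi> L"
proof -
  have "coords_in_frame {p. \<exists>w. polar1 d c p w = 0 \<and> polar1 n \<phi> p w \<noteq> 0} = {p. \<exists>w. polar1 d c' p w = 0 \<and> polar1 n \<phi>' p w \<noteq> 0}"
    unfolding assms using frame_map_surj[OF basis] by (auto simp: vimage_def) metis
  then show ?thesis
    unfolding tangential_along_def
    using finite_on_line_coords_in_frame[of L "{p. \<exists>w. polar1 d c p w = 0 \<and> polar1 n \<phi> p w \<noteq> 0}"] by simp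
qed

lemma exists_first_coord_nonzero:
  assumes "\<not> L \<subseteq> span3 h2 h3 h4"
  shows "\<exists>x\<in>coords_in_frame L. x$1 \<noteq> 0"
proof (rule ccontr)
  assume "\<not> ?thesis"
  then have first_coord: "x$1 = 0" if "frame_map h1 h2 h3 h4 x \<in> L" for x using that by blast
  have "L \<subseteq> span3 h2 h3 h4"
  proof
    fix y assume "y \<in> L"
    obtain x where x: "frame_map h1 h2 h3 h4 x = y" by (rule frame_map_surj[OF basis])
    then have "y = x$2 *s h2 + x$3 *s h3 + x$4 *s h4" using first_coord[of x] \<open>y \<in> L\<close> unfolding x[symmetric] by (simp add: frame_map_def)
    then show "y \<in> span3 h2 h3 h4" using span3I by metis
  qed
  then show False using assms by contradiction
qed

end

context weighted_lines
begin

lemma sum_weights_le_in_affine_frame: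
  assumes basis: "basis4 h1 h2 h3 h4" and flags: "e \<le> 1" "e' \<le> 1"
    and skew_edges: "\<And>x. e = 1 \<Longrightarrow> x \<in> span2 h1 h2 \<union> span2 h3 h4 \<Longrightarrow> form_at d c x = 0 \<and> form_at n \<phi> x = 0"
    and third_edge: "\<And>x. e' = 1 \<Longrightarrow> x \<in> span2 h1 h3 \<Longrightarrow> form_at d c x = 0 \<and> form_at n \<phi> x = 0"
    and edges_off_surface: "e = 0 \<Longrightarrow> \<exists>x\<in>span2 h1 h2. form_at d c x \<noteq> 0" "e = 0 \<Longrightarrow> \<exists>x\<in>span2 h3 h4. form_at d c x \<noteq> 0"
    and L0: "L0 \<in> lines_in d c" "\<not> meets L0 (span2 h3 h4)" "\<And>x. x \<in> L0 \<Longrightarrow> form_at n \<phi> x = 0" "\<not> tangential_along d c n \<phi> L0"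
    and few: "\<And>L. L \<in> M \<Longrightarrow> lines_met (frame_edges h1 h2 h3 h4) L \<le> 1" and affine: "\<And>L. L \<in> M \<Longrightarrow> \<not> L \<subseteq> span3 h2 h3 h4"
  shows "(\<Sum>L\<in>M. (2 - lines_met (frame_edges h1 h2 h3 h4) L) * m L) \<le> (d - 2 * e) * (n - e') + (n - 2 * e) * (d - e')"
proof -
  let ?f = "frame_map h1 h2 h3 h4"
  obtain c' where c': "homogeneous d c'" "\<And>x. form_at d c' x = form_at d c (?f x)" "\<And>x v. polar1 d c' x v = polar1 d c (?f x) (?f v)"
    by (rule obtain_form_in_frame[OF homogeneous, of h1 h2 h3 h4]) (rule that)
  obtain \<phi>' where \<phi>': "homogeneous n \<phi>'" "\<And>x. form_at n \<phi>' x = form_at n \<phi> (?f x)" "\<And>x v. polar1 n \<phi>' x v = polar1 n \<phi> (?f x) (?f v)"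
    by (rule obtain_form_in_frame[OF homogeneous_form, of h1 h2 h3 h4]) (rule that)
  have ball: "(\<forall>x\<in>?f -` L. P (?f x)) \<longleftrightarrow> (\<forall>y\<in>L. P y)" for P L
    using frame_map_surj[OF basis] by (metis vimage_eq)
  have lines_in: "L \<in> lines_in d c \<Longrightarrow> ?f -` L \<in> lines_in d c'" for L
    using is_line_coords_in_frame[OF basis] unfolding lines_in_def c'(2) by simp
  note tangential = tangential_along_coords_in_frame[OF basis c'(3) \<phi>'(3)]
  have image: "?f ` (?f -` L) = L" for L by (simp add: surj_frame_map[OF basis])
  note edges = coords_in_frame_edges[OF basis, symmetric]
  interpret frame: quadric_net d c' n \<phi>' "vimage ?f ` M" "\<lambda>K. m (?f ` K)" e e' "?f -` L0"
  proof
    show "smooth_form d c'"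
      unfolding smooth_form_def c'(2,3) using smooth_point frame_map_eq_0_iff[OF basis] frame_map_surj[OF basis] by metis
    show "\<not> meets (?f -` L0) (edge 3 4)" using L0(2) unfolding edges meets_coords_in_frame[OF basis] .
    show "\<exists>x\<in>edge 1 2. form_at d c' x \<noteq> 0" "\<exists>x\<in>edge 3 4. form_at d c' x \<noteq> 0" if "e = 0"
      using edges_off_surface[OF that] ball[of "span2 h1 h2" "\<lambda>x. form_at d c x = 0"] ball[of "span2 h3 h4" "\<lambda>x. form_at d c x = 0"]
      unfolding edges c'(2) by blast+
    fix K assume "K \<in> vimage ?f ` M"
    then obtain L where L: "K = ?f -` L" "L \<in> M" by blast
    show "m (?f ` K) = 1 \<or> m (?f ` K) = 2 \<and> tangential_along d c' n \<phi>' K"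
      using weight[OF L(2)] unfolding L(1) image tangential .
    show "edges_met K \<le> 1" using few[OF L(2)] unfolding L(1) edges_met_coords_in_frame[OF basis] .
    show "\<exists>x\<in>K. x$1 \<noteq> 0" using exists_first_coord_nonzero[OF basis affine[OF L(2)]] unfolding L(1) .
  qed (use c'(1) \<phi>'(1) degree_ge_3 char flags finite_lines lines lines_in L0 tangential form_zero skew_edges third_edge
      in \<open>auto simp: edges c'(2) \<phi>'(2)\<close>)
  have "(\<Sum>L\<in>M. (2 - lines_met (frame_edges h1 h2 h3 h4) L) * m L) = (\<Sum>K\<in>vimage ?f ` M. (2 - edges_met K) * m (?f ` K))"
    using inj_on_subset[OF inj_coords_in_frame[OF basis]]
    by (subst sum.reindex) (simp_all add: edges_met_coords_in_frame[OF basis] surj_frame_map[OF basis])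
  then show ?thesis using frame.sum_residual_weights_le by simp
qed

end

lemma obtain_affine_frame:
  fixes h1 b h3 h4 :: "'a::alg_closed_field^4"
  assumes basis: "basis4 h1 b h3 h4" and M: "finite M" "\<And>L. L \<in> M \<Longrightarrow> is_line L \<and> L \<noteq> span2 h3 h4"
  obtains h2 where "basis4 h1 h2 h3 h4" "span2 h1 h2 = span2 h1 b" "\<And>L. L \<in> M \<Longrightarrow> \<not> L \<subseteq> span3 h2 h3 h4"
proof -
  have "finite {t. L \<subseteq> span3 (b + t *s h1) h3 h4}" if L: "L \<in> M" for L
  proof -
    have "is_line (span2 h3 h4)" by (rule is_line_span2[OF basis4_indep2(2)[OF basis]])
    then obtain y where y: "y \<in> L" "y \<notin> span2 h3 h4" using obtain_point_off_line M(2)[OF L] by blast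
    obtain y1 y2 y3 y4 where y_eq: "y = y1 *s h1 + y2 *s b + y3 *s h3 + y4 *s h4" by (rule basis4_span[OF basis])
    have nonzero: "[:y1, - y2:] \<noteq> 0"
    proof
      assume "[:y1, - y2:] = 0"
      then have "y = y3 *s h3 + y4 *s h4" using y_eq by simp
      then show False using y(2) span2I by metis
    qed
    have "poly [:y1, - y2:] t = 0" if "L \<subseteq> span3 (b + t *s h1) h3 h4" for t
    proof -
      have "y \<in> span3 (b + t *s h1) h3 h4" using y(1) that by blast
      then obtain p q s where "y = p *s (b + t *s h1) + q *s h3 + s *s h4" by (rule span3E)
      then have "y1 *s h1 + y2 *s b + y3 *s h3 + y4 *s h4 = (p * t) *s h1 + p *s b + q *s h3 + s *s h4"
        unfolding y_eq by (simp add: cart_eq algebra_simps)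
      from basis4_coords_eq[OF basis this] show ?thesis by simp
    qed
    then have "{t. L \<subseteq> span3 (b + t *s h1) h3 h4} \<subseteq> {t. poly [:y1, - y2:] t = 0}" by blast
    then show ?thesis using poly_roots_finite[OF nonzero] by (rule finite_subset)
  qed
  then have "finite (\<Union>L\<in>M. {t. L \<subseteq> span3 (b + t *s h1) h3 h4})" using M(1) by blast
  then obtain t where t: "t \<notin> (\<Union>L\<in>M. {t. L \<subseteq> span3 (b + t *s h1) h3 h4})" by (rule obtain_outside_finite)
  define h2 where "h2 = b + t *s h1"
  have "basis4 h1 h2 h3 h4"
    unfolding basis4_def
  proof (intro allI impI)
    fix s u p q assume "s *s h1 + u *s h2 + p *s h3 + q *s h4 = 0"
    then have "(s + u * t) *s h1 + u *s b + p *s h3 + q *s h4 = 0" unfolding h2_def by (simp add: cart_eq algebra_simps)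
    from basis4_zero[OF basis this] show "s = 0 \<and> u = 0 \<and> p = 0 \<and> q = 0" by auto
  qed
  moreover have "span2 h1 h2 = span2 h1 b"
    by (rule span2_eq_if_indep2[OF basis4_indep2(1)[OF calculation]]) (use span2I[of t h1 1 b] in \<open>simp_all add: h2_def add.commute\<close>)
  ultimately show ?thesis using that t unfolding h2_def by blast
qed

context weighted_lines
begin

theorem sum_weights_le_in_frame:
  assumes basis: "basis4 h1 b h3 h4" and flags: "e \<le> 1" "e' \<le> 1"
    and skew_edges: "\<And>x. e = 1 \<Longrightarrow> x \<in> span2 h1 b \<union> span2 h3 h4 \<Longrightarrow> form_at d c x = 0 \<and> form_at n \<phi> x = 0"
    and third_edge: "\<And>x. e' = 1 \<Longrightarrow> x \<in> span2 h1 h3 \<Longrightarrow> form_at d c x = 0 \<and> form_at n \<phi> x = 0"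
    and edges_off_surface: "e = 0 \<Longrightarrow> \<exists>x\<in>span2 h1 b. form_at d c x \<noteq> 0" "e = 0 \<Longrightarrow> \<exists>x\<in>span2 h3 h4. form_at d c x \<noteq> 0"
    and L0: "L0 \<in> lines_in d c" "\<not> meets L0 (span2 h3 h4)" "\<And>x. x \<in> L0 \<Longrightarrow> form_at n \<phi> x = 0" "\<not> tangential_along d c n \<phi> L0"
  shows "(\<Sum>L\<in>M. (2 - lines_met (frame_edges h1 b h3 h4) L) * m L) \<le> (d - 2 * e) * (n - e') + (n - 2 * e) * (d - e')"
proof -
  define M' where "M' = {L \<in> M. lines_met (frame_edges h1 b h3 h4) L \<le> 1}"
  interpret M': weighted_lines d c n \<phi> M' m
    by unfold_locales (use homogeneous_form finite_lines lines form_zero weight in \<open>auto simp: M'_def\<close>)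
  have "L \<noteq> span2 h3 h4" if "L \<in> M'" for L
  proof -
    have "frame_map h1 b h3 h4 -` L \<notin> net_edges"
      by (rule not_net_edge_if_edges_met_le_1) (use that in \<open>simp add: M'_def edges_met_coords_in_frame[OF basis]\<close>)
    then show ?thesis using coords_in_frame_edges(2)[OF basis] unfolding net_edges_def by blast
  qed
  then obtain h2 where h2: "basis4 h1 h2 h3 h4" "span2 h1 h2 = span2 h1 b" "\<And>L. L \<in> M' \<Longrightarrow> \<not> L \<subseteq> span3 h2 h3 h4"
    using obtain_affine_frame[OF basis M'.finite_lines] M'.is_line by metis
  have edges: "frame_edges h1 h2 h3 h4 = frame_edges h1 b h3 h4" by (simp add: frame_edges_def h2(2))
  have "(\<Sum>L\<in>M. (2 - lines_met (frame_edges h1 b h3 h4) L) * m L) = (\<Sum>L\<in>M'. (2 - lines_met (frame_edges h1 h2 h3 h4) L) * m L)"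
    unfolding edges by (rule sum.mono_neutral_right) (auto simp: M'_def finite_lines)
  also have "\<dots> \<le> (d - 2 * e) * (n - e') + (n - 2 * e) * (d - e')"
    by (rule M'.sum_weights_le_in_affine_frame[OF h2(1) flags _ third_edge _ edges_off_surface(2) L0])
      (use skew_edges edges_off_surface(1) h2(3) in \<open>simp_all add: h2(2) edges M'_def\<close>)
  finally show ?thesis .
qed

end

section \<open>Generic frames\<close>

lemma obtain_generic_skew_point:
  fixes h :: "'a::alg_closed_field^4"
  assumes M: "finite M" "\<And>L. L \<in> M \<Longrightarrow> is_line L \<and> h \<notin> L" and F: "generic_family F"
  obtains h' where "\<forall>f\<in>F. f h' \<noteq> 0" "\<And>L. L \<in> M \<Longrightarrow> indep2 h h' \<and> \<not> meets L (span2 h h')"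
proof -
  obtain p q where pq: "\<And>L. L \<in> M \<Longrightarrow> indep2 (p L) (q L) \<and> L = span2 (p L) (q L)"
    using M(2) unfolding is_line_def by metis
  have "generic_family ((\<lambda>L v. det4 (p L) (q L) h v) ` M)"
  proof (rule generic_family_image[OF M(1)])
    fix L assume L: "L \<in> M"
    show "poly_on_lines (\<lambda>v. det4 (p L) (q L) h v)"
      by (intro poly_on_lines_det4 poly_on_lines_const poly_on_lines_coord)
    obtain g g' where "basis4 (p L) (q L) g g'" using pq[OF L] basis4_extend by blast
    moreover have "h \<notin> span2 (p L) (q L)" using M(2)[OF L] pq[OF L] by simp
    ultimately have "basis4 (p L) (q L) g h \<or> basis4 (p L) (q L) g' h" by (rule basis4_replace)
    then show "\<exists>v. det4 (p L) (q L) h v \<noteq> 0" unfolding basis4_iff_det4[symmetric] using basis4_swap34 by blast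
  qed
  then obtain h' where h': "\<forall>f\<in>F \<union> (\<lambda>L v. det4 (p L) (q L) h v) ` M. f h' \<noteq> 0"
    using generic_point generic_family_Un F by blast
  have "indep2 h h' \<and> \<not> meets L (span2 h h')" if L: "L \<in> M" for L
  proof -
    have "basis4 (p L) (q L) h h'" unfolding basis4_iff_det4 using h' L by blast
    then show ?thesis using basis4_indep2(2) skew_if_basis4 pq[OF L] by metis
  qed
  then show ?thesis using that h' by blast
qed

context surface
begin

lemma obtain_point_off_surface:
  obtains x where "form_at d c x \<noteq> 0"
proof (rule ccontr)
  assume "\<not> thesis"
  then have zero: "form_at d c x = 0" for x using that by blast
  have "axis 1 1 \<noteq> (0::'a^4)" by (simp add: axis_eq_0_iff)
  then obtain v where "polar1 d c (axis 1 1) v \<noteq> 0" using smooth_point zero by blast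
  moreover have "form_along d c (axis 1 1) v = 0" by (rule poly_eq_0I) (simp add: poly_form_at zero)
  ultimately show False using polar_eq_0_if_form_along_eq_0(1)[OF homogeneous] by blast
qed

lemma obtain_generic_frame:
  assumes M: "finite M" "M \<subseteq> lines_in d c" "M \<noteq> {}"
  obtains h1 h2 h3 h4 where "basis4 h1 h2 h3 h4" "form_at d c h1 \<noteq> 0" "form_at d c h3 \<noteq> 0"
    "\<And>L. L \<in> M \<Longrightarrow> lines_met (frame_edges h1 h2 h3 h4) L = 0"
proof -
  obtain L0 where L0: "L0 \<in> M" using M(3) by blast
  have off: "is_line L \<and> h \<notin> L" if "L \<in> M" "form_at d c h \<noteq> 0" for L h
    using that M(2) lines_in_is_line unfolding lines_in_def by blast
  obtain h1 where h1: "form_at d c h1 \<noteq> 0" by (rule obtain_point_off_surface)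
  then have generic: "generic_family {form_at d c}"
    unfolding generic_family_def using poly_on_lines_form_at[where M="\<lambda>v. v"] by auto
  obtain h2 where "\<forall>f\<in>{form_at d c}. f h2 \<noteq> 0" "\<And>L. L \<in> M \<Longrightarrow> indep2 h1 h2 \<and> \<not> meets L (span2 h1 h2)"
    by (rule obtain_generic_skew_point[OF M(1) off[OF _ h1] generic]) (assumption, rule that)
  then have h2: "indep2 h1 h2" "\<And>L. L \<in> M \<Longrightarrow> \<not> meets L (span2 h1 h2)" using L0 by blast+
  obtain g g' where g: "basis4 h1 h2 g g'" by (rule basis4_extend[OF h2(1)])
  have generic': "generic_family ({form_at d c} \<union> {det4 h1 h2 g})"
  proof (rule generic_family_Un[OF generic])
    show "generic_family {det4 h1 h2 g}"
      unfolding generic_family_def using g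
      by (auto simp: basis4_iff_det4 intro!: poly_on_lines_det4 poly_on_lines_const poly_on_lines_coord)
  qed
  obtain h3 where "\<forall>f\<in>{form_at d c} \<union> {det4 h1 h2 g}. f h3 \<noteq> 0" "\<And>L. L \<in> M \<Longrightarrow> indep2 h1 h3 \<and> \<not> meets L (span2 h1 h3)"
    by (rule obtain_generic_skew_point[OF M(1) off[OF _ h1] generic']) (assumption, rule that)
  then have h3: "form_at d c h3 \<noteq> 0" "basis4 h1 h2 g h3" "\<And>L. L \<in> M \<Longrightarrow> \<not> meets L (span2 h1 h3)"
    by (simp_all add: basis4_iff_det4)
  have "h3 \<notin> span2 h1 h2"
    using skew_if_basis4[OF h3(2)] indep2_nonzero(2)[OF basis4_indep2(2)[OF h3(2)]] span2_generators(2) unfolding meets_def by blast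
  then have off_h3: "is_line L \<and> h3 \<notin> L" if "L \<in> insert (span2 h1 h2) M" for L
    using that off[OF _ h3(1)] is_line_span2[OF h2(1)] by blast
  obtain h4 where "\<forall>f\<in>{form_at d c}. f h4 \<noteq> 0" and h4: "\<And>L. L \<in> insert (span2 h1 h2) M \<Longrightarrow> indep2 h3 h4 \<and> \<not> meets L (span2 h3 h4)"
    by (rule obtain_generic_skew_point[OF finite.insertI[OF M(1)] off_h3 generic]) (assumption, rule that)
  have "basis4 h1 h2 h3 h4" by (rule basis4_if_skew) (use h2(1) h4 in blast)+
  moreover have "lines_met (frame_edges h1 h2 h3 h4) L = 0" if "L \<in> M" for L
    using that h2(2) h3(3) h4 by (auto simp: lines_met_def frame_edges_def)
  ultimately show ?thesis using that h1 h3(1) by blast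
qed

lemma obtain_skew_secant:
  assumes L: "is_line L" and ab: "indep2 a1 b1" "indep2 a2 b2" and skew: "\<not> meets L (span2 a1 b1)" and neq: "span2 a2 b2 \<noteq> L"
    and L_eq: "L = span2 p q" "indep2 p q"
  obtains s t u w where "basis4 p q (s *s a1 + t *s b1) (u *s a2 + w *s b2)"
proof -
  have "basis4 p q a1 b1" by (rule basis4_if_skew[OF L_eq(2) ab(1)]) (use skew L_eq(1) in simp)
  moreover obtain h where h: "h \<in> span2 a2 b2" "h \<notin> L" using obtain_point_off_line[OF is_line_span2[OF ab(2)] L neq] .
  ultimately have "basis4 p q a1 h \<or> basis4 p q b1 h" using basis4_replace L_eq(1) by blast
  moreover obtain u w where "h = u *s a2 + w *s b2" using h(1) by (rule span2E)
  ultimately show ?thesis using that[of 1 0 u w] that[of 0 1 u w] by auto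
qed

end

context weighted_lines
begin

theorem sum_weights_le:
  assumes L0: "L0 \<in> M" "\<not> tangential_along d c n \<phi> L0"
  shows "(\<Sum>L\<in>M. m L) \<le> d * n"
proof -
  obtain h1 h2 h3 h4 where frame: "basis4 h1 h2 h3 h4" "form_at d c h1 \<noteq> 0" "form_at d c h3 \<noteq> 0"
    and skew: "\<And>L. L \<in> M \<Longrightarrow> lines_met (frame_edges h1 h2 h3 h4) L = 0"
    using obtain_generic_frame[OF finite_lines lines] L0(1) by blast
  have "(\<Sum>L\<in>M. (2 - lines_met (frame_edges h1 h2 h3 h4) L) * m L) \<le> (d - 2 * 0) * (n - 0) + (n - 2 * 0) * (d - 0)"
  proof (rule sum_weights_le_in_frame[OF frame(1) _ _ _ _ _ _ _ _ _ L0(2)])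
    show "\<exists>x\<in>span2 h1 h2. form_at d c x \<noteq> 0" "\<exists>x\<in>span2 h3 h4. form_at d c x \<noteq> 0"
      using frame(2,3) span2_generators(1) by blast+
    show "\<not> meets L0 (span2 h3 h4)"
      using skew[OF L0(1)] by (auto simp: lines_met_def frame_edges_def)
  qed (use L0(1) lines form_zero in auto)
  moreover have "(\<Sum>L\<in>M. (2 - lines_met (frame_edges h1 h2 h3 h4) L) * m L) = 2 * (\<Sum>L\<in>M. m L)"
    unfolding sum_distrib_left using skew by (intro sum.cong) simp_all
  ultimately show ?thesis by (simp add: mult.commute)
qed

theorem sum_weights_off_chain_le:
  assumes l: "{l1, l2, l3} \<subseteq> lines_in d c" "\<not> meets l1 l2" "meets l3 l1" "meets l3 l2"
    and zero: "\<And>x. x \<in> l1 \<union> l2 \<union> l3 \<Longrightarrow> form_at n \<phi> x = 0" and transversal: "\<not> tangential_along d c n \<phi> l1"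
  shows "(\<Sum>L\<in>M. (2 - lines_met {l1, l2, l3} L) * m L) \<le> (d - 2) * (n - 1) + (n - 2) * (d - 1)"
proof -
  have l_line: "is_line l1" "is_line l2" "is_line l3" using l(1) lines_in_is_line by blast+
  obtain h1 where h1: "h1 \<noteq> 0" "h1 \<in> l3" "h1 \<in> l1" using l(3) unfolding meets_def by blast
  obtain h3 where h3: "h3 \<noteq> 0" "h3 \<in> l3" "h3 \<in> l2" using l(4) unfolding meets_def by blast
  obtain b where b: "indep2 h1 b" "l1 = span2 h1 b" by (rule line_through_point[OF l_line(1) h1(3,1)])
  obtain h4 where h4: "indep2 h3 h4" "l2 = span2 h3 h4" by (rule line_through_point[OF l_line(2) h3(3,1)])
  have basis: "basis4 h1 b h3 h4" by (rule basis4_if_skew[OF b(1) h4(1)]) (use l(2) b(2) h4(2) in simp)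
  have l3: "l3 = span2 h1 h3" by (rule line_eq_span2[OF l_line(3) basis4_indep2(3)[OF basis] h1(2) h3(2)])
  have edges: "frame_edges h1 b h3 h4 = {l1, l2, l3}" by (simp add: frame_edges_def b(2) h4(2) l3)
  have "(\<Sum>L\<in>M. (2 - lines_met {l1, l2, l3} L) * m L) \<le> (d - 2 * 1) * (n - 1) + (n - 2 * 1) * (d - 1)"
    unfolding edges[symmetric]
    by (rule sum_weights_le_in_frame[OF basis _ _ _ _ _ _ _ _ _ transversal])
      (use l zero in \<open>auto simp: lines_in_def simp flip: b(2) h4(2) l3\<close>)
  then show ?thesis by simp
qed

lemma obtain_generic_secant:
  assumes l: "l1 \<in> lines_in d c" "l2 \<in> lines_in d c" and M: "l1 \<notin> M" "l2 \<notin> M"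
    and skew: "\<And>L. L \<in> M \<Longrightarrow> \<not> meets L l1 \<or> \<not> meets L l2"
  obtains h1 h3 where "h1 \<in> l1" "h3 \<in> l2" "h1 \<noteq> 0" "h3 \<noteq> 0" "\<And>L. L \<in> M \<Longrightarrow> \<not> meets L (span2 h1 h3)"
proof -
  obtain a1 b1 where l1: "indep2 a1 b1" "l1 = span2 a1 b1" using lines_in_is_line[OF l(1)] unfolding is_line_def by blast
  obtain a2 b2 where l2: "indep2 a2 b2" "l2 = span2 a2 b2" using lines_in_is_line[OF l(2)] unfolding is_line_def by blast
  obtain p q where pq: "\<And>L. L \<in> M \<Longrightarrow> indep2 (p L) (q L) \<and> L = span2 (p L) (q L)"
    using is_line unfolding is_line_def by metis
  define h h' where "h v = v$1 *s a1 + v$2 *s b1" and "h' v = v$3 *s a2 + v$4 *s b2" for v :: "'a^4"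
  let ?F = "{\<lambda>v::'a^4. v$1, \<lambda>v. v$3} \<union> (\<lambda>L v. det4 (p L) (q L) (h v) (h' v)) ` M"
  have "generic_family ?F"
  proof (intro generic_family_Un generic_family_image finite_lines)
    show "generic_family {\<lambda>v::'a^4. v$1, \<lambda>v. v$3}"
      unfolding generic_family_def by (auto intro: poly_on_lines_coord exI[of _ "vec4 1 0 1 0"])
    fix L assume L: "L \<in> M"
    have "poly_on_lines (\<lambda>v. h v $ i)" "poly_on_lines (\<lambda>v. h' v $ i)" for i
      by (simp_all add: h_def h'_def poly_on_lines_add poly_on_lines_mult poly_on_lines_coord poly_on_lines_const)
    then show "poly_on_lines (\<lambda>v. det4 (p L) (q L) (h v) (h' v))" by (intro poly_on_lines_det4 poly_on_lines_const)
    obtain s t u w where "basis4 (p L) (q L) (s *s a1 + t *s b1) (u *s a2 + w *s b2)"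
    proof (cases "meets L l1")
      case False
      then show ?thesis
        using obtain_skew_secant[OF is_line[OF L] l1(1) l2(1), of "p L" "q L"] l1(2) l2(2) pq[OF L] M L that by metis
    next
      case True
      then have "\<not> meets L l2" using skew[OF L] by blast
      then obtain s t u w where "basis4 (p L) (q L) (u *s a2 + w *s b2) (s *s a1 + t *s b1)"
        using obtain_skew_secant[OF is_line[OF L] l2(1) l1(1), of "p L" "q L"] l1(2) l2(2) pq[OF L] M L by metis
      from basis4_swap34[OF this] show ?thesis by (rule that)
    qed
    then show "\<exists>v. det4 (p L) (q L) (h v) (h' v) \<noteq> 0"
      by (intro exI[of _ "vec4 s t u w"]) (simp add: h_def h'_def basis4_iff_det4)
  qed
  from generic_point[OF this] obtain v where v: "\<forall>f\<in>?F. f v \<noteq> 0" by blast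
  then have v13: "v$1 \<noteq> 0" "v$3 \<noteq> 0" by simp_all
  have "h v \<noteq> 0" "h' v \<noteq> 0" using l1(1) l2(1) v13 unfolding h_def h'_def indep2_def by blast+
  moreover have "h v \<in> l1" "h' v \<in> l2" unfolding h_def h'_def l1(2) l2(2) by (rule span2I)+
  moreover have "\<not> meets L (span2 (h v) (h' v))" if L: "L \<in> M" for L
    using skew_if_basis4[of "p L" "q L" "h v" "h' v"] v L pq[OF L] unfolding basis4_iff_det4 by auto
  ultimately show ?thesis using that by blast
qed

theorem sum_weights_off_skew_pair_le:
  assumes l: "l1 \<in> lines_in d c" "l2 \<in> lines_in d c" "\<not> meets l1 l2" and M: "l1 \<notin> M" "l2 \<notin> M"
    and zero: "\<And>x. x \<in> l1 \<union> l2 \<Longrightarrow> form_at n \<phi> x = 0" and transversal: "\<not> tangential_along d c n \<phi> l1"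
  shows "(\<Sum>L\<in>M. (2 - lines_met {l1, l2} L) * m L) \<le> (d - 2) * n + (n - 2) * d"
proof -
  define M' where "M' = {L \<in> M. \<not> meets L l1 \<or> \<not> meets L l2}"
  interpret M': weighted_lines d c n \<phi> M' m
    by unfold_locales (use homogeneous_form finite_lines lines form_zero weight in \<open>auto simp: M'_def\<close>)
  obtain h1 h3 where h: "h1 \<in> l1" "h3 \<in> l2" "h1 \<noteq> 0" "h3 \<noteq> 0" and skew: "\<And>L. L \<in> M' \<Longrightarrow> \<not> meets L (span2 h1 h3)"
    using M'.obtain_generic_secant[OF l(1,2)] M by (auto simp: M'_def)
  obtain b where b: "indep2 h1 b" "l1 = span2 h1 b" by (rule line_through_point[OF lines_in_is_line[OF l(1)] h(1,3)])
  obtain h4 where h4: "indep2 h3 h4" "l2 = span2 h3 h4" by (rule line_through_point[OF lines_in_is_line[OF l(2)] h(2,4)])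
  have basis: "basis4 h1 b h3 h4" by (rule basis4_if_skew[OF b(1) h4(1)]) (use l(3) b(2) h4(2) in simp)
  have edges: "lines_met (frame_edges h1 b h3 h4) L = lines_met {l1, l2} L" if "L \<in> M'" for L
    unfolding lines_met_def frame_edges_def b(2)[symmetric] h4(2)[symmetric]
    using skew[OF that] by (intro arg_cong[of _ _ card]) auto
  have "(\<Sum>L\<in>M. (2 - lines_met {l1, l2} L) * m L) = (\<Sum>L\<in>M'. (2 - lines_met {l1, l2} L) * m L)"
  proof (rule sum.mono_neutral_right)
    have "l1 \<noteq> l2" using l(3) h(1,3) unfolding meets_def by blast
    then show "\<forall>L\<in>M - M'. (2 - lines_met {l1, l2} L) * m L = 0"
      unfolding M'_def lines_met_def by (auto simp: Collect_conv_if conj_disj_distribR Collect_disj_eq)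
  qed (auto simp: M'_def finite_lines)
  also have "\<dots> = (\<Sum>L\<in>M'. (2 - lines_met (frame_edges h1 b h3 h4) L) * m L)" by (simp add: edges)
  also have "\<dots> \<le> (d - 2 * 1) * (n - 0) + (n - 2 * 1) * (d - 0)"
    by (rule M'.sum_weights_le_in_frame[OF basis _ _ _ _ _ _ l(1) _ _ transversal])
      (use l zero in \<open>auto simp: lines_in_def simp flip: b(2) h4(2)\<close>)
  finally show ?thesis by simp
qed

end

section \<open>Counting lines\<close>

lemma lines_met_insert:
  assumes "finite E" "K \<notin> E"
  shows "lines_met (insert K E) L = of_bool (meets L K) + lines_met E L"
proof -
  have "{K' \<in> insert K E. meets L K'} = (if meets L K then insert K {K' \<in> E. meets L K'} else {K' \<in> E. meets L K'})" by auto
  then show ?thesis unfolding lines_met_def using assms by simp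
qed

lemma lines_met_empty: "lines_met {} L = 0"
  by (simp add: lines_met_def)

lemma lines_met_mono: "finite E' \<Longrightarrow> E \<subseteq> E' \<Longrightarrow> lines_met E L \<le> lines_met E' L"
  unfolding lines_met_def by (intro card_mono) auto

lemma sum_lines_met_swap:
  assumes "finite E" "finite M"
  shows "(\<Sum>L\<in>M. lines_met E L) = (\<Sum>K\<in>E. lines_met M K)"
  unfolding lines_met_def by (rule sum_multicount_gen) (use assms in \<open>auto intro!: arg_cong[of _ _ card] dest: meets_sym\<close>)

lemma sum_two_minus_lines_met:
  assumes "finite E" "finite M"
  shows "(\<Sum>L\<in>M. 2 - int (lines_met E L)) = 2 * int (card M) - (\<Sum>K\<in>E. int (lines_met M K))"
  using sum_lines_met_swap[OF assms] by (simp add: sum_subtractf flip: of_nat_sum)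

lemma card_common_neighbours:
  assumes "finite F" "finite T" and few: "\<And>s. s \<in> T \<Longrightarrow> 5 * card {l \<in> F. \<not> meets l s} \<le> card F"
  shows "(5 - card T) * card F \<le> 5 * card {l \<in> F. \<forall>s\<in>T. meets l s}"
proof -
  have "card F \<le> card ({l \<in> F. \<forall>s\<in>T. meets l s} \<union> (\<Union>s\<in>T. {l \<in> F. \<not> meets l s}))"
    by (rule card_mono) (use assms(1,2) in auto)
  also have "\<dots> \<le> card {l \<in> F. \<forall>s\<in>T. meets l s} + card (\<Union>s\<in>T. {l \<in> F. \<not> meets l s})" by (rule card_Un_le)
  also have "\<dots> \<le> card {l \<in> F. \<forall>s\<in>T. meets l s} + (\<Sum>s\<in>T. card {l \<in> F. \<not> meets l s})"
    using card_UN_le[OF assms(2)] by simp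
  finally have "5 * card F \<le> 5 * card {l \<in> F. \<forall>s\<in>T. meets l s} + (\<Sum>s\<in>T. 5 * card {l \<in> F. \<not> meets l s})"
    unfolding sum_distrib_left[symmetric] by simp
  also have "(\<Sum>s\<in>T. 5 * card {l \<in> F. \<not> meets l s}) \<le> card T * card F" using sum_bounded_above[of T, OF few] by simp
  finally show ?thesis by (simp add: diff_mult_distrib)
qed

context surface
begin

lemma card_le_if_few_missed:
  assumes F: "finite F" "F \<subseteq> lines_in d c" and S: "finite S" "S \<subseteq> lines_in d c"
    and missed: "\<And>l. l \<in> F \<Longrightarrow> card {s \<in> S. \<not> meets l s} \<le> k" and many: "5 * k + 3 \<le> card S"
  shows "2 * card F \<le> 5 * d + 5"
proof (cases "F = {}")
  case False
  define T where "T = {s \<in> S. 5 * card {l \<in> F. \<not> meets l s} \<le> card F}"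
  have T: "finite T" "T \<subseteq> S" using S(1) by (auto simp: T_def)
  have "card (S - T) * card F \<le> (\<Sum>s\<in>S - T. 5 * card {l \<in> F. \<not> meets l s})"
    using sum_bounded_below[of "S - T" "card F" "\<lambda>s. 5 * card {l \<in> F. \<not> meets l s}"] by (force simp: T_def)
  also have "\<dots> \<le> (\<Sum>s\<in>S. 5 * card {l \<in> F. \<not> meets l s})" by (rule sum_mono2) (use S(1) in auto)
  also have "\<dots> = 5 * (\<Sum>l\<in>F. card {s \<in> S. \<not> meets l s})"
    unfolding sum_distrib_left[symmetric] by (subst sum_multicount_gen[OF F(1) S(1)]) auto
  also have "\<dots> \<le> 5 * (card F * k)" using sum_bounded_above[of F, OF missed] by simp
  finally have "card (S - T) * card F \<le> (5 * k) * card F" by (simp add: mult_ac)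
  then have "card (S - T) \<le> 5 * k" using False F(1) by (simp add: card_gt_0_iff)
  then have "3 \<le> card T" using many card_Diff_subset[OF T] card_mono[OF S(1) T(2)] by linarith
  then obtain T3 where T3: "T3 \<subseteq> T" "card T3 = 3" using obtain_subset_with_card_n by metis
  then obtain s1 s2 s3 where s: "T3 = {s1, s2, s3}" "s1 \<noteq> s2" "s1 \<noteq> s3" "s2 \<noteq> s3" unfolding card_3_iff by blast
  have common: "(5 - card T') * card F \<le> 5 * card {l \<in> F. \<forall>s\<in>T'. meets l s}" if "T' \<subseteq> T" for T'
    by (rule card_common_neighbours[OF F(1) finite_subset[OF that T(1)]]) (use that in \<open>auto simp: T_def\<close>)
  have lines: "s \<in> lines_in d c" if "s \<in> T3" for s using that T3(1) T(2) S(2) by blast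
  show ?thesis
  proof (cases "\<exists>s\<in>T3. \<exists>s'\<in>T3. s \<noteq> s' \<and> meets s s'")
    case True
    then obtain s s' where pair: "s \<in> T3" "s' \<in> T3" "s \<noteq> s'" "meets s s'" by blast
    define C where "C = {l \<in> F. \<forall>t\<in>{s, s'}. meets l t}"
    have "card (C \<union> {s, s'}) \<le> d"
      by (rule card_lines_meeting_two_meeting_lines_le[OF lines[OF pair(1)] lines[OF pair(2)] pair(3,4)]) (use F in \<open>auto simp: C_def\<close>)
    moreover have "card C \<le> card (C \<union> {s, s'})" by (rule card_mono) (use F in \<open>auto simp: C_def\<close>)
    moreover have "{s, s'} \<subseteq> T" using pair(1,2) T3(1) by blast
    from common[OF this] have "3 * card F \<le> 5 * card C" using pair(3) by (simp add: C_def)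
    ultimately show ?thesis by linarith
  next
    case False
    define C where "C = {l \<in> F. \<forall>t\<in>T3. meets l t}"
    have "card C \<le> d + 1"
      by (rule card_transversals_of_skew_triple_le[of s1 s2 s3]) (use lines False s F in \<open>auto simp: C_def\<close>)
    moreover have "2 * card F \<le> 5 * card C" using common[OF T3(1)] T3(2) by (simp add: C_def)
    ultimately show ?thesis by linarith
  qed
qed simp

theorem card_second_kind_lines_le:
  assumes M: "finite M" "M \<subseteq> lines_in d c" "\<And>L. L \<in> M \<Longrightarrow> second_kind d c L"
  shows "card M \<le> d * (8 * d - 14)"
proof (cases "M = {}")
  case False
  then obtain L0 where L0: "L0 \<in> M" "L0 \<in> lines_in d c" using M(2) by blast
  show ?thesis
  proof (rule apolar_form_not_tangential_along[OF L0(2)])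
    fix e g
    assume apolar: "\<And>n \<psi>. homogeneous n \<psi> \<Longrightarrow> (\<And>x. apolar_form d c e g x = form_at n \<psi> x) \<Longrightarrow> \<not> tangential_along d c n \<psi> L0"
    obtain \<psi> where \<psi>: "homogeneous (8*d-14) \<psi>" "\<And>x. apolar_form d c e g x = form_at (8*d-14) \<psi> x"
      using is_form_apolar_form[OF degree_ge_3, of c e g] unfolding is_form_def by blast
    interpret weighted_lines d c "8*d-14" \<psi> M "\<lambda>_. 1"
      by unfold_locales (use \<psi>(1) M apolar_form_eq_0_on_second_kind[OF \<psi>(2)] in auto)
    have "(\<Sum>L\<in>M. 1) \<le> d * (8*d-14)" by (rule sum_weights_le[OF L0(1) apolar[OF \<psi>]])
    then show "card M \<le> d * (8*d-14)" by simp
  qed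
qed simp

lemma lines_met_first_kind_le:
  assumes "l \<in> lines_in d c" "\<not> second_kind d c l" "finite B" "B \<subseteq> lines_in d c - {l}"
  shows "lines_met B l \<le> 8 * d - 14"
  unfolding lines_met_def
  by (rule card_lines_meeting_first_kind_le[OF assms(1,2)]) (use assms(3,4) meets_sym in auto)

lemma meets_self: "L \<in> lines_in d c \<Longrightarrow> meets L L"
  using lines_in_is_line indep2_nonzero(1) span2_generators(1) unfolding is_line_def meets_def by blast

lemma lines_met_le_if_neighbours_meet:
  assumes F: "finite F" "F \<subseteq> lines_in d c" "l \<in> F"
    and meet: "\<And>l1 l2. l1 \<in> F \<Longrightarrow> l2 \<in> F \<Longrightarrow> meets l l1 \<Longrightarrow> meets l l2 \<Longrightarrow> meets l1 l2"
  shows "lines_met (F - {l}) l + 1 \<le> d"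
proof -
  have "card (insert l {L \<in> F - {l}. meets l L}) \<le> d"
  proof (rule card_pairwise_meeting_lines_le)
    have "meets l l" using F(2,3) meets_self by blast
    then show "meets L L'" if "L \<in> insert l {L \<in> F - {l}. meets l L}" "L' \<in> insert l {L \<in> F - {l}. meets l L}" for L L'
      using meet that F(3) by blast
  qed (use F in auto)
  then show ?thesis using F(1) by (simp add: lines_met_def)
qed

end

lemma (in surface) exists_skew_line:
  assumes F: "finite F" "l \<in> F" and few: "lines_met (F - {l}) l + 1 \<le> d" and many: "d < card F"
  shows "\<exists>l'\<in>F. \<not> meets l l'"
proof (rule ccontr)
  assume "\<not> ?thesis"
  then have "{K \<in> F - {l}. meets l K} = F - {l}" by blast
  then have "card F \<le> d" using few card.remove[OF F] by (simp add: lines_met_def)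
  then show False using many by simp
qed

lemma card_eq_met_plus_missed: "finite S \<Longrightarrow> card S = lines_met S l + card {s \<in> S. \<not> meets l s}"
  unfolding lines_met_def using card_Int_Diff[of S "{s. meets l s}"] by (simp add: Int_def set_diff_eq)

locale line_set = flecnodal_surface d c n \<phi> for d :: nat and c :: "'a::alg_closed_field form4" and n \<phi> +
  fixes A :: "('a^4) set set"
  assumes finite: "finite A" and lines: "A \<subseteq> lines_in d c"
begin

definition first_kind_lines :: "('a^4) set set" where "first_kind_lines = {L \<in> A. \<not> second_kind d c L}"
definition second_kind_lines :: "('a^4) set set" where "second_kind_lines = {L \<in> A. second_kind d c L}"

lemma kinds: "finite first_kind_lines" "finite second_kind_lines" "first_kind_lines \<subseteq> lines_in d c" "second_kind_lines \<subseteq> lines_in d c"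
  "A = first_kind_lines \<union> second_kind_lines" "first_kind_lines \<inter> second_kind_lines = {}"
  using finite lines by (auto simp: first_kind_lines_def second_kind_lines_def)

lemma first_kind_line: "l \<in> first_kind_lines \<Longrightarrow> l \<in> A \<and> l \<in> lines_in d c \<and> \<not> second_kind d c l \<and> \<not> tangential_along d c n \<phi> l"
  using lines not_tangential_along_if_first_kind by (auto simp: first_kind_lines_def)

text \<open>Lines of the second kind count twice, since the flecnodal surface is tangent to the surface along them.\<close>
definition flec_mult :: "('a^4) set \<Rightarrow> nat" where "flec_mult L = (if second_kind d c L then 2 else 1)"

lemma weighted_subset: "B \<subseteq> A \<Longrightarrow> weighted_lines d c n \<phi> B flec_mult"
  by unfold_locales (use finite_subset finite lines homogeneous_flecnodal flecnodal_zero_on_lines tangential_along_if_second_kind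
      in \<open>auto simp: flec_mult_def\<close>)

lemma sum_flec_mult:
  assumes "B \<subseteq> A"
  shows "(\<Sum>L\<in>B. g L * int (flec_mult L)) = (\<Sum>L\<in>B \<inter> first_kind_lines. g L) + 2 * (\<Sum>L\<in>B \<inter> second_kind_lines. g L)"
proof -
  have "B = (B \<inter> first_kind_lines) \<union> (B \<inter> second_kind_lines)" using assms kinds(5) by blast
  then have "(\<Sum>L\<in>B. g L * int (flec_mult L)) = (\<Sum>L\<in>(B \<inter> first_kind_lines) \<union> (B \<inter> second_kind_lines). g L * int (flec_mult L))"
    by (rule arg_cong)
  also have "\<dots> = (\<Sum>L\<in>B \<inter> first_kind_lines. g L * int (flec_mult L)) + (\<Sum>L\<in>B \<inter> second_kind_lines. g L * int (flec_mult L))"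
    by (rule sum.union_disjoint) (use kinds in auto)
  also have "\<dots> = (\<Sum>L\<in>B \<inter> first_kind_lines. g L) + (\<Sum>L\<in>B \<inter> second_kind_lines. 2 * g L)"
    by (intro arg_cong2[of _ _ _ _ plus] sum.cong) (auto simp: flec_mult_def first_kind_lines_def second_kind_lines_def)
  finally show ?thesis by (simp add: sum_distrib_left)
qed

lemma obtain_degree_offset:
  obtains k where "d = k + 3" "n = 11 * k + 9"
  using that[of "d - 3"] degree_ge_3 degree_flecnodal by simp

theorem card_le_if_first_kind_chain:
  assumes l: "{l1, l2, l3} \<subseteq> first_kind_lines" "\<not> meets l1 l2" "meets l3 l1" "meets l3 l2"
  shows "int (card A) \<le> 11 * int d ^ 2 - 30 * int d + 18"
proof -
  have l_lines: "{l1, l2, l3} \<subseteq> lines_in d c" using l(1) kinds(3) by blast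
  have distinct: "l1 \<noteq> l2" "l1 \<noteq> l3" "l2 \<noteq> l3" using l(2-4) meets_self[of l1] l_lines meets_sym[of l3 l1] by auto
  define M where "M = A - {l1, l2, l3}"
  interpret M: weighted_lines d c n \<phi> M flec_mult by (rule weighted_subset) (auto simp: M_def)
  have others: "A = insert l1 (insert l2 (insert l3 M))" "l1 \<notin> M" "l2 \<notin> M" "l3 \<notin> M"
    using l(1) kinds(5) by (auto simp: M_def)
  then have card_A: "card A = card M + 3" using M.finite_lines distinct by simp
  have valence: "lines_met (A - {l}) l \<le> 8 * d - 14" if "l \<in> {l1, l2, l3}" for l
  proof (rule lines_met_first_kind_le)
    show "l \<in> lines_in d c" "\<not> second_kind d c l" using that l(1) first_kind_line by blast+
  qed (use finite lines in auto)
  have rest: "A - {l1} = insert l2 (insert l3 M)" "A - {l2} = insert l1 (insert l3 M)" "A - {l3} = insert l1 (insert l2 M)"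
    using others distinct by auto
  note add = lines_met_insert[OF M.finite_lines] lines_met_insert[OF finite.insertI[OF M.finite_lines]]
  have "meets l1 l3" "meets l2 l3" "\<not> meets l2 l1" using l(2-4) meets_sym by blast+
  then have valence12: "lines_met M l1 + 1 \<le> 8 * d - 14" "lines_met M l2 + 1 \<le> 8 * d - 14"
    using valence[of l1] valence[of l2] l(2) others(2-4) distinct unfolding rest by (simp_all add: add)
  have valence3: "lines_met M l3 + 2 \<le> 8 * d - 14"
    using valence[of l3] l(3,4) others(2-4) distinct unfolding rest by (simp add: add)
  have "2 * int (card M) - (int (lines_met M l1) + (int (lines_met M l2) + int (lines_met M l3)))
      = (\<Sum>L\<in>M. 2 - int (lines_met {l1, l2, l3} L))"
    using distinct M.finite_lines by (simp add: sum_two_minus_lines_met)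
  also have "\<dots> \<le> int (\<Sum>L\<in>M. (2 - lines_met {l1, l2, l3} L) * flec_mult L)"
    unfolding of_nat_sum by (rule sum_mono) (auto simp: flec_mult_def)
  also have "\<dots> \<le> int ((d - 2) * (n - 1) + (n - 2) * (d - 1))"
    unfolding of_nat_le_iff by (rule M.sum_weights_off_chain_le[OF l_lines l(2-4)])
      (use l_lines l(1) flecnodal_zero_on_lines first_kind_line in auto)
  also have "\<dots> = 22 * int d ^ 2 - 84 * int d + 76"
    by (rule obtain_degree_offset) (simp add: power2_eq_square algebra_simps)
  finally show ?thesis using valence12 valence3 card_A degree_ge_3 by linarith
qed

lemma lines_met_skew_pair_ge:
  assumes l: "l \<in> first_kind_lines" "l' \<in> first_kind_lines" "\<not> meets l l'"
  shows "2 * int (card first_kind_lines) + 4 * int (card second_kind_lines) \<le> 22 * int d ^ 2 - 72 * int d + 52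
     + int (lines_met (first_kind_lines - {l}) l) + int (lines_met (first_kind_lines - {l'}) l')
     + 2 * int (lines_met second_kind_lines l) + 2 * int (lines_met second_kind_lines l')"
proof -
  have "l \<noteq> l'" using l first_kind_line meets_self by blast
  define M F where "M = A - {l, l'}" and "F = first_kind_lines - {l, l'}"
  interpret M: weighted_lines d c n \<phi> M flec_mult by (rule weighted_subset) (auto simp: M_def)
  have M: "M \<inter> first_kind_lines = F" "M \<inter> second_kind_lines = second_kind_lines" "finite F"
    using l kinds by (auto simp: M_def F_def)
  have "first_kind_lines = insert l (insert l' F)" "l \<notin> F" "l' \<notin> F" using l by (auto simp: F_def)
  then have card_F: "int (card F) = int (card first_kind_lines) - 2" using \<open>l \<noteq> l'\<close> M(3) by simp
  let ?w = "\<lambda>L. 2 - int (lines_met {l, l'} L)"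
  have "lines_met {l, l'} L \<le> 2" for L using \<open>l \<noteq> l'\<close> by (simp add: lines_met_insert lines_met_empty)
  then have "int (\<Sum>L\<in>M. (2 - lines_met {l, l'} L) * flec_mult L) = (\<Sum>L\<in>M. ?w L * int (flec_mult L))"
    by (simp add: of_nat_diff)
  also have "\<dots> = (\<Sum>L\<in>F. ?w L) + 2 * (\<Sum>L\<in>second_kind_lines. ?w L)"
    using sum_flec_mult[of M ?w] unfolding M(1,2) by (simp add: M_def)
  finally have weights: "(\<Sum>L\<in>F. ?w L) + 2 * (\<Sum>L\<in>second_kind_lines. ?w L) = int (\<Sum>L\<in>M. (2 - lines_met {l, l'} L) * flec_mult L)" ..
  have "(\<Sum>L\<in>M. (2 - lines_met {l, l'} L) * flec_mult L) \<le> (d - 2) * n + (n - 2) * d"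
  proof (rule M.sum_weights_off_skew_pair_le)
    show "l \<in> lines_in d c" "l' \<in> lines_in d c" "\<not> tangential_along d c n \<phi> l" using l(1,2) first_kind_line by blast+
    then show "form_at n \<phi> x = 0" if "x \<in> l \<union> l'" for x using that flecnodal_zero_on_lines by blast
  qed (use l(3) in \<open>simp_all add: M_def\<close>)
  then have "(\<Sum>L\<in>F. ?w L) + 2 * (\<Sum>L\<in>second_kind_lines. ?w L) \<le> int ((d - 2) * n + (n - 2) * d)"
    unfolding weights by (simp only: of_nat_le_iff)
  moreover have "int ((d - 2) * n + (n - 2) * d) = 22 * int d ^ 2 - 72 * int d + 48"
    by (rule obtain_degree_offset) (simp add: power2_eq_square algebra_simps)
  moreover have "lines_met F l \<le> lines_met (first_kind_lines - {l}) l" "lines_met F l' \<le> lines_met (first_kind_lines - {l'}) l'"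
    by (intro lines_met_mono; use kinds(1) in \<open>auto simp: F_def\<close>)+
  ultimately show ?thesis
    using card_F \<open>l \<noteq> l'\<close> M(3) kinds(2) by (simp add: sum_two_minus_lines_met)
qed

lemma weighted_card_le:
  assumes "first_kind_lines \<noteq> {}"
  shows "int (card first_kind_lines) + 2 * int (card second_kind_lines) \<le> 11 * int d ^ 2 - 24 * int d"
proof -
  interpret A: weighted_lines d c n \<phi> A flec_mult by (rule weighted_subset) simp
  obtain l where "l \<in> first_kind_lines" using assms by blast
  then have "(\<Sum>L\<in>A. flec_mult L) \<le> d * n" using A.sum_weights_le first_kind_line by blast
  moreover have restrict: "A \<inter> first_kind_lines = first_kind_lines" "A \<inter> second_kind_lines = second_kind_lines"
    using kinds(5) by blast+
  ultimately have "(\<Sum>L\<in>A. 1 * int (flec_mult L)) \<le> int (d * n)" by (simp flip: of_nat_sum of_nat_mult)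
  then have "int (card first_kind_lines) + 2 * int (card second_kind_lines) \<le> int (d * n)"
    unfolding sum_flec_mult[OF subset_refl] restrict by simp
  moreover have "int (d * n) = 11 * int d ^ 2 - 24 * int d"
    by (rule obtain_degree_offset) (simp add: power2_eq_square algebra_simps)
  ultimately show ?thesis by simp
qed

theorem card_le_if_first_kind:
  assumes "first_kind_lines \<noteq> {}"
  shows "int (card A) \<le> 11 * int d ^ 2 - 30 * int d + 18"
proof (rule ccontr)
  let ?F = first_kind_lines and ?S = second_kind_lines
  assume "\<not> ?thesis"
  then have large: "int (card A) \<ge> 11 * int d ^ 2 - 30 * int d + 19" by simp
  have card_A: "int (card A) = int (card ?F) + int (card ?S)" using kinds card_Un_disjoint[of ?F ?S] by simp
  have S_le: "int (card ?S) \<le> 6 * int d - 19" using weighted_card_le[OF assms] large card_A by linarith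
  then have F_ge: "int (card ?F) \<ge> 11 * int d ^ 2 - 36 * int d + 38" using large card_A by linarith
  have valence: "lines_met (?F - {l}) l + 1 \<le> d" if l: "l \<in> ?F" for l
  proof (rule lines_met_le_if_neighbours_meet[OF kinds(1,3) l], rule ccontr)
    fix l1 l2 assume "l1 \<in> ?F" "l2 \<in> ?F" "meets l l1" "meets l l2" "\<not> meets l1 l2"
    then show False using card_le_if_first_kind_chain[of l1 l2 l] l large by simp
  qed
  have "int d < int (card ?F)"
    using F_ge zero_le_power2[of "22 * int d - 37"] by (simp add: power2_eq_square algebra_simps)
  then have partner: "\<exists>l'\<in>?F. \<not> meets l l'" if "l \<in> ?F" for l using exists_skew_line[OF kinds(1) that valence[OF that]] by simp
  have pair: "int (lines_met ?S l) + int (lines_met ?S l') \<ge> int (card ?S) + 5 * int d - 6"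
    if "l \<in> ?F" "l' \<in> ?F" "\<not> meets l l'" for l l'
    using lines_met_skew_pair_ge[OF that] valence[OF that(1)] valence[OF that(2)] large card_A by linarith
  have missed: "int (card {s \<in> ?S. \<not> meets l s}) + 13 \<le> int d" and S_ge: "5 * int d - 6 \<le> int (card ?S)" if l: "l \<in> ?F" for l
  proof -
    obtain l' where l': "l' \<in> ?F" "\<not> meets l l'" using partner[OF l] by blast
    show "int (card {s \<in> ?S. \<not> meets l s}) + 13 \<le> int d" "5 * int d - 6 \<le> int (card ?S)"
      using pair[OF l l'] card_eq_met_plus_missed[OF kinds(2), of l] card_eq_met_plus_missed[OF kinds(2), of l'] S_le by linarith+
  qed
  obtain l0 where l0: "l0 \<in> ?F" using assms by blast
  have d: "d \<ge> 13" using missed[OF l0] by linarith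
  have "2 * card ?F \<le> 5 * d + 5"
  proof (rule card_le_if_few_missed[OF kinds(1,3,2,4), of "d - 13"])
    show "card {s \<in> ?S. \<not> meets l s} \<le> d - 13" if "l \<in> ?F" for l using missed[OF that] by linarith
    show "5 * (d - 13) + 3 \<le> card ?S" using S_ge[OF l0] d by linarith
  qed
  moreover have "13 * int d \<le> int d ^ 2" using d by (simp add: power2_eq_square)
  ultimately show False using F_ge d by linarith
qed

end

theorem (in surface) card_lines_le:
  assumes A: "finite A" "A \<subseteq> lines_in d c"
  shows "int (card A) \<le> 11 * int d ^ 2 - 30 * int d + 18"
proof (cases "\<exists>L\<in>A. \<not> second_kind d c L")
  case True
  obtain \<phi> where "homogeneous (11*d-24) \<phi>" "\<And>x. flecnodal d c x = form_at (11*d-24) \<phi> x"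
    using is_form_flecnodal[OF degree_ge_3, of c] unfolding is_form_def by blast
  then interpret line_set d c "11*d-24" \<phi> A by unfold_locales (use A in auto)
  show ?thesis by (rule card_le_if_first_kind) (use True in \<open>auto simp: first_kind_lines_def\<close>)
next
  case all_second: False
  show ?thesis
  proof (cases "d = 3")
    case True
    then have "A = {}" using all_second A(2) cubic_not_second_kind by blast
    then show ?thesis using True by simp
  next
    case False
    have "card A \<le> d * (8 * d - 14)" by (rule card_second_kind_lines_le[OF A]) (use all_second in blast)
    then have "int (card A) \<le> int (d * (8 * d - 14))" by (simp only: of_nat_le_iff)
    also have "\<dots> = 8 * int d ^ 2 - 14 * int d" using degree_ge_3 by (simp add: power2_eq_square of_nat_diff algebra_simps)
    finally have "int (card A) \<le> 8 * int d ^ 2 - 14 * int d" .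
    moreover have "(int d - 4) * (3 * int d - 4) \<ge> 0" using degree_ge_3 False by simp
    ultimately show ?thesis by (simp add: power2_eq_square algebra_simps)
  qed
qed

section \<open>Points as tuples\<close>

definition vec_of :: "'a pt4 \<Rightarrow> 'a^4" where "vec_of = (\<lambda>(a,b,c,e). vec4 a b c e)"

lemma bij_vec_of: "bij (vec_of :: 'a pt4 \<Rightarrow> 'a^4)"
proof (rule bijI)
  show "inj (vec_of :: 'a pt4 \<Rightarrow> 'a^4)"
  proof (rule injI)
    fix x y :: "'a pt4" assume eq: "vec_of x = vec_of y"
    have "vec_of x $ i = vec_of y $ i" for i using eq by simp
    from this[of 1] this[of 2] this[of 3] this[of 4] show "x = y" by (cases x, cases y) (simp add: vec_of_def)
  qed
  show "surj (vec_of :: 'a pt4 \<Rightarrow> 'a^4)" by (rule surjI[of _ "\<lambda>y. (y$1, y$2, y$3, y$4)"]) (simp add: vec_of_def vec4_eta)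
qed

lemma form_at_vec_of: "form_at d c (vec_of x) = form_eval d c x"
  by (cases x) (simp add: form_at_def form_eval_def monom_at_def vec_of_def)
lemma vec_of_lincomb: "vec_of (lincomb a u b v) = a *s vec_of u + b *s vec_of v"
  by (cases u, cases v, rule vec4_eqI) (simp_all add: lincomb_def vec_of_def)
lemma vec_of_eq_0_iff: "vec_of x = 0 \<longleftrightarrow> x = (0,0,0,0)"
  by (cases x) (auto simp: vec_of_def cart_eq forall_4)

lemma form_eval_cong: "(\<And>m. m \<in> mons d \<Longrightarrow> c m = c' m) \<Longrightarrow> form_eval d c x = form_eval d c' x"
  unfolding form_eval_def by (rule sum.cong) simp_all

lemma lines_on_subset_lines_in:
  fixes c :: "'a::field form4"
  assumes "\<And>m. m \<in> mons d \<Longrightarrow> c m = c' m"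
  shows "image vec_of ` lines_on d c \<subseteq> lines_in d c'"
proof
  fix K assume "K \<in> image vec_of ` lines_on d c"
  then obtain L where L: "K = vec_of ` L" "proj_line L" "\<And>x. x \<in> L \<Longrightarrow> form_eval d c x = 0" unfolding lines_on_def by blast
  obtain u v where uv: "\<And>a b. lincomb a u b v = (0,0,0,0) \<Longrightarrow> a = 0 \<and> b = 0" "L = {lincomb a u b v | a b. True}"
    using L(2) unfolding proj_line_def by blast
  have "indep2 (vec_of u) (vec_of v)" unfolding indep2_def vec_of_lincomb[symmetric] vec_of_eq_0_iff using uv(1) by blast
  moreover have "K = span2 (vec_of u) (vec_of v)" unfolding L(1) uv(2) span2_def vec_of_lincomb[symmetric] by blast
  moreover have "form_at d c' y = 0" if "y \<in> K" for y
    using that L(3) form_eval_cong[OF assms] unfolding L(1) by (auto simp: form_at_vec_of)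
  ultimately show "K \<in> lines_in d c'" unfolding lines_in_def is_line_def by blast
qed

lemma smooth_form_if_smooth_surface:
  fixes c :: "'a::field form4"
  assumes smooth: "smooth_surface d c" and "d \<ge> 1" and c': "\<And>m. m \<in> mons d \<Longrightarrow> c m = c' m"
  shows "smooth_form d c'"
  unfolding smooth_form_def
proof (intro allI impI, rule ccontr)
  fix y :: "'a^4" assume y: "y \<noteq> 0" "form_at d c' y = 0" "\<nexists>v. polar1 d c' y v \<noteq> 0"
  obtain x where x: "y = vec_of x" using bij_vec_of by (metis bij_pointE)
  have "form_at (d - 1) (partial i c') y = 0" for i
  proof -
    have "polar1 d c' y (axis i 1) = 0" using y(3) by blast
    then show ?thesis unfolding polar1_def axis_def by (simp add: if_distrib[of "\<lambda>a. a * _"] cong: if_cong)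
  qed
  then have partials: "form_eval (d - 1) (partial i c') x = 0" for i unfolding x form_at_vec_of .
  have "form_eval (d-1) (pderiv0 d c) x = form_eval (d-1) (partial 1 c') x" "form_eval (d-1) (pderiv1 d c) x = form_eval (d-1) (partial 2 c') x"
    "form_eval (d-1) (pderiv2 d c) x = form_eval (d-1) (partial 3 c') x" "form_eval (d-1) (pderiv3 d c) x = form_eval (d-1) (partial 4 c') x"
    by (rule form_eval_cong; use assms(2) in \<open>auto simp: partial_def exponent_def map_exponent_def
        pderiv0_def pderiv1_def pderiv2_def pderiv3_def mons_def intro!: c'\<close>)+
  moreover have "form_eval d c x = 0" using y(2) form_eval_cong[OF c'] unfolding x form_at_vec_of by simp
  moreover have "x \<noteq> (0,0,0,0)" using y(1) x vec_of_eq_0_iff by metis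
  ultimately show False using smooth partials unfolding smooth_surface_def by metis
qed

theorem theorem1p1:
  fixes c :: "'a::alg_closed_field form4" and d :: nat
  assumes "d \<ge> 3"
    and "CHAR('a) = 0 \<or> CHAR('a) > d"
    and "smooth_surface d c"
  shows "finite (lines_on d c) \<and>
         int (card (lines_on d c)) \<le> 11 * int d ^ 2 - 30 * int d + 18"
proof -
  define c' where "c' m = (if m \<in> mons d then c m else 0)" for m
  then have agree: "m \<in> mons d \<Longrightarrow> c m = c' m" for m by simp
  interpret surface d c'
  proof
    show "homogeneous d c'" by (simp add: homogeneous_def c'_def)
    show "good_char TYPE('a) d" using assms(2) by (simp add: good_char_def)
    show "smooth_form d c'" using assms(1) by (intro smooth_form_if_smooth_surface[OF assms(3) _ agree]) simp
  qed (rule assms(1))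
  have subset: "image vec_of ` lines_on d c \<subseteq> lines_in d c'" by (rule lines_on_subset_lines_in) (rule agree)
  have bound: "int (card B) \<le> 11 * int d ^ 2 - 30 * int d + 18" if B: "B \<subseteq> lines_on d c" "finite B" for B
  proof -
    have "inj_on (image vec_of) B" by (rule inj_onI) (simp add: inj_image_eq_iff bij_is_inj[OF bij_vec_of])
    moreover have "image vec_of ` B \<subseteq> lines_in d c'" using B(1) subset by blast
    ultimately show ?thesis using card_lines_le[of "image vec_of ` B"] B(2) by (simp add: card_image)
  qed
  have "card B \<le> nat (11 * int d ^ 2 - 30 * int d + 18)" if "B \<subseteq> lines_on d c" "finite B" for B
    using nat_mono[OF bound[OF that]] by simp
  then have "finite (lines_on d c)" using finite_if_finite_subsets_card_bdd by blast
  then show ?thesis using bound by blast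
qed

end
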